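(* Let $\mathbf{A}$ be a polycategory whose composition is computable and in which equality of morphisms is decidable. Then there is an algorithm which, given two $\Sigma\Pi_{\mathbf{A}}$-terms (derivations) of the same sequent, decides whether they are equivalent, i.e. related by the equivalence relation $\sim$ generated by the rewrites (1)-(12), the permuting conversions (13)-(22), and the identification of essential cuts with composition in $\mathbf{A}$.
   Context: Logic and terms. Let $\mathbf{A}$ be a symmetric polycategory. Formulas of $\Sigma\Pi_{\mathbf{A}}$ are the objects of $\mathbf{A}$ (atoms) and, for every finite (possibly empty) set $I$ and formulas $X_i$ ($i\in I$), the sum $\sum_{i\in I}a_i{:}X_i$ and the product $\prod_{i\in I}a_i{:}X_i$ (the $a_i$ are distinct names of the components). A sequent $\Gamma\vdash\Delta$ consists of two finite unordered families of formulas, every occurrence being labelled by a distinct channel name (Greek letter). Terms (derivations) are formed as follows. - Axioms: every polymorphism $f:\Gamma\to\Delta$ of $\mathbf{A}$ between atoms; in particular the identity $1_A$ derives $\alpha{:}A\vdash\beta{:}A$ for an atom $A$. - Cotuple: from $f_i$ deriving $\Gamma,\alpha{:}X_i\vdash\Delta$ ($i\in I$), $\alpha\{a_i\mapsto f_i\}_{i\in I}$ derives $\Gamma,\alpha{:}\sum_i a_i{:}X_i\vdash\Delta$. - Tuple: from $f_i$ deriving $\Gamma\vdash\alpha{:}X_i,\Delta$ ($i\in I$), $\alpha(a_i\mapsto f_i)_{i\in I}$ derives $\Gamma\vdash\alpha{:}\prod_i a_i{:}X_i,\Delta$. - Projection: from $f$ deriving $\Gamma,\alpha{:}X_k\vdash\Delta$,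 $\overleftarrow{\alpha}[a_k](f)$ derives $\Gamma,\alpha{:}\prod_i a_i{:}X_i\vdash\Delta$. - Injection: from $f$ deriving $\Gamma\vdash\alpha{:}X_k,\Delta$, $\overrightarrow{\alpha}[a_k](f)$ derives $\Gamma\vdash\alpha{:}\sum_i a_i{:}X_i,\Delta$. - Cut: from $f$ deriving $\Gamma\vdash\Delta,\gamma{:}Z$ and $g$ deriving $\gamma{:}Z,\Gamma'\vdash\Delta'$ ($\gamma$ the only common channel name), $f;_\gamma g$ derives $\Gamma,\Gamma'\vdash\Delta,\Delta'$. An essential cut is a cut between two axioms; it is identified with the axiom given by composition in $\mathbf{A}$. All steps below may be applied to subterms and preserve the sequent. Rewrites (different Greek letters denote distinct channels; (1),(2) up to renaming of the channel): (1) $f;_\gamma 1\Rightarrow f$; (2) $1;_\gamma f\Rightarrow f$; (3) $\alpha\{a_i\mapsto f_i\}_i;_\gamma g\Rightarrow\alpha\{a_i\mapsto f_i;_\gamma g\}_i$; (4) $f;_\gamma\beta(b_i\mapsto g_i)_i\Rightarrow\beta(b_i\mapsto f;_\gamma g_i)_i$; (5) $\overrightarrow{\alpha}[a_k](f);_\gamma g\Rightarrow\overrightarrow{\alpha}[a_k](f;_\gamma g)$; (6) $f;_\gamma\overleftarrow{\beta}[b_k](g)\Rightarrow\overleftarrow{\beta}[b_k](f;_\gamma g)$; (7) $\overleftarrow{\alpha}[a_k](f);_\gamma g\Rightarrow\overleftarrow{\alpha}[a_k](f;_\gamma g)$; (8) $f;_\gamma\overrightarrow{\beta}[b_k](g)\Rightarrow\overrightarrow{\beta}[b_k](f;_\gamma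 g)$; (9) $\alpha(a_i\mapsto f_i)_i;_\gamma g\Rightarrow\alpha(a_i\mapsto f_i;_\gamma g)_i$; (10) $f;_\gamma\beta\{b_i\mapsto g_i\}_i\Rightarrow\beta\{b_i\mapsto f;_\gamma g_i\}_i$; (11) $\overrightarrow{\gamma}[a_k](f);_\gamma\gamma\{a_i\mapsto g_i\}_i\Rightarrow f;_\gamma g_k$; (12) $\gamma(a_i\mapsto f_i)_i;_\gamma\overleftarrow{\gamma}[a_k](g)\Rightarrow f_k;_\gamma g$. Permuting conversions (two-way, $\alpha\neq\beta$; index sets of cotuples/tuples may be empty): (13) $\alpha\{a_i\mapsto\beta\{b_j\mapsto f_{ij}\}_j\}_i\leftrightarrow\beta\{b_j\mapsto\alpha\{a_i\mapsto f_{ij}\}_i\}_j$; (14) $\alpha(a_i\mapsto\beta(b_j\mapsto f_{ij})_j)_i\leftrightarrow\beta(b_j\mapsto\alpha(a_i\mapsto f_{ij})_i)_j$; (15) $\alpha\{a_i\mapsto\overrightarrow{\beta}[b_k](f_i)\}_i\leftrightarrow\overrightarrow{\beta}[b_k](\alpha\{a_i\mapsto f_i\}_i)$; (16) $\overleftarrow{\alpha}[a_k](\beta(b_i\mapsto g_i)_i)\leftrightarrow\beta(b_i\mapsto\overleftarrow{\alpha}[a_k](g_i))_i$; (17) $\alpha\{a_i\mapsto\overleftarrow{\beta}[b_k](f_i)\}_i\leftrightarrow\overleftarrow{\beta}[b_k](\alpha\{a_i\mapsto f_i\}_i)$; (18) $\overrightarrow{\alpha}[a_k](\beta(b_i\mapsto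 g_i)_i)\leftrightarrow\beta(b_i\mapsto\overrightarrow{\alpha}[a_k](g_i))_i$; (19) $\alpha\{a_i\mapsto\beta(b_j\mapsto f_{ij})_j\}_i\leftrightarrow\beta(b_j\mapsto\alpha\{a_i\mapsto f_{ij}\}_i)_j$; (20) $\overrightarrow{\alpha}[a_k](\overrightarrow{\beta}[b_l](f))\leftrightarrow\overrightarrow{\beta}[b_l](\overrightarrow{\alpha}[a_k](f))$; (21) $\overleftarrow{\alpha}[a_k](\overleftarrow{\beta}[b_l](f))\leftrightarrow\overleftarrow{\beta}[b_l](\overleftarrow{\alpha}[a_k](f))$; (22) $\overrightarrow{\alpha}[a_k](\overleftarrow{\beta}[b_l](f))\leftrightarrow\overleftarrow{\beta}[b_l](\overrightarrow{\alpha}[a_k](f))$. *)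

theory Defs
  imports
    "HOL-Library.Finite_Map"
    "HOL-Library.Nat_Bijection"
    "HOL-Combinatorics.Transposition"
begin

section \<open>Symmetric polycategories\<close>

type_synonym chan = nat
type_synonym name = nat

text \<open>
  The source and the target of a polymorphism are finite unordered families of objects, indexed by
  channel names, with no channel occurring twice. Thus an element of \<open>Mor\<close> is a polymorphism
  together with a labelling of its inputs and outputs, and the symmetric group actions on lists of
  inputs and outputs become the relabelling \<open>Ren\<close> of channels along permutations of
  the channel names. \<open>Comp \<gamma> f g\<close> composes along the output \<open>\<gamma>\<close> of \<open>f\<close> and the input \<open>\<gamma>\<close> of \<open>g\<close>;
  \<open>Ident Z \<alpha> \<beta>\<close> is the identity of \<open>Z\<close>, with input \<open>\<alpha>\<close> and output \<open>\<beta>\<close>.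
\<close>

record ('o, 'm) polycat =
  Obj :: "'o set"
  Mor :: "'m set"
  Dom :: "'m \<Rightarrow> (chan, 'o) fmap"
  Cod :: "'m \<Rightarrow> (chan, 'o) fmap"
  Ident :: "'o \<Rightarrow> chan \<Rightarrow> chan \<Rightarrow> 'm"
  Comp :: "chan \<Rightarrow> 'm \<Rightarrow> 'm \<Rightarrow> 'm"
  Ren :: "(chan \<Rightarrow> chan) \<Rightarrow> 'm \<Rightarrow> 'm"

definition chans :: "('o, 'm) polycat \<Rightarrow> 'm \<Rightarrow> chan set" where
  "chans A f = fmdom' (Dom A f) \<union> fmdom' (Cod A f)"

definition composable :: "('o, 'm) polycat \<Rightarrow> chan \<Rightarrow> 'm \<Rightarrow> 'm \<Rightarrow> bool" where
  "composable A \<gamma> f g \<longleftrightarrow>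
     f \<in> Mor A \<and> g \<in> Mor A \<and> chans A f \<inter> chans A g = {\<gamma>} \<and>
     (\<exists>Z. fmlookup (Cod A f) \<gamma> = Some Z \<and> fmlookup (Dom A g) \<gamma> = Some Z)"

locale symmetric_polycategory =
  fixes A :: "('o, 'm) polycat"
  assumes Dom_Obj: "f \<in> Mor A \<Longrightarrow> fmran' (Dom A f) \<subseteq> Obj A"
    and Cod_Obj: "f \<in> Mor A \<Longrightarrow> fmran' (Cod A f) \<subseteq> Obj A"
    and Dom_Cod_disjoint: "f \<in> Mor A \<Longrightarrow> fmdom' (Dom A f) \<inter> fmdom' (Cod A f) = {}"
    \<comment> \<open>relabelling of channels\<close>
    and Ren_Mor: "f \<in> Mor A \<Longrightarrow> bij \<pi> \<Longrightarrow> Ren A \<pi> f \<in> Mor A"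
    and Dom_Ren: "f \<in> Mor A \<Longrightarrow> bij \<pi> \<Longrightarrow>
           fmlookup (Dom A (Ren A \<pi> f)) (\<pi> c) = fmlookup (Dom A f) c"
    and Cod_Ren: "f \<in> Mor A \<Longrightarrow> bij \<pi> \<Longrightarrow>
           fmlookup (Cod A (Ren A \<pi> f)) (\<pi> c) = fmlookup (Cod A f) c"
    and Ren_fixed: "f \<in> Mor A \<Longrightarrow> bij \<pi> \<Longrightarrow> \<forall>c \<in> chans A f. \<pi> c = c \<Longrightarrow> Ren A \<pi> f = f"
    and Ren_Ren: "f \<in> Mor A \<Longrightarrow> bij \<pi> \<Longrightarrow> bij \<rho> \<Longrightarrow>
           Ren A \<pi> (Ren A \<rho> f) = Ren A (\<pi> \<circ> \<rho>) f"
    \<comment> \<open>identities\<close>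
    and Ident_Mor: "Z \<in> Obj A \<Longrightarrow> \<alpha> \<noteq> \<beta> \<Longrightarrow> Ident A Z \<alpha> \<beta> \<in> Mor A"
    and Dom_Ident: "Z \<in> Obj A \<Longrightarrow> \<alpha> \<noteq> \<beta> \<Longrightarrow> Dom A (Ident A Z \<alpha> \<beta>) = fmupd \<alpha> Z fmempty"
    and Cod_Ident: "Z \<in> Obj A \<Longrightarrow> \<alpha> \<noteq> \<beta> \<Longrightarrow> Cod A (Ident A Z \<alpha> \<beta>) = fmupd \<beta> Z fmempty"
    and Ren_Ident: "Z \<in> Obj A \<Longrightarrow> \<alpha> \<noteq> \<beta> \<Longrightarrow> bij \<pi> \<Longrightarrow>
           Ren A \<pi> (Ident A Z \<alpha> \<beta>) = Ident A Z (\<pi> \<alpha>) (\<pi> \<beta>)"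
    \<comment> \<open>composition\<close>
    and Comp_Mor: "composable A \<gamma> f g \<Longrightarrow> Comp A \<gamma> f g \<in> Mor A"
    and Dom_Comp: "composable A \<gamma> f g \<Longrightarrow>
           Dom A (Comp A \<gamma> f g) = Dom A f ++\<^sub>f fmdrop \<gamma> (Dom A g)"
    and Cod_Comp: "composable A \<gamma> f g \<Longrightarrow>
           Cod A (Comp A \<gamma> f g) = fmdrop \<gamma> (Cod A f) ++\<^sub>f Cod A g"
    and Ren_Comp: "composable A \<gamma> f g \<Longrightarrow> bij \<pi> \<Longrightarrow>
           Ren A \<pi> (Comp A \<gamma> f g) = Comp A (\<pi> \<gamma>) (Ren A \<pi> f) (Ren A \<pi> g)"
    \<comment> \<open>identity laws: composing with an identity only changes the name of the channel\<close>
    and Comp_Ident: "Z \<in> Obj A \<Longrightarrow> \<gamma> \<noteq> \<beta> \<Longrightarrow> composable A \<gamma> f (Ident A Z \<gamma> \<beta>) \<Longrightarrow>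
           Comp A \<gamma> f (Ident A Z \<gamma> \<beta>) = Ren A (transpose \<gamma> \<beta>) f"
    and Ident_Comp: "Z \<in> Obj A \<Longrightarrow> \<alpha> \<noteq> \<gamma> \<Longrightarrow> composable A \<gamma> (Ident A Z \<alpha> \<gamma>) g \<Longrightarrow>
           Comp A \<gamma> (Ident A Z \<alpha> \<gamma>) g = Ren A (transpose \<alpha> \<gamma>) g"
    \<comment> \<open>associativity and the two interchange laws\<close>
    and Comp_assoc: "composable A \<gamma> f g \<Longrightarrow> composable A \<delta> g h \<Longrightarrow> chans A f \<inter> chans A h = {} \<Longrightarrow>
           Comp A \<delta> (Comp A \<gamma> f g) h = Comp A \<gamma> f (Comp A \<delta> g h)"
    and Comp_interchange_cod:
          "composable A \<gamma> f g \<Longrightarrow> composable A \<delta> f h \<Longrightarrow> chans A g \<inter> chans A h = {} \<Longrightarrow>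
           Comp A \<delta> (Comp A \<gamma> f g) h = Comp A \<gamma> (Comp A \<delta> f h) g"
    and Comp_interchange_dom:
          "composable A \<gamma> f h \<Longrightarrow> composable A \<delta> g h \<Longrightarrow> chans A f \<inter> chans A g = {} \<Longrightarrow>
           Comp A \<gamma> f (Comp A \<delta> g h) = Comp A \<delta> g (Comp A \<gamma> f h)"


section \<open>Formulas, sequents and terms\<close>

datatype 'o fm =
    Atom 'o
  | Sum "(name, 'o fm) fmap"
  | Prod "(name, 'o fm) fmap"

type_synonym 'o family = "(chan, 'o fm) fmap"

definition seq_chans :: "'o family \<Rightarrow> 'o family \<Rightarrow> chan set" where
  "seq_chans \<Gamma> \<Delta> = fmdom' \<Gamma> \<union> fmdom' \<Delta>"

definition wf_seq :: "('o, 'm) polycat \<Rightarrow> 'o family \<Rightarrow> 'o family \<Rightarrow> bool" where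
  "wf_seq A \<Gamma> \<Delta> \<longleftrightarrow>
     fmdom' \<Gamma> \<inter> fmdom' \<Delta> = {} \<and> (\<forall>X \<in> fmran' \<Gamma> \<union> fmran' \<Delta>. set_fm X \<subseteq> Obj A)"

text \<open>
  \<open>Project \<alpha> a f\<close> and \<open>Inject \<alpha> a f\<close> are \<open>\<alpha>[a](f)\<close> with an arrow to the left and to the right over \<open>\<alpha>\<close>;
  \<open>Cut f \<gamma> g\<close> is \<open>f ;\<^sub>\<gamma> g\<close>.
\<close>

datatype 'm tm =
    Ax 'm
  | Cotuple chan "(name, 'm tm) fmap"
  | Tuple chan "(name, 'm tm) fmap"
  | Project chan name "'m tm"
  | Inject chan name "'m tm"
  | Cut "'m tm" chan "'m tm"

text \<open>
  The well-formedness side conditions say that the conclusion is a sequent of \<open>A\<close>. They are not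
  implied by the premises, because index sets may be empty and because the components that are not
  selected by an injection or a projection do not occur in the premise.
\<close>

inductive derives :: "('o, 'm) polycat \<Rightarrow> 'o family \<Rightarrow> 'o family \<Rightarrow> 'm tm \<Rightarrow> bool"
  for A :: "('o, 'm) polycat" where
  derives_Ax:
    "f \<in> Mor A \<Longrightarrow> derives A (fmmap Atom (Dom A f)) (fmmap Atom (Cod A f)) (Ax f)"
| derives_Cotuple:
    "\<alpha> \<notin> fmdom' \<Gamma> \<Longrightarrow> wf_seq A (fmupd \<alpha> (Sum Xs) \<Gamma>) \<Delta> \<Longrightarrow> fmdom' F = fmdom' Xs \<Longrightarrow>
     (\<And>i X f. fmlookup Xs i = Some X \<Longrightarrow> fmlookup F i = Some f \<Longrightarrow>
        derives A (fmupd \<alpha> X \<Gamma>) \<Delta> f) \<Longrightarrow>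
     derives A (fmupd \<alpha> (Sum Xs) \<Gamma>) \<Delta> (Cotuple \<alpha> F)"
| derives_Tuple:
    "\<alpha> \<notin> fmdom' \<Delta> \<Longrightarrow> wf_seq A \<Gamma> (fmupd \<alpha> (Prod Xs) \<Delta>) \<Longrightarrow> fmdom' F = fmdom' Xs \<Longrightarrow>
     (\<And>i X f. fmlookup Xs i = Some X \<Longrightarrow> fmlookup F i = Some f \<Longrightarrow>
        derives A \<Gamma> (fmupd \<alpha> X \<Delta>) f) \<Longrightarrow>
     derives A \<Gamma> (fmupd \<alpha> (Prod Xs) \<Delta>) (Tuple \<alpha> F)"
| derives_Project:
    "\<alpha> \<notin> fmdom' \<Gamma> \<Longrightarrow> wf_seq A (fmupd \<alpha> (Prod Xs) \<Gamma>) \<Delta> \<Longrightarrow> fmlookup Xs k = Some X \<Longrightarrow>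
     derives A (fmupd \<alpha> X \<Gamma>) \<Delta> f \<Longrightarrow>
     derives A (fmupd \<alpha> (Prod Xs) \<Gamma>) \<Delta> (Project \<alpha> k f)"
| derives_Inject:
    "\<alpha> \<notin> fmdom' \<Delta> \<Longrightarrow> wf_seq A \<Gamma> (fmupd \<alpha> (Sum Xs) \<Delta>) \<Longrightarrow> fmlookup Xs k = Some X \<Longrightarrow>
     derives A \<Gamma> (fmupd \<alpha> X \<Delta>) f \<Longrightarrow>
     derives A \<Gamma> (fmupd \<alpha> (Sum Xs) \<Delta>) (Inject \<alpha> k f)"
| derives_Cut:
    "\<gamma> \<notin> seq_chans \<Gamma> \<Delta> \<Longrightarrow> \<gamma> \<notin> seq_chans \<Gamma>' \<Delta>' \<Longrightarrow>
     seq_chans \<Gamma> \<Delta> \<inter> seq_chans \<Gamma>' \<Delta>' = {} \<Longrightarrow>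
     derives A \<Gamma> (fmupd \<gamma> Z \<Delta>) f \<Longrightarrow> derives A (fmupd \<gamma> Z \<Gamma>') \<Delta>' g \<Longrightarrow>
     derives A (\<Gamma> ++\<^sub>f \<Gamma>') (\<Delta> ++\<^sub>f \<Delta>') (Cut f \<gamma> g)"


section \<open>Rewrites, permuting conversions and equivalence\<close>

text \<open>
  Permutations act on all channels of a term, those of cuts included. If \<open>\<gamma>\<close> is free and \<open>\<beta>\<close> is
  fresh for the sequent of \<open>f\<close>, then \<open>rename A (transpose \<gamma> \<beta>) f\<close> is the capture-avoiding
  renaming of \<open>\<gamma>\<close> to \<open>\<beta>\<close> in \<open>f\<close>.
\<close>

primrec rename :: "('o, 'm) polycat \<Rightarrow> (chan \<Rightarrow> chan) \<Rightarrow> 'm tm \<Rightarrow> 'm tm" where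
  "rename A \<pi> (Ax f) = Ax (Ren A \<pi> f)"
| "rename A \<pi> (Cotuple \<alpha> F) = Cotuple (\<pi> \<alpha>) (fmmap (rename A \<pi>) F)"
| "rename A \<pi> (Tuple \<alpha> F) = Tuple (\<pi> \<alpha>) (fmmap (rename A \<pi>) F)"
| "rename A \<pi> (Project \<alpha> k f) = Project (\<pi> \<alpha>) k (rename A \<pi> f)"
| "rename A \<pi> (Inject \<alpha> k f) = Inject (\<pi> \<alpha>) k (rename A \<pi> f)"
| "rename A \<pi> (Cut f \<gamma> g) = Cut (rename A \<pi> f) (\<pi> \<gamma>) (rename A \<pi> g)"

text \<open>The family of all \<open>h i\<close> for \<open>i\<close> in the finite set \<open>I\<close>.\<close>

definition fam :: "name fset \<Rightarrow> (name \<Rightarrow> 'x) \<Rightarrow> (name, 'x) fmap" where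
  "fam I h = fmap_of_list (map (\<lambda>i. (i, h i)) (sorted_list_of_fset I))"

lemma fmlookup_fam: "fmlookup (fam I h) i = (if i |\<in>| I then Some (h i) else None)"
  by (simp add: fam_def fmlookup_of_list map_of_map_restrict restrict_map_def)

text \<open>
  The next two relations are the root instances, on raw terms. They are restricted to
  instances whose two sides derive the same sequent when the equivalence is generated below.
\<close>

inductive rewrite :: "('o, 'm) polycat \<Rightarrow> 'm tm \<Rightarrow> 'm tm \<Rightarrow> bool"
  for A :: "('o, 'm) polycat" where
  essential: "rewrite A (Cut (Ax f) \<gamma> (Ax g)) (Ax (Comp A \<gamma> f g))"
| rw1: "Z \<in> Obj A \<Longrightarrow> \<gamma> \<noteq> \<beta> \<Longrightarrow>
    rewrite A (Cut f \<gamma> (Ax (Ident A Z \<gamma> \<beta>))) (rename A (transpose \<gamma> \<beta>) f)"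
| rw2: "Z \<in> Obj A \<Longrightarrow> \<alpha> \<noteq> \<gamma> \<Longrightarrow>
    rewrite A (Cut (Ax (Ident A Z \<alpha> \<gamma>)) \<gamma> f) (rename A (transpose \<alpha> \<gamma>) f)"
| rw3: "\<alpha> \<noteq> \<gamma> \<Longrightarrow>
    rewrite A (Cut (Cotuple \<alpha> F) \<gamma> g) (Cotuple \<alpha> (fmmap (\<lambda>f. Cut f \<gamma> g) F))"
| rw4: "\<beta> \<noteq> \<gamma> \<Longrightarrow>
    rewrite A (Cut f \<gamma> (Tuple \<beta> G)) (Tuple \<beta> (fmmap (\<lambda>g. Cut f \<gamma> g) G))"
| rw5: "\<alpha> \<noteq> \<gamma> \<Longrightarrow>
    rewrite A (Cut (Inject \<alpha> k f) \<gamma> g) (Inject \<alpha> k (Cut f \<gamma> g))"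
| rw6: "\<beta> \<noteq> \<gamma> \<Longrightarrow>
    rewrite A (Cut f \<gamma> (Project \<beta> k g)) (Project \<beta> k (Cut f \<gamma> g))"
| rw7: "\<alpha> \<noteq> \<gamma> \<Longrightarrow>
    rewrite A (Cut (Project \<alpha> k f) \<gamma> g) (Project \<alpha> k (Cut f \<gamma> g))"
| rw8: "\<beta> \<noteq> \<gamma> \<Longrightarrow>
    rewrite A (Cut f \<gamma> (Inject \<beta> k g)) (Inject \<beta> k (Cut f \<gamma> g))"
| rw9: "\<alpha> \<noteq> \<gamma> \<Longrightarrow>
    rewrite A (Cut (Tuple \<alpha> F) \<gamma> g) (Tuple \<alpha> (fmmap (\<lambda>f. Cut f \<gamma> g) F))"
| rw10: "\<beta> \<noteq> \<gamma> \<Longrightarrow>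
    rewrite A (Cut f \<gamma> (Cotuple \<beta> G)) (Cotuple \<beta> (fmmap (\<lambda>g. Cut f \<gamma> g) G))"
| rw11: "fmlookup G k = Some g \<Longrightarrow>
    rewrite A (Cut (Inject \<gamma> k f) \<gamma> (Cotuple \<gamma> G)) (Cut f \<gamma> g)"
| rw12: "fmlookup F k = Some f \<Longrightarrow>
    rewrite A (Cut (Tuple \<gamma> F) \<gamma> (Project \<gamma> k g)) (Cut f \<gamma> g)"

inductive conversion :: "'m tm \<Rightarrow> 'm tm \<Rightarrow> bool" where
  cv13: "\<alpha> \<noteq> \<beta> \<Longrightarrow>
    conversion (Cotuple \<alpha> (fam I (\<lambda>i. Cotuple \<beta> (fam J (\<lambda>j. f i j)))))
               (Cotuple \<beta> (fam J (\<lambda>j. Cotuple \<alpha> (fam I (\<lambda>i. f i j)))))"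
| cv14: "\<alpha> \<noteq> \<beta> \<Longrightarrow>
    conversion (Tuple \<alpha> (fam I (\<lambda>i. Tuple \<beta> (fam J (\<lambda>j. f i j)))))
               (Tuple \<beta> (fam J (\<lambda>j. Tuple \<alpha> (fam I (\<lambda>i. f i j)))))"
| cv15: "\<alpha> \<noteq> \<beta> \<Longrightarrow>
    conversion (Cotuple \<alpha> (fmmap (\<lambda>f. Inject \<beta> k f) F)) (Inject \<beta> k (Cotuple \<alpha> F))"
| cv16: "\<alpha> \<noteq> \<beta> \<Longrightarrow>
    conversion (Project \<alpha> k (Tuple \<beta> G)) (Tuple \<beta> (fmmap (\<lambda>g. Project \<alpha> k g) G))"
| cv17: "\<alpha> \<noteq> \<beta> \<Longrightarrow>
    conversion (Cotuple \<alpha> (fmmap (\<lambda>f. Project \<beta> k f) F)) (Project \<beta> k (Cotuple \<alpha> F))"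
| cv18: "\<alpha> \<noteq> \<beta> \<Longrightarrow>
    conversion (Inject \<alpha> k (Tuple \<beta> G)) (Tuple \<beta> (fmmap (\<lambda>g. Inject \<alpha> k g) G))"
| cv19: "\<alpha> \<noteq> \<beta> \<Longrightarrow>
    conversion (Cotuple \<alpha> (fam I (\<lambda>i. Tuple \<beta> (fam J (\<lambda>j. f i j)))))
               (Tuple \<beta> (fam J (\<lambda>j. Cotuple \<alpha> (fam I (\<lambda>i. f i j)))))"
| cv20: "\<alpha> \<noteq> \<beta> \<Longrightarrow>
    conversion (Inject \<alpha> k (Inject \<beta> l f)) (Inject \<beta> l (Inject \<alpha> k f))"
| cv21: "\<alpha> \<noteq> \<beta> \<Longrightarrow>
    conversion (Project \<alpha> k (Project \<beta> l f)) (Project \<beta> l (Project \<alpha> k f))"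
| cv22: "\<alpha> \<noteq> \<beta> \<Longrightarrow>
    conversion (Inject \<alpha> k (Project \<beta> l f)) (Project \<beta> l (Inject \<alpha> k f))"

text \<open>
  \<open>equivalent A \<Gamma> \<Delta> s t\<close>: the terms \<open>s\<close> and \<open>t\<close> deriving \<open>\<Gamma> \<turnstile> \<Delta>\<close> are related by the least
  equivalence relation that contains all steps between derivations of a common sequent and
  is closed under the term formers.
\<close>

inductive equivalent ::
    "('o, 'm) polycat \<Rightarrow> 'o family \<Rightarrow> 'o family \<Rightarrow> 'm tm \<Rightarrow> 'm tm \<Rightarrow> bool"
  for A :: "('o, 'm) polycat" where
  eq_rewrite:
    "rewrite A s t \<Longrightarrow> derives A \<Gamma> \<Delta> s \<Longrightarrow> derives A \<Gamma> \<Delta> t \<Longrightarrow> equivalent A \<Gamma> \<Delta> s t"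
| eq_conversion:
    "conversion s t \<Longrightarrow> derives A \<Gamma> \<Delta> s \<Longrightarrow> derives A \<Gamma> \<Delta> t \<Longrightarrow> equivalent A \<Gamma> \<Delta> s t"
| eq_refl: "derives A \<Gamma> \<Delta> s \<Longrightarrow> equivalent A \<Gamma> \<Delta> s s"
| eq_sym: "equivalent A \<Gamma> \<Delta> s t \<Longrightarrow> equivalent A \<Gamma> \<Delta> t s"
| eq_trans:
    "equivalent A \<Gamma> \<Delta> s t \<Longrightarrow> equivalent A \<Gamma> \<Delta> t u \<Longrightarrow> equivalent A \<Gamma> \<Delta> s u"
| eq_Cotuple:
    "\<alpha> \<notin> fmdom' \<Gamma> \<Longrightarrow> wf_seq A (fmupd \<alpha> (Sum Xs) \<Gamma>) \<Delta> \<Longrightarrow>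
     fmdom' F = fmdom' Xs \<Longrightarrow> fmdom' G = fmdom' Xs \<Longrightarrow>
     (\<And>i X f g. fmlookup Xs i = Some X \<Longrightarrow> fmlookup F i = Some f \<Longrightarrow> fmlookup G i = Some g \<Longrightarrow>
        equivalent A (fmupd \<alpha> X \<Gamma>) \<Delta> f g) \<Longrightarrow>
     equivalent A (fmupd \<alpha> (Sum Xs) \<Gamma>) \<Delta> (Cotuple \<alpha> F) (Cotuple \<alpha> G)"
| eq_Tuple:
    "\<alpha> \<notin> fmdom' \<Delta> \<Longrightarrow> wf_seq A \<Gamma> (fmupd \<alpha> (Prod Xs) \<Delta>) \<Longrightarrow>
     fmdom' F = fmdom' Xs \<Longrightarrow> fmdom' G = fmdom' Xs \<Longrightarrow>
     (\<And>i X f g. fmlookup Xs i = Some X \<Longrightarrow> fmlookup F i = Some f \<Longrightarrow> fmlookup G i = Some g \<Longrightarrow>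
        equivalent A \<Gamma> (fmupd \<alpha> X \<Delta>) f g) \<Longrightarrow>
     equivalent A \<Gamma> (fmupd \<alpha> (Prod Xs) \<Delta>) (Tuple \<alpha> F) (Tuple \<alpha> G)"
| eq_Project:
    "\<alpha> \<notin> fmdom' \<Gamma> \<Longrightarrow> wf_seq A (fmupd \<alpha> (Prod Xs) \<Gamma>) \<Delta> \<Longrightarrow> fmlookup Xs k = Some X \<Longrightarrow>
     equivalent A (fmupd \<alpha> X \<Gamma>) \<Delta> f g \<Longrightarrow>
     equivalent A (fmupd \<alpha> (Prod Xs) \<Gamma>) \<Delta> (Project \<alpha> k f) (Project \<alpha> k g)"
| eq_Inject:
    "\<alpha> \<notin> fmdom' \<Delta> \<Longrightarrow> wf_seq A \<Gamma> (fmupd \<alpha> (Sum Xs) \<Delta>) \<Longrightarrow> fmlookup Xs k = Some X \<Longrightarrow>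
     equivalent A \<Gamma> (fmupd \<alpha> X \<Delta>) f g \<Longrightarrow>
     equivalent A \<Gamma> (fmupd \<alpha> (Sum Xs) \<Delta>) (Inject \<alpha> k f) (Inject \<alpha> k g)"
| eq_Cut:
    "\<gamma> \<notin> seq_chans \<Gamma> \<Delta> \<Longrightarrow> \<gamma> \<notin> seq_chans \<Gamma>' \<Delta>' \<Longrightarrow>
     seq_chans \<Gamma> \<Delta> \<inter> seq_chans \<Gamma>' \<Delta>' = {} \<Longrightarrow>
     equivalent A \<Gamma> (fmupd \<gamma> Z \<Delta>) f f' \<Longrightarrow> equivalent A (fmupd \<gamma> Z \<Gamma>') \<Delta>' g g' \<Longrightarrow>
     equivalent A (\<Gamma> ++\<^sub>f \<Gamma>') (\<Delta> ++\<^sub>f \<Delta>') (Cut f \<gamma> g) (Cut f' \<gamma> g')"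


section \<open>Algorithms: partial recursive functions\<close>

datatype prog =
    Zero
  | Succ
  | Arg nat
  | Compose prog "prog list"
  | PrimRec prog prog
  | Minimize prog

text \<open>\<open>computes p xs y\<close>: the program \<open>p\<close> halts on the arguments \<open>xs\<close> with the result \<open>y\<close>.\<close>

inductive computes :: "prog \<Rightarrow> nat list \<Rightarrow> nat \<Rightarrow> bool" where
  "computes Zero xs 0"
| "computes Succ [x] (Suc x)"
| "i < length xs \<Longrightarrow> computes (Arg i) xs (xs ! i)"
| "length ys = length qs \<Longrightarrow> (\<And>i. i < length qs \<Longrightarrow> computes (qs ! i) xs (ys ! i)) \<Longrightarrow>
     computes p ys z \<Longrightarrow> computes (Compose p qs) xs z"
| "computes p xs y \<Longrightarrow> computes (PrimRec p q) (0 # xs) y"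
| "computes (PrimRec p q) (n # xs) r \<Longrightarrow> computes q (n # r # xs) y \<Longrightarrow>
     computes (PrimRec p q) (Suc n # xs) y"
| "computes p (n # xs) 0 \<Longrightarrow> (\<And>m. m < n \<Longrightarrow> \<exists>v. computes p (m # xs) (Suc v)) \<Longrightarrow>
     computes (Minimize p) xs n"


section \<open>Effective presentations\<close>

text \<open>
  Objects and polymorphisms are given to programs through natural numbers. A numbering of a set
  \<open>S\<close> is a map from a set \<open>C\<close> of codes onto \<open>S\<close>; an element may have several codes. Syntax is coded
  by the usual pairing and list encodings.
\<close>

definition numbering :: "(nat \<Rightarrow> 'x) \<Rightarrow> nat set \<Rightarrow> 'x set \<Rightarrow> bool" where
  "numbering \<nu> C S \<longleftrightarrow> \<nu> ` C = S"

definition composition_computable ::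
    "('o, 'm) polycat \<Rightarrow> (nat \<Rightarrow> 'm) \<Rightarrow> nat set \<Rightarrow> bool" where
  "composition_computable A mor MC \<longleftrightarrow>
     (\<exists>p. \<forall>x \<in> MC. \<forall>y \<in> MC. \<forall>\<gamma>. composable A \<gamma> (mor x) (mor y) \<longrightarrow>
        (\<exists>z \<in> MC. computes p [x, \<gamma>, y] z \<and> mor z = Comp A \<gamma> (mor x) (mor y)))"

definition equality_decidable ::
    "('o, 'm) polycat \<Rightarrow> (nat \<Rightarrow> 'm) \<Rightarrow> nat set \<Rightarrow> bool" where
  "equality_decidable A mor MC \<longleftrightarrow>
     (\<exists>p. \<forall>x \<in> MC. \<forall>y \<in> MC.
        Dom A (mor x) = Dom A (mor y) \<and> Cod A (mor x) = Cod A (mor y) \<longrightarrow>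
        computes p [x, y] (if mor x = mor y then 1 else 0))"

definition fmap_code :: "(nat, nat) fmap \<Rightarrow> nat" where
  "fmap_code m = list_encode (map prod_encode (sorted_list_of_fmap m))"

primrec fm_code :: "nat fm \<Rightarrow> nat" where
  "fm_code (Atom a) = prod_encode (0, a)"
| "fm_code (Sum Xs) = prod_encode (1, fmap_code (fmmap fm_code Xs))"
| "fm_code (Prod Xs) = prod_encode (2, fmap_code (fmmap fm_code Xs))"

definition family_code :: "nat family \<Rightarrow> nat" where
  "family_code \<Gamma> = fmap_code (fmmap fm_code \<Gamma>)"

primrec tm_code :: "nat tm \<Rightarrow> nat" where
  "tm_code (Ax x) = prod_encode (0, x)"
| "tm_code (Cotuple \<alpha> F) = prod_encode (1, prod_encode (\<alpha>, fmap_code (fmmap tm_code F)))"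
| "tm_code (Tuple \<alpha> F) = prod_encode (2, prod_encode (\<alpha>, fmap_code (fmmap tm_code F)))"
| "tm_code (Project \<alpha> k f) = prod_encode (3, prod_encode (\<alpha>, prod_encode (k, tm_code f)))"
| "tm_code (Inject \<alpha> k f) = prod_encode (4, prod_encode (\<alpha>, prod_encode (k, tm_code f)))"
| "tm_code (Cut f \<gamma> g) = prod_encode (5, prod_encode (\<gamma>, prod_encode (tm_code f, tm_code g)))"

text \<open>
  \<open>family_named_by obj OC \<Gamma>\<^sub>c \<Gamma>\<close>: the family \<open>\<Gamma>\<close> results from \<open>\<Gamma>\<^sub>c\<close> by replacing the codes of
  atoms by the atoms that they name; likewise for the axioms of a term.
\<close>

definition family_named_by ::
    "(nat \<Rightarrow> 'o) \<Rightarrow> nat set \<Rightarrow> nat family \<Rightarrow> 'o family \<Rightarrow> bool" where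
  "family_named_by obj OC \<Gamma>\<^sub>c \<Gamma> \<longleftrightarrow>
     (\<forall>X \<in> fmran' \<Gamma>\<^sub>c. set_fm X \<subseteq> OC) \<and> \<Gamma> = fmmap (map_fm obj) \<Gamma>\<^sub>c"

definition tm_named_by :: "(nat \<Rightarrow> 'm) \<Rightarrow> nat set \<Rightarrow> nat tm \<Rightarrow> 'm tm \<Rightarrow> bool" where
  "tm_named_by mor MC s\<^sub>c s \<longleftrightarrow> set_tm s\<^sub>c \<subseteq> MC \<and> s = map_tm mor s\<^sub>c"

end

theory Submission
  imports Defs
begin

text \<open>
  Every derivation is equivalent to a cut-free one, computed by pushing cuts inwards, and two
  derivations are equivalent if and only if their cut-free forms are related by the permuting
  conversions through terms of the given sequent. A cut-free term is built from axioms by rules that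
  replace a formula of the sequent by one of its components, and conversions permute the leaves
  without changing the sequents at which they occur. Hence only finitely many terms can be reached,
  and convertibility is the least set of pairs of terms closed under finitely many kinds of rules.

  Programs know only primitive recursion and minimization. Cut-free forms are found by searching for
  a finite set of claims that justify one another, and the least number that codes a closed set is
  the code of the least closed set. The axioms of the cut-free forms are first kept as formal
  composites; composition is called only on composable ones, and equality is tested only
  between composites that occur as leaves at the same sequent, where the oracle is correct.
\<close>

text \<open>Two features of the logic decide the form of the proof. Index sets may be empty: by (13)
  to (19) an empty cotuple or tuple can acquire further rules, so conversion preserves neither the
  size of a term nor the number of its rules, and no canonical representative is in sight. What
  stays under control is the sequent, which every rule shrinks; so the related pairs are found by
  saturation over the finite stock of terms of the sequent. Atoms are known by codes, one atom may
  have many, and nothing decides whether two codes name the same atom. The program therefore never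
  compares atoms. It follows the sequent formed by the codes of atoms through the terms; two leaves
  met at the same coded sequent have equal domain and codomain, which is all that the equality test
  asks for. Cut elimination is a fixed function that lets the rules of the left premise out first.
  Rewrites that act on the right premise are respected only up to conversion, so its correctness is
  stated modulo conversions from the start.\<close>

subsection \<open>Computable functions on lists\<close>

text \<open>The program is constrained on \<open>D\<close> only and may diverge elsewhere. Total
  functions take for \<open>D\<close> all lists of one length; calls of the two oracles force
  smaller domains.\<close>

definition pc :: "nat list set \<Rightarrow> (nat list \<Rightarrow> nat) \<Rightarrow> bool" where
  "pc D f \<longleftrightarrow> (\<exists>p. \<forall>xs\<in>D. computes p xs (f xs))"

abbreviation cmp :: "nat \<Rightarrow> (nat list \<Rightarrow> nat) \<Rightarrow> bool" where
  "cmp n f \<equiv> pc {xs. length xs = n} f"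

abbreviation dec :: "nat \<Rightarrow> (nat list \<Rightarrow> bool) \<Rightarrow> bool" where
  "dec n P \<equiv> cmp n (\<lambda>e. of_bool (P e))"

lemma pc_mono: "pc E f \<Longrightarrow> D \<subseteq> E \<Longrightarrow> pc D f"
  unfolding pc_def by blast

lemma pc_cong: "pc D g \<Longrightarrow> (\<And>xs. xs \<in> D \<Longrightarrow> f xs = g xs) \<Longrightarrow> pc D f"
  unfolding pc_def by auto

lemma pc_compose:
  assumes "pc E g" "\<And>f. f \<in> set fs \<Longrightarrow> pc D f" "\<And>e. e \<in> D \<Longrightarrow> map (\<lambda>f. f e) fs \<in> E"
  shows "pc D (\<lambda>e. g (map (\<lambda>f. f e) fs))"
proof -
  obtain p where p: "\<And>xs. xs \<in> E \<Longrightarrow> computes p xs (g xs)"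
    using assms(1) unfolding pc_def by blast
  define q where "q f = (SOME q. \<forall>xs\<in>D. computes q xs (f xs))" for f
  have q: "computes (q f) xs (f xs)" if "f \<in> set fs" "xs \<in> D" for f xs
    using someI_ex[OF assms(2)[OF that(1), unfolded pc_def]] that(2) unfolding q_def by blast
  have "computes (Compose p (map q fs)) e (g (map (\<lambda>f. f e) fs))" if "e \<in> D" for e
    by (rule computes.intros(4)[where ys = "map (\<lambda>f. f e) fs"]) (auto intro: q p assms(3) that)
  then show ?thesis unfolding pc_def by blast
qed

lemma cmp_compose:
  "cmp (length fs) g \<Longrightarrow> (\<And>f. f \<in> set fs \<Longrightarrow> pc D f) \<Longrightarrow> pc D (\<lambda>e. g (map (\<lambda>f. f e) fs))"
  by (erule pc_compose) auto

lemma cmp_arg: "i < n \<Longrightarrow> cmp n (\<lambda>e. e ! i)"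
  unfolding pc_def by (rule exI[of _ "Arg i"]) (auto intro: computes.intros)

lemma cmp1: "cmp 1 (\<lambda>e. F (e ! 0)) \<Longrightarrow> pc D f \<Longrightarrow> pc D (\<lambda>e. F (f e))"
  using cmp_compose[of "[f]" "\<lambda>e. F (e ! 0)" D] by simp

lemma cmp2:
  "cmp 2 (\<lambda>e. F (e ! 0) (e ! 1)) \<Longrightarrow> pc D f \<Longrightarrow> pc D g \<Longrightarrow> pc D (\<lambda>e. F (f e) (g e))"
  using cmp_compose[of "[f, g]" "\<lambda>e. F (e ! 0) (e ! 1)" D] by (auto simp: numeral_2_eq_2)

lemma cmp3:
  "cmp 3 (\<lambda>e. F (e ! 0) (e ! 1) (e ! 2)) \<Longrightarrow> pc D f \<Longrightarrow> pc D g \<Longrightarrow> pc D h \<Longrightarrow>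
   pc D (\<lambda>e. F (f e) (g e) (h e))"
  using cmp_compose[of "[f, g, h]" "\<lambda>e. F (e ! 0) (e ! 1) (e ! 2)" D]
  by (auto simp: numeral_3_eq_3 numeral_2_eq_2)

lemma cmp4:
  "cmp 4 (\<lambda>e. F (e ! 0) (e ! 1) (e ! 2) (e ! 3)) \<Longrightarrow> pc D f \<Longrightarrow> pc D g \<Longrightarrow> pc D h \<Longrightarrow>
   pc D k \<Longrightarrow> pc D (\<lambda>e. F (f e) (g e) (h e) (k e))"
  using cmp_compose[of "[f, g, h, k]" "\<lambda>e. F (e ! 0) (e ! 1) (e ! 2) (e ! 3)" D]
  by (auto simp: eval_nat_numeral)

lemma cmp5:
  "cmp 5 (\<lambda>e. F (e ! 0) (e ! 1) (e ! 2) (e ! 3) (e ! 4)) \<Longrightarrow> pc D f \<Longrightarrow> pc D g \<Longrightarrow>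
   pc D h \<Longrightarrow> pc D k \<Longrightarrow> pc D l \<Longrightarrow> pc D (\<lambda>e. F (f e) (g e) (h e) (k e) (l e))"
  using cmp_compose[of "[f, g, h, k, l]" "\<lambda>e. F (e ! 0) (e ! 1) (e ! 2) (e ! 3) (e ! 4)" D]
  by (auto simp: eval_nat_numeral)

lemma cmp_Suc: "pc D f \<Longrightarrow> pc D (\<lambda>e. Suc (f e))"
proof (erule cmp1[rotated, where F = Suc])
  show "cmp 1 (\<lambda>e. Suc (e ! 0))"
    unfolding pc_def
    by (rule exI[of _ "Succ"]) (auto simp: length_Suc_conv intro: computes.intros)
qed

lemma cmp_const: "pc D (\<lambda>e. k)"
proof (induction k)
  case 0
  show ?case unfolding pc_def by (rule exI[of _ Zero]) (auto intro: computes.intros)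
qed (rule cmp_Suc)

lemma nth_funpow_tl: "k + i < length e \<Longrightarrow> (tl ^^ k) e ! i = e ! (k + i)"
proof (induction k arbitrary: e)
  case (Suc k)
  have "(tl ^^ Suc k) e ! i = (tl ^^ k) (tl e) ! i" by (simp add: funpow_swap1)
  also have "\<dots> = tl e ! (k + i)" using Suc.prems by (intro Suc.IH) simp
  also have "\<dots> = e ! (Suc k + i)" using Suc.prems by (simp add: nth_tl)
  finally show ?case .
qed simp

lemma cmp_acc: "k + i < n \<Longrightarrow> cmp n (\<lambda>e. (tl ^^ k) e ! i)"
  by (rule pc_cong[OF cmp_arg[of "k + i"]]) (auto simp: nth_funpow_tl)

text \<open>A bounded quantifier or a recursion pushes its variables in front of the argument list,
  so inside nested ones the older arguments appear as entries of iterated tails. These forms are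
  listed literally because introduction rules match them syntactically.\<close>

lemma cmp_accs:
  shows "i < n \<Longrightarrow> cmp n (\<lambda>e. e ! i)"
  and "1 + i < n \<Longrightarrow> cmp n (\<lambda>e. (tl e) ! i)"
  and "2 + i < n \<Longrightarrow> cmp n (\<lambda>e. (tl (tl e)) ! i)"
  and "3 + i < n \<Longrightarrow> cmp n (\<lambda>e. (tl (tl (tl e))) ! i)"
  and "4 + i < n \<Longrightarrow> cmp n (\<lambda>e. (tl (tl (tl (tl e)))) ! i)"
  and "5 + i < n \<Longrightarrow> cmp n (\<lambda>e. (tl (tl (tl (tl (tl e))))) ! i)"
  and "6 + i < n \<Longrightarrow> cmp n (\<lambda>e. (tl (tl (tl (tl (tl (tl e)))))) ! i)"
  and "7 + i < n \<Longrightarrow> cmp n (\<lambda>e. (tl (tl (tl (tl (tl (tl (tl e))))))) ! i)"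
  and "8 + i < n \<Longrightarrow> cmp n (\<lambda>e. (tl (tl (tl (tl (tl (tl (tl (tl e)))))))) ! i)"
  and "9 + i < n \<Longrightarrow> cmp n (\<lambda>e. (tl (tl (tl (tl (tl (tl (tl (tl (tl e))))))))) ! i)"
  using cmp_acc[of 0 i n] cmp_acc[of 1 i n] cmp_acc[of 2 i n]  cmp_acc[of 3 i n]  cmp_acc[of 4 i n]  cmp_acc[of 5 i n]  cmp_acc[of 6 i n]  cmp_acc[of 7 i n]  cmp_acc[of 8 i n]  cmp_acc[of 9 i n]
  by (simp_all add: eval_nat_numeral)

text \<open>The step has to be right only in the states that the recursion really reaches:
  \<open>m\<close> below the bound and the accumulator equal to the value at \<open>m\<close>. This
  is what keeps an oracle called from within a recursion inside its domain.\<close>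

lemma pc_PrimRec:
  assumes "\<exists>q. \<forall>e\<in>D. computes q e (b e)"
    and "\<exists>q. \<forall>e\<in>D. \<forall>m < k e. computes q (m # rec_nat (b e) (\<lambda>m r. s m r e) m # e)
           (s m (rec_nat (b e) (\<lambda>m r. s m r e) m) e)"
    and "pc D k" and D: "\<And>e. e \<in> D \<Longrightarrow> length e = n"
  shows "pc D (\<lambda>e. rec_nat (b e) (\<lambda>m r. s m r e) (k e))"
proof -
  obtain pb ps pk where p: "\<And>e. e \<in> D \<Longrightarrow> computes pb e (b e)"
    "\<And>e m. e \<in> D \<Longrightarrow> m < k e \<Longrightarrow> computes ps (m # rec_nat (b e) (\<lambda>m r. s m r e) m # e)
           (s m (rec_nat (b e) (\<lambda>m r. s m r e) m) e)"
    "\<And>e. e \<in> D \<Longrightarrow> computes pk e (k e)"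
    using assms unfolding pc_def by blast
  have rec: "computes (PrimRec pb ps) (m # e) (rec_nat (b e) (\<lambda>m r. s m r e) m)"
    if "e \<in> D" "m \<le> k e" for e m
    using that(2)
  proof (induction m)
    case 0
    then show ?case using p(1)[OF that(1)] by (auto intro: computes.intros)
  next
    case (Suc m)
    then show ?case using computes.intros(6)[OF Suc.IH p(2)[OF that(1), of m]] by simp
  qed
  have "computes (Compose (PrimRec pb ps) (pk # map Arg [0..<n])) e
          (rec_nat (b e) (\<lambda>m r. s m r e) (k e))" if e: "e \<in> D" for e
    by (rule computes.intros(4)[where ys = "k e # e"])
      (auto simp: D[OF e] nth_Cons' intro!: p(3) e rec computes.intros(3))
  then show ?thesis unfolding pc_def by blast
qed

lemma cmp_rec0:
  assumes "cmp n b" "cmp (Suc (Suc n)) s" "cmp n k"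
  shows "cmp n (\<lambda>e. rec_nat (b e) (\<lambda>m r. s (m # r # e)) (k e))"
proof (rule pc_PrimRec[OF _ _ assms(3)])
  show "\<exists>q. \<forall>e\<in>{xs. length xs = n}. computes q e (b e)" using assms(1) by (simp add: pc_def)
  obtain q where "\<forall>e\<in>{xs. length xs = Suc (Suc n)}. computes q e (s e)"
    using assms(2) unfolding pc_def by blast
  then show "\<exists>q. \<forall>e\<in>{xs. length xs = n}. \<forall>m<k e.
      computes q (m # rec_nat (b e) (\<lambda>m r. s (m # r # e)) m # e)
        (s (m # rec_nat (b e) (\<lambda>m r. s (m # r # e)) m # e))"
    by (intro exI[of _ q]) auto
qed auto

lemma cmp_rec:
  assumes "cmp n b" "cmp (Suc (Suc n)) (\<lambda>e. s (e ! 0) (e ! 1) (tl (tl e)))" "cmp n k"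
  shows "cmp n (\<lambda>e. rec_nat (b e) (\<lambda>m r. s m r e) (k e))"
  using cmp_rec0[OF assms] by simp

text \<open>In a recursive step the accumulator stands between the counter and the arguments;
  projections drop it, so that a function of counter and arguments can be used there.\<close>

lemma cmp_weaken:
  assumes "cmp (Suc n) (\<lambda>e. f (e ! 0) (tl e))"
  shows "cmp (Suc (Suc n)) (\<lambda>e. f (e ! 0) (tl (tl e)))"
proof -
  have "cmp (Suc (Suc n)) (\<lambda>e. (\<lambda>e. f (e ! 0) (tl e))
     (map (\<lambda>f. f e) ((\<lambda>e. e ! 0) # map (\<lambda>i e. e ! i) [2..<Suc (Suc n)])))"
    using assms by (intro cmp_compose) (auto intro!: cmp_arg simp del: upt_Suc)
  moreover have "map ((!) e) [2..<Suc (Suc n)] = tl (tl e)" if "length e = Suc (Suc n)" for e :: "nat list"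
    using that by (intro nth_equalityI) (auto simp: nth_tl simp del: upt_Suc)
  ultimately show ?thesis
    by (elim pc_cong) (auto simp: o_def simp del: upt_Suc)
qed

lemma cmp_add: "pc D f \<Longrightarrow> pc D g \<Longrightarrow> pc D (\<lambda>e. f e + g e)"
proof (erule (1) cmp2[rotated])
  have "cmp 2 (\<lambda>e. rec_nat (e ! 0) (\<lambda>m r. Suc r) (e ! 1))"
    by (intro cmp_rec cmp_Suc cmp_arg) auto
  moreover have "rec_nat a (\<lambda>m r. Suc r) b = a + b" for a b by (induction b) auto
  ultimately show "cmp 2 (\<lambda>e. e ! 0 + e ! 1)" by simp
qed

lemma cmp_mult: "pc D f \<Longrightarrow> pc D g \<Longrightarrow> pc D (\<lambda>e. f e * g e)"
proof (erule (1) cmp2[rotated])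
  have "cmp 2 (\<lambda>e. rec_nat 0 (\<lambda>m r. r + e ! 0) (e ! 1))"
    by (intro cmp_rec cmp_add cmp_const cmp_accs) auto
  moreover have "rec_nat 0 (\<lambda>m r. r + a) b = a * b" for a b :: nat by (induction b) auto
  ultimately show "cmp 2 (\<lambda>e. e ! 0 * e ! 1)" by simp
qed

lemma cmp_diff: "pc D f \<Longrightarrow> pc D g \<Longrightarrow> pc D (\<lambda>e. f e - g e)"
proof (erule (1) cmp2[rotated])
  have "cmp 1 (\<lambda>e. rec_nat 0 (\<lambda>m r. m) (e ! 0))"
    by (intro cmp_rec cmp_const cmp_accs) auto
  moreover have "rec_nat 0 (\<lambda>m r. m) b = b - 1" for b :: nat by (induction b) auto
  ultimately have pred: "cmp 1 (\<lambda>e. e ! 0 - 1)" by simp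
  have "cmp 2 (\<lambda>e. rec_nat (e ! 0) (\<lambda>m r. r - 1) (e ! 1))"
    by (intro cmp_rec cmp1[OF pred] cmp_accs) auto
  moreover have "rec_nat a (\<lambda>m r. r - 1) b = a - b" for a b :: nat by (induction b) auto
  ultimately show "cmp 2 (\<lambda>e. e ! 0 - e ! 1)" by simp
qed

lemma cmp_pow2: "pc D f \<Longrightarrow> pc D (\<lambda>e. 2 ^ f e)"
proof (erule cmp1[rotated])
  have "cmp 1 (\<lambda>e. rec_nat 1 (\<lambda>m r. r + r) (e ! 0))"
    by (intro cmp_rec cmp_add cmp_const cmp_accs) auto
  moreover have "rec_nat (1 :: nat) (\<lambda>m r. r + r) b = 2 ^ b" for b by (induction b) auto
  ultimately show "cmp 1 (\<lambda>e. 2 ^ (e ! 0))" by simp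
qed

lemma dec_not: "pc D (\<lambda>e. of_bool (P e)) \<Longrightarrow> pc D (\<lambda>e. of_bool (\<not> P e))"
proof -
  assume "pc D (\<lambda>e. of_bool (P e))"
  then have "pc D (\<lambda>e. 1 - of_bool (P e))" by (intro cmp_diff cmp_const)
  then show ?thesis by (elim pc_cong) auto
qed

lemma dec_conj: "pc D (\<lambda>e. of_bool (P e)) \<Longrightarrow> pc D (\<lambda>e. of_bool (Q e)) \<Longrightarrow>
   pc D (\<lambda>e. of_bool (P e \<and> Q e))"
  by (rule pc_cong[OF cmp_mult[of D "\<lambda>e. of_bool (P e)" "\<lambda>e. of_bool (Q e)"]]) auto

lemma dec_disj: "pc D (\<lambda>e. of_bool (P e)) \<Longrightarrow> pc D (\<lambda>e. of_bool (Q e)) \<Longrightarrow>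
   pc D (\<lambda>e. of_bool (P e \<or> Q e))"
proof -
  assume "pc D (\<lambda>e. of_bool (P e))" "pc D (\<lambda>e. of_bool (Q e))"
  then have "pc D (\<lambda>e. of_bool (\<not> (\<not> P e \<and> \<not> Q e)))" by (intro dec_not dec_conj)
  then show ?thesis by simp
qed

lemma dec_imp: "pc D (\<lambda>e. of_bool (P e)) \<Longrightarrow> pc D (\<lambda>e. of_bool (Q e)) \<Longrightarrow>
   pc D (\<lambda>e. of_bool (P e \<longrightarrow> Q e))"
proof -
  assume "pc D (\<lambda>e. of_bool (P e))" "pc D (\<lambda>e. of_bool (Q e))"
  then have "pc D (\<lambda>e. of_bool (\<not> (P e \<and> \<not> Q e)))" by (intro dec_not dec_conj)
  then show ?thesis by simp
qed

lemma dec_less: "pc D f \<Longrightarrow> pc D g \<Longrightarrow> pc D (\<lambda>e. of_bool (f e < g e))"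
proof -
  assume "pc D f" "pc D g"
  \<comment> \<open>Subtraction is truncated: \<open>g e - f e\<close> is positive exactly if
    \<open>f e < g e\<close>, and subtracting twice from 1 cuts this down to a truth value.\<close>
  then have "pc D (\<lambda>e. 1 - (1 - (g e - f e)))" by (intro cmp_diff cmp_const)
  then show ?thesis by (elim pc_cong) auto
qed

lemma dec_le: "pc D f \<Longrightarrow> pc D g \<Longrightarrow> pc D (\<lambda>e. of_bool (f e \<le> g e))"
  using dec_less[of D f "\<lambda>e. Suc (g e)"] by (simp add: cmp_Suc less_Suc_eq_le)

lemma dec_eq: "pc D f \<Longrightarrow> pc D g \<Longrightarrow> pc D (\<lambda>e. of_bool (f e = g e))"
proof -
  assume "pc D f" "pc D g"
  then have "pc D (\<lambda>e. of_bool (f e \<le> g e \<and> g e \<le> f e))" by (intro dec_conj dec_le)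
  then show ?thesis by (elim pc_cong) auto
qed

lemma cmp_if: "pc D (\<lambda>e. of_bool (P e)) \<Longrightarrow> pc D f \<Longrightarrow> pc D g \<Longrightarrow>
  pc D (\<lambda>e. if P e then f e else g e)"
proof -
  assume "pc D (\<lambda>e. of_bool (P e))" "pc D f" "pc D g"
  then have "pc D (\<lambda>e. of_bool (P e) * f e + of_bool (\<not> P e) * g e)"
    by (intro cmp_add cmp_mult dec_not)
  then show ?thesis by (elim pc_cong) auto
qed

lemma cmp_sum:
  assumes "cmp n b" "cmp (Suc n) (\<lambda>e. f (e ! 0) (tl e))"
  shows "cmp n (\<lambda>e. \<Sum>x<b e. f x e)"
proof -
  have "cmp n (\<lambda>e. rec_nat 0 (\<lambda>m r. r + f m e) (b e))"
    by (intro cmp_rec cmp_add cmp_const cmp_accs cmp_weaken assms) auto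
  moreover have "rec_nat 0 (\<lambda>m r. r + f m e) k = (\<Sum>x<k. f x e)" for k e by (induction k) auto
  ultimately show ?thesis by simp
qed

lemma dec_ex:
  assumes "cmp n b" "dec (Suc n) (\<lambda>e. P (e ! 0) (tl e))"
  shows "dec n (\<lambda>e. \<exists>x<b e. P x e)"
proof -
  \<comment> \<open>Bounded search by counting: some instance holds if and only if the sum of the
    truth values is positive.\<close>
  have "dec n (\<lambda>e. 0 < (\<Sum>x<b e. of_bool (P x e) :: nat))"
    by (intro cmp_sum dec_less assms cmp_const)
  then show ?thesis by (elim pc_cong) (auto simp: Bex_def)
qed

lemma dec_all:
  assumes "cmp n b" "dec (Suc n) (\<lambda>e. P (e ! 0) (tl e))"
  shows "dec n (\<lambda>e. \<forall>x<b e. P x e)"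
proof -
  have "dec n (\<lambda>e. \<not> (\<exists>x<b e. \<not> P x e))"
    by (intro dec_not dec_ex assms)
  then show ?thesis by simp
qed

lemmas dec0 = dec_all dec_ex dec_not dec_conj dec_disj dec_imp dec_less dec_le dec_eq
  cmp_if cmp_add cmp_mult cmp_diff cmp_pow2 cmp_Suc cmp_const

text \<open>The test must be total, while a witness has to exist on \<open>D\<close> only.
  \<open>Minimize\<close> looks for a zero, hence the negated test.\<close>

lemma pc_Least:
  assumes "dec (Suc n) (\<lambda>e. P (e ! 0) (tl e))"
    and "\<And>e. e \<in> D \<Longrightarrow> length e = n" "\<And>e. e \<in> D \<Longrightarrow> \<exists>x. P x e"
  shows "pc D (\<lambda>e. LEAST x. P x e)"
proof -
  obtain p where p: "\<And>xs. length xs = Suc n \<Longrightarrow> computes p xs (of_bool (\<not> P (xs ! 0) (tl xs)))"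
    using dec_not[OF assms(1)] unfolding pc_def by blast
  have "computes (Minimize p) e (LEAST x. P x e)" if e: "e \<in> D" for e
  proof (rule computes.intros(7))
    show "computes p ((LEAST x. P x e) # e) 0"
      using p[of "(LEAST x. P x e) # e"] assms(2)[OF e] LeastI_ex[OF assms(3)[OF e]] by simp
    show "\<exists>v. computes p (m # e) (Suc v)" if "m < (LEAST x. P x e)" for m
      using p[of "m # e"] assms(2)[OF e] not_less_Least[OF that] by auto
  qed
  then show ?thesis unfolding pc_def by blast
qed

section \<open>Pairs, finite sets and lists as numbers\<close>

definition mem :: "nat \<Rightarrow> nat \<Rightarrow> bool" where "mem x R \<longleftrightarrow> x \<in> set_decode R"

abbreviation "pr a b \<equiv> prod_encode (a, b)"
definition "f1 n = fst (prod_decode n)"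
definition "f2 n = snd (prod_decode n)"

lemma f1_pr[simp]: "f1 (pr a b) = a" and f2_pr[simp]: "f2 (pr a b) = b"
  by (auto simp: f1_def f2_def)

lemma pr_f[simp]: "pr (f1 n) (f2 n) = n" by (simp add: f1_def f2_def)

lemma pr_eq: "pr a b = n \<longleftrightarrow> a = f1 n \<and> b = f2 n" by auto

lemma cmp_pr: "pc D f \<Longrightarrow> pc D g \<Longrightarrow> pc D (\<lambda>e. pr (f e) (g e))"
proof (erule (1) cmp2[rotated])
  have "cmp 1 (\<lambda>e. \<Sum>x<Suc (e ! 0). x)"
    by (intro cmp_sum dec0 cmp_accs) auto
  moreover have "(\<Sum>x<Suc k. x) = triangle k" for k
    by (induction k) (auto simp: triangle_Suc)
  ultimately have t: "cmp 1 (\<lambda>e. triangle (e ! 0))" by simp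
  show "cmp 2 (\<lambda>e. pr (e ! 0) (e ! 1))"
    unfolding prod_encode_def by (auto intro!: cmp1[OF t] dec0 cmp_accs)
qed

lemma f1_le: "f1 n \<le> n" and f2_le: "f2 n \<le> n"
  by (metis le_prod_encode_1 pr_f) (metis le_prod_encode_2 pr_f)

lemma cmp_f1: "pc D f \<Longrightarrow> pc D (\<lambda>e. f1 (f e))"
proof (erule cmp1[rotated])
  \<comment> \<open>Bounded search written as a sum: the only summand that can be nonzero is the one
    at the component sought.\<close>
  have "cmp 1 (\<lambda>e. \<Sum>a<Suc (e ! 0). if \<exists>b<Suc (e ! 0). pr a b = e ! 0 then a else 0)"
    by (intro cmp_sum dec0 cmp_accs cmp_pr) auto
  moreover have "(\<Sum>a<Suc k. if \<exists>b<Suc k. pr a b = k then a else 0) = f1 k" for k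
  proof -
    have "(\<exists>b<Suc k. pr a b = k) \<longleftrightarrow> a = f1 k" for a
      using f2_le[of k] by (auto simp: pr_eq less_Suc_eq_le)
    then show ?thesis using f1_le[of k] by (simp add: sum.delta del: sum.lessThan_Suc)
  qed
  ultimately show "cmp 1 (\<lambda>e. f1 (e ! 0))" by simp
qed

lemma cmp_f2: "pc D f \<Longrightarrow> pc D (\<lambda>e. f2 (f e))"
proof (erule cmp1[rotated])
  have "cmp 1 (\<lambda>e. \<Sum>a<Suc (e ! 0). if \<exists>b<Suc (e ! 0). pr b a = e ! 0 then a else 0)"
    by (intro cmp_sum dec0 cmp_accs cmp_pr) auto
  moreover have "(\<Sum>a<Suc k. if \<exists>b<Suc k. pr b a = k then a else 0) = f2 k" for k
  proof -
    have "(\<exists>b<Suc k. pr b a = k) \<longleftrightarrow> a = f2 k" for a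
      using f1_le[of k] by (auto simp: pr_eq less_Suc_eq_le)
    then show ?thesis using f2_le[of k] by (simp add: sum.delta del: sum.lessThan_Suc)
  qed
  ultimately show "cmp 1 (\<lambda>e. f2 (e ! 0))" by simp
qed

text \<open>Bit \<open>x\<close> of \<open>R\<close> is set if the quotient by \<open>2 ^ x\<close>
  is odd. Spelling out quotient and remainder leaves addition, multiplication, powers of two and
  bounded quantifiers, for which programs are already at hand.\<close>

lemma mem_bounded: "mem x R \<longleftrightarrow> (\<exists>q<Suc R. \<exists>r<2 ^ x. R = (2 * q + 1) * 2 ^ x + r)"
proof
  assume "mem x R"
  then have "odd (R div 2 ^ x)" by (simp add: mem_def set_decode_def)
  then obtain q where "R div 2 ^ x = 2 * q + 1" by (rule oddE)
  then have "R = (2 * q + 1) * 2 ^ x + R mod 2 ^ x" by (metis div_mult_mod_eq)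
  moreover have "q < Suc R" using \<open>R div 2 ^ x = 2 * q + 1\<close> div_le_dividend[of R "2 ^ x"] by linarith
  ultimately show "\<exists>q<Suc R. \<exists>r<2 ^ x. R = (2 * q + 1) * 2 ^ x + r"
    by (intro exI[of _ q] conjI exI[of _ "R mod 2 ^ x"]) auto
next
  assume "\<exists>q<Suc R. \<exists>r<2 ^ x. R = (2 * q + 1) * 2 ^ x + r"
  then obtain q r where qr: "r < 2 ^ x" and R: "R = r + (2 * q + 1) * 2 ^ x" by (auto simp: add.commute)
  have "R div 2 ^ x = 2 * q + 1" unfolding R using qr by (subst div_mult_self1) auto
  then show "mem x R" by (simp add: mem_def set_decode_def)
qed

lemma dec_mem: "pc D f \<Longrightarrow> pc D g \<Longrightarrow> pc D (\<lambda>e. of_bool (mem (f e) (g e)))"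
  by (erule (1) cmp2[rotated], unfold mem_bounded) (intro dec0 cmp_accs; simp)

definition lmem :: "nat \<Rightarrow> nat \<Rightarrow> bool" where "lmem x c \<longleftrightarrow> x \<in> set (list_decode c)"

text \<open>\<open>list_encode\<close> maps the empty list to 0 and any other list to the successor
  of the pair of head and coded tail. So \<open>f2 (r - 1)\<close> passes to the tail and leaves 0
  fixed, and a list is exhausted after at most as many rounds as its code.\<close>

lemma lmem_bounded:
  "lmem x c \<longleftrightarrow> (\<exists>k<Suc c. (let r = rec_nat c (\<lambda>_ r. f2 (r - 1)) k in 0 < r \<and> f1 (r - 1) = x))"
proof -
  have f2_less: "f2 (r - 1) < r" if "0 < r" for r using f2_le[of "r - 1"] that by linarith
  have shift: "rec_nat (f2 (c - 1)) (\<lambda>_ r. f2 (r - 1)) k = rec_nat c (\<lambda>_ r. f2 (r - 1)) (Suc k)" for k c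
    by (induction k) auto
  have z: "rec_nat 0 (\<lambda>_ r. f2 (r - 1)) k = 0" for k
    using f2_le[of 0] by (induction k) auto
  show ?thesis
  proof (induction c rule: less_induct)
    case (less c)
    show ?case
    proof (cases c)
      case 0
      then show ?thesis by (simp add: lmem_def)
    next
      case (Suc m)
      have dm: "lmem x c \<longleftrightarrow> x = f1 m \<or> lmem x (f2 m)"
        by (cases "prod_decode m") (simp add: lmem_def Suc f1_def f2_def)
      let ?r = "\<lambda>c. rec_nat c (\<lambda>_ r. f2 (r - 1))"
      have "lmem x (f2 m) \<longleftrightarrow> (\<exists>k<Suc (f2 m). let r = ?r (f2 m) k in 0 < r \<and> f1 (r - 1) = x)"
        using f2_le[of m] Suc by (intro less.IH) simp
      also have "\<dots> \<longleftrightarrow> (\<exists>k<Suc m. let r = ?r (f2 m) k in 0 < r \<and> f1 (r - 1) = x)"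
      proof -
        have le: "k \<le> f2 m" if "0 < ?r (f2 m) k" for k
        proof -
          \<comment> \<open>Each round lowers a nonzero code by at least one. Rounds beyond
            \<open>f2 m\<close> therefore see only 0 and add no entries, and the bound can be raised
            to \<open>m\<close>.\<close>
          have "?r d k + k \<le> d \<or> ?r d k = 0" for d
          proof (induction k)
            case (Suc k)
            show ?case
            proof (cases "?r d k = 0")
              case True
              then show ?thesis using f2_le[of 0] by simp
            next
              case False
              then show ?thesis using Suc f2_less[of "?r d k"] by auto
            qed
          qed simp
          from this[of "f2 m"] that show ?thesis by auto
        qed
        show ?thesis
          using le f2_le[of m] by (auto simp: Let_def less_Suc_eq_le intro: le_trans)
      qed
      also have "\<dots> \<longleftrightarrow> (\<exists>k<Suc m. let r = ?r c (Suc k) in 0 < r \<and> f1 (r - 1) = x)"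
        using shift[of c] Suc by simp
      finally have 1: "lmem x (f2 m) \<longleftrightarrow> (\<exists>k<Suc m. let r = ?r c (Suc k) in 0 < r \<and> f1 (r - 1) = x)" .
      have 2: "(let r = ?r c 0 in 0 < r \<and> f1 (r - 1) = x) \<longleftrightarrow> x = f1 m"
        using Suc by (auto simp: Let_def)
      show ?thesis unfolding Ex_less_Suc2[of c] 2 dm 1 unfolding Suc ..
    qed
  qed
qed

lemma dec_lmem: "pc D f \<Longrightarrow> pc D g \<Longrightarrow> pc D (\<lambda>e. of_bool (lmem (f e) (g e)))"
  by (erule (1) cmp2[rotated], unfold lmem_bounded Let_def)
    (intro dec0 cmp_rec cmp_accs cmp_f1 cmp_f2; simp)

lemmas dec_rules = dec0 cmp_pr cmp_f1 cmp_f2 dec_mem dec_lmem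

text \<open>Turns quantification over a coded set into bounded quantification.\<close>

lemma mem_less: "mem x R \<Longrightarrow> x < R"
proof -
  assume "mem x R"
  then have "R div 2 ^ x \<noteq> 0" unfolding mem_def set_decode_def by (metis even_zero mem_Collect_eq)
  then have "2 ^ x \<le> R" by (simp add: div_eq_0_iff)
  then show ?thesis using less_exp[of x] by linarith
qed

section \<open>Cut-free terms and their typing\<close>

text \<open>
  Cut-free terms with leaves in \<open>'l\<close>. \<open>Par\<close> stands for cotuples and tuples, \<open>Sel\<close> for projections and
  injections: the sequent determines which one is meant. The values of \<open>h\<close> outside \<open>I\<close> in \<open>Par \<alpha> I h\<close>
  are junk.
\<close>

datatype 'l nt =
    Leaf 'l
  | Par chan "name set" "name \<Rightarrow> 'l nt"
  | Sel chan name "'l nt"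

text \<open>The flag is \<open>True\<close> for the formulas on the right of the sequent.\<close>

type_synonym 'o sq = "chan \<Rightarrow> (bool \<times> 'o fm) option"

primrec branches :: "'o fm \<Rightarrow> (name, 'o fm) fmap" where
  "branches (Atom a) = fmempty"
| "branches (Sum Xs) = Xs"
| "branches (Prod Xs) = Xs"

text \<open>\<open>Some True\<close>: the invertible rule \<open>Par\<close> applies; \<open>Some False\<close>: the rule \<open>Sel\<close> applies.\<close>

fun kind :: "bool \<times> 'o fm \<Rightarrow> bool option" where
  "kind (s, Atom a) = None"
| "kind (s, Sum Xs) = Some (\<not> s)"
| "kind (s, Prod Xs) = Some s"

definition knd :: "'o sq \<Rightarrow> chan \<Rightarrow> bool option" where
  "knd S \<alpha> = Option.bind (S \<alpha>) kind"

definition idx :: "'o sq \<Rightarrow> chan \<Rightarrow> name set" where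
  "idx S \<alpha> = (case S \<alpha> of None \<Rightarrow> {} | Some (s, X) \<Rightarrow> fmdom' (branches X))"

definition nxt :: "'o sq \<Rightarrow> chan \<Rightarrow> name \<Rightarrow> 'o sq" where
  "nxt S \<alpha> k = (case S \<alpha> of None \<Rightarrow> S
     | Some (s, X) \<Rightarrow> S(\<alpha> \<mapsto> (s, the (fmlookup (branches X) k))))"

lemma knd_nxt[simp]: "\<alpha> \<noteq> \<beta> \<Longrightarrow> knd (nxt S \<alpha> i) \<beta> = knd S \<beta>"
  and idx_nxt[simp]: "\<alpha> \<noteq> \<beta> \<Longrightarrow> idx (nxt S \<alpha> i) \<beta> = idx S \<beta>"
  by (auto simp: knd_def idx_def nxt_def split: option.splits)

lemma nxt_nxt: "\<alpha> \<noteq> \<beta> \<Longrightarrow> nxt (nxt S \<alpha> i) \<beta> j = nxt (nxt S \<beta> j) \<alpha> i"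
  by (auto simp: nxt_def fun_upd_twist split: option.splits)

lemma dom_nxt[simp]: "dom (nxt S \<alpha> i) = dom S"
  by (auto simp: nxt_def split: option.splits)

lemma finite_idx[simp]: "finite (idx S \<alpha>)"
  by (auto simp: idx_def split: option.splits)

lemma knd_dom: "knd S \<alpha> = Some b \<Longrightarrow> \<alpha> \<in> dom S"
  by (auto simp: knd_def bind_eq_Some_conv)

text \<open>The typing of leaves is a parameter because the same calculus is used with leaves that
  are morphisms, formal composites, or values of the codes in a finite table.\<close>

inductive ty :: "('o sq \<Rightarrow> 'l \<Rightarrow> bool) \<Rightarrow> 'o sq \<Rightarrow> 'l nt \<Rightarrow> bool" for lt where
  ty_Leaf: "lt S a \<Longrightarrow> ty lt S (Leaf a)"
| ty_Par: "knd S \<alpha> = Some True \<Longrightarrow> I = idx S \<alpha> \<Longrightarrow> (\<And>i. i \<in> I \<Longrightarrow> ty lt (nxt S \<alpha> i) (h i)) \<Longrightarrow>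
    ty lt S (Par \<alpha> I h)"
| ty_Sel: "knd S \<alpha> = Some False \<Longrightarrow> k \<in> idx S \<alpha> \<Longrightarrow> ty lt (nxt S \<alpha> k) f \<Longrightarrow> ty lt S (Sel \<alpha> k f)"

inductive_cases ty_LeafE[elim!]: "ty lt S (Leaf a)"
inductive_cases ty_ParE[elim!]: "ty lt S (Par \<alpha> I h)"
inductive_cases ty_SelE[elim!]: "ty lt S (Sel \<alpha> k f)"

lemma ty_simps[simp]:
  "ty lt S (Leaf a) \<longleftrightarrow> lt S a"
  "ty lt S (Par \<alpha> I h) \<longleftrightarrow> knd S \<alpha> = Some True \<and> I = idx S \<alpha> \<and> (\<forall>i\<in>I. ty lt (nxt S \<alpha> i) (h i))"
  "ty lt S (Sel \<alpha> k f) \<longleftrightarrow> knd S \<alpha> = Some False \<and> k \<in> idx S \<alpha> \<and> ty lt (nxt S \<alpha> k) f"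
  by (auto intro: ty.intros)

text \<open>A leaf never faces a sum or product as cut formula. With this, the default branches of
  \<open>cut\<close> are not reached from typed terms.\<close>

definition atomic :: "('o sq \<Rightarrow> 'l \<Rightarrow> bool) \<Rightarrow> bool" where
  "atomic lt \<longleftrightarrow> (\<forall>S a \<alpha>. lt S a \<longrightarrow> knd S \<alpha> = None)"

subsection \<open>Typed permutation equivalence\<close>

text \<open>With one constructor for the invertible rules and one for the others, the ten
  conversions become three: \<open>pe_PP\<close> is (13), (14), (19), \<open>pe_PS\<close> is (15)
  to (18) and \<open>pe_SS\<close> is (20) to (22). Each step is tied to its sequent, since an
  untyped conversion of an empty \<open>Par\<close> could introduce a rule on a channel that is
  absent.\<close>

inductive peq :: "('o sq \<Rightarrow> 'l \<Rightarrow> bool) \<Rightarrow> 'o sq \<Rightarrow> 'l nt \<Rightarrow> 'l nt \<Rightarrow> bool" for lt where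
  pe_refl: "ty lt S n \<Longrightarrow> peq lt S n n"
| pe_sym: "peq lt S m n \<Longrightarrow> peq lt S n m"
| pe_trans: "peq lt S m n \<Longrightarrow> peq lt S n k \<Longrightarrow> peq lt S m k"
| pe_Par: "knd S \<alpha> = Some True \<Longrightarrow> I = idx S \<alpha> \<Longrightarrow>
    (\<And>i. i \<in> I \<Longrightarrow> peq lt (nxt S \<alpha> i) (h i) (h' i)) \<Longrightarrow> peq lt S (Par \<alpha> I h) (Par \<alpha> I h')"
| pe_Sel: "knd S \<alpha> = Some False \<Longrightarrow> k \<in> idx S \<alpha> \<Longrightarrow>
    peq lt (nxt S \<alpha> k) f g \<Longrightarrow> peq lt S (Sel \<alpha> k f) (Sel \<alpha> k g)"
| pe_PP: "\<alpha> \<noteq> \<beta> \<Longrightarrow> knd S \<alpha> = Some True \<Longrightarrow> knd S \<beta> = Some True \<Longrightarrow> I = idx S \<alpha> \<Longrightarrow> J = idx S \<beta> \<Longrightarrow>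
    (\<And>i j. i \<in> I \<Longrightarrow> j \<in> J \<Longrightarrow> ty lt (nxt (nxt S \<alpha> i) \<beta> j) (f i j)) \<Longrightarrow>
    peq lt S (Par \<alpha> I (\<lambda>i. Par \<beta> J (f i))) (Par \<beta> J (\<lambda>j. Par \<alpha> I (\<lambda>i. f i j)))"
| pe_PS: "\<alpha> \<noteq> \<beta> \<Longrightarrow> knd S \<alpha> = Some True \<Longrightarrow> knd S \<beta> = Some False \<Longrightarrow> I = idx S \<alpha> \<Longrightarrow>
    k \<in> idx S \<beta> \<Longrightarrow> (\<And>i. i \<in> I \<Longrightarrow> ty lt (nxt (nxt S \<alpha> i) \<beta> k) (f i)) \<Longrightarrow>
    peq lt S (Par \<alpha> I (\<lambda>i. Sel \<beta> k (f i))) (Sel \<beta> k (Par \<alpha> I f))"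
| pe_SS: "\<alpha> \<noteq> \<beta> \<Longrightarrow> knd S \<alpha> = Some False \<Longrightarrow> knd S \<beta> = Some False \<Longrightarrow> k \<in> idx S \<alpha> \<Longrightarrow>
    l \<in> idx S \<beta> \<Longrightarrow> ty lt (nxt (nxt S \<alpha> k) \<beta> l) f \<Longrightarrow>
    peq lt S (Sel \<alpha> k (Sel \<beta> l f)) (Sel \<beta> l (Sel \<alpha> k f))"

lemma peq_ty: "peq lt S m n \<Longrightarrow> ty lt S m \<and> ty lt S n"
  by (induction rule: peq.induct) (auto simp: nxt_nxt)

lemmas peq_ty1 = peq_ty[THEN conjunct1] and peq_ty2 = peq_ty[THEN conjunct2]

text \<open>Terms that differ only in junk are not equal but convertible. Many facts about terms
  that look like equations hold as conversions for this reason alone.\<close>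

lemma pe_ext:
  "ty lt S (Par \<alpha> I h) \<Longrightarrow> (\<And>i. i \<in> I \<Longrightarrow> h i = h' i) \<Longrightarrow> peq lt S (Par \<alpha> I h) (Par \<alpha> I h')"
  by (intro pe_Par) (auto intro!: pe_refl)

subsection \<open>Cut\<close>

text \<open>The inner recursion of \<open>cut\<close>, over the right premise with the left one
  fixed: \<open>lf\<close> handles leaves, \<open>pa\<close> and \<open>se\<close> a rule on the cut
  channel, and all other rules come out. Splitting it off makes \<open>cut\<close> primitive
  recursive in the left premise.\<close>

primrec inn :: "chan \<Rightarrow> ('l \<Rightarrow> 'l nt) \<Rightarrow> ((name \<Rightarrow> 'l nt) \<Rightarrow> 'l nt) \<Rightarrow> (name \<Rightarrow> 'l nt \<Rightarrow> 'l nt) \<Rightarrow>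
    'l nt \<Rightarrow> 'l nt" where
  "inn \<gamma> lf pa se (Leaf b) = lf b"
| "inn \<gamma> lf pa se (Par \<beta> J G) = (if \<beta> = \<gamma> then pa G else Par \<beta> J (\<lambda>j. inn \<gamma> lf pa se (G j)))"
| "inn \<gamma> lf pa se (Sel \<beta> l g) = (if \<beta> = \<gamma> then se l g else Sel \<beta> l (inn \<gamma> lf pa se g))"

abbreviation "junk \<equiv> Leaf undefined"

primrec cut :: "('l \<Rightarrow> 'l \<Rightarrow> 'l) \<Rightarrow> chan \<Rightarrow> 'l nt \<Rightarrow> 'l nt \<Rightarrow> 'l nt" where
  "cut op \<gamma> (Leaf a) = inn \<gamma> (\<lambda>b. Leaf (op a b)) (\<lambda>_. junk) (\<lambda>_ _. junk)"
| "cut op \<gamma> (Par \<alpha> I F) = (if \<alpha> = \<gamma> then inn \<gamma> (\<lambda>_. junk) (\<lambda>_. junk) (\<lambda>l g. cut op \<gamma> (F l) g)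
     else (\<lambda>g. Par \<alpha> I (\<lambda>i. cut op \<gamma> (F i) g)))"
| "cut op \<gamma> (Sel \<alpha> k f) = (if \<alpha> = \<gamma> then inn \<gamma> (\<lambda>_. junk) (\<lambda>G. cut op \<gamma> f (G k)) (\<lambda>_ _. junk)
     else (\<lambda>g. Sel \<alpha> k (cut op \<gamma> f g)))"

fun blocked :: "chan \<Rightarrow> 'l nt \<Rightarrow> bool" where
  "blocked \<gamma> (Leaf a) = True"
| "blocked \<gamma> (Par \<alpha> I F) = (\<alpha> = \<gamma>)"
| "blocked \<gamma> (Sel \<alpha> k f) = (\<alpha> = \<gamma>)"

lemma cut_blocked:
  "blocked \<gamma> f \<Longrightarrow> \<beta> \<noteq> \<gamma> \<Longrightarrow> cut op \<gamma> f (Par \<beta> J G) = Par \<beta> J (\<lambda>j. cut op \<gamma> f (G j))"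
  "blocked \<gamma> f \<Longrightarrow> \<beta> \<noteq> \<gamma> \<Longrightarrow> cut op \<gamma> f (Sel \<beta> l g) = Sel \<beta> l (cut op \<gamma> f g)"
  by (cases f; simp)+

lemma cut_simps:
  "\<alpha> \<noteq> \<gamma> \<Longrightarrow> cut op \<gamma> (Par \<alpha> I F) g = Par \<alpha> I (\<lambda>i. cut op \<gamma> (F i) g)"
  "\<alpha> \<noteq> \<gamma> \<Longrightarrow> cut op \<gamma> (Sel \<alpha> k f) g = Sel \<alpha> k (cut op \<gamma> f g)"
  "cut op \<gamma> (Leaf a) (Leaf b) = Leaf (op a b)"
  "cut op \<gamma> (Sel \<gamma> k f) (Par \<gamma> J G) = cut op \<gamma> f (G k)"
  "cut op \<gamma> (Par \<gamma> I F) (Sel \<gamma> l g) = cut op \<gamma> (F l) g"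
  by simp_all

declare cut.simps[simp del] cut_simps[simp] cut_blocked[simp]

definition cs :: "chan \<Rightarrow> 'o sq \<Rightarrow> 'o sq \<Rightarrow> 'o sq" where
  "cs \<gamma> S1 S2 c = (if c = \<gamma> then None else case S1 c of Some x \<Rightarrow> Some x | None \<Rightarrow> S2 c)"

text \<open>The flag \<open>s\<close> is the side of the cut formula in \<open>S1\<close>. In
  derivations it is \<open>True\<close>; leaving it open allows the two premises to be
  exchanged.\<close>

definition cc :: "bool \<Rightarrow> chan \<Rightarrow> 'o sq \<Rightarrow> 'o sq \<Rightarrow> bool" where
  "cc s \<gamma> S1 S2 \<longleftrightarrow> dom S1 \<inter> dom S2 = {\<gamma>} \<and> (\<exists>Z. S1 \<gamma> = Some (s, Z) \<and> S2 \<gamma> = Some (\<not> s, Z))"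

definition opok :: "('o sq \<Rightarrow> 'l \<Rightarrow> bool) \<Rightarrow> bool \<Rightarrow> chan \<Rightarrow> ('l \<Rightarrow> 'l \<Rightarrow> 'l) \<Rightarrow> bool" where
  "opok lt s \<gamma> op \<longleftrightarrow> (\<forall>S1 S2 a b. lt S1 a \<longrightarrow> lt S2 b \<longrightarrow> cc s \<gamma> S1 S2 \<longrightarrow> lt (cs \<gamma> S1 S2) (op a b))"

lemma cc_flip: "cc s \<gamma> S1 S2 \<Longrightarrow> cc (\<not> s) \<gamma> S2 S1"
  by (auto simp: cc_def)

lemma cs_flip: "cc s \<gamma> S1 S2 \<Longrightarrow> cs \<gamma> S2 S1 = cs \<gamma> S1 S2"
proof
  fix c
  assume "cc s \<gamma> S1 S2"
  then have "c \<in> dom S1 \<Longrightarrow> c \<in> dom S2 \<Longrightarrow> c = \<gamma>" unfolding cc_def by blast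
  then show "cs \<gamma> S2 S1 c = cs \<gamma> S1 S2 c" by (auto simp: cs_def split: option.splits)
qed

lemma opok_flip: "opok lt s \<gamma> op \<Longrightarrow> opok lt (\<not> s) \<gamma> (\<lambda>a b. op b a)"
  unfolding opok_def
proof (intro allI impI)
  fix S1 S2 a b
  assume "\<forall>S1 S2 a b. lt S1 a \<longrightarrow> lt S2 b \<longrightarrow> cc s \<gamma> S1 S2 \<longrightarrow> lt (cs \<gamma> S1 S2) (op a b)"
    and "lt S1 a" "lt S2 b" and c: "cc (\<not> s) \<gamma> S1 S2"
  then have "lt (cs \<gamma> S2 S1) (op b a)" using cc_flip[OF c] by simp
  then show "lt (cs \<gamma> S1 S2) (op b a)" using cs_flip[OF c] by simp
qed

lemma cc_left:
  assumes "cc s \<gamma> S1 S2" "\<alpha> \<in> dom S1" "\<alpha> \<noteq> \<gamma>"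
  shows "knd (cs \<gamma> S1 S2) \<alpha> = knd S1 \<alpha>" "idx (cs \<gamma> S1 S2) \<alpha> = idx S1 \<alpha>"
    "nxt (cs \<gamma> S1 S2) \<alpha> k = cs \<gamma> (nxt S1 \<alpha> k) S2" "cc s \<gamma> (nxt S1 \<alpha> k) S2"
    "knd S2 \<alpha> = None" "\<alpha> \<notin> dom S2"
proof -
  obtain s' X where S1: "S1 \<alpha> = Some (s', X)" using assms(2) by auto
  show n: "\<alpha> \<notin> dom S2" using assms by (auto simp: cc_def)
  show "knd (cs \<gamma> S1 S2) \<alpha> = knd S1 \<alpha>" "idx (cs \<gamma> S1 S2) \<alpha> = idx S1 \<alpha>"
    "nxt (cs \<gamma> S1 S2) \<alpha> k = cs \<gamma> (nxt S1 \<alpha> k) S2"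
    using assms(3) S1 by (auto simp: knd_def idx_def nxt_def cs_def)
  show "cc s \<gamma> (nxt S1 \<alpha> k) S2" using assms unfolding cc_def dom_nxt by (auto simp: nxt_def)
  show "knd S2 \<alpha> = None" using n by (cases "S2 \<alpha>") (auto simp: knd_def)
qed

lemma cc_right:
  assumes "cc s \<gamma> S1 S2" "\<alpha> \<in> dom S2" "\<alpha> \<noteq> \<gamma>"
  shows "knd (cs \<gamma> S1 S2) \<alpha> = knd S2 \<alpha>" "idx (cs \<gamma> S1 S2) \<alpha> = idx S2 \<alpha>"
    "nxt (cs \<gamma> S1 S2) \<alpha> k = cs \<gamma> S1 (nxt S2 \<alpha> k)" "cc s \<gamma> S1 (nxt S2 \<alpha> k)"
    "knd S1 \<alpha> = None" "\<alpha> \<notin> dom S1"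
proof -
  note a = cc_left[OF cc_flip[OF assms(1)] assms(2,3)]
  show r: "cc s \<gamma> S1 (nxt S2 \<alpha> k)" using cc_flip[OF a(4)[of k]] by simp
  show "knd (cs \<gamma> S1 S2) \<alpha> = knd S2 \<alpha>" "idx (cs \<gamma> S1 S2) \<alpha> = idx S2 \<alpha>"
    "nxt (cs \<gamma> S1 S2) \<alpha> k = cs \<gamma> S1 (nxt S2 \<alpha> k)" "knd S1 \<alpha> = None" "\<alpha> \<notin> dom S1"
    using a cs_flip[OF assms(1)] cs_flip[OF r] by auto
qed

text \<open>The premises see the cut formula from opposite sides, so where one has an invertible
  rule the other has a choice. Hence a principal pair always consists of a \<open>Par\<close> and a
  \<open>Sel\<close>.\<close>

lemma cc_main:
  assumes "cc s \<gamma> S1 S2"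
  shows "knd S2 \<gamma> = map_option Not (knd S1 \<gamma>)" "idx S2 \<gamma> = idx S1 \<gamma>"
    "cs \<gamma> (nxt S1 \<gamma> k) (nxt S2 \<gamma> k) = cs \<gamma> S1 S2"
    "cc s \<gamma> (nxt S1 \<gamma> k) (nxt S2 \<gamma> k)"
proof -
  obtain Z where Z: "S1 \<gamma> = Some (s, Z)" "S2 \<gamma> = Some (\<not> s, Z)" and d: "dom S1 \<inter> dom S2 = {\<gamma>}"
    using assms by (auto simp: cc_def)
  show "knd S2 \<gamma> = map_option Not (knd S1 \<gamma>)" "idx S2 \<gamma> = idx S1 \<gamma>"
    using Z by (auto simp: knd_def idx_def) (cases Z; auto)
  show "cs \<gamma> (nxt S1 \<gamma> k) (nxt S2 \<gamma> k) = cs \<gamma> S1 S2"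
    using Z by (auto simp: cs_def nxt_def fun_eq_iff split: option.splits)
  show "cc s \<gamma> (nxt S1 \<gamma> k) (nxt S2 \<gamma> k)"
    using Z d unfolding cc_def dom_nxt by (auto simp: nxt_def)
qed

text \<open>Induction along the recursion of \<open>cut\<close>, with the combinations that typing
  excludes left out: two \<open>Par\<close> or two \<open>Sel\<close> on the cut channel contradict
  the opposite kinds, and a leaf opposite to a rule on the cut channel contradicts
  atomicity.\<close>

lemma cut_induct [consumes 4, case_names ParL SelL ParR SelR LeafLeaf SelPar ParSel]:
  assumes "atomic lt" "cc s \<gamma> S1 S2" "ty lt S1 f" "ty lt S2 g"
    and ParL: "\<And>S1 S2 \<alpha> F g. cc s \<gamma> S1 S2 \<Longrightarrow> ty lt S1 (Par \<alpha> (idx S1 \<alpha>) F) \<Longrightarrow> ty lt S2 g \<Longrightarrow> \<alpha> \<noteq> \<gamma> \<Longrightarrow>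
      \<alpha> \<in> dom S1 \<Longrightarrow> (\<And>i. i \<in> idx S1 \<alpha> \<Longrightarrow> P (nxt S1 \<alpha> i) S2 (F i) g) \<Longrightarrow> P S1 S2 (Par \<alpha> (idx S1 \<alpha>) F) g"
    and SelL: "\<And>S1 S2 \<alpha> k f g. cc s \<gamma> S1 S2 \<Longrightarrow> ty lt S1 (Sel \<alpha> k f) \<Longrightarrow> ty lt S2 g \<Longrightarrow> \<alpha> \<noteq> \<gamma> \<Longrightarrow>
      \<alpha> \<in> dom S1 \<Longrightarrow> P (nxt S1 \<alpha> k) S2 f g \<Longrightarrow> P S1 S2 (Sel \<alpha> k f) g"
    and ParR: "\<And>S1 S2 f \<beta> G. cc s \<gamma> S1 S2 \<Longrightarrow> ty lt S1 f \<Longrightarrow> ty lt S2 (Par \<beta> (idx S2 \<beta>) G) \<Longrightarrow> blocked \<gamma> f \<Longrightarrow>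
      \<beta> \<noteq> \<gamma> \<Longrightarrow> \<beta> \<in> dom S2 \<Longrightarrow> (\<And>j. j \<in> idx S2 \<beta> \<Longrightarrow> P S1 (nxt S2 \<beta> j) f (G j)) \<Longrightarrow>
      P S1 S2 f (Par \<beta> (idx S2 \<beta>) G)"
    and SelR: "\<And>S1 S2 f \<beta> k g. cc s \<gamma> S1 S2 \<Longrightarrow> ty lt S1 f \<Longrightarrow> ty lt S2 (Sel \<beta> k g) \<Longrightarrow> blocked \<gamma> f \<Longrightarrow>
      \<beta> \<noteq> \<gamma> \<Longrightarrow> \<beta> \<in> dom S2 \<Longrightarrow> P S1 (nxt S2 \<beta> k) f g \<Longrightarrow> P S1 S2 f (Sel \<beta> k g)"
    and LeafLeaf: "\<And>S1 S2 a b. cc s \<gamma> S1 S2 \<Longrightarrow> lt S1 a \<Longrightarrow> lt S2 b \<Longrightarrow> P S1 S2 (Leaf a) (Leaf b)"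
    and SelPar: "\<And>S1 S2 k f G. cc s \<gamma> S1 S2 \<Longrightarrow> ty lt S1 (Sel \<gamma> k f) \<Longrightarrow> ty lt S2 (Par \<gamma> (idx S1 \<gamma>) G) \<Longrightarrow>
      P (nxt S1 \<gamma> k) (nxt S2 \<gamma> k) f (G k) \<Longrightarrow> P S1 S2 (Sel \<gamma> k f) (Par \<gamma> (idx S1 \<gamma>) G)"
    and ParSel: "\<And>S1 S2 k F g. cc s \<gamma> S1 S2 \<Longrightarrow> ty lt S1 (Par \<gamma> (idx S1 \<gamma>) F) \<Longrightarrow> ty lt S2 (Sel \<gamma> k g) \<Longrightarrow>
      k \<in> idx S1 \<gamma> \<Longrightarrow>
      P (nxt S1 \<gamma> k) (nxt S2 \<gamma> k) (F k) g \<Longrightarrow> P S1 S2 (Par \<gamma> (idx S1 \<gamma>) F) (Sel \<gamma> k g)"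
  shows "P S1 S2 f g"
proof -
  have at: "lt S a \<Longrightarrow> knd S \<alpha> = None" for S a \<alpha> using assms(1) by (auto simp: atomic_def)
  show ?thesis
    using assms(3) assms(2) assms(4)
  proof (induction f arbitrary: S1 S2 g rule: nt.induct)
    case (Leaf a)
    show ?case using Leaf.prems(3) Leaf.prems
    proof (induction rule: ty.induct)
      case (ty_Leaf S b)
      then show ?case by (intro LeafLeaf) auto
    next
      case (ty_Par S \<beta> J G)
      have "\<beta> \<noteq> \<gamma>" using ty_Par cc_main(1)[OF ty_Par.prems(2)] at[of S1 a \<gamma>] by auto
      moreover have "\<beta> \<in> dom S" by (rule knd_dom[OF ty_Par.hyps(1)])
      ultimately show ?case using ty_Par.hyps ty_Par.prems cc_right(4)[OF ty_Par.prems(2)] ty_Par.IH unfolding ty_Par.hyps(2)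
        by (intro ParR) auto
    next
      case (ty_Sel S \<beta> k g)
      have "\<beta> \<noteq> \<gamma>" using ty_Sel cc_main(1)[OF ty_Sel.prems(2)] at[of S1 a \<gamma>] by auto
      moreover have "\<beta> \<in> dom S" by (rule knd_dom[OF ty_Sel.hyps(1)])
      ultimately show ?case using ty_Sel.hyps ty_Sel.prems cc_right(4)[OF ty_Sel.prems(2)] ty_Sel.IH
        by (intro SelR) auto
    qed
  next
    case (Par \<alpha> I F)
    then have tyF: "knd S1 \<alpha> = Some True" "I = idx S1 \<alpha>" "\<And>i. i \<in> I \<Longrightarrow> ty lt (nxt S1 \<alpha> i) (F i)"
      by auto
    have d: "\<alpha> \<in> dom S1" by (rule knd_dom[OF tyF(1)])
    note IH = Par.IH[OF rangeI]
    show ?case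
    proof (cases "\<alpha> = \<gamma>")
      case False
      then show ?thesis unfolding tyF(2) using Par.prems tyF d cc_left(4)[OF Par.prems(2) d False]
        by (intro ParL) (auto intro!: IH)
    next
      case True
      show ?thesis using Par.prems(3) Par.prems(2) Par.prems(1) tyF(3) unfolding tyF(2) True
      proof (induction rule: ty.induct)
        case (ty_Leaf S b)
        then show ?case using at[of S b \<gamma>] cc_main(1)[OF ty_Leaf(2)] tyF True by auto
      next
        case (ty_Par S \<beta> J G)
        have "\<beta> \<noteq> \<gamma>" using ty_Par.prems ty_Par.hyps(1) cc_main(1)[OF ty_Par.prems(1)] by auto
        moreover have "\<beta> \<in> dom S" using ty_Par.hyps(1) by (rule knd_dom)
        ultimately show ?case using ty_Par.hyps ty_Par.prems cc_right(4)[OF ty_Par.prems(1)] ty_Par.IH unfolding ty_Par.hyps(2)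
          by (intro ParR) auto
      next
        case (ty_Sel S \<beta> k g)
        show ?case
        proof (cases "\<beta> = \<gamma>")
          case True
          note m = cc_main[OF ty_Sel.prems(1)]
          show ?thesis unfolding True using ty_Sel.hyps ty_Sel.prems True m
            by (intro ParSel) (auto intro!: IH)
        next
          case False
          moreover have "\<beta> \<in> dom S" using ty_Sel.hyps(1) by (rule knd_dom)
          ultimately show ?thesis using ty_Sel.hyps ty_Sel.prems cc_right(4)[OF ty_Sel.prems(1)] ty_Sel.IH
            by (intro SelR) auto
        qed
      qed
    qed
  next
    case (Sel \<alpha> k f)
    then have tyF: "knd S1 \<alpha> = Some False" "k \<in> idx S1 \<alpha>" "ty lt (nxt S1 \<alpha> k) f"
      by auto
    have d: "\<alpha> \<in> dom S1" by (rule knd_dom[OF tyF(1)])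
    show ?case
    proof (cases "\<alpha> = \<gamma>")
      case False
      then show ?thesis using Sel.prems tyF d cc_left(4)[OF Sel.prems(2) d False]
        by (intro SelL) (auto intro!: Sel.IH)
    next
      case True
      show ?thesis using Sel.prems(3) Sel.prems(2) Sel.prems(1) tyF unfolding True
      proof (induction rule: ty.induct)
        case (ty_Leaf S b)
        then show ?case using at[of S b \<gamma>] cc_main(1)[OF ty_Leaf(2)] by auto
      next
        case (ty_Sel S \<beta> l g)
        have "\<beta> \<noteq> \<gamma>" using ty_Sel.prems ty_Sel.hyps(1) cc_main(1)[OF ty_Sel.prems(1)] by auto
        moreover have "\<beta> \<in> dom S" using ty_Sel.hyps(1) by (rule knd_dom)
        ultimately show ?case using ty_Sel.hyps ty_Sel.prems cc_right(4)[OF ty_Sel.prems(1)] ty_Sel.IH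
          by (intro SelR) auto
      next
        case (ty_Par S \<beta> J G)
        show ?case
        proof (cases "\<beta> = \<gamma>")
          case True
          note m = cc_main[OF ty_Par.prems(1)]
          have J: "J = idx S1 \<gamma>" using ty_Par.hyps(2) True m by simp
          show ?thesis unfolding True J using ty_Par.hyps ty_Par.prems True m
            by (intro SelPar) (auto intro!: Sel.IH)
        next
          case False
          moreover have "\<beta> \<in> dom S" using ty_Par.hyps(1) by (rule knd_dom)
          ultimately show ?thesis using ty_Par.hyps ty_Par.prems cc_right(4)[OF ty_Par.prems(1)] ty_Par.IH
            unfolding ty_Par.hyps(2) by (intro ParR) auto
        qed
      qed
    qed
  qed
qed

lemma cut_ty:
  assumes "atomic lt" "cc s \<gamma> S1 S2" "ty lt S1 f" "ty lt S2 g" "opok lt s \<gamma> op"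
  shows "ty lt (cs \<gamma> S1 S2) (cut op \<gamma> f g)"
  using assms(1-4)
proof (induction rule: cut_induct)
  case (ParL S1 S2 \<alpha> F g)
  then show ?case using cc_left[OF ParL(1,5,4)] by simp
next
  case (SelL S1 S2 \<alpha> k f g)
  then show ?case using cc_left[OF SelL(1,5,4)] by simp
next
  case (ParR S1 S2 f \<beta> G)
  then show ?case using cc_right[OF ParR(1,6,5)] by (simp add: cut_blocked)
next
  case (SelR S1 S2 f \<beta> k g)
  then show ?case using cc_right[OF SelR(1,6,5)] by (simp add: cut_blocked)
next
  case (LeafLeaf S1 S2 a b)
  then show ?case using assms(5) by (auto simp: opok_def)
next
  case (SelPar S1 S2 k f G)
  then show ?case using cc_main[OF SelPar(1)] by simp
next
  case (ParSel S1 S2 k F g)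
  then show ?case using cc_main[OF ParSel(1)] by simp
qed

lemma ty_Leaf_knd: "atomic lt \<Longrightarrow> lt S a \<Longrightarrow> knd S \<alpha> = None"
  by (auto simp: atomic_def)

text \<open>A rule of the right premise comes out by definition only if the left premise is blocked.
  In general the left rules are already out, and the right rule has to be permuted below each of
  them by a conversion.\<close>

lemma cut_push_Par:
  assumes at: "atomic lt" and op: "opok lt s \<gamma> op"
    and "ty lt S1 f" "cc s \<gamma> S1 S2" "ty lt S2 (Par \<beta> J G)" "\<beta> \<noteq> \<gamma>"
  shows "peq lt (cs \<gamma> S1 S2) (cut op \<gamma> f (Par \<beta> J G)) (Par \<beta> J (\<lambda>j. cut op \<gamma> f (G j)))"
  using assms(3,4)
proof (induction rule: ty.induct)
  case (ty_Leaf S a)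
  then show ?case using cut_ty[OF at _ _ assms(5) op, of S "Leaf a"] assms(6) by (simp add: pe_refl)
next
  case (ty_Par S \<alpha> I h)
  have b: "knd S2 \<beta> = Some True" "J = idx S2 \<beta>" using assms(5) by auto
  note d = knd_dom[OF ty_Par(1)] knd_dom[OF b(1)]
  have T: "ty lt (cs \<gamma> S S2) (cut op \<gamma> (Par \<alpha> I h) (Par \<beta> J G))"
    using ty_Par by (intro cut_ty[OF at _ _ assms(5) op]) auto
  show ?case
  proof (cases "\<alpha> = \<gamma>")
    case True
    then show ?thesis using T assms(6) by (simp add: pe_refl)
  next
    case False
    note l = cc_left[OF ty_Par.prems d(1) False] and r = cc_right[OF ty_Par.prems d(2) assms(6)]
    have ab: "\<alpha> \<noteq> \<beta>" using l(6) d by auto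
    have "peq lt (cs \<gamma> S S2) (Par \<alpha> I (\<lambda>i. cut op \<gamma> (h i) (Par \<beta> J G)))
        (Par \<alpha> I (\<lambda>i. Par \<beta> J (\<lambda>j. cut op \<gamma> (h i) (G j))))"
      using l ty_Par.hyps(1,2) by (intro pe_Par) (auto intro!: ty_Par.IH)
    note 1 = this
    have "peq lt (cs \<gamma> S S2) (Par \<alpha> I (\<lambda>i. Par \<beta> J (\<lambda>j. cut op \<gamma> (h i) (G j))))
        (Par \<beta> J (\<lambda>j. Par \<alpha> I (\<lambda>i. cut op \<gamma> (h i) (G j))))"
    proof (rule pe_PP[OF ab])
      fix i j assume ij: "i \<in> I" "j \<in> J"
      have "cc s \<gamma> (nxt S \<alpha> i) S2" by (rule l)
      note r' = cc_right[OF this d(2) assms(6)]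
      show "ty lt (nxt (nxt (cs \<gamma> S S2) \<alpha> i) \<beta> j) (cut op \<gamma> (h i) (G j))"
        unfolding l(3) r'(3) using r'(4) ty_Par.hyps ij assms(5) by (intro cut_ty[OF at _ _ _ op]) auto
    qed (use l r ty_Par.hyps(1,2) b in auto)
    note 2 = this
    show ?thesis using False pe_trans[OF 1 2] by simp
  qed
next
  case (ty_Sel S \<alpha> k f)
  have b: "knd S2 \<beta> = Some True" "J = idx S2 \<beta>" using assms(5) by auto
  note d = knd_dom[OF ty_Sel(1)] knd_dom[OF b(1)]
  have T: "ty lt (cs \<gamma> S S2) (cut op \<gamma> (Sel \<alpha> k f) (Par \<beta> J G))"
    using ty_Sel by (intro cut_ty[OF at _ _ assms(5) op]) auto
  show ?case
  proof (cases "\<alpha> = \<gamma>")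
    case True
    then show ?thesis using T assms(6) by (simp add: pe_refl)
  next
    case False
    note l = cc_left[OF ty_Sel.prems d(1) False] and r = cc_right[OF ty_Sel.prems d(2) assms(6)]
    have ab: "\<beta> \<noteq> \<alpha>" using l(6) d by auto
    have "peq lt (cs \<gamma> S S2) (Sel \<alpha> k (cut op \<gamma> f (Par \<beta> J G)))
        (Sel \<alpha> k (Par \<beta> J (\<lambda>j. cut op \<gamma> f (G j))))"
      using l ty_Sel.hyps(1,2) by (intro pe_Sel) (auto intro!: ty_Sel.IH)
    note 1 = this
    have "peq lt (cs \<gamma> S S2) (Par \<beta> J (\<lambda>j. Sel \<alpha> k (cut op \<gamma> f (G j))))
        (Sel \<alpha> k (Par \<beta> J (\<lambda>j. cut op \<gamma> f (G j))))"
    proof (rule pe_PS[OF ab])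
      fix j assume j: "j \<in> J"
      have c: "cc s \<gamma> S (nxt S2 \<beta> j)" by (rule r)
      note l' = cc_left[OF this d(1) False]
      show "ty lt (nxt (nxt (cs \<gamma> S S2) \<beta> j) \<alpha> k) (cut op \<gamma> f (G j))"
        unfolding r(3) l'(3) using l'(4) ty_Sel.hyps j assms(5) by (intro cut_ty[OF at _ _ _ op]) auto
    qed (use l r ty_Sel.hyps(1,2) b in auto)
    note 2 = this
    show ?thesis using False pe_trans[OF 1 pe_sym[OF 2]] by simp
  qed
qed

lemma cut_push_Sel:
  assumes at: "atomic lt" and op: "opok lt s \<gamma> op"
    and "ty lt S1 f" "cc s \<gamma> S1 S2" "ty lt S2 (Sel \<beta> l g)" "\<beta> \<noteq> \<gamma>"
  shows "peq lt (cs \<gamma> S1 S2) (cut op \<gamma> f (Sel \<beta> l g)) (Sel \<beta> l (cut op \<gamma> f g))"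
  using assms(3,4)
proof (induction rule: ty.induct)
  case (ty_Leaf S a)
  then show ?case using cut_ty[OF at _ _ assms(5) op, of S "Leaf a"] assms(6) by (simp add: pe_refl)
next
  case (ty_Par S \<alpha> I h)
  have b: "knd S2 \<beta> = Some False" "l \<in> idx S2 \<beta>" "ty lt (nxt S2 \<beta> l) g" using assms(5) by auto
  note d = knd_dom[OF ty_Par(1)] knd_dom[OF b(1)]
  have T: "ty lt (cs \<gamma> S S2) (cut op \<gamma> (Par \<alpha> I h) (Sel \<beta> l g))"
    using ty_Par by (intro cut_ty[OF at _ _ assms(5) op]) auto
  show ?case
  proof (cases "\<alpha> = \<gamma>")
    case True
    then show ?thesis using T assms(6) by (simp add: pe_refl)
  next
    case False
    note l = cc_left[OF ty_Par.prems d(1) False] and r = cc_right[OF ty_Par.prems d(2) assms(6)]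
    have ab: "\<alpha> \<noteq> \<beta>" using l(6) d by auto
    have "peq lt (cs \<gamma> S S2) (Par \<alpha> I (\<lambda>i. cut op \<gamma> (h i) (Sel \<beta> l g)))
        (Par \<alpha> I (\<lambda>i. Sel \<beta> l (cut op \<gamma> (h i) g)))"
      using l ty_Par.hyps(1,2) by (intro pe_Par) (auto intro!: ty_Par.IH)
    note 1 = this
    have "peq lt (cs \<gamma> S S2) (Par \<alpha> I (\<lambda>i. Sel \<beta> l (cut op \<gamma> (h i) g)))
        (Sel \<beta> l (Par \<alpha> I (\<lambda>i. cut op \<gamma> (h i) g)))"
    proof (rule pe_PS[OF ab])
      fix i assume ij: "i \<in> I"
      have "cc s \<gamma> (nxt S \<alpha> i) S2" by (rule l)
      note r' = cc_right[OF this d(2) assms(6)]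
      show "ty lt (nxt (nxt (cs \<gamma> S S2) \<alpha> i) \<beta> l) (cut op \<gamma> (h i) g)"
        unfolding l(3) r'(3) using r'(4) ty_Par.hyps ij b by (intro cut_ty[OF at _ _ _ op]) auto
    qed (use l r ty_Par.hyps(1,2) b in auto)
    note 2 = this
    show ?thesis using False pe_trans[OF 1 2] by simp
  qed
next
  case (ty_Sel S \<alpha> k f)
  have b: "knd S2 \<beta> = Some False" "l \<in> idx S2 \<beta>" "ty lt (nxt S2 \<beta> l) g" using assms(5) by auto
  note d = knd_dom[OF ty_Sel(1)] knd_dom[OF b(1)]
  have T: "ty lt (cs \<gamma> S S2) (cut op \<gamma> (Sel \<alpha> k f) (Sel \<beta> l g))"
    using ty_Sel by (intro cut_ty[OF at _ _ assms(5) op]) auto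
  show ?case
  proof (cases "\<alpha> = \<gamma>")
    case True
    then show ?thesis using T assms(6) by (simp add: pe_refl)
  next
    case False
    note l = cc_left[OF ty_Sel.prems d(1) False] and r = cc_right[OF ty_Sel.prems d(2) assms(6)]
    have ab: "\<alpha> \<noteq> \<beta>" using l(6) d by auto
    have "peq lt (cs \<gamma> S S2) (Sel \<alpha> k (cut op \<gamma> f (Sel \<beta> l g))) (Sel \<alpha> k (Sel \<beta> l (cut op \<gamma> f g)))"
      using l ty_Sel.hyps(1,2) by (intro pe_Sel) (auto intro!: ty_Sel.IH)
    note 1 = this
    have "peq lt (cs \<gamma> S S2) (Sel \<alpha> k (Sel \<beta> l (cut op \<gamma> f g)))
        (Sel \<beta> l (Sel \<alpha> k (cut op \<gamma> f g)))"
    proof (rule pe_SS[OF ab])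
      have "cc s \<gamma> (nxt S \<alpha> k) S2" by (rule l)
      note r' = cc_right[OF this d(2) assms(6)]
      show "ty lt (nxt (nxt (cs \<gamma> S S2) \<alpha> k) \<beta> l) (cut op \<gamma> f g)"
        unfolding l(3) r'(3) using r'(4) ty_Sel.hyps b by (intro cut_ty[OF at _ _ _ op]) auto
    qed (use l r ty_Sel.hyps(1,2) b in auto)
    note 2 = this
    show ?thesis using False pe_trans[OF 1 2] by simp
  qed
qed

text \<open>Whether the rules of the left or of the right premise come out first makes no difference
  up to conversion. This transfers facts about the left premise to the right one.\<close>

lemma cut_flip:
  assumes at: "atomic lt" and "cc s \<gamma> S1 S2" "ty lt S1 f" "ty lt S2 g" and op: "opok lt s \<gamma> op"
  shows "peq lt (cs \<gamma> S1 S2) (cut op \<gamma> f g) (cut (\<lambda>a b. op b a) \<gamma> g f)"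
  using assms(1-4)
proof (induction rule: cut_induct)
  case (ParL S1 S2 \<alpha> F g)
  note l = cc_left[OF ParL(1,5,4)]
  have "peq lt (cs \<gamma> S1 S2) (cut op \<gamma> (Par \<alpha> (idx S1 \<alpha>) F) g)
      (Par \<alpha> (idx S1 \<alpha>) (\<lambda>i. cut (\<lambda>a b. op b a) \<gamma> g (F i)))"
    using ParL l by (auto intro!: pe_Par)
  note 1 = this
  have 2: "peq lt (cs \<gamma> S2 S1) (cut (\<lambda>a b. op b a) \<gamma> g (Par \<alpha> (idx S1 \<alpha>) F))
      (Par \<alpha> (idx S1 \<alpha>) (\<lambda>i. cut (\<lambda>a b. op b a) \<gamma> g (F i)))"
    by (rule cut_push_Par[OF at opok_flip[OF op]]) (use ParL cc_flip in auto)
  show ?case by (rule pe_trans[OF 1 pe_sym[OF 2[unfolded cs_flip[OF ParL(1)]]]])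
next
  case (SelL S1 S2 \<alpha> k f g)
  note l = cc_left[OF SelL(1,5,4)]
  have "peq lt (cs \<gamma> S1 S2) (cut op \<gamma> (Sel \<alpha> k f) g) (Sel \<alpha> k (cut (\<lambda>a b. op b a) \<gamma> g f))"
    using SelL l by (auto intro!: pe_Sel)
  note 1 = this
  have 2: "peq lt (cs \<gamma> S2 S1) (cut (\<lambda>a b. op b a) \<gamma> g (Sel \<alpha> k f))
      (Sel \<alpha> k (cut (\<lambda>a b. op b a) \<gamma> g f))"
    by (rule cut_push_Sel[OF at opok_flip[OF op]]) (use SelL cc_flip in auto)
  show ?case by (rule pe_trans[OF 1 pe_sym[OF 2[unfolded cs_flip[OF SelL(1)]]]])
next
  case (ParR S1 S2 f \<beta> G)
  then show ?case using cc_right[OF ParR(1,6,5)] by (auto simp: cut_blocked intro!: pe_Par)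
next
  case (SelR S1 S2 f \<beta> k g)
  then show ?case using cc_right[OF SelR(1,6,5)] by (auto simp: cut_blocked intro!: pe_Sel)
next
  case (LeafLeaf S1 S2 a b)
  then show ?case using op by (auto simp: opok_def intro!: pe_refl)
next
  case (SelPar S1 S2 k f G)
  then show ?case using cc_main[OF SelPar(1)] by simp
next
  case (ParSel S1 S2 k F g)
  then show ?case using cc_main[OF ParSel(1)] by simp
qed

text \<open>The critical conversions in the left premise are those at its root that involve the cut
  channel. With \<open>\<gamma>\<close> at the root the cut first works through the right premise;
  with \<open>\<beta>\<close> there, \<open>\<beta>\<close> comes out at once. Induction on the
  right premise permutes \<open>\<beta>\<close> past its rules. The next three lemmas treat the
  other kinds in the same way.\<close>

lemma cut_root_Par_Par:
  assumes at: "atomic lt" and op: "opok lt s \<gamma> op" and "ty lt S2 g" "cc s \<gamma> S1 S2" "\<beta> \<noteq> \<gamma>"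
    and k: "knd S1 \<gamma> = Some True" "knd S1 \<beta> = Some True" "I = idx S1 \<gamma>" "J = idx S1 \<beta>"
    and f: "\<And>i j. i \<in> I \<Longrightarrow> j \<in> J \<Longrightarrow> ty lt (nxt (nxt S1 \<gamma> i) \<beta> j) (f i j)"
  shows "peq lt (cs \<gamma> S1 S2) (cut op \<gamma> (Par \<gamma> I (\<lambda>i. Par \<beta> J (f i))) g)
    (Par \<beta> J (\<lambda>j. cut op \<gamma> (Par \<gamma> I (\<lambda>i. f i j)) g))"
  using assms(3,4)
proof (induction rule: ty.induct)
  case (ty_Leaf S a)
  then show ?case using cc_main(1)[OF ty_Leaf(2)] k ty_Leaf_knd[OF at ty_Leaf(1), of \<gamma>] by simp
next
  case (ty_Sel S \<delta> l g)
  have T: "ty lt (cs \<gamma> S1 S) (cut op \<gamma> (Par \<gamma> I (\<lambda>i. Par \<beta> J (f i))) (Sel \<delta> l g))"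
    using ty_Sel k f assms(5) by (intro cut_ty[OF at _ _ _ op]) auto
  note d = knd_dom[OF ty_Sel(1)] knd_dom[OF k(2)]
  note lb = cc_left[OF ty_Sel.prems d(2) assms(5)]
  show ?case
  proof (cases "\<delta> = \<gamma>")
    case True
    \<comment> \<open>Principal step: selecting branch \<open>l\<close> and bringing out
      \<open>\<beta>\<close> commute, so both sides are literally the same term.\<close>
    then show ?thesis using T assms(5) by (simp add: pe_refl)
  next
    case False
    note r = cc_right[OF ty_Sel.prems d(1) False]
    have bd: "\<beta> \<noteq> \<delta>" using r(6) d by auto
    have 1: "peq lt (cs \<gamma> S1 S) (Sel \<delta> l (cut op \<gamma> (Par \<gamma> I (\<lambda>i. Par \<beta> J (f i))) g))
        (Sel \<delta> l (Par \<beta> J (\<lambda>j. cut op \<gamma> (Par \<gamma> I (\<lambda>i. f i j)) g)))"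
      using r ty_Sel.hyps(1,2) by (intro pe_Sel) (auto intro!: ty_Sel.IH)
    have 2: "peq lt (cs \<gamma> S1 S) (Par \<beta> J (\<lambda>j. Sel \<delta> l (cut op \<gamma> (Par \<gamma> I (\<lambda>i. f i j)) g)))
       (Sel \<delta> l (Par \<beta> J (\<lambda>j. cut op \<gamma> (Par \<gamma> I (\<lambda>i. f i j)) g)))"
      by (rule pe_PS[OF bd]) (use r(1,2) lb(1,2) k ty_Sel.hyps(1,2) peq_ty2[OF 1] in \<open>auto simp: nxt_nxt[OF bd]\<close>)
    show ?thesis using False pe_trans[OF 1 pe_sym[OF 2]] by simp
  qed
next
  case (ty_Par S \<delta> D g)
  have nd: "\<delta> \<noteq> \<gamma>" using ty_Par.hyps(1) k cc_main(1)[OF ty_Par.prems] by auto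
  note d = knd_dom[OF ty_Par(1)] knd_dom[OF k(2)]
  note lb = cc_left[OF ty_Par.prems d(2) assms(5)]
  note r = cc_right[OF ty_Par.prems d(1) nd]
  have bd: "\<delta> \<noteq> \<beta>" using r(6) d by auto
  have 1: "peq lt (cs \<gamma> S1 S) (Par \<delta> D (\<lambda>d. cut op \<gamma> (Par \<gamma> I (\<lambda>i. Par \<beta> J (f i))) (g d)))
      (Par \<delta> D (\<lambda>d. Par \<beta> J (\<lambda>j. cut op \<gamma> (Par \<gamma> I (\<lambda>i. f i j)) (g d))))"
    using r ty_Par.hyps(1,2) by (intro pe_Par) (auto intro!: ty_Par.IH)
  have 2: "peq lt (cs \<gamma> S1 S) (Par \<delta> D (\<lambda>d. Par \<beta> J (\<lambda>j. cut op \<gamma> (Par \<gamma> I (\<lambda>i. f i j)) (g d))))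
      (Par \<beta> J (\<lambda>j. Par \<delta> D (\<lambda>d. cut op \<gamma> (Par \<gamma> I (\<lambda>i. f i j)) (g d))))"
    by (rule pe_PP[OF bd]) (use r(1,2) lb(1,2) k ty_Par.hyps(1,2) peq_ty2[OF 1] in auto)
  show ?case using nd pe_trans[OF 1 2] by simp
qed

lemma cut_root_Par_Sel:
  assumes at: "atomic lt" and op: "opok lt s \<gamma> op" and "ty lt S2 g" "cc s \<gamma> S1 S2" "\<beta> \<noteq> \<gamma>"
    and k: "knd S1 \<gamma> = Some True" "knd S1 \<beta> = Some False" "I = idx S1 \<gamma>" "l \<in> idx S1 \<beta>"
    and f: "\<And>i. i \<in> I \<Longrightarrow> ty lt (nxt (nxt S1 \<gamma> i) \<beta> l) (f i)"
  shows "peq lt (cs \<gamma> S1 S2) (cut op \<gamma> (Par \<gamma> I (\<lambda>i. Sel \<beta> l (f i))) g)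
    (Sel \<beta> l (cut op \<gamma> (Par \<gamma> I f) g))"
  using assms(3,4)
proof (induction rule: ty.induct)
  case (ty_Leaf S a)
  then show ?case using cc_main(1)[OF ty_Leaf(2)] k ty_Leaf_knd[OF at ty_Leaf(1), of \<gamma>] by simp
next
  case (ty_Sel S \<delta> m g)
  have T: "ty lt (cs \<gamma> S1 S) (cut op \<gamma> (Par \<gamma> I (\<lambda>i. Sel \<beta> l (f i))) (Sel \<delta> m g))"
    using ty_Sel k f assms(5) by (intro cut_ty[OF at _ _ _ op]) auto
  note d = knd_dom[OF ty_Sel(1)] knd_dom[OF k(2)]
  note lb = cc_left[OF ty_Sel.prems d(2) assms(5)]
  show ?case
  proof (cases "\<delta> = \<gamma>")
    case True
    then show ?thesis using T assms(5) by (simp add: pe_refl)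
  next
    case False
    note r = cc_right[OF ty_Sel.prems d(1) False]
    have bd: "\<delta> \<noteq> \<beta>" using r(6) d by auto
    have 1: "peq lt (cs \<gamma> S1 S) (Sel \<delta> m (cut op \<gamma> (Par \<gamma> I (\<lambda>i. Sel \<beta> l (f i))) g))
        (Sel \<delta> m (Sel \<beta> l (cut op \<gamma> (Par \<gamma> I f) g)))"
      using r ty_Sel.hyps(1,2) by (intro pe_Sel) (auto intro!: ty_Sel.IH)
    have 2: "peq lt (cs \<gamma> S1 S) (Sel \<delta> m (Sel \<beta> l (cut op \<gamma> (Par \<gamma> I f) g)))
       (Sel \<beta> l (Sel \<delta> m (cut op \<gamma> (Par \<gamma> I f) g)))"
      by (rule pe_SS[OF bd]) (use r(1,2) lb(1,2) k ty_Sel.hyps(1,2) peq_ty2[OF 1] in \<open>auto simp: nxt_nxt[OF bd]\<close>)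
    show ?thesis using False pe_trans[OF 1 2] by simp
  qed
next
  case (ty_Par S \<delta> D g)
  have nd: "\<delta> \<noteq> \<gamma>" using ty_Par.hyps(1) k cc_main(1)[OF ty_Par.prems] by auto
  note d = knd_dom[OF ty_Par(1)] knd_dom[OF k(2)]
  note lb = cc_left[OF ty_Par.prems d(2) assms(5)]
  note r = cc_right[OF ty_Par.prems d(1) nd]
  have bd: "\<delta> \<noteq> \<beta>" using r(6) d by auto
  have 1: "peq lt (cs \<gamma> S1 S) (Par \<delta> D (\<lambda>d. cut op \<gamma> (Par \<gamma> I (\<lambda>i. Sel \<beta> l (f i))) (g d)))
      (Par \<delta> D (\<lambda>d. Sel \<beta> l (cut op \<gamma> (Par \<gamma> I f) (g d))))"
    using r ty_Par.hyps(1,2) by (intro pe_Par) (auto intro!: ty_Par.IH)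
  have 2: "peq lt (cs \<gamma> S1 S) (Par \<delta> D (\<lambda>d. Sel \<beta> l (cut op \<gamma> (Par \<gamma> I f) (g d))))
      (Sel \<beta> l (Par \<delta> D (\<lambda>d. cut op \<gamma> (Par \<gamma> I f) (g d))))"
    by (rule pe_PS[OF bd]) (use r(1,2) lb(1,2) k ty_Par.hyps(1,2) peq_ty2[OF 1] in auto)
  show ?case using nd pe_trans[OF 1 2] by simp
qed

lemma cut_root_Sel_Par:
  assumes at: "atomic lt" and op: "opok lt s \<gamma> op" and "ty lt S2 g" "cc s \<gamma> S1 S2" "\<beta> \<noteq> \<gamma>"
    and k: "knd S1 \<gamma> = Some False" "knd S1 \<beta> = Some True" "l \<in> idx S1 \<gamma>" "J = idx S1 \<beta>"
    and f: "\<And>j. j \<in> J \<Longrightarrow> ty lt (nxt (nxt S1 \<gamma> l) \<beta> j) (f j)"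
  shows "peq lt (cs \<gamma> S1 S2) (cut op \<gamma> (Sel \<gamma> l (Par \<beta> J f)) g)
    (Par \<beta> J (\<lambda>j. cut op \<gamma> (Sel \<gamma> l (f j)) g))"
  using assms(3,4)
proof (induction rule: ty.induct)
  case (ty_Leaf S a)
  then show ?case using cc_main(1)[OF ty_Leaf(2)] k ty_Leaf_knd[OF at ty_Leaf(1), of \<gamma>] by simp
next
  case (ty_Sel S \<delta> m g)
  have nd: "\<delta> \<noteq> \<gamma>" using ty_Sel.hyps(1) k cc_main(1)[OF ty_Sel.prems] by auto
  note d = knd_dom[OF ty_Sel(1)] knd_dom[OF k(2)]
  note lb = cc_left[OF ty_Sel.prems d(2) assms(5)]
  note r = cc_right[OF ty_Sel.prems d(1) nd]
  have bd: "\<beta> \<noteq> \<delta>" using r(6) d by auto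
  have 1: "peq lt (cs \<gamma> S1 S) (Sel \<delta> m (cut op \<gamma> (Sel \<gamma> l (Par \<beta> J f)) g))
      (Sel \<delta> m (Par \<beta> J (\<lambda>j. cut op \<gamma> (Sel \<gamma> l (f j)) g)))"
    using r ty_Sel.hyps(1,2) by (intro pe_Sel) (auto intro!: ty_Sel.IH)
  have 2: "peq lt (cs \<gamma> S1 S) (Par \<beta> J (\<lambda>j. Sel \<delta> m (cut op \<gamma> (Sel \<gamma> l (f j)) g)))
     (Sel \<delta> m (Par \<beta> J (\<lambda>j. cut op \<gamma> (Sel \<gamma> l (f j)) g)))"
    by (rule pe_PS[OF bd]) (use r(1,2) lb(1,2) k ty_Sel.hyps(1,2) peq_ty2[OF 1] in \<open>auto simp: nxt_nxt[OF bd]\<close>)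
  show ?case using nd pe_trans[OF 1 pe_sym[OF 2]] by simp
next
  case (ty_Par S \<delta> D g)
  have T: "ty lt (cs \<gamma> S1 S) (cut op \<gamma> (Sel \<gamma> l (Par \<beta> J f)) (Par \<delta> D g))"
    using ty_Par k f assms(5) by (intro cut_ty[OF at _ _ _ op]) auto
  note d = knd_dom[OF ty_Par(1)] knd_dom[OF k(2)]
  note lb = cc_left[OF ty_Par.prems d(2) assms(5)]
  show ?case
  proof (cases "\<delta> = \<gamma>")
    case True
    then show ?thesis using T assms(5) by (simp add: pe_refl)
  next
    case False
    note r = cc_right[OF ty_Par.prems d(1) False]
    have bd: "\<delta> \<noteq> \<beta>" using r(6) d by auto
    have 1: "peq lt (cs \<gamma> S1 S) (Par \<delta> D (\<lambda>d. cut op \<gamma> (Sel \<gamma> l (Par \<beta> J f)) (g d)))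
        (Par \<delta> D (\<lambda>d. Par \<beta> J (\<lambda>j. cut op \<gamma> (Sel \<gamma> l (f j)) (g d))))"
      using r ty_Par.hyps(1,2) by (intro pe_Par) (auto intro!: ty_Par.IH)
    have 2: "peq lt (cs \<gamma> S1 S) (Par \<delta> D (\<lambda>d. Par \<beta> J (\<lambda>j. cut op \<gamma> (Sel \<gamma> l (f j)) (g d))))
        (Par \<beta> J (\<lambda>j. Par \<delta> D (\<lambda>d. cut op \<gamma> (Sel \<gamma> l (f j)) (g d))))"
      by (rule pe_PP[OF bd]) (use r(1,2) lb(1,2) k ty_Par.hyps(1,2) peq_ty2[OF 1] in auto)
    show ?thesis using False pe_trans[OF 1 2] by simp
  qed
qed

lemma cut_root_Sel_Sel:
  assumes at: "atomic lt" and op: "opok lt s \<gamma> op" and "ty lt S2 g" "cc s \<gamma> S1 S2" "\<beta> \<noteq> \<gamma>"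
    and k: "knd S1 \<gamma> = Some False" "knd S1 \<beta> = Some False" "l \<in> idx S1 \<gamma>" "m \<in> idx S1 \<beta>"
    and f: "ty lt (nxt (nxt S1 \<gamma> l) \<beta> m) f"
  shows "peq lt (cs \<gamma> S1 S2) (cut op \<gamma> (Sel \<gamma> l (Sel \<beta> m f)) g)
    (Sel \<beta> m (cut op \<gamma> (Sel \<gamma> l f) g))"
  using assms(3,4)
proof (induction rule: ty.induct)
  case (ty_Leaf S a)
  then show ?case using cc_main(1)[OF ty_Leaf(2)] k ty_Leaf_knd[OF at ty_Leaf(1), of \<gamma>] by simp
next
  case (ty_Sel S \<delta> n g)
  have nd: "\<delta> \<noteq> \<gamma>" using ty_Sel.hyps(1) k cc_main(1)[OF ty_Sel.prems] by auto
  note d = knd_dom[OF ty_Sel(1)] knd_dom[OF k(2)]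
  note lb = cc_left[OF ty_Sel.prems d(2) assms(5)]
  note r = cc_right[OF ty_Sel.prems d(1) nd]
  have bd: "\<delta> \<noteq> \<beta>" using r(6) d by auto
  have 1: "peq lt (cs \<gamma> S1 S) (Sel \<delta> n (cut op \<gamma> (Sel \<gamma> l (Sel \<beta> m f)) g))
      (Sel \<delta> n (Sel \<beta> m (cut op \<gamma> (Sel \<gamma> l f) g)))"
    using r ty_Sel.hyps(1,2) by (intro pe_Sel) (auto intro!: ty_Sel.IH)
  have 2: "peq lt (cs \<gamma> S1 S) (Sel \<delta> n (Sel \<beta> m (cut op \<gamma> (Sel \<gamma> l f) g)))
     (Sel \<beta> m (Sel \<delta> n (cut op \<gamma> (Sel \<gamma> l f) g)))"
    by (rule pe_SS[OF bd]) (use r(1,2) lb(1,2) k ty_Sel.hyps(1,2) peq_ty2[OF 1] in \<open>auto simp: nxt_nxt[OF bd]\<close>)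
  show ?case using nd pe_trans[OF 1 2] by simp
next
  case (ty_Par S \<delta> D g)
  have T: "ty lt (cs \<gamma> S1 S) (cut op \<gamma> (Sel \<gamma> l (Sel \<beta> m f)) (Par \<delta> D g))"
    using ty_Par k f assms(5) by (intro cut_ty[OF at _ _ _ op]) auto
  note d = knd_dom[OF ty_Par(1)] knd_dom[OF k(2)]
  note lb = cc_left[OF ty_Par.prems d(2) assms(5)]
  show ?case
  proof (cases "\<delta> = \<gamma>")
    case True
    then show ?thesis using T assms(5) by (simp add: pe_refl)
  next
    case False
    note r = cc_right[OF ty_Par.prems d(1) False]
    have bd: "\<delta> \<noteq> \<beta>" using r(6) d by auto
    have 1: "peq lt (cs \<gamma> S1 S) (Par \<delta> D (\<lambda>d. cut op \<gamma> (Sel \<gamma> l (Sel \<beta> m f)) (g d)))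
        (Par \<delta> D (\<lambda>d. Sel \<beta> m (cut op \<gamma> (Sel \<gamma> l f) (g d))))"
      using r ty_Par.hyps(1,2) by (intro pe_Par) (auto intro!: ty_Par.IH)
    have 2: "peq lt (cs \<gamma> S1 S) (Par \<delta> D (\<lambda>d. Sel \<beta> m (cut op \<gamma> (Sel \<gamma> l f) (g d))))
        (Sel \<beta> m (Par \<delta> D (\<lambda>d. cut op \<gamma> (Sel \<gamma> l f) (g d))))"
      by (rule pe_PS[OF bd]) (use r(1,2) lb(1,2) k ty_Par.hyps(1,2) peq_ty2[OF 1] in auto)
    show ?thesis using False pe_trans[OF 1 2] by simp
  qed
qed

text \<open>Induction on the conversion. Rules off the cut channel simply come out; a congruence on
  the cut channel needs an inner induction on the right premise, which continues until the principal
  partner is met. Root conversions with the cut channel are the four preceding lemmas.\<close>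

lemma cut_cong_left:
  assumes at: "atomic lt" and op: "opok lt s \<gamma> op"
    and "peq lt S1 f f'" "cc s \<gamma> S1 S2" "ty lt S2 g"
  shows "peq lt (cs \<gamma> S1 S2) (cut op \<gamma> f g) (cut op \<gamma> f' g)"
  using assms(3-5)
proof (induction arbitrary: S2 g rule: peq.induct)
  case (pe_refl S n)
  then show ?case by (intro peq.pe_refl cut_ty[OF at _ _ _ op])
next
  case (pe_sym S m n)
  show ?case by (rule peq.pe_sym[OF pe_sym.IH[OF pe_sym.prems]])
next
  case (pe_trans S m n k)
  show ?case by (rule peq.pe_trans[OF pe_trans.IH(1)[OF pe_trans.prems] pe_trans.IH(2)[OF pe_trans.prems]])
next
  case (pe_Par S \<alpha> I h h')
  show ?case
  proof (cases "\<alpha> = \<gamma>")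
    case False
    note l = cc_left[OF pe_Par.prems(1) knd_dom[OF pe_Par.hyps(1)] False]
    show ?thesis using False l pe_Par by (auto intro!: peq.pe_Par)
  next
    case True
    show ?thesis using pe_Par.prems(2,1)
    proof (induction rule: ty.induct)
      case (ty_Leaf S2 a)
      then show ?case using cc_main(1)[OF ty_Leaf(2)] pe_Par.hyps True ty_Leaf_knd[OF at ty_Leaf(1), of \<gamma>] by simp
    next
      case (ty_Par S2 \<delta> D g)
      have nd: "\<delta> \<noteq> \<gamma>" using ty_Par.hyps(1) pe_Par.hyps True cc_main(1)[OF ty_Par.prems] by auto
      note r = cc_right[OF ty_Par.prems knd_dom[OF ty_Par(1)] nd]
      show ?case using r nd True ty_Par.hyps(1,2) ty_Par.IH by (auto intro!: peq.pe_Par)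
    next
      case (ty_Sel S2 \<delta> l g)
      show ?case
      proof (cases "\<delta> = \<gamma>")
        case False
        note r = cc_right[OF ty_Sel.prems knd_dom[OF ty_Sel(1)] False]
        show ?thesis using r False True ty_Sel.hyps(1,2) ty_Sel.IH by (auto intro!: peq.pe_Sel)
      next
        case d: True
        note m = cc_main[OF ty_Sel.prems]
        have "peq lt (cs \<gamma> (nxt S \<gamma> l) (nxt S2 \<gamma> l)) (cut op \<gamma> (h l) g) (cut op \<gamma> (h' l) g)"
          using pe_Par.IH[of l "nxt S2 \<gamma> l" g] m ty_Sel.hyps d True pe_Par.hyps by auto
        then show ?thesis using d True m by simp
      qed
    qed
  qed
next
  case (pe_Sel S \<alpha> k f f')
  show ?case
  proof (cases "\<alpha> = \<gamma>")
    case False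
    note l = cc_left[OF pe_Sel.prems(1) knd_dom[OF pe_Sel.hyps(1)] False]
    show ?thesis using False l pe_Sel by (auto intro!: peq.pe_Sel)
  next
    case True
    show ?thesis using pe_Sel.prems(2,1)
    proof (induction rule: ty.induct)
      case (ty_Leaf S2 a)
      then show ?case using cc_main(1)[OF ty_Leaf(2)] pe_Sel.hyps True ty_Leaf_knd[OF at ty_Leaf(1), of \<gamma>] by simp
    next
      case (ty_Sel S2 \<delta> l g)
      have nd: "\<delta> \<noteq> \<gamma>" using ty_Sel.hyps(1) pe_Sel.hyps True cc_main(1)[OF ty_Sel.prems] by auto
      note r = cc_right[OF ty_Sel.prems knd_dom[OF ty_Sel(1)] nd]
      show ?case using r nd True ty_Sel.hyps(1,2) ty_Sel.IH by (auto intro!: peq.pe_Sel)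
    next
      case (ty_Par S2 \<delta> D g)
      show ?case
      proof (cases "\<delta> = \<gamma>")
        case False
        note r = cc_right[OF ty_Par.prems knd_dom[OF ty_Par(1)] False]
        show ?thesis using r False True ty_Par.hyps(1,2) ty_Par.IH by (auto intro!: peq.pe_Par)
      next
        case d: True
        note m = cc_main[OF ty_Par.prems]
        have "peq lt (cs \<gamma> (nxt S \<gamma> k) (nxt S2 \<gamma> k)) (cut op \<gamma> f (g k)) (cut op \<gamma> f' (g k))"
          using pe_Sel.IH[of "nxt S2 \<gamma> k" "g k"] m ty_Par.hyps d True pe_Sel.hyps by auto
        then show ?thesis using d True m by simp
      qed
    qed
  qed
next
  case (pe_PP \<alpha> \<beta> S I J f)
  note tf = pe_PP.hyps(6)
  note d = knd_dom[OF pe_PP(2)] knd_dom[OF pe_PP(3)]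
  consider "\<alpha> = \<gamma>" | "\<beta> = \<gamma>" | "\<alpha> \<noteq> \<gamma>" "\<beta> \<noteq> \<gamma>" by blast
  then show ?case
  proof cases
    case 1
    show ?thesis using cut_root_Par_Par[OF at op pe_PP.prems(2,1), of \<beta> I J f] pe_PP.hyps 1 by auto
  next
    case 2
    have "peq lt (cs \<gamma> S S2) (cut op \<gamma> (Par \<gamma> J (\<lambda>j. Par \<alpha> I (\<lambda>i. f i j))) g)
        (Par \<alpha> I (\<lambda>i. cut op \<gamma> (Par \<gamma> J (\<lambda>j. f i j)) g))"
      using pe_PP.hyps(1-5) tf 2 by (intro cut_root_Par_Par[OF at op pe_PP.prems(2,1)]) (auto simp: nxt_nxt)
    from peq.pe_sym[OF this] show ?thesis using pe_PP.hyps(1) 2 by simp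
  next
    case 3
    note la = cc_left[OF pe_PP.prems(1) d(1) 3(1)] and lb = cc_left[OF pe_PP.prems(1) d(2) 3(2)]
    have "ty lt (nxt (nxt (cs \<gamma> S S2) \<alpha> i) \<beta> j) (cut op \<gamma> (f i j) g)" if "i \<in> I" "j \<in> J" for i j
    proof -
      note lb' = cc_left[OF la(4)[of i] _ 3(2)]
      show ?thesis unfolding la(3) using lb' d(2) tf[OF that] pe_PP.prems(2)
        by (auto intro!: cut_ty[OF at _ _ _ op])
    qed
    then show ?thesis using 3 la lb pe_PP.hyps by (auto intro!: peq.pe_PP)
  qed
next
  case (pe_PS \<alpha> \<beta> S I k f)
  note tf = pe_PS.hyps(6)
  note d = knd_dom[OF pe_PS(2)] knd_dom[OF pe_PS(3)]
  consider "\<alpha> = \<gamma>" | "\<beta> = \<gamma>" | "\<alpha> \<noteq> \<gamma>" "\<beta> \<noteq> \<gamma>" by blast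
  then show ?case
  proof cases
    case 1
    show ?thesis using cut_root_Par_Sel[OF at op pe_PS.prems(2,1), of \<beta> I k f] pe_PS.hyps 1 by auto
  next
    case 2
    have "peq lt (cs \<gamma> S S2) (cut op \<gamma> (Sel \<gamma> k (Par \<alpha> I f)) g)
        (Par \<alpha> I (\<lambda>i. cut op \<gamma> (Sel \<gamma> k (f i)) g))"
      using pe_PS.hyps(1-5) tf 2 by (intro cut_root_Sel_Par[OF at op pe_PS.prems(2,1)]) (auto simp: nxt_nxt)
    from peq.pe_sym[OF this] show ?thesis using pe_PS.hyps(1) 2 by simp
  next
    case 3
    note la = cc_left[OF pe_PS.prems(1) d(1) 3(1)] and lb = cc_left[OF pe_PS.prems(1) d(2) 3(2)]
    have "ty lt (nxt (nxt (cs \<gamma> S S2) \<alpha> i) \<beta> k) (cut op \<gamma> (f i) g)" if "i \<in> I" for i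
    proof -
      note lb' = cc_left[OF la(4)[of i] _ 3(2)]
      show ?thesis unfolding la(3) using lb' d(2) tf[OF that] pe_PS.prems(2)
        by (auto intro!: cut_ty[OF at _ _ _ op])
    qed
    then show ?thesis using 3 la lb pe_PS.hyps by (auto intro!: peq.pe_PS)
  qed
next
  case (pe_SS \<alpha> \<beta> S k l f)
  note tf = pe_SS.hyps(6)
  note d = knd_dom[OF pe_SS(2)] knd_dom[OF pe_SS(3)]
  consider "\<alpha> = \<gamma>" | "\<beta> = \<gamma>" | "\<alpha> \<noteq> \<gamma>" "\<beta> \<noteq> \<gamma>" by blast
  then show ?case
  proof cases
    case 1
    show ?thesis using cut_root_Sel_Sel[OF at op pe_SS.prems(2,1), of \<beta> k l f] pe_SS.hyps 1 by auto
  next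
    case 2
    have "peq lt (cs \<gamma> S S2) (cut op \<gamma> (Sel \<gamma> l (Sel \<alpha> k f)) g)
        (Sel \<alpha> k (cut op \<gamma> (Sel \<gamma> l f) g))"
      using pe_SS.hyps(1-5) tf 2 by (intro cut_root_Sel_Sel[OF at op pe_SS.prems(2,1)]) (auto simp: nxt_nxt)
    from peq.pe_sym[OF this] show ?thesis using pe_SS.hyps(1) 2 by simp
  next
    case 3
    note la = cc_left[OF pe_SS.prems(1) d(1) 3(1)] and lb = cc_left[OF pe_SS.prems(1) d(2) 3(2)]
    have "ty lt (nxt (nxt (cs \<gamma> S S2) \<alpha> k) \<beta> l) (cut op \<gamma> f g)"
    proof -
      note lb' = cc_left[OF la(4)[of k] _ 3(2)]
      show ?thesis unfolding la(3) using lb' d(2) tf pe_SS.prems(2)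
        by (auto intro!: cut_ty[OF at _ _ _ op])
    qed
    then show ?thesis using 3 la lb pe_SS.hyps by (auto intro!: peq.pe_SS)
  qed
qed

text \<open>Exchange the premises with \<open>cut_flip\<close>, use congruence on the left, and
  exchange back.\<close>

lemma cut_cong_right:
  assumes at: "atomic lt" and op: "opok lt s \<gamma> op"
    and "peq lt S2 g g'" "cc s \<gamma> S1 S2" "ty lt S1 f"
  shows "peq lt (cs \<gamma> S1 S2) (cut op \<gamma> f g) (cut op \<gamma> f g')"
proof -
  have "peq lt (cs \<gamma> S2 S1) (cut (\<lambda>a b. op b a) \<gamma> g f) (cut (\<lambda>a b. op b a) \<gamma> g' f)"
    by (rule cut_cong_left[OF at opok_flip[OF op] assms(3) cc_flip[OF assms(4)] assms(5)])
  note 1 = this[unfolded cs_flip[OF assms(4)]]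
  show ?thesis
    by (rule pe_trans[OF cut_flip[OF at assms(4,5) peq_ty1[OF assms(3)] op]
          pe_trans[OF 1 pe_sym[OF cut_flip[OF at assms(4,5) peq_ty2[OF assms(3)] op]]]])
qed

lemma cut_cong:
  assumes "atomic lt" "opok lt s \<gamma> op" "peq lt S1 f f'" "peq lt S2 g g'" "cc s \<gamma> S1 S2"
  shows "peq lt (cs \<gamma> S1 S2) (cut op \<gamma> f g) (cut op \<gamma> f' g')"
  by (rule pe_trans[OF cut_cong_left[OF assms(1-3,5) peq_ty1[OF assms(4)]]
      cut_cong_right[OF assms(1,2,4,5) peq_ty2[OF assms(3)]]])

section \<open>Normal forms of derivations\<close>

primrec nf :: "(chan \<Rightarrow> 'l \<Rightarrow> 'l \<Rightarrow> 'l) \<Rightarrow> 'l tm \<Rightarrow> 'l nt" where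
  "nf op (Ax a) = Leaf a"
| "nf op (Cotuple \<alpha> F) = Par \<alpha> (fmdom' F) (\<lambda>i. the (fmlookup (fmmap (nf op) F) i))"
| "nf op (Tuple \<alpha> F) = Par \<alpha> (fmdom' F) (\<lambda>i. the (fmlookup (fmmap (nf op) F) i))"
| "nf op (Project \<alpha> k f) = Sel \<alpha> k (nf op f)"
| "nf op (Inject \<alpha> k f) = Sel \<alpha> k (nf op f)"
| "nf op (Cut f \<gamma> g) = cut (op \<gamma>) \<gamma> (nf op f) (nf op g)"

definition sqn :: "'o family \<Rightarrow> 'o family \<Rightarrow> 'o sq" where
  "sqn \<Gamma> \<Delta> c = (case fmlookup \<Gamma> c of Some X \<Rightarrow> Some (False, X)
     | None \<Rightarrow> map_option (Pair True) (fmlookup \<Delta> c))"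

lemma wf_seq_alt: "wf_seq A \<Gamma> \<Delta> \<longleftrightarrow>
    (\<forall>c. fmlookup \<Gamma> c = None \<or> fmlookup \<Delta> c = None) \<and>
    (\<forall>c X. fmlookup \<Gamma> c = Some X \<longrightarrow> set_fm X \<subseteq> Obj A) \<and>
    (\<forall>c X. fmlookup \<Delta> c = Some X \<longrightarrow> set_fm X \<subseteq> Obj A)"
proof -
  have "fmdom' \<Gamma> \<inter> fmdom' \<Delta> = {} \<longleftrightarrow> (\<forall>c. fmlookup \<Gamma> c = None \<or> fmlookup \<Delta> c = None)"
    unfolding disjoint_iff fmlookup_dom'_iff by (metis option.exhaust option.distinct(1))
  moreover have "(\<forall>X\<in>fmran' \<Gamma> \<union> fmran' \<Delta>. set_fm X \<subseteq> Obj A) \<longleftrightarrow>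
    (\<forall>c X. fmlookup \<Gamma> c = Some X \<longrightarrow> set_fm X \<subseteq> Obj A) \<and>
    (\<forall>c X. fmlookup \<Delta> c = Some X \<longrightarrow> set_fm X \<subseteq> Obj A)"
    unfolding ball_Un unfolding Ball_def fmlookup_ran'_iff by blast
  ultimately show ?thesis unfolding wf_seq_def by (simp only:)
qed

lemma fmdom'_eqE:
  assumes "i \<in> fmdom' Xs" "fmdom' F = fmdom' Xs"
  obtains X f where "fmlookup Xs i = Some X" "fmlookup F i = Some f"
  using assms unfolding set_eq_iff fmlookup_dom'_iff by blast

lemma seq_chans_iff: "c \<in> seq_chans \<Gamma> \<Delta> \<longleftrightarrow> fmlookup \<Gamma> c \<noteq> None \<or> fmlookup \<Delta> c \<noteq> None"
  by (auto simp: seq_chans_def fmlookup_dom'_iff)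

lemma sqn_updL: "sqn (fmupd \<alpha> X \<Gamma>) \<Delta> = (sqn \<Gamma> \<Delta>)(\<alpha> \<mapsto> (False, X))"
  by (auto simp: sqn_def fun_eq_iff)

lemma sqn_updR: "fmlookup \<Gamma> \<alpha> = None \<Longrightarrow> sqn \<Gamma> (fmupd \<alpha> X \<Delta>) = (sqn \<Gamma> \<Delta>)(\<alpha> \<mapsto> (True, X))"
  by (auto simp: sqn_def fun_eq_iff split: option.split)

lemma wf_updR: "wf_seq A \<Gamma> (fmupd \<alpha> X \<Delta>) \<Longrightarrow> fmlookup \<Gamma> \<alpha> = None"
  by (auto simp: wf_seq_alt split: if_splits)

lemma knd_upd[simp]: "knd (S(\<alpha> \<mapsto> x)) \<alpha> = kind x"
  and idx_upd[simp]: "idx (S(\<alpha> \<mapsto> (s, X))) \<alpha> = fmdom' (branches X)"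
  and nxt_upd[simp]: "nxt (S(\<alpha> \<mapsto> (s, X))) \<alpha> k = S(\<alpha> \<mapsto> (s, the (fmlookup (branches X) k)))"
  by (auto simp: knd_def idx_def nxt_def)

lemma sqn_cut:
  assumes "wf_seq A \<Gamma> (fmupd \<gamma> Z \<Delta>)" "wf_seq A (fmupd \<gamma> Z \<Gamma>') \<Delta>'"
    "\<gamma> \<notin> seq_chans \<Gamma> \<Delta>" "\<gamma> \<notin> seq_chans \<Gamma>' \<Delta>'" "seq_chans \<Gamma> \<Delta> \<inter> seq_chans \<Gamma>' \<Delta>' = {}"
  shows "cc True \<gamma> (sqn \<Gamma> (fmupd \<gamma> Z \<Delta>)) (sqn (fmupd \<gamma> Z \<Gamma>') \<Delta>')"
    "sqn (\<Gamma> ++\<^sub>f \<Gamma>') (\<Delta> ++\<^sub>f \<Delta>') = cs \<gamma> (sqn \<Gamma> (fmupd \<gamma> Z \<Delta>)) (sqn (fmupd \<gamma> Z \<Gamma>') \<Delta>')"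
proof -
  have g: "fmlookup \<Gamma> \<gamma> = None" "fmlookup \<Delta> \<gamma> = None" "fmlookup \<Gamma>' \<gamma> = None" "fmlookup \<Delta>' \<gamma> = None"
    using assms(3,4) by (auto simp: seq_chans_iff)
  have w: "fmlookup \<Gamma> c = None \<or> fmlookup \<Delta> c = None" "fmlookup \<Gamma>' c = None \<or> fmlookup \<Delta>' c = None" for c
    using assms(1,2) g unfolding wf_seq_alt by (metis fmupd_lookup)+
  have d: "fmlookup \<Gamma> c = None \<and> fmlookup \<Delta> c = None \<or> fmlookup \<Gamma>' c = None \<and> fmlookup \<Delta>' c = None" for c
    using assms(5) seq_chans_iff[of c \<Gamma> \<Delta>] seq_chans_iff[of c \<Gamma>' \<Delta>'] by blast
  have s: "sqn \<Gamma> (fmupd \<gamma> Z \<Delta>) c = (if c = \<gamma> then Some (True, Z) else sqn \<Gamma> \<Delta> c)"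
    "sqn (fmupd \<gamma> Z \<Gamma>') \<Delta>' c = (if c = \<gamma> then Some (False, Z) else sqn \<Gamma>' \<Delta>' c)" for c
    using g by (auto simp: sqn_def split: option.split)
  have n: "sqn \<Gamma> \<Delta> c = None \<or> sqn \<Gamma>' \<Delta>' c = None" for c
    using d[of c] by (auto simp: sqn_def)
  have "dom (sqn \<Gamma> (fmupd \<gamma> Z \<Delta>)) \<inter> dom (sqn (fmupd \<gamma> Z \<Gamma>') \<Delta>') = {\<gamma>}"
  proof (intro set_eqI)
    fix c
    show "c \<in> dom (sqn \<Gamma> (fmupd \<gamma> Z \<Delta>)) \<inter> dom (sqn (fmupd \<gamma> Z \<Gamma>') \<Delta>') \<longleftrightarrow> c \<in> {\<gamma>}"
      using n[of c] unfolding Int_iff domIff s by auto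
  qed
  then show "cc True \<gamma> (sqn \<Gamma> (fmupd \<gamma> Z \<Delta>)) (sqn (fmupd \<gamma> Z \<Gamma>') \<Delta>')"
    unfolding cc_def s by auto
  show "sqn (\<Gamma> ++\<^sub>f \<Gamma>') (\<Delta> ++\<^sub>f \<Delta>') = cs \<gamma> (sqn \<Gamma> (fmupd \<gamma> Z \<Delta>)) (sqn (fmupd \<gamma> Z \<Gamma>') \<Delta>')"
  proof
    fix c
    show "sqn (\<Gamma> ++\<^sub>f \<Gamma>') (\<Delta> ++\<^sub>f \<Delta>') c = cs \<gamma> (sqn \<Gamma> (fmupd \<gamma> Z \<Delta>)) (sqn (fmupd \<gamma> Z \<Gamma>') \<Delta>') c"
      using d[of c] w[of c] g
      unfolding cs_def s
      by (cases "c = \<gamma>"; cases "fmlookup \<Gamma> c"; cases "fmlookup \<Gamma>' c"; cases "fmlookup \<Delta> c"; cases "fmlookup \<Delta>' c")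
        (simp_all add: sqn_def fmlookup_dom_iff)
  qed
qed

definition mseq :: "('o, 'm) polycat \<Rightarrow> 'm \<Rightarrow> 'o sq" where
  "mseq A f = sqn (fmmap Atom (Dom A f)) (fmmap Atom (Cod A f))"

definition rl :: "('o, 'm) polycat \<Rightarrow> 'o sq \<Rightarrow> 'm \<Rightarrow> bool" where
  "rl A S f \<longleftrightarrow> f \<in> Mor A \<and> S = mseq A f"

lemma mseq_atom: "mseq A f \<alpha> = Some (s, X) \<Longrightarrow> \<exists>Z. X = Atom Z"
  by (auto simp: mseq_def sqn_def split: option.splits)

lemma atomic_mseq: "(\<And>S x. lt S x \<Longrightarrow> \<exists>f. S = mseq A f) \<Longrightarrow> atomic lt"
  unfolding atomic_def
proof (intro allI impI)
  fix S a \<alpha>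
  assume "\<And>S x. lt S x \<Longrightarrow> \<exists>f. S = mseq A f" "lt S a"
  then obtain f where "S = mseq A f" by blast
  then show "knd S \<alpha> = None"
    by (cases "mseq A f \<alpha>") (auto simp: knd_def dest: mseq_atom)
qed

lemma atomic_rl: "atomic (rl A)"
  by (rule atomic_mseq[of _ A]) (auto simp: rl_def)

context symmetric_polycategory
begin

lemma mseq_iff:
  assumes "f \<in> Mor A"
  shows "mseq A f c = Some (False, Atom Z) \<longleftrightarrow> fmlookup (Dom A f) c = Some Z"
    and "mseq A f c = Some (True, Atom Z) \<longleftrightarrow> fmlookup (Cod A f) c = Some Z"
    and "c \<in> dom (mseq A f) \<longleftrightarrow> c \<in> chans A f"
proof -
  have "fmlookup (Dom A f) c = None \<or> fmlookup (Cod A f) c = None"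
    using Dom_Cod_disjoint[OF assms] by (meson disjoint_iff fmdom'I not_None_eq)
  then show "mseq A f c = Some (False, Atom Z) \<longleftrightarrow> fmlookup (Dom A f) c = Some Z"
    "mseq A f c = Some (True, Atom Z) \<longleftrightarrow> fmlookup (Cod A f) c = Some Z"
    "c \<in> dom (mseq A f) \<longleftrightarrow> c \<in> chans A f"
    by (auto simp: mseq_def sqn_def chans_def fmlookup_dom'_iff split: option.splits)
qed

text \<open>The sequents of axioms contain atoms only, so agreement of the two cut formulas is
  agreement of the two objects. Typed cuts of leaves thus never ask for an undefined
  composite.\<close>

lemma cc_composable:
  assumes "cc True \<gamma> (mseq A f) (mseq A g)" "f \<in> Mor A" "g \<in> Mor A"
  shows "composable A \<gamma> f g"
proof -
  obtain X where X: "mseq A f \<gamma> = Some (True, X)" "mseq A g \<gamma> = Some (False, X)"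
    using assms(1) by (auto simp: cc_def)
  then obtain Z where "X = Atom Z" using mseq_atom[OF X(1)] by blast
  moreover have "chans A f \<inter> chans A g = {\<gamma>}"
    using assms by (simp add: cc_def set_eq_iff mseq_iff(3))
  ultimately show ?thesis using assms X by (auto simp: composable_def mseq_iff)
qed

lemma mseq_Comp:
  assumes "composable A \<gamma> f g"
  shows "mseq A (Comp A \<gamma> f g) = cs \<gamma> (mseq A f) (mseq A g)"
proof
  fix c
  have m: "f \<in> Mor A" "g \<in> Mor A" and ch: "chans A f \<inter> chans A g = {\<gamma>}" using assms by (auto simp: composable_def)
  obtain Z where Z: "fmlookup (Cod A f) \<gamma> = Some Z" "fmlookup (Dom A g) \<gamma> = Some Z"
    using assms by (auto simp: composable_def)
  have d: "fmlookup (Dom A h) c = None \<or> fmlookup (Cod A h) c = None" if "h \<in> Mor A" for h c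
    using Dom_Cod_disjoint[OF that] by (meson disjoint_iff fmdom'I not_None_eq)
  have z: "fmlookup (Dom A f) \<gamma> = None" "fmlookup (Cod A g) \<gamma> = None"
    using d[OF m(1), of \<gamma>] d[OF m(2), of \<gamma>] Z by auto
  have x: "c \<noteq> \<gamma> \<Longrightarrow> fmlookup (Dom A f) c = None \<and> fmlookup (Cod A f) c = None \<or>
      fmlookup (Dom A g) c = None \<and> fmlookup (Cod A g) c = None"
    using ch by (auto simp: chans_def fmlookup_dom'_iff set_eq_iff) 
  show "mseq A (Comp A \<gamma> f g) c = cs \<gamma> (mseq A f) (mseq A g) c"
    unfolding mseq_def cs_def sqn_def Dom_Comp[OF assms] Cod_Comp[OF assms] using z x d[OF m(1), of c] d[OF m(2), of c]
    by (cases "c = \<gamma>"; cases "fmlookup (Dom A f) c"; cases "fmlookup (Cod A f) c"; cases "fmlookup (Dom A g) c";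
        cases "fmlookup (Cod A g) c") (simp_all add: fmlookup_dom_iff)
qed

lemma opok_rl: "opok (rl A) True \<gamma> (Comp A \<gamma>)"
  unfolding opok_def rl_def using cc_composable Comp_Mor mseq_Comp by auto

lemma derives_wf: "derives A \<Gamma> \<Delta> s \<Longrightarrow> wf_seq A \<Gamma> \<Delta>"
proof (induction rule: derives.induct)
  case (derives_Ax f)
  have "fmlookup (Dom A f) c = None \<or> fmlookup (Cod A f) c = None" for c
    using Dom_Cod_disjoint[OF derives_Ax] by (meson disjoint_iff fmdom'I not_None_eq)
  then show ?case using Dom_Obj[OF derives_Ax] Cod_Obj[OF derives_Ax]
    by (auto simp: wf_seq_alt fmlookup_ran'_iff subset_iff)
next
  case (derives_Cut \<gamma> \<Gamma> \<Delta> \<Gamma>' \<Delta>' Z f g)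
  have g: "fmlookup \<Gamma> \<gamma> = None" "fmlookup \<Delta> \<gamma> = None" "fmlookup \<Gamma>' \<gamma> = None" "fmlookup \<Delta>' \<gamma> = None"
    using derives_Cut.hyps by (auto simp: seq_chans_iff)
  have w: "wf_seq A \<Gamma> \<Delta>" "wf_seq A \<Gamma>' \<Delta>'"
    using derives_Cut.IH g unfolding wf_seq_alt by (metis fmupd_lookup option.distinct(1))+
  have d: "fmlookup \<Gamma> c = None \<and> fmlookup \<Delta> c = None \<or> fmlookup \<Gamma>' c = None \<and> fmlookup \<Delta>' c = None" for c
    using derives_Cut.hyps(3) seq_chans_iff[of c \<Gamma> \<Delta>] seq_chans_iff[of c \<Gamma>' \<Delta>'] by blast
  have l: "fmlookup (\<Gamma> ++\<^sub>f \<Gamma>') c = (if fmlookup \<Gamma> c = None then fmlookup \<Gamma>' c else fmlookup \<Gamma> c)"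
    "fmlookup (\<Delta> ++\<^sub>f \<Delta>') c = (if fmlookup \<Delta> c = None then fmlookup \<Delta>' c else fmlookup \<Delta> c)" for c
    using d[of c] by (auto simp: fmlookup_dom_iff)
  have w': "fmlookup \<Gamma> c = None \<or> fmlookup \<Delta> c = None" "fmlookup \<Gamma>' c = None \<or> fmlookup \<Delta>' c = None" for c
    using w by (simp_all only: wf_seq_alt)
  have "(if fmlookup \<Gamma> c = None then fmlookup \<Gamma>' c else fmlookup \<Gamma> c) = None \<or>
      (if fmlookup \<Delta> c = None then fmlookup \<Delta>' c else fmlookup \<Delta> c) = None" for c
    using w'(1)[of c] w'(2)[of c] d[of c] by auto
  then show ?case using w unfolding wf_seq_alt l by (simp split: if_splits)
qed auto

lemma derives_CutD:
  assumes "derives A \<Gamma> \<Delta> (Cut f \<gamma> g)"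
  obtains \<Gamma>1 \<Delta>1 \<Gamma>2 \<Delta>2 where "derives A \<Gamma>1 \<Delta>1 f" "derives A \<Gamma>2 \<Delta>2 g"
    "cc True \<gamma> (sqn \<Gamma>1 \<Delta>1) (sqn \<Gamma>2 \<Delta>2)" "sqn \<Gamma> \<Delta> = cs \<gamma> (sqn \<Gamma>1 \<Delta>1) (sqn \<Gamma>2 \<Delta>2)"
  using assms
proof cases
  case (derives_Cut \<Gamma>1 \<Delta>1 \<Gamma>' \<Delta>' Z)
  note w = sqn_cut[OF derives_wf[OF derives_Cut(6)] derives_wf[OF derives_Cut(7)] derives_Cut(3-5)]
  show ?thesis by (rule that[OF derives_Cut(6,7) w(1)]) (simp add: derives_Cut(1,2) w(2))
qed

text \<open>The leaves of \<open>t\<close> need not be morphisms; it is the image \<open>s\<close>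
  under \<open>v\<close> that is a derivation. Besides the normal form in \<open>A\<close> this
  covers the normal form with formal composites as leaves, which is the one that the program
  finds.\<close>

lemma nf_ty:
  assumes "derives A \<Gamma> \<Delta> s" "s = map_tm v t" "\<And>x. x \<in> set_tm t \<Longrightarrow> v x \<in> Mor A \<Longrightarrow> lt (mseq A (v x)) x"
    and at: "atomic lt" and op: "\<And>\<gamma>. opok lt True \<gamma> (op \<gamma>)"
  shows "ty lt (sqn \<Gamma> \<Delta>) (nf op t)"
  using assms(1-3)
proof (induction arbitrary: t rule: derives.induct)
  case (derives_Ax f)
  then show ?case by (cases t) (auto simp: mseq_def)
next
  case (derives_Cotuple \<alpha> \<Gamma> Xs \<Delta> F)
  obtain F' where t: "t = Cotuple \<alpha> F'" "F = fmmap (map_tm v) F'" using derives_Cotuple.prems(1) by (cases t) auto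
  have D: "fmdom' F' = fmdom' Xs" using derives_Cotuple.hyps(3) by (simp add: t)
  have "ty lt ((sqn \<Gamma> \<Delta>)(\<alpha> \<mapsto> (False, the (fmlookup Xs i)))) (the (fmlookup (fmmap (nf op) F') i))"
    if i: "i \<in> fmdom' Xs" for i
  proof -
    obtain X f where X: "fmlookup Xs i = Some X" "fmlookup F' i = Some f"
      by (rule fmdom'_eqE[OF i D])
    have "ty lt (sqn (fmupd \<alpha> X \<Gamma>) \<Delta>) (nf op f)"
    proof (rule derives_Cotuple.IH[OF X(1) _ refl])
      show "fmlookup F i = Some (map_tm v f)" by (simp add: t X)
      fix x assume "x \<in> set_tm f" and m: "v x \<in> Mor A"
      then have "x \<in> set_tm t" unfolding t(1) using fmran'I[OF X(2)] by auto
      then show "lt (mseq A (v x)) x" using m by (rule derives_Cotuple.prems(2))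
    qed
    then show ?thesis by (simp add: X sqn_updL)
  qed
  then show ?case unfolding t(1) sqn_updL nf.simps ty_simps by (simp add: D)
next
  case (derives_Tuple \<alpha> \<Delta> \<Gamma> Xs F)
  obtain F' where t: "t = Tuple \<alpha> F'" "F = fmmap (map_tm v) F'" using derives_Tuple.prems(1) by (cases t) auto
  have D: "fmdom' F' = fmdom' Xs" using derives_Tuple.hyps(3) by (simp add: t)
  note a = wf_updR[OF derives_Tuple.hyps(2)]
  have "ty lt ((sqn \<Gamma> \<Delta>)(\<alpha> \<mapsto> (True, the (fmlookup Xs i)))) (the (fmlookup (fmmap (nf op) F') i))"
    if i: "i \<in> fmdom' Xs" for i
  proof -
    obtain X f where X: "fmlookup Xs i = Some X" "fmlookup F' i = Some f"
      by (rule fmdom'_eqE[OF i D])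
    have "ty lt (sqn \<Gamma> (fmupd \<alpha> X \<Delta>)) (nf op f)"
    proof (rule derives_Tuple.IH[OF X(1) _ refl])
      show "fmlookup F i = Some (map_tm v f)" by (simp add: t X)
      fix x assume "x \<in> set_tm f" and m: "v x \<in> Mor A"
      then have "x \<in> set_tm t" unfolding t(1) using fmran'I[OF X(2)] by auto
      then show "lt (mseq A (v x)) x" using m by (rule derives_Tuple.prems(2))
    qed
    then show ?thesis by (simp add: X sqn_updR[OF a])
  qed
  then show ?case unfolding t(1) sqn_updR[OF a] nf.simps ty_simps by (simp add: D)
next
  case (derives_Project \<alpha> \<Gamma> Xs \<Delta> k X f)
  obtain f' where t: "t = Project \<alpha> k f'" "f = map_tm v f'" using derives_Project.prems(1) by (cases t) auto
  have "ty lt (sqn (fmupd \<alpha> X \<Gamma>) \<Delta>) (nf op f')"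
    by (rule derives_Project.IH[OF t(2)]) (rule derives_Project.prems(2), simp add: t(1))
  then show ?case unfolding t(1) sqn_updL nf.simps ty_simps using derives_Project.hyps(3)
    by (simp add: fmlookup_dom'_iff)
next
  case (derives_Inject \<alpha> \<Delta> \<Gamma> Xs k X f)
  obtain f' where t: "t = Inject \<alpha> k f'" "f = map_tm v f'" using derives_Inject.prems(1) by (cases t) auto
  have "ty lt (sqn \<Gamma> (fmupd \<alpha> X \<Delta>)) (nf op f')"
    by (rule derives_Inject.IH[OF t(2)]) (rule derives_Inject.prems(2), simp add: t(1))
  then show ?case unfolding t(1) sqn_updR[OF wf_updR[OF derives_Inject.hyps(2)]] nf.simps ty_simps
    using derives_Inject.hyps(3) by (simp add: fmlookup_dom'_iff)
next
  case (derives_Cut \<gamma> \<Gamma> \<Delta> \<Gamma>' \<Delta>' Z f g)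
  obtain f' g' where t: "t = Cut f' \<gamma> g'" "f = map_tm v f'" "g = map_tm v g'" using derives_Cut.prems(1) by (cases t) auto
  note w = sqn_cut[OF derives_wf[OF derives_Cut(4)] derives_wf[OF derives_Cut(5)] derives_Cut(1-3)]
  have "ty lt (sqn \<Gamma> (fmupd \<gamma> Z \<Delta>)) (nf op f')"
    by (rule derives_Cut.IH(1)[OF t(2)]) (rule derives_Cut.prems(2), simp add: t(1))
  moreover have "ty lt (sqn (fmupd \<gamma> Z \<Gamma>') \<Delta>') (nf op g')"
    by (rule derives_Cut.IH(2)[OF t(3)]) (rule derives_Cut.prems(2), simp add: t(1))
  ultimately show ?case unfolding w(2) t(1) nf.simps by (rule cut_ty[OF at w(1) _ _ op])
qed

end

text \<open>The simplifier meets map updates eta-expanded when a sequent comes out of an induction rule.\<close>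

lemma upd_eta[simp]: "(\<lambda>c. if c = \<alpha> then Some x else S c) = S(\<alpha> \<mapsto> x)"
  by auto

text \<open>The families obtained from finite maps agree with the pattern of \<open>pe_PP\<close> on
  the index sets only. The discrepancy elsewhere is junk and is bridged by \<open>pe_ext\<close> on
  both sides.\<close>

lemma conv_PP:
  assumes "ty lt S (Par \<alpha> I h)" "ty lt S (Par \<beta> J g)" "\<alpha> \<noteq> \<beta>"
    and h: "\<And>i. i \<in> I \<Longrightarrow> \<exists>hi. h i = Par \<beta> J hi \<and> (\<forall>j\<in>J. hi j = f i j)"
    and g: "\<And>j. j \<in> J \<Longrightarrow> \<exists>gj. g j = Par \<alpha> I gj \<and> (\<forall>i\<in>I. gj i = f i j)"
  shows "peq lt S (Par \<alpha> I h) (Par \<beta> J g)"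
proof -
  have k: "knd S \<alpha> = Some True" "I = idx S \<alpha>" "knd S \<beta> = Some True" "J = idx S \<beta>"
    using assms(1,2) by auto
  have h': "peq lt (nxt S \<alpha> i) (h i) (Par \<beta> J (f i))" if i: "i \<in> I" for i
  proof -
    obtain hi where hi: "h i = Par \<beta> J hi" "\<forall>j\<in>J. hi j = f i j" using h[OF i] by blast
    show ?thesis using assms(1) i unfolding hi(1) ty_simps(2) by (intro pe_ext) (auto simp: hi simp del: ty_simps(2) simp flip: hi(1))
  qed
  have g': "peq lt (nxt S \<beta> j) (g j) (Par \<alpha> I (\<lambda>i. f i j))" if j: "j \<in> J" for j
  proof -
    obtain hi where hi: "g j = Par \<alpha> I hi" "\<forall>i\<in>I. hi i = f i j" using g[OF j] by blast
    show ?thesis using assms(2) j unfolding hi(1) ty_simps(2) by (intro pe_ext) (auto simp: hi simp del: ty_simps(2) simp flip: hi(1))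
  qed
  have tf: "ty lt (nxt (nxt S \<alpha> i) \<beta> j) (f i j)" if "i \<in> I" "j \<in> J" for i j
    using peq_ty2[OF h'[OF that(1)]] that(2) by auto
  show ?thesis
    by (rule pe_trans[OF pe_Par[OF k(1,2) h'] pe_trans[OF pe_PP[OF assms(3) k(1,3,2,4) tf] pe_sym[OF pe_Par[OF k(3,4) g']]]])
qed

lemma conv_PS:
  assumes "ty lt S (Par \<alpha> I h)" "ty lt S (Sel \<beta> k (Par \<alpha> I g))" "\<alpha> \<noteq> \<beta>"
    and h: "\<And>i. i \<in> I \<Longrightarrow> h i = Sel \<beta> k (g i)"
  shows "peq lt S (Par \<alpha> I h) (Sel \<beta> k (Par \<alpha> I g))"
proof -
  have k: "knd S \<alpha> = Some True" "I = idx S \<alpha>" "knd S \<beta> = Some False" "k \<in> idx S \<beta>"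
    using assms(1,2) by auto
  have "peq lt S (Par \<alpha> I h) (Par \<alpha> I (\<lambda>i. Sel \<beta> k (g i)))"
    using assms(1) h by (rule pe_ext)
  moreover have "peq lt S (Par \<alpha> I (\<lambda>i. Sel \<beta> k (g i))) (Sel \<beta> k (Par \<alpha> I g))"
    using peq_ty2[OF calculation] k by (intro pe_PS[OF assms(3)]) auto
  ultimately show ?thesis by (rule pe_trans)
qed

lemma conv_SS:
  assumes "ty lt S (Sel \<alpha> k (Sel \<beta> l f))" "\<alpha> \<noteq> \<beta>"
  shows "peq lt S (Sel \<alpha> k (Sel \<beta> l f)) (Sel \<beta> l (Sel \<alpha> k f))"
  using assms by (intro pe_SS) auto

subsection \<open>Renaming\<close>

primrec rn :: "('l \<Rightarrow> 'l) \<Rightarrow> (chan \<Rightarrow> chan) \<Rightarrow> 'l nt \<Rightarrow> 'l nt" where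
  "rn r \<pi> (Leaf a) = Leaf (r a)"
| "rn r \<pi> (Par \<alpha> I h) = Par (\<pi> \<alpha>) I (\<lambda>i. rn r \<pi> (h i))"
| "rn r \<pi> (Sel \<alpha> k f) = Sel (\<pi> \<alpha>) k (rn r \<pi> f)"

definition rsq :: "(chan \<Rightarrow> chan) \<Rightarrow> 'o sq \<Rightarrow> 'o sq" where
  "rsq \<pi> S = S \<circ> inv \<pi>"

lemma rsq_simps:
  assumes "bij \<pi>"
  shows "rsq \<pi> S (\<pi> c) = S c" "knd (rsq \<pi> S) (\<pi> c) = knd S c" "idx (rsq \<pi> S) (\<pi> c) = idx S c"
    "nxt (rsq \<pi> S) (\<pi> c) k = rsq \<pi> (nxt S c k)"
proof -
  have i: "inv \<pi> (\<pi> c) = c" for c using assms by (simp add: bij_is_inj)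
  show "rsq \<pi> S (\<pi> c) = S c" "knd (rsq \<pi> S) (\<pi> c) = knd S c" "idx (rsq \<pi> S) (\<pi> c) = idx S c"
    by (auto simp: rsq_def knd_def idx_def i)
  have "inv \<pi> x = c \<longleftrightarrow> x = \<pi> c" for x using assms by (metis bij_inv_eq_iff)
  then show "nxt (rsq \<pi> S) (\<pi> c) k = rsq \<pi> (nxt S c k)"
    by (auto simp: rsq_def nxt_def i fun_eq_iff split: option.splits)
qed

lemma rsq_eqI: "bij \<pi> \<Longrightarrow> (\<And>c. T (\<pi> c) = S c) \<Longrightarrow> rsq \<pi> S = T"
proof
  fix c assume b: "bij \<pi>" and e: "\<And>c. T (\<pi> c) = S c"
  have "c = \<pi> (inv \<pi> c)" using b by (simp add: bij_is_surj surj_f_inv_f)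
  then show "rsq \<pi> S c = T c" using e[of "inv \<pi> c"] by (simp add: rsq_def)
qed

lemma rsq_cs:
  assumes "bij \<pi>" "cc s \<gamma> S1 S2"
  shows "rsq \<pi> (cs \<gamma> S1 S2) = cs (\<pi> \<gamma>) (rsq \<pi> S1) (rsq \<pi> S2)" "cc s (\<pi> \<gamma>) (rsq \<pi> S1) (rsq \<pi> S2)"
proof -
  have inj: "\<pi> c = \<pi> d \<longleftrightarrow> c = d" for c d using assms(1) by (simp add: bij_def inj_eq)
  show "rsq \<pi> (cs \<gamma> S1 S2) = cs (\<pi> \<gamma>) (rsq \<pi> S1) (rsq \<pi> S2)"
    by (rule rsq_eqI[OF assms(1)]) (simp add: cs_def inj rsq_simps[OF assms(1)] split: option.split)
  have "c \<in> dom (rsq \<pi> S1) \<inter> dom (rsq \<pi> S2) \<longleftrightarrow> c = \<pi> \<gamma>" for c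
  proof -
    obtain d where d: "c = \<pi> d" using assms(1) by (metis bij_pointE)
    have "d \<in> dom S1 \<inter> dom S2 \<longleftrightarrow> d = \<gamma>" using assms(2) by (simp add: cc_def)
    then show ?thesis unfolding d inj by (simp add: domIff rsq_simps(1)[OF assms(1)])
  qed
  then show "cc s (\<pi> \<gamma>) (rsq \<pi> S1) (rsq \<pi> S2)"
    using assms(2) unfolding cc_def rsq_simps(1)[OF assms(1)] by auto
qed

context symmetric_polycategory
begin

abbreviation "cutA \<equiv> \<lambda>\<gamma>. cut (Comp A \<gamma>) \<gamma>"
abbreviation "rnA \<equiv> \<lambda>\<pi>. rn (Ren A \<pi>) \<pi>"
abbreviation "nfA \<equiv> nf (Comp A)"

lemma nfA_ty: "derives A \<Gamma> \<Delta> s \<Longrightarrow> ty (rl A) (sqn \<Gamma> \<Delta>) (nfA s)"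
  by (rule nf_ty[of _ _ s "\<lambda>x. x" s]) (auto simp: tm.map_ident rl_def atomic_rl opok_rl)

lemma mseq_Ren:
  assumes "f \<in> Mor A" "bij \<pi>"
  shows "mseq A (Ren A \<pi> f) = rsq \<pi> (mseq A f)"
  by (rule rsq_eqI[OF assms(2), symmetric]) (simp add: mseq_def sqn_def Dom_Ren[OF assms] Cod_Ren[OF assms] split: option.split)

lemma rn_ty: "ty (rl A) S n \<Longrightarrow> bij \<pi> \<Longrightarrow> ty (rl A) (rsq \<pi> S) (rnA \<pi> n)"
  by (induction rule: ty.induct) (auto simp: rl_def rsq_simps mseq_Ren Ren_Mor)

text \<open>Stated as a conversion because of junk: outside the index sets a cut may produce the
  default leaf, which renaming may change.\<close>

lemma rn_cut:
  assumes "cc True \<gamma> S1 S2" "ty (rl A) S1 f" "ty (rl A) S2 g" "bij \<pi>"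
  shows "peq (rl A) (rsq \<pi> (cs \<gamma> S1 S2)) (cutA (\<pi> \<gamma>) (rnA \<pi> f) (rnA \<pi> g)) (rnA \<pi> (cutA \<gamma> f g))"
  using atomic_rl assms(1-3)
proof (induction rule: cut_induct)
  case (ParL S1 S2 \<alpha> F g)
  have "\<pi> \<alpha> \<noteq> \<pi> \<gamma>" using ParL(4) assms(4) by (simp add: bij_def inj_eq)
  then show ?case using ParL cc_left[OF ParL(1,5,4)] by (auto simp: rsq_simps[OF assms(4)] intro!: pe_Par)
next
  case (SelL S1 S2 \<alpha> k f g)
  have "\<pi> \<alpha> \<noteq> \<pi> \<gamma>" using SelL(4) assms(4) by (simp add: bij_def inj_eq)
  then show ?case using SelL cc_left[OF SelL(1,5,4)] by (auto simp: rsq_simps[OF assms(4)] intro!: pe_Sel)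
next
  case (ParR S1 S2 f \<beta> G)
  have "\<pi> \<beta> \<noteq> \<pi> \<gamma>" using ParR(5) assms(4) by (simp add: bij_def inj_eq)
  moreover have "blocked (\<pi> \<gamma>) (rnA \<pi> f)" using ParR(4) by (cases f) auto
  ultimately show ?case using ParR cc_right[OF ParR(1,6,5)] by (auto simp: rsq_simps[OF assms(4)] intro!: pe_Par)
next
  case (SelR S1 S2 f \<beta> k g)
  have "\<pi> \<beta> \<noteq> \<pi> \<gamma>" using SelR(5) assms(4) by (simp add: bij_def inj_eq)
  moreover have "blocked (\<pi> \<gamma>) (rnA \<pi> f)" using SelR(4) by (cases f) auto
  ultimately show ?case using SelR cc_right[OF SelR(1,6,5)] by (auto simp: rsq_simps[OF assms(4)] intro!: pe_Sel)
next
  case (LeafLeaf S1 S2 a b)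
  have c: "composable A \<gamma> a b" using LeafLeaf cc_composable by (auto simp: rl_def)
  have "ty (rl A) (cs \<gamma> S1 S2) (Leaf (Comp A \<gamma> a b))"
    using c mseq_Comp Comp_Mor LeafLeaf by (auto simp: rl_def)
  then have "ty (rl A) (rsq \<pi> (cs \<gamma> S1 S2)) (rnA \<pi> (Leaf (Comp A \<gamma> a b)))"
    by (rule rn_ty[OF _ assms(4)])
  then show ?case using Ren_Comp[OF c assms(4)] by (simp add: pe_refl)
next
  case (SelPar S1 S2 k f G)
  then show ?case using cc_main[OF SelPar(1)] by simp
next
  case (ParSel S1 S2 k F g)
  then show ?case using cc_main[OF ParSel(1)] by simp
qed

lemma nf_rename:
  assumes "derives A \<Gamma> \<Delta> s" "bij \<pi>"
  shows "peq (rl A) (rsq \<pi> (sqn \<Gamma> \<Delta>)) (nfA (rename A \<pi> s)) (rnA \<pi> (nfA s))"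
  using assms(1)
proof (induction rule: derives.induct)
  case (derives_Ax f)
  then have "ty (rl A) (mseq A f) (Leaf f)" by (simp add: rl_def)
  from rn_ty[OF this assms(2)] show ?case by (simp add: mseq_def pe_refl)
next
  case (derives_Cotuple \<alpha> \<Gamma> Xs \<Delta> F)
  have "peq (rl A) (rsq \<pi> ((sqn \<Gamma> \<Delta>)(\<alpha> \<mapsto> (False, the (fmlookup Xs i)))))
      (the (fmlookup (fmmap nfA (fmmap (rename A \<pi>) F)) i)) (rnA \<pi> (the (fmlookup (fmmap nfA F) i)))"
    if i: "i \<in> fmdom' Xs" for i
  proof -
    obtain X f where X: "fmlookup Xs i = Some X" "fmlookup F i = Some f"
      by (rule fmdom'_eqE[OF i derives_Cotuple.hyps(3)])
    show ?thesis unfolding fmlookup_map X option.map option.sel by (rule derives_Cotuple.IH[OF X, unfolded sqn_updL])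
  qed
  then show ?case unfolding sqn_updL rename.simps nf.simps rn.simps fmdom'_map derives_Cotuple.hyps(3)
    by (intro pe_Par) (simp_all add: rsq_simps[OF assms(2)])
next
  case (derives_Tuple \<alpha> \<Delta> \<Gamma> Xs F)
  note a = sqn_updR[OF wf_updR[OF derives_Tuple.hyps(2)]]
  have "peq (rl A) (rsq \<pi> ((sqn \<Gamma> \<Delta>)(\<alpha> \<mapsto> (True, the (fmlookup Xs i)))))
      (the (fmlookup (fmmap nfA (fmmap (rename A \<pi>) F)) i)) (rnA \<pi> (the (fmlookup (fmmap nfA F) i)))"
    if i: "i \<in> fmdom' Xs" for i
  proof -
    obtain X f where X: "fmlookup Xs i = Some X" "fmlookup F i = Some f"
      by (rule fmdom'_eqE[OF i derives_Tuple.hyps(3)])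
    show ?thesis unfolding fmlookup_map X option.map option.sel by (rule derives_Tuple.IH[OF X, unfolded a])
  qed
  then show ?case unfolding a rename.simps nf.simps rn.simps fmdom'_map derives_Tuple.hyps(3)
    by (intro pe_Par) (simp_all add: rsq_simps[OF assms(2)])
next
  case (derives_Project \<alpha> \<Gamma> Xs \<Delta> k X f)
  then show ?case unfolding sqn_updL rename.simps nf.simps rn.simps
    by (intro pe_Sel) (simp_all add: rsq_simps[OF assms(2)] fmlookup_dom'_iff)
next
  case (derives_Inject \<alpha> \<Delta> \<Gamma> Xs k X f)
  then show ?case unfolding sqn_updR[OF wf_updR[OF derives_Inject.hyps(2)]] rename.simps nf.simps rn.simps
    by (intro pe_Sel) (simp_all add: rsq_simps[OF assms(2)] fmlookup_dom'_iff)
next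
  case (derives_Cut \<gamma> \<Gamma> \<Delta> \<Gamma>' \<Delta>' Z f g)
  note w = sqn_cut[OF derives_wf[OF derives_Cut(4)] derives_wf[OF derives_Cut(5)] derives_Cut(1-3)]
  have "peq (rl A) (rsq \<pi> (cs \<gamma> (sqn \<Gamma> (fmupd \<gamma> Z \<Delta>)) (sqn (fmupd \<gamma> Z \<Gamma>') \<Delta>')))
     (cutA (\<pi> \<gamma>) (nfA (rename A \<pi> f)) (nfA (rename A \<pi> g))) (cutA (\<pi> \<gamma>) (rnA \<pi> (nfA f)) (rnA \<pi> (nfA g)))"
    unfolding rsq_cs(1)[OF assms(2) w(1)]
    by (rule cut_cong[OF atomic_rl opok_rl derives_Cut.IH rsq_cs(2)[OF assms(2) w(1)]])
  from pe_trans[OF this rn_cut[OF w(1) nfA_ty[OF derives_Cut(4)] nfA_ty[OF derives_Cut(5)] assms(2)]]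
  show ?case unfolding w(2) by simp
qed

text \<open>The cut channel carries an atom, so no rule of the term acts on it, nor on
  \<open>\<beta>\<close>, which is absent. The identity therefore travels unchanged to every leaf,
  where it only renames the channel.\<close>

lemma cut_Ident_right:
  assumes "ty (rl A) S n" "S \<gamma> = Some (True, Atom Z)" "\<beta> \<notin> dom S" "Z \<in> Obj A" "\<gamma> \<noteq> \<beta>"
  shows "peq (rl A) (rsq (transpose \<gamma> \<beta>) S) (cutA \<gamma> n (Leaf (Ident A Z \<gamma> \<beta>))) (rnA (transpose \<gamma> \<beta>) n)"
  using assms(1-3)
proof (induction rule: ty.induct)
  case (ty_Leaf S f)
  have f: "f \<in> Mor A" "S = mseq A f" using ty_Leaf by (auto simp: rl_def)
  have m: "Ident A Z \<gamma> \<beta> \<in> Mor A" "chans A (Ident A Z \<gamma> \<beta>) = {\<gamma>, \<beta>}"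
    using assms(4,5) by (auto simp: Ident_Mor chans_def Dom_Ident Cod_Ident)
  have "composable A \<gamma> f (Ident A Z \<gamma> \<beta>)"
  proof -
    have "chans A f = dom S" using mseq_iff(3)[OF f(1)] f(2) by auto
    moreover have "\<gamma> \<in> dom S" using ty_Leaf.prems(1) by auto
    moreover have "fmlookup (Cod A f) \<gamma> = Some Z" using ty_Leaf.prems(1) mseq_iff(2)[OF f(1)] f(2) by simp
    ultimately show ?thesis
      unfolding composable_def m(2) using ty_Leaf.prems(2) m(1) f(1) assms(4,5) by (auto simp: Dom_Ident)
  qed
  then show ?case using rn_ty[OF ty.ty_Leaf[of "rl A", OF ty_Leaf.hyps], of "transpose \<gamma> \<beta>"]
    by (simp add: Comp_Ident assms(4,5) pe_refl)
next
  case (ty_Par S \<alpha> I h)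
  have a: "\<alpha> \<noteq> \<gamma>" "\<alpha> \<noteq> \<beta>" using ty_Par.hyps(1) ty_Par.prems knd_dom[OF ty_Par.hyps(1)] by (auto simp: knd_def)
  then have t: "transpose \<gamma> \<beta> \<alpha> = \<alpha>" by simp
  have n: "nxt S \<alpha> i \<gamma> = Some (True, Atom Z)" for i using a(1) ty_Par.prems by (auto simp: nxt_def split: option.splits)
  note r = rsq_simps[of "transpose \<gamma> \<beta>" _ \<alpha>, unfolded t]
  show ?case using a ty_Par n by (auto simp: r t intro!: pe_Par)
next
  case (ty_Sel S \<alpha> k f)
  have a: "\<alpha> \<noteq> \<gamma>" "\<alpha> \<noteq> \<beta>" using ty_Sel.hyps(1) ty_Sel.prems knd_dom[OF ty_Sel.hyps(1)] by (auto simp: knd_def)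
  then have t: "transpose \<gamma> \<beta> \<alpha> = \<alpha>" by simp
  have n: "nxt S \<alpha> i \<gamma> = Some (True, Atom Z)" for i using a(1) ty_Sel.prems by (auto simp: nxt_def split: option.splits)
  note r = rsq_simps[of "transpose \<gamma> \<beta>" _ \<alpha>, unfolded t]
  show ?case using a ty_Sel n by (auto simp: r t intro!: pe_Sel)
qed

lemma cut_Ident_left:
  assumes "ty (rl A) S n" "S \<gamma> = Some (False, Atom Z)" "\<alpha> \<notin> dom S" "Z \<in> Obj A" "\<alpha> \<noteq> \<gamma>"
  shows "peq (rl A) (rsq (transpose \<alpha> \<gamma>) S) (cutA \<gamma> (Leaf (Ident A Z \<alpha> \<gamma>)) n) (rnA (transpose \<alpha> \<gamma>) n)"
  using assms(1-3)
proof (induction rule: ty.induct)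
  case (ty_Leaf S f)
  have f: "f \<in> Mor A" "S = mseq A f" using ty_Leaf by (auto simp: rl_def)
  have m: "Ident A Z \<alpha> \<gamma> \<in> Mor A" "chans A (Ident A Z \<alpha> \<gamma>) = {\<alpha>, \<gamma>}"
    using assms(4,5) by (auto simp: Ident_Mor chans_def Dom_Ident Cod_Ident)
  have "composable A \<gamma> (Ident A Z \<alpha> \<gamma>) f"
  proof -
    have "chans A f = dom S" using mseq_iff(3)[OF f(1)] f(2) by auto
    moreover have "\<gamma> \<in> dom S" using ty_Leaf.prems(1) by auto
    moreover have "fmlookup (Dom A f) \<gamma> = Some Z" using ty_Leaf.prems(1) mseq_iff(1)[OF f(1)] f(2) by simp
    ultimately show ?thesis
      unfolding composable_def m(2) using ty_Leaf.prems(2) m(1) f(1) assms(4,5) by (auto simp: Cod_Ident)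
  qed
  then show ?case using rn_ty[OF ty.ty_Leaf[of "rl A", OF ty_Leaf.hyps], of "transpose \<alpha> \<gamma>"]
    by (simp add: Ident_Comp assms(4,5) pe_refl)
next
  case (ty_Par S \<beta> I h)
  have a: "\<beta> \<noteq> \<gamma>" "\<beta> \<noteq> \<alpha>" using ty_Par.hyps(1) ty_Par.prems knd_dom[OF ty_Par.hyps(1)] by (auto simp: knd_def)
  then have t: "transpose \<alpha> \<gamma> \<beta> = \<beta>" by simp
  have n: "nxt S \<beta> i \<gamma> = Some (False, Atom Z)" for i using a(1) ty_Par.prems by (auto simp: nxt_def split: option.splits)
  note r = rsq_simps[of "transpose \<alpha> \<gamma>" _ \<beta>, unfolded t]
  show ?case using a ty_Par n by (auto simp: r t intro!: pe_Par)
next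
  case (ty_Sel S \<beta> k f)
  have a: "\<beta> \<noteq> \<gamma>" "\<beta> \<noteq> \<alpha>" using ty_Sel.hyps(1) ty_Sel.prems knd_dom[OF ty_Sel.hyps(1)] by (auto simp: knd_def)
  then have t: "transpose \<alpha> \<gamma> \<beta> = \<beta>" by simp
  have n: "nxt S \<beta> i \<gamma> = Some (False, Atom Z)" for i using a(1) ty_Sel.prems by (auto simp: nxt_def split: option.splits)
  note r = rsq_simps[of "transpose \<alpha> \<gamma>" _ \<beta>, unfolded t]
  show ?case using a ty_Sel n by (auto simp: r t intro!: pe_Sel)
qed

end

section \<open>Equivalent derivations have convertible normal forms\<close>

context symmetric_polycategory
begin

lemma equivalent_derives: "equivalent A \<Gamma> \<Delta> s t \<Longrightarrow> derives A \<Gamma> \<Delta> s \<and> derives A \<Gamma> \<Delta> t"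
proof (induction rule: equivalent.induct)
  case (eq_Cotuple \<alpha> \<Gamma> Xs \<Delta> F G)
  show ?case
  proof (intro conjI derives_Cotuple eq_Cotuple.hyps)
    fix i X f assume i: "fmlookup Xs i = Some X" "fmlookup F i = Some f"
    then obtain g where "fmlookup G i = Some g" using eq_Cotuple.hyps(3,4) by (metis fmdom'I fmdom'_eqE)
    with i show "derives A (fmupd \<alpha> X \<Gamma>) \<Delta> f" using eq_Cotuple.IH by blast
  next
    fix i X g assume i: "fmlookup Xs i = Some X" "fmlookup G i = Some g"
    then obtain f where "fmlookup F i = Some f" using eq_Cotuple.hyps(3,4) by (metis fmdom'I fmdom'_eqE)
    with i show "derives A (fmupd \<alpha> X \<Gamma>) \<Delta> g" using eq_Cotuple.IH by blast
  qed
next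
  case (eq_Tuple \<alpha> \<Delta> \<Gamma> Xs F G)
  show ?case
  proof (intro conjI derives_Tuple eq_Tuple.hyps)
    fix i X f assume i: "fmlookup Xs i = Some X" "fmlookup F i = Some f"
    then obtain g where "fmlookup G i = Some g" using eq_Tuple.hyps(3,4) by (metis fmdom'I fmdom'_eqE)
    with i show "derives A \<Gamma> (fmupd \<alpha> X \<Delta>) f" using eq_Tuple.IH by blast
  next
    fix i X g assume i: "fmlookup Xs i = Some X" "fmlookup G i = Some g"
    then obtain f where "fmlookup F i = Some f" using eq_Tuple.hyps(3,4) by (metis fmdom'I fmdom'_eqE)
    with i show "derives A \<Gamma> (fmupd \<alpha> X \<Delta>) g" using eq_Tuple.IH by blast
  qed
next
  case (eq_Project \<alpha> \<Gamma> Xs \<Delta> k X f g)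
  then show ?case by (simp add: derives_Project)
next
  case (eq_Inject \<alpha> \<Delta> \<Gamma> Xs k X f g)
  then show ?case by (simp add: derives_Inject)
next
  case (eq_Cut \<gamma> \<Gamma> \<Delta> \<Gamma>' \<Delta>' Z f f' g g')
  then show ?case by (blast intro: derives.derives_Cut)
qed auto

lemma derives_Ident:
  assumes "derives A \<Gamma> \<Delta> (Ax (Ident A Z \<alpha> \<beta>))" "Z \<in> Obj A" "\<alpha> \<noteq> \<beta>"
  shows "sqn \<Gamma> \<Delta> c = (if c = \<alpha> then Some (False, Atom Z) else if c = \<beta> then Some (True, Atom Z) else None)"
  using assms(1)
proof cases
  case derives_Ax
  then show ?thesis using assms(2,3) by (simp add: sqn_def Dom_Ident Cod_Ident)
qed

text \<open>Rewrites on the left premise and the principal ones (11), (12) are defining equations of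
  \<open>cut\<close>, up to junk in (3) and (9). Rewrites on the right premise are
  \<open>cut_push_Par\<close> and \<open>cut_push_Sel\<close>. For (1) and (2), cutting with an
  identity and renaming the derivation are both compared with the renamed normal form.\<close>

lemma rewrite_peq:
  assumes "rewrite A s t" and d: "derives A \<Gamma> \<Delta> s" "derives A \<Gamma> \<Delta> t"
  shows "peq (rl A) (sqn \<Gamma> \<Delta>) (nfA s) (nfA t)"
  using assms(1)
proof cases
  case (essential f \<gamma> g)
  then show ?thesis using nfA_ty[OF d(2)] by (simp add: pe_refl)
next
  case (rw1 Z \<gamma> \<beta> f)
  from d(1)[unfolded rw1(1)] obtain \<Gamma>1 \<Delta>1 \<Gamma>2 \<Delta>2 where
    f: "derives A \<Gamma>1 \<Delta>1 f" and I: "derives A \<Gamma>2 \<Delta>2 (Ax (Ident A Z \<gamma> \<beta>))" and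
    c: "cc True \<gamma> (sqn \<Gamma>1 \<Delta>1) (sqn \<Gamma>2 \<Delta>2)" "sqn \<Gamma> \<Delta> = cs \<gamma> (sqn \<Gamma>1 \<Delta>1) (sqn \<Gamma>2 \<Delta>2)"
    by (rule derives_CutD)
  note S2 = derives_Ident[OF I rw1(3,4)]
  have S1: "sqn \<Gamma>1 \<Delta>1 \<gamma> = Some (True, Atom Z)" using c(1) by (simp add: cc_def S2)
  have b: "sqn \<Gamma>1 \<Delta>1 \<beta> = None"
  proof -
    have "\<beta> \<in> dom (sqn \<Gamma>2 \<Delta>2)" using rw1(4) by (simp add: domIff S2)
    then have "\<beta> \<notin> dom (sqn \<Gamma>1 \<Delta>1)" using c(1)[unfolded cc_def, THEN conjunct1] rw1(4)[symmetric] by blast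
    then show ?thesis by (simp only: domIff not_not)
  qed
  have r: "rsq (transpose \<gamma> \<beta>) (sqn \<Gamma>1 \<Delta>1) = sqn \<Gamma> \<Delta>"
  proof (rule rsq_eqI)
    fix c show "sqn \<Gamma> \<Delta> (transpose \<gamma> \<beta> c) = sqn \<Gamma>1 \<Delta>1 c"
      unfolding c(2) cs_def S2 using S1 b rw1(4)
      by (cases "c = \<gamma>"; cases "c = \<beta>") (auto split: option.split)
  qed simp
  have "peq (rl A) (sqn \<Gamma> \<Delta>) (nfA s) (rnA (transpose \<gamma> \<beta>) (nfA f))"
    using cut_Ident_right[OF nfA_ty[OF f] S1 _ rw1(3,4)] b unfolding r rw1(1) by (simp add: domIff)
  moreover have "peq (rl A) (sqn \<Gamma> \<Delta>) (nfA t) (rnA (transpose \<gamma> \<beta>) (nfA f))"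
    using nf_rename[OF f, of "transpose \<gamma> \<beta>"] unfolding r rw1(2) by simp
  ultimately show ?thesis by (rule pe_trans[OF _ pe_sym])
next
  case (rw2 Z \<alpha> \<gamma> f)
  from d(1)[unfolded rw2(1)] obtain \<Gamma>1 \<Delta>1 \<Gamma>2 \<Delta>2 where
    I: "derives A \<Gamma>1 \<Delta>1 (Ax (Ident A Z \<alpha> \<gamma>))" and f: "derives A \<Gamma>2 \<Delta>2 f" and
    c: "cc True \<gamma> (sqn \<Gamma>1 \<Delta>1) (sqn \<Gamma>2 \<Delta>2)" "sqn \<Gamma> \<Delta> = cs \<gamma> (sqn \<Gamma>1 \<Delta>1) (sqn \<Gamma>2 \<Delta>2)"
    by (rule derives_CutD)
  note S2 = derives_Ident[OF I rw2(3,4)]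
  have S1: "sqn \<Gamma>2 \<Delta>2 \<gamma> = Some (False, Atom Z)" using c(1) rw2(4) by (auto simp: cc_def S2)
  have b: "sqn \<Gamma>2 \<Delta>2 \<alpha> = None"
  proof -
    have "\<alpha> \<in> dom (sqn \<Gamma>1 \<Delta>1)" using rw2(4) by (simp add: domIff S2)
    then have "\<alpha> \<notin> dom (sqn \<Gamma>2 \<Delta>2)" using c(1)[unfolded cc_def, THEN conjunct1] rw2(4) by blast
    then show ?thesis by (simp only: domIff not_not)
  qed
  have r: "rsq (transpose \<alpha> \<gamma>) (sqn \<Gamma>2 \<Delta>2) = sqn \<Gamma> \<Delta>"
  proof (rule rsq_eqI)
    fix c show "sqn \<Gamma> \<Delta> (transpose \<alpha> \<gamma> c) = sqn \<Gamma>2 \<Delta>2 c"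
      unfolding c(2) cs_def S2 using S1 b rw2(4)
      by (cases "c = \<gamma>"; cases "c = \<alpha>") (auto split: option.split)
  qed simp
  have "peq (rl A) (sqn \<Gamma> \<Delta>) (nfA s) (rnA (transpose \<alpha> \<gamma>) (nfA f))"
    using cut_Ident_left[OF nfA_ty[OF f] S1 _ rw2(3,4)] b unfolding r rw2(1) by (simp add: domIff)
  moreover have "peq (rl A) (sqn \<Gamma> \<Delta>) (nfA t) (rnA (transpose \<alpha> \<gamma>) (nfA f))"
    using nf_rename[OF f, of "transpose \<alpha> \<gamma>"] unfolding r rw2(2) by simp
  ultimately show ?thesis by (rule pe_trans[OF _ pe_sym])
next
  case (rw3 \<alpha> \<gamma> F g)
  have T: "ty (rl A) (sqn \<Gamma> \<Delta>) (Par \<alpha> (fmdom' F) (\<lambda>i. cutA \<gamma> (the (fmlookup (fmmap nfA F) i)) (nfA g)))"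
    using nfA_ty[OF d(1)] rw3(3) unfolding rw3(1) by (simp del: ty_simps)
  have "peq (rl A) (sqn \<Gamma> \<Delta>) (Par \<alpha> (fmdom' F) (\<lambda>i. cutA \<gamma> (the (fmlookup (fmmap nfA F) i)) (nfA g))) (nfA t)"
    unfolding rw3(2) nf.simps fmdom'_map by (rule pe_ext[OF T]) (auto simp: fmlookup_dom'_iff)
  then show ?thesis using rw3(3) unfolding rw3(1) by simp
next
  case (rw9 \<alpha> \<gamma> F g)
  have T: "ty (rl A) (sqn \<Gamma> \<Delta>) (Par \<alpha> (fmdom' F) (\<lambda>i. cutA \<gamma> (the (fmlookup (fmmap nfA F) i)) (nfA g)))"
    using nfA_ty[OF d(1)] rw9(3) unfolding rw9(1) by (simp del: ty_simps)
  have "peq (rl A) (sqn \<Gamma> \<Delta>) (Par \<alpha> (fmdom' F) (\<lambda>i. cutA \<gamma> (the (fmlookup (fmmap nfA F) i)) (nfA g))) (nfA t)"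
    unfolding rw9(2) nf.simps fmdom'_map by (rule pe_ext[OF T]) (auto simp: fmlookup_dom'_iff)
  then show ?thesis using rw9(3) unfolding rw9(1) by simp
next
  case (rw5 \<alpha> \<gamma> k f g)
  then show ?thesis using nfA_ty[OF d(2)] by (simp add: pe_refl del: ty_simps)
next
  case (rw7 \<alpha> \<gamma> k f g)
  then show ?thesis using nfA_ty[OF d(2)] by (simp add: pe_refl del: ty_simps)
next
  case (rw4 \<beta> \<gamma> f G)
  from d(1)[unfolded rw4(1)] obtain \<Gamma>1 \<Delta>1 \<Gamma>2 \<Delta>2 where
    f: "derives A \<Gamma>1 \<Delta>1 f" and g: "derives A \<Gamma>2 \<Delta>2 (Tuple \<beta> G)" and
    c: "cc True \<gamma> (sqn \<Gamma>1 \<Delta>1) (sqn \<Gamma>2 \<Delta>2)" "sqn \<Gamma> \<Delta> = cs \<gamma> (sqn \<Gamma>1 \<Delta>1) (sqn \<Gamma>2 \<Delta>2)"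
    by (rule derives_CutD)
  have 1: "peq (rl A) (sqn \<Gamma> \<Delta>) (nfA s) (Par \<beta> (fmdom' G) (\<lambda>i. cutA \<gamma> (nfA f) (the (fmlookup (fmmap nfA G) i))))"
    using cut_push_Par[OF atomic_rl opok_rl nfA_ty[OF f] c(1) nfA_ty[OF g, unfolded nf.simps] rw4(3)]
    unfolding c(2) rw4(1) by simp
  have "peq (rl A) (sqn \<Gamma> \<Delta>) (Par \<beta> (fmdom' G) (\<lambda>i. cutA \<gamma> (nfA f) (the (fmlookup (fmmap nfA G) i)))) (nfA t)"
    unfolding rw4(2) nf.simps fmdom'_map
    by (rule pe_ext[OF peq_ty2[OF 1]]) (auto simp: fmlookup_dom'_iff)
  with 1 show ?thesis by (rule pe_trans)
next
  case (rw10 \<beta> \<gamma> f G)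
  from d(1)[unfolded rw10(1)] obtain \<Gamma>1 \<Delta>1 \<Gamma>2 \<Delta>2 where
    f: "derives A \<Gamma>1 \<Delta>1 f" and g: "derives A \<Gamma>2 \<Delta>2 (Cotuple \<beta> G)" and
    c: "cc True \<gamma> (sqn \<Gamma>1 \<Delta>1) (sqn \<Gamma>2 \<Delta>2)" "sqn \<Gamma> \<Delta> = cs \<gamma> (sqn \<Gamma>1 \<Delta>1) (sqn \<Gamma>2 \<Delta>2)"
    by (rule derives_CutD)
  have 1: "peq (rl A) (sqn \<Gamma> \<Delta>) (nfA s) (Par \<beta> (fmdom' G) (\<lambda>i. cutA \<gamma> (nfA f) (the (fmlookup (fmmap nfA G) i))))"
    using cut_push_Par[OF atomic_rl opok_rl nfA_ty[OF f] c(1) nfA_ty[OF g, unfolded nf.simps] rw10(3)]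
    unfolding c(2) rw10(1) by simp
  have "peq (rl A) (sqn \<Gamma> \<Delta>) (Par \<beta> (fmdom' G) (\<lambda>i. cutA \<gamma> (nfA f) (the (fmlookup (fmmap nfA G) i)))) (nfA t)"
    unfolding rw10(2) nf.simps fmdom'_map
    by (rule pe_ext[OF peq_ty2[OF 1]]) (auto simp: fmlookup_dom'_iff)
  with 1 show ?thesis by (rule pe_trans)
next
  case (rw6 \<beta> \<gamma> f k g)
  from d(1)[unfolded rw6(1)] obtain \<Gamma>1 \<Delta>1 \<Gamma>2 \<Delta>2 where
    f: "derives A \<Gamma>1 \<Delta>1 f" and g: "derives A \<Gamma>2 \<Delta>2 (Project \<beta> k g)" and
    c: "cc True \<gamma> (sqn \<Gamma>1 \<Delta>1) (sqn \<Gamma>2 \<Delta>2)" "sqn \<Gamma> \<Delta> = cs \<gamma> (sqn \<Gamma>1 \<Delta>1) (sqn \<Gamma>2 \<Delta>2)"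
    by (rule derives_CutD)
  show ?thesis
    using cut_push_Sel[OF atomic_rl opok_rl nfA_ty[OF f] c(1) nfA_ty[OF g, unfolded nf.simps] rw6(3)]
    unfolding c(2) rw6(1,2) by simp
next
  case (rw8 \<beta> \<gamma> f k g)
  from d(1)[unfolded rw8(1)] obtain \<Gamma>1 \<Delta>1 \<Gamma>2 \<Delta>2 where
    f: "derives A \<Gamma>1 \<Delta>1 f" and g: "derives A \<Gamma>2 \<Delta>2 (Inject \<beta> k g)" and
    c: "cc True \<gamma> (sqn \<Gamma>1 \<Delta>1) (sqn \<Gamma>2 \<Delta>2)" "sqn \<Gamma> \<Delta> = cs \<gamma> (sqn \<Gamma>1 \<Delta>1) (sqn \<Gamma>2 \<Delta>2)"
    by (rule derives_CutD)
  show ?thesis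
    using cut_push_Sel[OF atomic_rl opok_rl nfA_ty[OF f] c(1) nfA_ty[OF g, unfolded nf.simps] rw8(3)]
    unfolding c(2) rw8(1,2) by simp
next
  case (rw11 G k g \<gamma> f)
  then show ?thesis using nfA_ty[OF d(2)] by (simp add: pe_refl del: ty_simps)
next
  case (rw12 F k f \<gamma> g)
  then show ?thesis using nfA_ty[OF d(2)] by (simp add: pe_refl del: ty_simps)
qed

lemma fmdom'_fam[simp]: "fmdom' (fam I h) = fset I"
  by (auto simp: fmlookup_dom'_iff fmlookup_fam split: if_splits)

lemma conversion_peq:
  assumes "conversion s t" and d: "derives A \<Gamma> \<Delta> s" "derives A \<Gamma> \<Delta> t"
  shows "peq (rl A) (sqn \<Gamma> \<Delta>) (nfA s) (nfA t)"
proof -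
  note ty = nfA_ty[OF d(1)] nfA_ty[OF d(2)]
  show ?thesis using assms(1)
  proof cases
    case (cv13 \<alpha> \<beta> I J f)
    show ?thesis unfolding cv13(1,2) nf.simps fmdom'_fam
      by (rule conv_PP[where f = "\<lambda>i j. nfA (f i j)", OF ty(1)[unfolded cv13(1) nf.simps fmdom'_fam]
            ty(2)[unfolded cv13(2) nf.simps fmdom'_fam] cv13(3)]) (auto simp: fmlookup_fam)
  next
    case (cv14 \<alpha> \<beta> I J f)
    show ?thesis unfolding cv14(1,2) nf.simps fmdom'_fam
      by (rule conv_PP[where f = "\<lambda>i j. nfA (f i j)", OF ty(1)[unfolded cv14(1) nf.simps fmdom'_fam]
            ty(2)[unfolded cv14(2) nf.simps fmdom'_fam] cv14(3)]) (auto simp: fmlookup_fam)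
  next
    case (cv19 \<alpha> \<beta> I J f)
    show ?thesis unfolding cv19(1,2) nf.simps fmdom'_fam
      by (rule conv_PP[where f = "\<lambda>i j. nfA (f i j)", OF ty(1)[unfolded cv19(1) nf.simps fmdom'_fam]
            ty(2)[unfolded cv19(2) nf.simps fmdom'_fam] cv19(3)]) (auto simp: fmlookup_fam)
  next
    case (cv15 \<alpha> \<beta> k F)
    show ?thesis unfolding cv15(1,2) nf.simps fmdom'_map
      by (rule conv_PS[OF ty(1)[unfolded cv15(1) nf.simps fmdom'_map] ty(2)[unfolded cv15(2) nf.simps] cv15(3)])
        (auto simp: fmlookup_dom'_iff)
  next
    case (cv17 \<alpha> \<beta> k F)
    show ?thesis unfolding cv17(1,2) nf.simps fmdom'_map
      by (rule conv_PS[OF ty(1)[unfolded cv17(1) nf.simps fmdom'_map] ty(2)[unfolded cv17(2) nf.simps] cv17(3)])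
        (auto simp: fmlookup_dom'_iff)
  next
    case (cv16 \<alpha> \<beta> k G)
    show ?thesis unfolding cv16(1,2) nf.simps fmdom'_map
      by (rule pe_sym[OF conv_PS[OF ty(2)[unfolded cv16(2) nf.simps fmdom'_map] ty(1)[unfolded cv16(1) nf.simps] cv16(3)[symmetric]]])
        (auto simp: fmlookup_dom'_iff)
  next
    case (cv18 \<alpha> \<beta> k G)
    show ?thesis unfolding cv18(1,2) nf.simps fmdom'_map
      by (rule pe_sym[OF conv_PS[OF ty(2)[unfolded cv18(2) nf.simps fmdom'_map] ty(1)[unfolded cv18(1) nf.simps] cv18(3)[symmetric]]])
        (auto simp: fmlookup_dom'_iff)
  next
    case (cv20 \<alpha> \<beta> k l f)
    then show ?thesis using conv_SS[OF ty(1)[unfolded cv20(1) nf.simps] cv20(3)] by simp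
  next
    case (cv21 \<alpha> \<beta> k l f)
    then show ?thesis using conv_SS[OF ty(1)[unfolded cv21(1) nf.simps] cv21(3)] by simp
  next
    case (cv22 \<alpha> \<beta> k l f)
    then show ?thesis using conv_SS[OF ty(1)[unfolded cv22(1) nf.simps] cv22(3)] by simp
  qed
qed

lemma equivalent_peq: "equivalent A \<Gamma> \<Delta> s t \<Longrightarrow> peq (rl A) (sqn \<Gamma> \<Delta>) (nfA s) (nfA t)"
proof (induction rule: equivalent.induct)
  case (eq_rewrite s t \<Gamma> \<Delta>)
  then show ?case by (rule rewrite_peq)
next
  case (eq_conversion s t \<Gamma> \<Delta>)
  then show ?case by (rule conversion_peq)
next
  case (eq_refl \<Gamma> \<Delta> s)
  then show ?case by (rule pe_refl[OF nfA_ty])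
next
  case (eq_sym \<Gamma> \<Delta> s t)
  show ?case by (rule pe_sym[OF eq_sym.IH])
next
  case (eq_trans \<Gamma> \<Delta> s t u)
  show ?case by (rule pe_trans[OF eq_trans.IH])
next
  case (eq_Cotuple \<alpha> \<Gamma> Xs \<Delta> F G)
  have "peq (rl A) (nxt ((sqn \<Gamma> \<Delta>)(\<alpha> \<mapsto> (False, Sum Xs))) \<alpha> i)
      (the (fmlookup (fmmap nfA F) i)) (the (fmlookup (fmmap nfA G) i))" if i: "i \<in> fmdom' Xs" for i
  proof -
    obtain X f where X: "fmlookup Xs i = Some X" "fmlookup F i = Some f"
      by (rule fmdom'_eqE[OF i eq_Cotuple.hyps(3)])
    obtain g where g: "fmlookup G i = Some g"
      by (rule fmdom'_eqE[OF i eq_Cotuple.hyps(4)])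
    show ?thesis unfolding fmlookup_map X g option.map option.sel nxt_upd branches.simps
      by (rule eq_Cotuple.IH[OF X g, unfolded sqn_updL])
  qed
  then show ?case unfolding sqn_updL nf.simps eq_Cotuple.hyps(3,4)
    by (intro pe_Par) simp_all
next
  case (eq_Tuple \<alpha> \<Delta> \<Gamma> Xs F G)
  note a = sqn_updR[OF wf_updR[OF eq_Tuple.hyps(2)]]
  have "peq (rl A) (nxt ((sqn \<Gamma> \<Delta>)(\<alpha> \<mapsto> (True, Prod Xs))) \<alpha> i)
      (the (fmlookup (fmmap nfA F) i)) (the (fmlookup (fmmap nfA G) i))" if i: "i \<in> fmdom' Xs" for i
  proof -
    obtain X f where X: "fmlookup Xs i = Some X" "fmlookup F i = Some f"
      by (rule fmdom'_eqE[OF i eq_Tuple.hyps(3)])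
    obtain g where g: "fmlookup G i = Some g"
      by (rule fmdom'_eqE[OF i eq_Tuple.hyps(4)])
    show ?thesis unfolding fmlookup_map X g option.map option.sel nxt_upd branches.simps
      by (rule eq_Tuple.IH[OF X g, unfolded a])
  qed
  then show ?case unfolding a nf.simps eq_Tuple.hyps(3,4)
    by (intro pe_Par) simp_all
next
  case (eq_Project \<alpha> \<Gamma> Xs \<Delta> k X f g)
  then show ?case unfolding sqn_updL nf.simps
    by (intro pe_Sel) (simp_all add: fmlookup_dom'_iff)
next
  case (eq_Inject \<alpha> \<Delta> \<Gamma> Xs k X f g)
  then show ?case unfolding sqn_updR[OF wf_updR[OF eq_Inject.hyps(2)]] nf.simps
    by (intro pe_Sel) (simp_all add: fmlookup_dom'_iff)
next
  case (eq_Cut \<gamma> \<Gamma> \<Delta> \<Gamma>' \<Delta>' Z f f' g g')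
  note d = equivalent_derives[OF eq_Cut(4), THEN conjunct1] equivalent_derives[OF eq_Cut(5), THEN conjunct1]
  note w = sqn_cut[OF derives_wf[OF d(1)] derives_wf[OF d(2)] eq_Cut(1-3)]
  show ?case unfolding w(2) nf.simps by (rule cut_cong[OF atomic_rl opok_rl eq_Cut.IH w(1)])
qed

end

section \<open>Reading cut-free terms back as derivations\<close>

lemma fmmap_fam: "fmmap g (fam I h) = fam I (\<lambda>i. g (h i))"
  by (intro fmap_ext) (simp add: fmlookup_fam)

definition lf :: "'o sq \<Rightarrow> 'o family" where
  "lf S = Abs_fmap (\<lambda>c. case S c of Some (s, X) \<Rightarrow> if s then None else Some X | None \<Rightarrow> None)"

definition rt :: "'o sq \<Rightarrow> 'o family" where
  "rt S = Abs_fmap (\<lambda>c. case S c of Some (s, X) \<Rightarrow> if s then Some X else None | None \<Rightarrow> None)"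

lemma lf_lookup: "finite (dom S) \<Longrightarrow>
    fmlookup (lf S) c = (case S c of Some (s, X) \<Rightarrow> if s then None else Some X | None \<Rightarrow> None)"
  unfolding lf_def
  by (subst Abs_fmap_inverse) (auto intro: rev_finite_subset split: option.splits if_splits)

lemma rt_lookup: "finite (dom S) \<Longrightarrow>
    fmlookup (rt S) c = (case S c of Some (s, X) \<Rightarrow> if s then Some X else None | None \<Rightarrow> None)"
  unfolding rt_def
  by (subst Abs_fmap_inverse) (auto intro: rev_finite_subset split: option.splits if_splits)

lemma lf_sqn:
  assumes "wf_seq A \<Gamma> \<Delta>"
  shows "lf (sqn \<Gamma> \<Delta>) = \<Gamma>" "rt (sqn \<Gamma> \<Delta>) = \<Delta>" "finite (dom (sqn \<Gamma> \<Delta>))"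
proof -
  have "dom (sqn \<Gamma> \<Delta>) \<subseteq> fmdom' \<Gamma> \<union> fmdom' \<Delta>"
    by (auto simp: sqn_def fmlookup_dom'_iff split: option.splits)
  then show f: "finite (dom (sqn \<Gamma> \<Delta>))" by (rule finite_subset) simp
  have w: "fmlookup \<Gamma> c = None \<or> fmlookup \<Delta> c = None" for c using assms by (simp add: wf_seq_alt)
  show "lf (sqn \<Gamma> \<Delta>) = \<Gamma>"
  proof (rule fmap_ext)
    fix c show "fmlookup (lf (sqn \<Gamma> \<Delta>)) c = fmlookup \<Gamma> c"
      using w[of c] by (auto simp: lf_lookup[OF f] sqn_def split: option.splits)
  qed
  show "rt (sqn \<Gamma> \<Delta>) = \<Delta>"
  proof (rule fmap_ext)
    fix c show "fmlookup (rt (sqn \<Gamma> \<Delta>)) c = fmlookup \<Delta> c"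
      using w[of c] by (auto simp: rt_lookup[OF f] sqn_def split: option.splits)
  qed
qed

definition mkPar :: "'o sq \<Rightarrow> chan \<Rightarrow> (name \<Rightarrow> 'm tm) \<Rightarrow> 'm tm" where
  "mkPar S \<alpha> f = (let F = fam (fmdom (branches (snd (the (S \<alpha>))))) f in
     if fst (the (S \<alpha>)) then Tuple \<alpha> F else Cotuple \<alpha> F)"

definition mkSel :: "'o sq \<Rightarrow> chan \<Rightarrow> name \<Rightarrow> 'm tm \<Rightarrow> 'm tm" where
  "mkSel S \<alpha> k f = (if fst (the (S \<alpha>)) then Inject \<alpha> k f else Project \<alpha> k f)"

text \<open>The sequent is carried along because only the side of the active formula tells whether a
  node is a tuple or a cotuple, an injection or a projection.\<close>

primrec bk :: "'m nt \<Rightarrow> 'o sq \<Rightarrow> 'm tm" where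
  "bk (Leaf a) S = Ax a"
| "bk (Par \<alpha> I h) S = mkPar S \<alpha> (\<lambda>i. bk (h i) (nxt S \<alpha> i))"
| "bk (Sel \<alpha> k f) S = mkSel S \<alpha> k (bk f (nxt S \<alpha> k))"

lemma nxt_other: "\<alpha> \<noteq> \<beta> \<Longrightarrow> nxt S \<alpha> k \<beta> = S \<beta>"
  by (auto simp: nxt_def split: option.splits)

lemma mk_nxt[simp]: "\<alpha> \<noteq> \<beta> \<Longrightarrow> mkPar (nxt S \<alpha> k) \<beta> = mkPar S \<beta>"
    "\<alpha> \<noteq> \<beta> \<Longrightarrow> mkSel (nxt S \<alpha> k) \<beta> = mkSel S \<beta>"
  by (auto simp: mkPar_def mkSel_def nxt_other fun_eq_iff)

context symmetric_polycategory
begin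

definition wfS :: "'o sq \<Rightarrow> bool" where
  "wfS S \<longleftrightarrow> finite (dom S) \<and> (\<forall>c s X. S c = Some (s, X) \<longrightarrow> set_fm X \<subseteq> Obj A)"

abbreviation "der S t \<equiv> derives A (lf S) (rt S) t"
abbreviation "eqv S s t \<equiv> equivalent A (lf S) (rt S) s t"

lemma wfS_sqn: "wf_seq A \<Gamma> \<Delta> \<Longrightarrow> wfS (sqn \<Gamma> \<Delta>)"
  unfolding wfS_def
proof (intro conjI allI impI lf_sqn(3))
  fix c s X assume w: "wf_seq A \<Gamma> \<Delta>" and "sqn \<Gamma> \<Delta> c = Some (s, X)"
  then have "fmlookup \<Gamma> c = Some X \<or> fmlookup \<Delta> c = Some X"
    by (auto simp: sqn_def split: option.splits)
  then show "set_fm X \<subseteq> Obj A" using w unfolding wf_seq_alt by blast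
qed

lemma wf_lf: "wfS S \<Longrightarrow> wf_seq A (lf S) (rt S)"
  by (auto simp: wfS_def wf_seq_alt lf_lookup rt_lookup split: option.splits if_splits)

lemma branches_set: "fmlookup (branches X) k = Some Y \<Longrightarrow> set_fm Y \<subseteq> set_fm X"
  by (cases X) (auto dest: fmran'I)

lemma wfS_upd: "wfS S \<Longrightarrow> set_fm X \<subseteq> Obj A \<Longrightarrow> wfS (S(\<alpha> \<mapsto> (s, X)))"
  by (auto simp: wfS_def)

lemma wfS_nxt: "wfS S \<Longrightarrow> k \<in> idx S \<alpha> \<Longrightarrow> wfS (nxt S \<alpha> k)"
proof -
  assume a: "wfS S" "k \<in> idx S \<alpha>"
  then obtain s X Y where S: "S \<alpha> = Some (s, X)" "fmlookup (branches X) k = Some Y"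
    by (auto simp: idx_def fmlookup_dom'_iff split: option.splits)
  have "set_fm X \<subseteq> Obj A" using a(1) S(1) unfolding wfS_def by blast
  then have "set_fm Y \<subseteq> Obj A" using branches_set[OF S(2)] by blast
  then show "wfS (nxt S \<alpha> k)" using wfS_upd[OF a(1)] by (simp add: nxt_def S)
qed

lemma wfS_cs: "wfS S1 \<Longrightarrow> wfS S2 \<Longrightarrow> wfS (cs \<gamma> S1 S2)"
proof -
  assume a: "wfS S1" "wfS S2"
  have "dom (cs \<gamma> S1 S2) \<subseteq> dom S1 \<union> dom S2" by (auto simp: cs_def split: option.splits if_splits)
  then have "finite (dom (cs \<gamma> S1 S2))" using a by (auto simp: wfS_def intro: finite_subset)
  then show ?thesis using a by (auto simp: wfS_def cs_def split: option.splits if_splits)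
qed

text \<open>Brings a sequent into the form that the rules of \<open>equivalent\<close> demand, an
  active formula added to a context in which its channel is free.\<close>

lemma lf_upd:
  assumes "wfS S" "S \<alpha> = Some (s, X)" "set_fm Y \<subseteq> Obj A"
  shows "\<not> s \<Longrightarrow> lf S = fmupd \<alpha> X (fmdrop \<alpha> (lf S))"
    "\<not> s \<Longrightarrow> lf (S(\<alpha> \<mapsto> (s, Y))) = fmupd \<alpha> Y (fmdrop \<alpha> (lf S))"
    "\<not> s \<Longrightarrow> rt (S(\<alpha> \<mapsto> (s, Y))) = rt S"
    "s \<Longrightarrow> rt S = fmupd \<alpha> X (fmdrop \<alpha> (rt S))"
    "s \<Longrightarrow> rt (S(\<alpha> \<mapsto> (s, Y))) = fmupd \<alpha> Y (fmdrop \<alpha> (rt S))"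
    "s \<Longrightarrow> lf (S(\<alpha> \<mapsto> (s, Y))) = lf S"
proof -
  have f: "finite (dom S)" "finite (dom (S(\<alpha> \<mapsto> (b, Y))))" for b using assms by (auto simp: wfS_def)
  note l = lf_lookup[OF f(1)] lf_lookup[OF f(2)] rt_lookup[OF f(1)] rt_lookup[OF f(2)]
  show "\<not> s \<Longrightarrow> lf S = fmupd \<alpha> X (fmdrop \<alpha> (lf S))"
    "\<not> s \<Longrightarrow> lf (S(\<alpha> \<mapsto> (s, Y))) = fmupd \<alpha> Y (fmdrop \<alpha> (lf S))"
    "\<not> s \<Longrightarrow> rt (S(\<alpha> \<mapsto> (s, Y))) = rt S"
    "s \<Longrightarrow> rt S = fmupd \<alpha> X (fmdrop \<alpha> (rt S))"
    "s \<Longrightarrow> rt (S(\<alpha> \<mapsto> (s, Y))) = fmupd \<alpha> Y (fmdrop \<alpha> (rt S))"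
    "s \<Longrightarrow> lf (S(\<alpha> \<mapsto> (s, Y))) = lf S"
    using assms(2) by (auto intro!: fmap_ext simp: l)
qed

lemma eqv_Par:
  assumes w: "wfS S" and k: "knd S \<alpha> = Some True"
    and e: "\<And>i. i \<in> idx S \<alpha> \<Longrightarrow> eqv (nxt S \<alpha> i) (f i) (g i)"
  shows "eqv S (mkPar S \<alpha> f) (mkPar S \<alpha> g)"
proof -
  obtain s X where S: "S \<alpha> = Some (s, X)" "kind (s, X) = Some True"
    using k by (auto simp: knd_def bind_eq_Some_conv)
  have X: "set_fm X \<subseteq> Obj A" using w S(1) unfolding wfS_def by blast
  have Y: "set_fm Y \<subseteq> Obj A" "i \<in> idx S \<alpha>" "nxt S \<alpha> i = S(\<alpha> \<mapsto> (s, Y))"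
    if "fmlookup (branches X) i = Some Y" for i Y
    using that S branches_set[OF that] X by (auto simp: idx_def nxt_def fmlookup_dom'_iff)
  note u = lf_upd[OF w S(1)]
  show ?thesis
  proof (cases s)
    case False
    then obtain Xs where X': "X = Sum Xs" using S(2) by (cases X) auto
    have "equivalent A (fmupd \<alpha> (Sum Xs) (fmdrop \<alpha> (lf S))) (rt S) (Cotuple \<alpha> (fam (fmdom Xs) f)) (Cotuple \<alpha> (fam (fmdom Xs) g))"
    proof (rule eq_Cotuple)
      show "wf_seq A (fmupd \<alpha> (Sum Xs) (fmdrop \<alpha> (lf S))) (rt S)"
        using wf_lf[OF w] u(1)[OF X] False X' by metis
      fix i Y' f' g' assume "fmlookup Xs i = Some Y'" "fmlookup (fam (fmdom Xs) f) i = Some f'"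
        "fmlookup (fam (fmdom Xs) g) i = Some g'"
      then show "equivalent A (fmupd \<alpha> Y' (fmdrop \<alpha> (lf S))) (rt S) f' g'"
        using e[of i] Y[of i Y'] u(2,3)[of Y'] False X' by (auto simp: fmlookup_fam split: if_splits)
    qed (auto simp: fmlookup_dom'_iff fmlookup_dom_iff)
    then show ?thesis using u(1)[OF X] S(1) False X' by (simp add: mkPar_def)
  next
    case True
    then obtain Xs where X': "X = Prod Xs" using S(2) by (cases X) auto
    have "equivalent A (lf S) (fmupd \<alpha> (Prod Xs) (fmdrop \<alpha> (rt S))) (Tuple \<alpha> (fam (fmdom Xs) f)) (Tuple \<alpha> (fam (fmdom Xs) g))"
    proof (rule eq_Tuple)
      show "wf_seq A (lf S) (fmupd \<alpha> (Prod Xs) (fmdrop \<alpha> (rt S)))"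
        using wf_lf[OF w] u(4)[OF X] True X' by metis
      fix i Y' f' g' assume "fmlookup Xs i = Some Y'" "fmlookup (fam (fmdom Xs) f) i = Some f'"
        "fmlookup (fam (fmdom Xs) g) i = Some g'"
      then show "equivalent A (lf S) (fmupd \<alpha> Y' (fmdrop \<alpha> (rt S))) f' g'"
        using e[of i] Y[of i Y'] u(5,6)[of Y'] True X' by (auto simp: fmlookup_fam split: if_splits)
    qed (auto simp: fmlookup_dom'_iff fmlookup_dom_iff)
    then show ?thesis using u(4)[OF X] S(1) True X' by (simp add: mkPar_def)
  qed
qed

lemma eqv_Sel:
  assumes w: "wfS S" and k: "knd S \<alpha> = Some False" "k \<in> idx S \<alpha>"
    and e: "eqv (nxt S \<alpha> k) f g"
  shows "eqv S (mkSel S \<alpha> k f) (mkSel S \<alpha> k g)"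
proof -
  obtain s X where S: "S \<alpha> = Some (s, X)" "kind (s, X) = Some False"
    using k by (auto simp: knd_def bind_eq_Some_conv)
  then obtain Y where y: "fmlookup (branches X) k = Some Y" using k(2) by (auto simp: idx_def fmlookup_dom'_iff)
  have X: "set_fm X \<subseteq> Obj A" using w S(1) unfolding wfS_def by blast
  have Y: "set_fm Y \<subseteq> Obj A" "nxt S \<alpha> k = S(\<alpha> \<mapsto> (s, Y))"
    using y S branches_set[OF y] X by (auto simp: nxt_def)
  note u = lf_upd[OF w S(1) X] lf_upd[OF w S(1) Y(1)]
  show ?thesis
  proof (cases s)
    case False
    then obtain Xs where X': "X = Prod Xs" using S(2) by (cases X) auto
    have "equivalent A (fmupd \<alpha> (Prod Xs) (fmdrop \<alpha> (lf S))) (rt S) (Project \<alpha> k f) (Project \<alpha> k g)"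
    proof (rule eq_Project)
      show "wf_seq A (fmupd \<alpha> (Prod Xs) (fmdrop \<alpha> (lf S))) (rt S)"
        using wf_lf[OF w] u(1) False X' by metis
      show "fmlookup Xs k = Some Y" using y X' by simp
      show "equivalent A (fmupd \<alpha> Y (fmdrop \<alpha> (lf S))) (rt S) f g"
        using e u(8,9) Y(2) False by simp
    qed (auto simp: fmlookup_dom'_iff)
    then show ?thesis using u(1) S(1) False X' by (simp add: mkSel_def)
  next
    case True
    then obtain Xs where X': "X = Sum Xs" using S(2) by (cases X) auto
    have "equivalent A (lf S) (fmupd \<alpha> (Sum Xs) (fmdrop \<alpha> (rt S))) (Inject \<alpha> k f) (Inject \<alpha> k g)"
    proof (rule eq_Inject)
      show "wf_seq A (lf S) (fmupd \<alpha> (Sum Xs) (fmdrop \<alpha> (rt S)))"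
        using wf_lf[OF w] u(4) True X' by metis
      show "fmlookup Xs k = Some Y" using y X' by simp
      show "equivalent A (lf S) (fmupd \<alpha> Y (fmdrop \<alpha> (rt S))) f g"
        using e u(11,12) Y(2) True by simp
    qed (auto simp: fmlookup_dom'_iff)
    then show ?thesis using u(4) S(1) True X' by (simp add: mkSel_def)
  qed
qed

lemma eqv_refl: "der S t \<Longrightarrow> eqv S t t" by (rule eq_refl)

lemma eqv_der: "eqv S s t \<Longrightarrow> der S s" "eqv S s t \<Longrightarrow> der S t"
  using equivalent_derives by blast+

text \<open>Reflexivity turns the congruence rule of the equivalence into the derivation rule, so
  both need to be matched with the sequent functions only once.\<close>

lemma der_Par: "wfS S \<Longrightarrow> knd S \<alpha> = Some True \<Longrightarrow>
    (\<And>i. i \<in> idx S \<alpha> \<Longrightarrow> der (nxt S \<alpha> i) (f i)) \<Longrightarrow> der S (mkPar S \<alpha> f)"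
  by (rule eqv_der(1)[OF eqv_Par]) (auto intro: eqv_refl)

lemma der_Sel: "wfS S \<Longrightarrow> knd S \<alpha> = Some False \<Longrightarrow> k \<in> idx S \<alpha> \<Longrightarrow> der (nxt S \<alpha> k) f \<Longrightarrow>
    der S (mkSel S \<alpha> k f)"
  by (rule eqv_der(1)[OF eqv_Sel]) (auto intro: eqv_refl)

text \<open>The sides of the two active formulas decide which conversion is meant: both on the right
  (14), both on the left (13), and one on each side (19), read in the direction that puts the
  cotuple first.\<close>

lemma eqv_PP:
  assumes w: "wfS S" and ab: "\<alpha> \<noteq> \<beta>" and k: "knd S \<alpha> = Some True" "knd S \<beta> = Some True"
    and f: "\<And>i j. i \<in> idx S \<alpha> \<Longrightarrow> j \<in> idx S \<beta> \<Longrightarrow> der (nxt (nxt S \<alpha> i) \<beta> j) (f i j)"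
  shows "eqv S (mkPar S \<alpha> (\<lambda>i. mkPar S \<beta> (f i))) (mkPar S \<beta> (\<lambda>j. mkPar S \<alpha> (\<lambda>i. f i j)))"
proof -
  have "der (nxt S \<alpha> i) (mkPar S \<beta> (f i))" if "i \<in> idx S \<alpha>" for i
    using der_Par[of "nxt S \<alpha> i" \<beta> "f i"] that w ab k f by (simp add: wfS_nxt)
  then have 1: "der S (mkPar S \<alpha> (\<lambda>i. mkPar S \<beta> (f i)))" by (intro der_Par w k)
  have "der (nxt S \<beta> j) (mkPar S \<alpha> (\<lambda>i. f i j))" if "j \<in> idx S \<beta>" for j
    using der_Par[of "nxt S \<beta> j" \<alpha> "\<lambda>i. f i j"] that w ab[symmetric] k f
    by (simp add: wfS_nxt nxt_nxt[OF ab[symmetric]])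
  then have 2: "der S (mkPar S \<beta> (\<lambda>j. mkPar S \<alpha> (\<lambda>i. f i j)))" by (intro der_Par w k)
  let ?I = "fmdom (branches (snd (the (S \<alpha>))))" and ?J = "fmdom (branches (snd (the (S \<beta>))))"
  note sides = mkPar_def Let_def
  show ?thesis
  proof (cases "fst (the (S \<alpha>))"; cases "fst (the (S \<beta>))")
    assume a: "fst (the (S \<alpha>))" "fst (the (S \<beta>))"
    show ?thesis using 1 2 a eq_conversion[OF cv14[OF ab, of ?I ?J f]] by (simp add: sides)
  next
    assume a: "fst (the (S \<alpha>))" "\<not> fst (the (S \<beta>))"
    show ?thesis using 1 2 a eq_sym[OF eq_conversion[OF cv19[OF ab[symmetric], of ?J ?I "\<lambda>j i. f i j"]]] by (simp add: sides)
  next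
    assume a: "\<not> fst (the (S \<alpha>))" "fst (the (S \<beta>))"
    show ?thesis using 1 2 a eq_conversion[OF cv19[OF ab, of ?I ?J f]] by (simp add: sides)
  next
    assume a: "\<not> fst (the (S \<alpha>))" "\<not> fst (the (S \<beta>))"
    show ?thesis using 1 2 a eq_conversion[OF cv13[OF ab, of ?I ?J f]] by (simp add: sides)
  qed
qed

lemma eqv_PS:
  assumes w: "wfS S" and ab: "\<alpha> \<noteq> \<beta>" and k: "knd S \<alpha> = Some True" "knd S \<beta> = Some False" "l \<in> idx S \<beta>"
    and f: "\<And>i. i \<in> idx S \<alpha> \<Longrightarrow> der (nxt (nxt S \<alpha> i) \<beta> l) (f i)"
  shows "eqv S (mkPar S \<alpha> (\<lambda>i. mkSel S \<beta> l (f i))) (mkSel S \<beta> l (mkPar S \<alpha> f))"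
proof -
  have "der (nxt S \<alpha> i) (mkSel S \<beta> l (f i))" if "i \<in> idx S \<alpha>" for i
    using der_Sel[of "nxt S \<alpha> i" \<beta> l "f i"] that w ab k f by (simp add: wfS_nxt)
  then have 1: "der S (mkPar S \<alpha> (\<lambda>i. mkSel S \<beta> l (f i)))" by (intro der_Par w k)
  have "der (nxt S \<beta> l) (mkPar S \<alpha> f)"
    using der_Par[of "nxt S \<beta> l" \<alpha> f] w ab[symmetric] k f
    by (simp add: wfS_nxt nxt_nxt[OF ab[symmetric]])
  then have 2: "der S (mkSel S \<beta> l (mkPar S \<alpha> f))" by (intro der_Sel w k)
  let ?F = "fam (fmdom (branches (snd (the (S \<alpha>))))) f"
  note sides = mkPar_def mkSel_def Let_def fmmap_fam
  show ?thesis
  proof (cases "fst (the (S \<alpha>))"; cases "fst (the (S \<beta>))")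
    assume a: "fst (the (S \<alpha>))" "fst (the (S \<beta>))"
    show ?thesis using 1 2 a eq_sym[OF eq_conversion[OF cv18[OF ab[symmetric], of l ?F]]] by (simp add: sides)
  next
    assume a: "fst (the (S \<alpha>))" "\<not> fst (the (S \<beta>))"
    show ?thesis using 1 2 a eq_sym[OF eq_conversion[OF cv16[OF ab[symmetric], of l ?F]]] by (simp add: sides)
  next
    assume a: "\<not> fst (the (S \<alpha>))" "fst (the (S \<beta>))"
    show ?thesis using 1 2 a eq_conversion[OF cv15[OF ab, of l ?F]] by (simp add: sides)
  next
    assume a: "\<not> fst (the (S \<alpha>))" "\<not> fst (the (S \<beta>))"
    show ?thesis using 1 2 a eq_conversion[OF cv17[OF ab, of l ?F]] by (simp add: sides)
  qed
qed

lemma eqv_SS: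
  assumes w: "wfS S" and ab: "\<alpha> \<noteq> \<beta>" and k: "knd S \<alpha> = Some False" "knd S \<beta> = Some False"
    "m \<in> idx S \<alpha>" "l \<in> idx S \<beta>" and f: "der (nxt (nxt S \<alpha> m) \<beta> l) f"
  shows "eqv S (mkSel S \<alpha> m (mkSel S \<beta> l f)) (mkSel S \<beta> l (mkSel S \<alpha> m f))"
proof -
  have "der (nxt S \<alpha> m) (mkSel S \<beta> l f)"
    using der_Sel[of "nxt S \<alpha> m" \<beta> l f] w ab k f by (simp add: wfS_nxt)
  then have 1: "der S (mkSel S \<alpha> m (mkSel S \<beta> l f))" by (intro der_Sel w k)
  have "der (nxt S \<beta> l) (mkSel S \<alpha> m f)"
    using der_Sel[of "nxt S \<beta> l" \<alpha> m f] w ab[symmetric] k f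
    by (simp add: wfS_nxt nxt_nxt[OF ab[symmetric]])
  then have 2: "der S (mkSel S \<beta> l (mkSel S \<alpha> m f))" by (intro der_Sel w k)
  note sides = mkSel_def
  show ?thesis
  proof (cases "fst (the (S \<alpha>))"; cases "fst (the (S \<beta>))")
    assume a: "fst (the (S \<alpha>))" "fst (the (S \<beta>))"
    show ?thesis using 1 2 a eq_conversion[OF cv20[OF ab, of m l f]] by (simp add: sides)
  next
    assume a: "fst (the (S \<alpha>))" "\<not> fst (the (S \<beta>))"
    show ?thesis using 1 2 a eq_conversion[OF cv22[OF ab, of m l f]] by (simp add: sides)
  next
    assume a: "\<not> fst (the (S \<alpha>))" "fst (the (S \<beta>))"
    show ?thesis using 1 2 a eq_sym[OF eq_conversion[OF cv22[OF ab[symmetric], of l m f]]] by (simp add: sides)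
  next
    assume a: "\<not> fst (the (S \<alpha>))" "\<not> fst (the (S \<beta>))"
    show ?thesis using 1 2 a eq_conversion[OF cv21[OF ab, of m l f]] by (simp add: sides)
  qed
qed

lemma eqv_Cut:
  assumes w: "wfS S1" "wfS S2" and c: "cc True \<gamma> S1 S2" and e: "eqv S1 f f'" "eqv S2 g g'"
  shows "eqv (cs \<gamma> S1 S2) (Cut f \<gamma> g) (Cut f' \<gamma> g')"
proof -
  obtain Z where Z: "S1 \<gamma> = Some (True, Z)" "S2 \<gamma> = Some (False, Z)" using c by (auto simp: cc_def)
  have fin: "finite (dom S1)" "finite (dom S2)" "finite (dom (cs \<gamma> S1 S2))"
    using w wfS_cs[OF w] by (auto simp: wfS_def)
  note l = lf_lookup[OF fin(1)] lf_lookup[OF fin(2)] lf_lookup[OF fin(3)]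
    rt_lookup[OF fin(1)] rt_lookup[OF fin(2)] rt_lookup[OF fin(3)]
  have d: "c \<noteq> \<gamma> \<Longrightarrow> S1 c = None \<or> S2 c = None" for c
    using c[unfolded cc_def, THEN conjunct1] by blast
  have "equivalent A (lf S1 ++\<^sub>f fmdrop \<gamma> (lf S2)) (fmdrop \<gamma> (rt S1) ++\<^sub>f rt S2) (Cut f \<gamma> g) (Cut f' \<gamma> g')"
  proof (rule eq_Cut[where Z = Z])
    have "rt S1 = fmupd \<gamma> Z (fmdrop \<gamma> (rt S1))"
      by (rule fmap_ext) (auto simp: l Z)
    then show "equivalent A (lf S1) (fmupd \<gamma> Z (fmdrop \<gamma> (rt S1))) f f'" using e by simp
    have "lf S2 = fmupd \<gamma> Z (fmdrop \<gamma> (lf S2))"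
      by (rule fmap_ext) (auto simp: l Z)
    then show "equivalent A (fmupd \<gamma> Z (fmdrop \<gamma> (lf S2))) (rt S2) g g'" using e by simp
    show "seq_chans (lf S1) (fmdrop \<gamma> (rt S1)) \<inter> seq_chans (fmdrop \<gamma> (lf S2)) (rt S2) = {}"
    proof (rule equals0I)
      fix c assume "c \<in> seq_chans (lf S1) (fmdrop \<gamma> (rt S1)) \<inter> seq_chans (fmdrop \<gamma> (lf S2)) (rt S2)"
      then show False using d[of c] unfolding Int_iff seq_chans_iff
        by (cases "c = \<gamma>") (auto simp: l Z)
    qed
  qed (auto simp: seq_chans_iff l Z)
  moreover have "lf (cs \<gamma> S1 S2) = lf S1 ++\<^sub>f fmdrop \<gamma> (lf S2)"
  proof (rule fmap_ext)
    fix c show "fmlookup (lf (cs \<gamma> S1 S2)) c = fmlookup (lf S1 ++\<^sub>f fmdrop \<gamma> (lf S2)) c"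
      using d[of c] Z by (cases "c = \<gamma>"; cases "S1 c"; cases "S2 c")
        (auto simp: l cs_def fmlookup_dom_iff)
  qed
  moreover have "rt (cs \<gamma> S1 S2) = fmdrop \<gamma> (rt S1) ++\<^sub>f rt S2"
  proof (rule fmap_ext)
    fix c show "fmlookup (rt (cs \<gamma> S1 S2)) c = fmlookup (fmdrop \<gamma> (rt S1) ++\<^sub>f rt S2) c"
      using d[of c] Z by (cases "c = \<gamma>"; cases "S1 c"; cases "S2 c")
        (auto simp: l cs_def fmlookup_dom_iff)
  qed
  ultimately show ?thesis by simp
qed

lemma der_Cut: "wfS S1 \<Longrightarrow> wfS S2 \<Longrightarrow> cc True \<gamma> S1 S2 \<Longrightarrow> der S1 f \<Longrightarrow> der S2 g \<Longrightarrow>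
    der (cs \<gamma> S1 S2) (Cut f \<gamma> g)"
  by (rule eqv_der(1)[OF eqv_Cut]) (auto intro: eqv_refl)

lemma der_Leaf: "rl A S a \<Longrightarrow> der S (Ax a)"
proof -
  assume a: "rl A S a"
  then have d: "derives A (fmmap Atom (Dom A a)) (fmmap Atom (Cod A a)) (Ax a)"
    by (intro derives_Ax) (simp add: rl_def)
  show ?thesis using lf_sqn[OF derives_wf[OF d]] d a by (simp add: rl_def mseq_def)
qed

lemma bk_der: "ty (rl A) S n \<Longrightarrow> wfS S \<Longrightarrow> der S (bk n S)"
proof (induction rule: ty.induct)
  case (ty_Leaf S a)
  then show ?case by (simp add: der_Leaf)
next
  case (ty_Par S \<alpha> I h)
  then show ?case by (auto intro!: der_Par wfS_nxt)
next
  case (ty_Sel S \<alpha> k f)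
  then show ?case by (auto intro!: der_Sel wfS_nxt)
qed

lemma rewrite_left:
  "\<alpha> \<noteq> \<gamma> \<Longrightarrow> rewrite A (Cut (mkPar S \<alpha> f) \<gamma> g) (mkPar S \<alpha> (\<lambda>i. Cut (f i) \<gamma> g))"
  "\<alpha> \<noteq> \<gamma> \<Longrightarrow> rewrite A (Cut (mkSel S \<alpha> k t) \<gamma> g) (mkSel S \<alpha> k (Cut t \<gamma> g))"
  using rw3[of \<alpha> \<gamma> A "fam (fmdom (branches (snd (the (S \<alpha>))))) f" g]
    rw9[of \<alpha> \<gamma> A "fam (fmdom (branches (snd (the (S \<alpha>))))) f" g] rw5[of \<alpha> \<gamma> A k t g] rw7[of \<alpha> \<gamma> A k t g]
  by (auto simp: mkPar_def mkSel_def Let_def fmmap_fam)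

lemma rewrite_right:
  "\<beta> \<noteq> \<gamma> \<Longrightarrow> rewrite A (Cut f \<gamma> (mkPar S \<beta> g)) (mkPar S \<beta> (\<lambda>i. Cut f \<gamma> (g i)))"
  "\<beta> \<noteq> \<gamma> \<Longrightarrow> rewrite A (Cut f \<gamma> (mkSel S \<beta> k t)) (mkSel S \<beta> k (Cut f \<gamma> t))"
  using rw4[of \<beta> \<gamma> A f "fam (fmdom (branches (snd (the (S \<beta>))))) g"]
    rw10[of \<beta> \<gamma> A f "fam (fmdom (branches (snd (the (S \<beta>))))) g"] rw6[of \<beta> \<gamma> A f k t] rw8[of \<beta> \<gamma> A f k t]
  by (auto simp: mkPar_def mkSel_def Let_def fmmap_fam)

lemma mk_cs:
  assumes "cc s \<gamma> S1 S2"
  shows "\<alpha> \<in> dom S1 \<Longrightarrow> \<alpha> \<noteq> \<gamma> \<Longrightarrow> mkPar (cs \<gamma> S1 S2) \<alpha> = mkPar S1 \<alpha>"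
    "\<alpha> \<in> dom S1 \<Longrightarrow> \<alpha> \<noteq> \<gamma> \<Longrightarrow> mkSel (cs \<gamma> S1 S2) \<alpha> = mkSel S1 \<alpha>"
    "\<alpha> \<in> dom S2 \<Longrightarrow> \<alpha> \<noteq> \<gamma> \<Longrightarrow> mkPar (cs \<gamma> S1 S2) \<alpha> = mkPar S2 \<alpha>"
    "\<alpha> \<in> dom S2 \<Longrightarrow> \<alpha> \<noteq> \<gamma> \<Longrightarrow> mkSel (cs \<gamma> S1 S2) \<alpha> = mkSel S2 \<alpha>"
proof -
  have 1: "cs \<gamma> S1 S2 \<alpha> = S1 \<alpha>" if "\<alpha> \<in> dom S1" "\<alpha> \<noteq> \<gamma>" using that by (auto simp: cs_def)
  have 2: "cs \<gamma> S1 S2 \<alpha> = S2 \<alpha>" if "\<alpha> \<in> dom S2" "\<alpha> \<noteq> \<gamma>"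
    using that cc_right(6)[OF assms that] by (cases "S1 \<alpha>") (auto simp: cs_def)
  show "\<alpha> \<in> dom S1 \<Longrightarrow> \<alpha> \<noteq> \<gamma> \<Longrightarrow> mkPar (cs \<gamma> S1 S2) \<alpha> = mkPar S1 \<alpha>"
    "\<alpha> \<in> dom S1 \<Longrightarrow> \<alpha> \<noteq> \<gamma> \<Longrightarrow> mkSel (cs \<gamma> S1 S2) \<alpha> = mkSel S1 \<alpha>"
    using 1 by (auto simp: mkPar_def mkSel_def Let_def fun_eq_iff)
  show "\<alpha> \<in> dom S2 \<Longrightarrow> \<alpha> \<noteq> \<gamma> \<Longrightarrow> mkPar (cs \<gamma> S1 S2) \<alpha> = mkPar S2 \<alpha>"
    "\<alpha> \<in> dom S2 \<Longrightarrow> \<alpha> \<noteq> \<gamma> \<Longrightarrow> mkSel (cs \<gamma> S1 S2) \<alpha> = mkSel S2 \<alpha>"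
    using 2 by (auto simp: mkPar_def mkSel_def Let_def fun_eq_iff)
qed

text \<open>Each step of \<open>cut\<close> on typed terms is one instance of a rewrite, or the
  essential cut on two leaves. Congruence carries the equivalence through the recursive
  calls.\<close>

lemma cut_bk:
  assumes "cc True \<gamma> S1 S2" "ty (rl A) S1 f" "ty (rl A) S2 g" "wfS S1" "wfS S2"
  shows "eqv (cs \<gamma> S1 S2) (Cut (bk f S1) \<gamma> (bk g S2)) (bk (cutA \<gamma> f g) (cs \<gamma> S1 S2))"
  using atomic_rl assms
proof (induction rule: cut_induct)
  case (ParL S1 S2 \<alpha> F g)
  note l = cc_left[OF ParL(1,5,4)] and m = mk_cs[OF ParL(1)]
  have k: "knd (cs \<gamma> S1 S2) \<alpha> = Some True" using l ParL(2) by simp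
  note D = der_Cut[OF ParL.prems ParL(1) bk_der[OF ParL(2) ParL.prems(1)] bk_der[OF ParL(3) ParL.prems(2)]]
  have 1: "eqv (cs \<gamma> S1 S2) (mkPar (cs \<gamma> S1 S2) \<alpha> (\<lambda>i. Cut (bk (F i) (nxt S1 \<alpha> i)) \<gamma> (bk g S2)))
      (mkPar (cs \<gamma> S1 S2) \<alpha> (\<lambda>i. bk (cutA \<gamma> (F i) g) (nxt (cs \<gamma> S1 S2) \<alpha> i)))"
    using ParL.IH ParL.prems l by (intro eqv_Par wfS_cs k) (auto simp: wfS_nxt)
  have 2: "eqv (cs \<gamma> S1 S2) (Cut (bk (Par \<alpha> (idx S1 \<alpha>) F) S1) \<gamma> (bk g S2))
      (mkPar (cs \<gamma> S1 S2) \<alpha> (\<lambda>i. Cut (bk (F i) (nxt S1 \<alpha> i)) \<gamma> (bk g S2)))"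
    using rewrite_left(1)[OF ParL(4)] D eqv_der(1)[OF 1] unfolding m(1)[OF ParL(5,4)] bk.simps
    by (intro eq_rewrite)
  show ?case using eq_trans[OF 2 1] ParL(4) by simp
next
  case (SelL S1 S2 \<alpha> k f g)
  note l = cc_left[OF SelL(1,5,4)] and m = mk_cs[OF SelL(1)]
  have k: "knd (cs \<gamma> S1 S2) \<alpha> = Some False" "k \<in> idx (cs \<gamma> S1 S2) \<alpha>" using l SelL(2) by simp_all
  note D = der_Cut[OF SelL.prems SelL(1) bk_der[OF SelL(2) SelL.prems(1)] bk_der[OF SelL(3) SelL.prems(2)]]
  have 1: "eqv (cs \<gamma> S1 S2) (mkSel (cs \<gamma> S1 S2) \<alpha> k (Cut (bk f (nxt S1 \<alpha> k)) \<gamma> (bk g S2)))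
      (mkSel (cs \<gamma> S1 S2) \<alpha> k (bk (cutA \<gamma> f g) (nxt (cs \<gamma> S1 S2) \<alpha> k)))"
    using SelL.IH SelL.prems SelL(2) l by (intro eqv_Sel wfS_cs k) (auto simp: wfS_nxt)
  have 2: "eqv (cs \<gamma> S1 S2) (Cut (bk (Sel \<alpha> k f) S1) \<gamma> (bk g S2))
      (mkSel (cs \<gamma> S1 S2) \<alpha> k (Cut (bk f (nxt S1 \<alpha> k)) \<gamma> (bk g S2)))"
    using rewrite_left(2)[OF SelL(4)] D eqv_der(1)[OF 1] unfolding m(2)[OF SelL(5,4)] bk.simps
    by (intro eq_rewrite)
  show ?case using eq_trans[OF 2 1] SelL(4) by simp
next
  case (ParR S1 S2 f \<beta> G)
  note l = cc_right[OF ParR(1,6,5)] and m = mk_cs[OF ParR(1)]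
  have k: "knd (cs \<gamma> S1 S2) \<beta> = Some True" using l ParR(3) by simp
  note D = der_Cut[OF ParR.prems ParR(1) bk_der[OF ParR(2) ParR.prems(1)] bk_der[OF ParR(3) ParR.prems(2)]]
  have 1: "eqv (cs \<gamma> S1 S2) (mkPar (cs \<gamma> S1 S2) \<beta> (\<lambda>i. Cut (bk f S1) \<gamma> (bk (G i) (nxt S2 \<beta> i))))
      (mkPar (cs \<gamma> S1 S2) \<beta> (\<lambda>i. bk (cutA \<gamma> f (G i)) (nxt (cs \<gamma> S1 S2) \<beta> i)))"
    using ParR.IH ParR.prems l by (intro eqv_Par wfS_cs k) (auto simp: wfS_nxt)
  have 2: "eqv (cs \<gamma> S1 S2) (Cut (bk f S1) \<gamma> (bk (Par \<beta> (idx S2 \<beta>) G) S2))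
      (mkPar (cs \<gamma> S1 S2) \<beta> (\<lambda>i. Cut (bk f S1) \<gamma> (bk (G i) (nxt S2 \<beta> i))))"
    using rewrite_right(1)[OF ParR(5)] D eqv_der(1)[OF 1] unfolding m(3)[OF ParR(6,5)] bk.simps
    by (intro eq_rewrite)
  show ?case using eq_trans[OF 2 1] ParR(4,5) by simp
next
  case (SelR S1 S2 f \<beta> k g)
  note l = cc_right[OF SelR(1,6,5)] and m = mk_cs[OF SelR(1)]
  have k: "knd (cs \<gamma> S1 S2) \<beta> = Some False" "k \<in> idx (cs \<gamma> S1 S2) \<beta>" using l SelR(3) by simp_all
  note D = der_Cut[OF SelR.prems SelR(1) bk_der[OF SelR(2) SelR.prems(1)] bk_der[OF SelR(3) SelR.prems(2)]]
  have 1: "eqv (cs \<gamma> S1 S2) (mkSel (cs \<gamma> S1 S2) \<beta> k (Cut (bk f S1) \<gamma> (bk g (nxt S2 \<beta> k))))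
      (mkSel (cs \<gamma> S1 S2) \<beta> k (bk (cutA \<gamma> f g) (nxt (cs \<gamma> S1 S2) \<beta> k)))"
    using SelR.IH SelR.prems SelR(3) l by (intro eqv_Sel wfS_cs k) (auto simp: wfS_nxt)
  have 2: "eqv (cs \<gamma> S1 S2) (Cut (bk f S1) \<gamma> (bk (Sel \<beta> k g) S2))
      (mkSel (cs \<gamma> S1 S2) \<beta> k (Cut (bk f S1) \<gamma> (bk g (nxt S2 \<beta> k))))"
    using rewrite_right(2)[OF SelR(5)] D eqv_der(1)[OF 1] unfolding m(4)[OF SelR(6,5)] bk.simps
    by (intro eq_rewrite)
  show ?case using eq_trans[OF 2 1] SelR(4,5) by simp
next
  case (LeafLeaf S1 S2 a b)
  have T: "rl A (cs \<gamma> S1 S2) (Comp A \<gamma> a b)" using LeafLeaf(1-3) opok_rl[of \<gamma>] by (auto simp: opok_def)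
  show ?case unfolding cut_simps bk.simps
    by (rule eq_rewrite[OF essential der_Cut[OF LeafLeaf.prems LeafLeaf(1)] der_Leaf[OF T]])
      (auto intro: der_Leaf LeafLeaf(2,3))
next
  case (SelPar S1 S2 k f G)
  note m = cc_main[OF SelPar(1)]
  obtain Z where Z: "S1 \<gamma> = Some (True, Z)" "S2 \<gamma> = Some (False, Z)" using SelPar(1) by (auto simp: cc_def)
  obtain Zs where Zs: "Z = Sum Zs" using SelPar(2) Z by (cases Z) (auto simp: knd_def)
  have k: "k |\<in>| fmdom Zs" using SelPar(2) Z Zs by (auto simp: idx_def fmlookup_dom'_iff fmlookup_dom_iff)
  note D = der_Cut[OF SelPar.prems SelPar(1) bk_der[OF SelPar(2) SelPar.prems(1)] bk_der[OF SelPar(3) SelPar.prems(2)]]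
  have 1: "eqv (cs \<gamma> S1 S2) (Cut (bk f (nxt S1 \<gamma> k)) \<gamma> (bk (G k) (nxt S2 \<gamma> k))) (bk (cutA \<gamma> f (G k)) (cs \<gamma> S1 S2))"
    using SelPar.IH SelPar.prems SelPar(2) m by (auto simp: wfS_nxt)
  have "rewrite A (Cut (bk (Sel \<gamma> k f) S1) \<gamma> (bk (Par \<gamma> (idx S1 \<gamma>) G) S2))
     (Cut (bk f (nxt S1 \<gamma> k)) \<gamma> (bk (G k) (nxt S2 \<gamma> k)))"
    using k by (simp add: mkPar_def mkSel_def Z Zs) (rule rw11, simp add: fmlookup_fam)
  from eq_trans[OF eq_rewrite[OF this D eqv_der(1)[OF 1]] 1]
  show ?case unfolding cut_simps .
next
  case (ParSel S1 S2 k F g)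
  note m = cc_main[OF ParSel(1)]
  obtain Z where Z: "S1 \<gamma> = Some (True, Z)" "S2 \<gamma> = Some (False, Z)" using ParSel(1) by (auto simp: cc_def)
  obtain Zs where Zs: "Z = Prod Zs" using ParSel(3) Z by (cases Z) (auto simp: knd_def)
  have k: "k |\<in>| fmdom Zs" using ParSel(3) Z Zs by (auto simp: idx_def fmlookup_dom'_iff fmlookup_dom_iff)
  note D = der_Cut[OF ParSel.prems ParSel(1) bk_der[OF ParSel(2) ParSel.prems(1)] bk_der[OF ParSel(3) ParSel.prems(2)]]
  have 1: "eqv (cs \<gamma> S1 S2) (Cut (bk (F k) (nxt S1 \<gamma> k)) \<gamma> (bk g (nxt S2 \<gamma> k))) (bk (cutA \<gamma> (F k) g) (cs \<gamma> S1 S2))"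
    using ParSel.IH ParSel.prems ParSel(3,4) m by (auto simp: wfS_nxt)
  have "rewrite A (Cut (bk (Par \<gamma> (idx S1 \<gamma>) F) S1) \<gamma> (bk (Sel \<gamma> k g) S2))
     (Cut (bk (F k) (nxt S1 \<gamma> k)) \<gamma> (bk g (nxt S2 \<gamma> k)))"
    using k by (simp add: mkPar_def mkSel_def Z Zs) (rule rw12, simp add: fmlookup_fam)
  from eq_trans[OF eq_rewrite[OF this D eqv_der(1)[OF 1]] 1]
  show ?case unfolding cut_simps .
qed

lemma cut_elimination:
  assumes "derives A \<Gamma> \<Delta> s"
  shows "equivalent A \<Gamma> \<Delta> s (bk (nfA s) (sqn \<Gamma> \<Delta>))"
  using assms
proof (induction rule: derives.induct)
  case (derives_Ax f)
  then show ?case by (auto intro: eq_refl derives.derives_Ax)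
next
  case (derives_Cotuple \<alpha> \<Gamma> Xs \<Delta> F)
  let ?S = "(sqn \<Gamma> \<Delta>)(\<alpha> \<mapsto> (False, Sum Xs))"
  have e: "bk (nfA (Cotuple \<alpha> F)) ?S =
     Cotuple \<alpha> (fam (fmdom Xs) (\<lambda>i. bk (the (fmlookup (fmmap nfA F) i)) (nxt ?S \<alpha> i)))"
    by (simp add: mkPar_def)
  show ?case unfolding sqn_updL e
  proof (rule eq_Cotuple[OF derives_Cotuple.hyps(1-3)])
    fix i X f g assume X: "fmlookup Xs i = Some X" "fmlookup F i = Some f"
      and g: "fmlookup (fam (fmdom Xs) (\<lambda>i. bk (the (fmlookup (fmmap nfA F) i)) (nxt ?S \<alpha> i))) i = Some g"
    have "g = bk (nfA f) ((sqn \<Gamma> \<Delta>)(\<alpha> \<mapsto> (False, X)))"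
      using g X by (simp add: fmlookup_fam split: if_splits)
    then show "equivalent A (fmupd \<alpha> X \<Gamma>) \<Delta> f g" using derives_Cotuple.IH[OF X] unfolding sqn_updL by simp
  qed (auto simp: fmlookup_dom'_iff fmlookup_dom_iff)
next
  case (derives_Tuple \<alpha> \<Delta> \<Gamma> Xs F)
  note a = sqn_updR[OF wf_updR[OF derives_Tuple.hyps(2)]]
  let ?S = "(sqn \<Gamma> \<Delta>)(\<alpha> \<mapsto> (True, Prod Xs))"
  have e: "bk (nfA (Tuple \<alpha> F)) ?S =
     Tuple \<alpha> (fam (fmdom Xs) (\<lambda>i. bk (the (fmlookup (fmmap nfA F) i)) (nxt ?S \<alpha> i)))"
    by (simp add: mkPar_def)
  show ?case unfolding a e
  proof (rule eq_Tuple[OF derives_Tuple.hyps(1-3)])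
    fix i X f g assume X: "fmlookup Xs i = Some X" "fmlookup F i = Some f"
      and g: "fmlookup (fam (fmdom Xs) (\<lambda>i. bk (the (fmlookup (fmmap nfA F) i)) (nxt ?S \<alpha> i))) i = Some g"
    have "g = bk (nfA f) ((sqn \<Gamma> \<Delta>)(\<alpha> \<mapsto> (True, X)))"
      using g X by (simp add: fmlookup_fam split: if_splits)
    then show "equivalent A \<Gamma> (fmupd \<alpha> X \<Delta>) f g" using derives_Tuple.IH[OF X] unfolding a by simp
  qed (auto simp: fmlookup_dom'_iff fmlookup_dom_iff)
next
  case (derives_Project \<alpha> \<Gamma> Xs \<Delta> k X f)
  have e: "bk (nfA (Project \<alpha> k f)) ((sqn \<Gamma> \<Delta>)(\<alpha> \<mapsto> (False, Prod Xs))) =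
     Project \<alpha> k (bk (nfA f) ((sqn \<Gamma> \<Delta>)(\<alpha> \<mapsto> (False, X))))"
    using derives_Project.hyps(3) by (simp add: mkSel_def)
  show ?case unfolding sqn_updL e
    by (rule eq_Project[OF derives_Project.hyps(1-3) derives_Project.IH[unfolded sqn_updL]])
next
  case (derives_Inject \<alpha> \<Delta> \<Gamma> Xs k X f)
  note a = sqn_updR[OF wf_updR[OF derives_Inject.hyps(2)]]
  have e: "bk (nfA (Inject \<alpha> k f)) ((sqn \<Gamma> \<Delta>)(\<alpha> \<mapsto> (True, Sum Xs))) =
     Inject \<alpha> k (bk (nfA f) ((sqn \<Gamma> \<Delta>)(\<alpha> \<mapsto> (True, X))))"
    using derives_Inject.hyps(3) by (simp add: mkSel_def)
  show ?case unfolding a e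
    by (rule eq_Inject[OF derives_Inject.hyps(1-3) derives_Inject.IH[unfolded a]])
next
  case (derives_Cut \<gamma> \<Gamma> \<Delta> \<Gamma>' \<Delta>' Z f g)
  note wf = derives_wf[OF derives_Cut(4)] derives_wf[OF derives_Cut(5)]
  note w = sqn_cut[OF wf derives_Cut(1-3)]
  have d: "derives A (\<Gamma> ++\<^sub>f \<Gamma>') (\<Delta> ++\<^sub>f \<Delta>') (Cut f \<gamma> g)" by (rule derives.derives_Cut[OF derives_Cut.hyps])
  have 1: "equivalent A (\<Gamma> ++\<^sub>f \<Gamma>') (\<Delta> ++\<^sub>f \<Delta>') (Cut f \<gamma> g)
      (Cut (bk (nfA f) (sqn \<Gamma> (fmupd \<gamma> Z \<Delta>))) \<gamma> (bk (nfA g) (sqn (fmupd \<gamma> Z \<Gamma>') \<Delta>')))"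
    by (rule eq_Cut[OF derives_Cut(1-3) derives_Cut.IH])
  have 2: "eqv (sqn (\<Gamma> ++\<^sub>f \<Gamma>') (\<Delta> ++\<^sub>f \<Delta>'))
      (Cut (bk (nfA f) (sqn \<Gamma> (fmupd \<gamma> Z \<Delta>))) \<gamma> (bk (nfA g) (sqn (fmupd \<gamma> Z \<Gamma>') \<Delta>')))
      (bk (nfA (Cut f \<gamma> g)) (sqn (\<Gamma> ++\<^sub>f \<Gamma>') (\<Delta> ++\<^sub>f \<Delta>')))"
    unfolding w(2) nf.simps
    by (rule cut_bk[OF w(1) nfA_ty[OF derives_Cut(4)] nfA_ty[OF derives_Cut(5)] wfS_sqn[OF wf(1)] wfS_sqn[OF wf(2)]])
  show ?case by (rule eq_trans[OF 1 2[unfolded lf_sqn[OF derives_wf[OF d]]]])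
qed

lemma peq_eqv: "peq (rl A) S m n \<Longrightarrow> wfS S \<Longrightarrow> eqv S (bk m S) (bk n S)"
proof (induction rule: peq.induct)
  case (pe_refl S n)
  then show ?case by (auto intro: eq_refl bk_der)
next
  case (pe_sym S m n)
  then show ?case by (auto intro: eq_sym)
next
  case (pe_trans S m n k)
  then show ?case by (auto intro: eq_trans)
next
  case (pe_Par S \<alpha> I h h')
  then show ?case by (auto intro!: eqv_Par wfS_nxt)
next
  case (pe_Sel S \<alpha> k f g)
  then show ?case by (auto intro!: eqv_Sel wfS_nxt)
next
  case (pe_PP \<alpha> \<beta> S I J f)
  note ba = pe_PP.hyps(1)[symmetric]
  have d: "der (nxt (nxt S \<alpha> i) \<beta> j) (bk (f i j) (nxt (nxt S \<alpha> i) \<beta> j))"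
    if "i \<in> idx S \<alpha>" "j \<in> idx S \<beta>" for i j
    using pe_PP that by (intro bk_der wfS_nxt) auto
  show ?case using eqv_PP[OF pe_PP.prems pe_PP.hyps(1-3) d] pe_PP.hyps(1) ba
    by (simp add: nxt_nxt[OF ba])
next
  case (pe_PS \<alpha> \<beta> S I k f)
  note ba = pe_PS.hyps(1)[symmetric]
  have d: "der (nxt (nxt S \<alpha> i) \<beta> k) (bk (f i) (nxt (nxt S \<alpha> i) \<beta> k))" if "i \<in> idx S \<alpha>" for i
    using pe_PS that by (intro bk_der wfS_nxt) auto
  show ?case using eqv_PS[OF pe_PS.prems pe_PS.hyps(1-3,5) d] pe_PS.hyps(1) ba
    by (simp add: nxt_nxt[OF ba])
next
  case (pe_SS \<alpha> \<beta> S k l f)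
  note ba = pe_SS.hyps(1)[symmetric]
  have d: "der (nxt (nxt S \<alpha> k) \<beta> l) (bk f (nxt (nxt S \<alpha> k) \<beta> l))"
    using pe_SS by (intro bk_der wfS_nxt) auto
  show ?case using eqv_SS[OF pe_SS.prems pe_SS.hyps(1-5) d] pe_SS.hyps(1) ba
    by (simp add: nxt_nxt[OF ba])
qed

text \<open>For the converse direction, pass from \<open>s\<close> to the derivation read back from
  its normal form, follow the conversions there, and return to \<open>t\<close>. No confluence
  argument is involved: that the normal form respects the equivalence is the other
  direction.\<close>

theorem equivalent_iff_peq:
  assumes "derives A \<Gamma> \<Delta> s" "derives A \<Gamma> \<Delta> t"
  shows "equivalent A \<Gamma> \<Delta> s t \<longleftrightarrow> peq (rl A) (sqn \<Gamma> \<Delta>) (nfA s) (nfA t)"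
proof
  assume "peq (rl A) (sqn \<Gamma> \<Delta>) (nfA s) (nfA t)"
  then have "eqv (sqn \<Gamma> \<Delta>) (bk (nfA s) (sqn \<Gamma> \<Delta>)) (bk (nfA t) (sqn \<Gamma> \<Delta>))"
    by (rule peq_eqv[OF _ wfS_sqn[OF derives_wf[OF assms(1)]]])
  then have "equivalent A \<Gamma> \<Delta> (bk (nfA s) (sqn \<Gamma> \<Delta>)) (bk (nfA t) (sqn \<Gamma> \<Delta>))"
    unfolding lf_sqn[OF derives_wf[OF assms(1)]] .
  then show "equivalent A \<Gamma> \<Delta> s t"
    by (rule eq_trans[OF eq_trans[OF cut_elimination[OF assms(1)]] eq_sym[OF cut_elimination[OF assms(2)]]])
qed (rule equivalent_peq)

end

section \<open>Normal forms on codes, with certificates\<close>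

abbreviation "leafc a \<equiv> pr 0 a"
abbreviation "parc \<alpha> F \<equiv> pr 1 (pr \<alpha> F)"
abbreviation "selc \<alpha> k x \<equiv> pr 2 (pr \<alpha> (pr k x))"

text \<open>A relation rather than a coding function: several leaf codes may have the same value
  under \<open>v\<close>, and terms that differ only in junk share their codes.\<close>

primrec nm :: "(nat \<Rightarrow> 'l) \<Rightarrow> 'l nt \<Rightarrow> nat \<Rightarrow> bool" where
  "nm v (Leaf m) = (\<lambda>c. \<exists>a. c = leafc a \<and> v a = m)"
| "nm v (Par \<alpha> I h) = (\<lambda>c. \<exists>F x. c = parc \<alpha> F \<and> set_decode F = (\<lambda>i. pr i (x i)) ` I \<and>
     (\<forall>i\<in>I. nm v (h i) (x i)))"
| "nm v (Sel \<alpha> k f) = (\<lambda>c. \<exists>x. c = selc \<alpha> k x \<and> nm v f x)"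

text \<open>\<open>Q\<close> relates two coded families entry by entry. \<open>F\<close> is known to
  be single-valued where this is used; \<open>N\<close> is the result of a search, so its
  single-valuedness is part of the test.\<close>

definition famrel :: "nat \<Rightarrow> nat \<Rightarrow> (nat \<Rightarrow> nat \<Rightarrow> bool) \<Rightarrow> bool" where
  "famrel F N Q \<longleftrightarrow>
     (\<forall>w<F. mem w F \<longrightarrow> (\<exists>u<N. mem u N \<and> f1 u = f1 w \<and> Q (f2 w) (f2 u))) \<and>
     (\<forall>u<N. mem u N \<longrightarrow> (\<exists>w<F. mem w F \<and> f1 w = f1 u)) \<and>
     (\<forall>u<N. \<forall>u'<N. mem u N \<and> mem u' N \<and> f1 u = f1 u' \<longrightarrow> u = u')"

text \<open>The variant for a family \<open>F\<close> coded as a list, as in \<open>tm_code\<close>;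
  normal forms code families as sets.\<close>

definition lfamrel :: "nat \<Rightarrow> nat \<Rightarrow> (nat \<Rightarrow> nat \<Rightarrow> bool) \<Rightarrow> bool" where
  "lfamrel F N Q \<longleftrightarrow>
     (\<forall>w<F. lmem w F \<longrightarrow> (\<exists>u<N. mem u N \<and> f1 u = f1 w \<and> Q (f2 w) (f2 u))) \<and>
     (\<forall>u<N. mem u N \<longrightarrow> (\<exists>w<F. lmem w F \<and> f1 w = f1 u)) \<and>
     (\<forall>u<N. \<forall>u'<N. mem u N \<and> mem u' N \<and> f1 u = f1 u' \<longrightarrow> u = u')"

definition cutR :: "nat \<Rightarrow> nat \<Rightarrow> nat \<Rightarrow> nat \<Rightarrow> nat \<Rightarrow> bool" where
  "cutR R \<gamma> a b n \<longleftrightarrow> mem (pr 1 (pr \<gamma> (pr a (pr b n)))) R"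

definition nfR :: "nat \<Rightarrow> nat \<Rightarrow> nat \<Rightarrow> bool" where
  "nfR R c n \<longleftrightarrow> mem (pr 0 (pr c n)) R"

text \<open>The disjuncts are the cases of \<open>cut_induct\<close>, in that order. Two leaves give
  a formal composite with tag 1, whereas \<open>jnf\<close> tags an original axiom with 0.\<close>

definition jcut :: "nat \<Rightarrow> nat \<Rightarrow> nat \<Rightarrow> nat \<Rightarrow> nat \<Rightarrow> bool" where
  "jcut R \<gamma> a b n \<longleftrightarrow>
     f1 a = 1 \<and> f1 (f2 a) \<noteq> \<gamma> \<and> f1 n = 1 \<and> f1 (f2 n) = f1 (f2 a) \<and>
       famrel (f2 (f2 a)) (f2 (f2 n)) (\<lambda>x y. cutR R \<gamma> x b y) \<or>
     f1 a = 2 \<and> f1 (f2 a) \<noteq> \<gamma> \<and> f1 n = 2 \<and> f1 (f2 n) = f1 (f2 a) \<and>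
       f1 (f2 (f2 n)) = f1 (f2 (f2 a)) \<and> cutR R \<gamma> (f2 (f2 (f2 a))) b (f2 (f2 (f2 n))) \<or>
     (f1 a = 0 \<or> f1 (f2 a) = \<gamma>) \<and> f1 b = 1 \<and> f1 (f2 b) \<noteq> \<gamma> \<and> f1 n = 1 \<and> f1 (f2 n) = f1 (f2 b) \<and>
       famrel (f2 (f2 b)) (f2 (f2 n)) (\<lambda>x y. cutR R \<gamma> a x y) \<or>
     (f1 a = 0 \<or> f1 (f2 a) = \<gamma>) \<and> f1 b = 2 \<and> f1 (f2 b) \<noteq> \<gamma> \<and> f1 n = 2 \<and> f1 (f2 n) = f1 (f2 b) \<and>
       f1 (f2 (f2 n)) = f1 (f2 (f2 b)) \<and> cutR R \<gamma> a (f2 (f2 (f2 b))) (f2 (f2 (f2 n))) \<or>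
     f1 a = 0 \<and> f1 b = 0 \<and> n = leafc (pr 1 (pr \<gamma> (pr (f2 a) (f2 b)))) \<or>
     f1 a = 2 \<and> f1 (f2 a) = \<gamma> \<and> f1 b = 1 \<and> f1 (f2 b) = \<gamma> \<and>
       (\<exists>u<f2 (f2 b). mem u (f2 (f2 b)) \<and> f1 u = f1 (f2 (f2 a)) \<and> cutR R \<gamma> (f2 (f2 (f2 a))) (f2 u) n) \<or>
     f1 a = 1 \<and> f1 (f2 a) = \<gamma> \<and> f1 b = 2 \<and> f1 (f2 b) = \<gamma> \<and>
       (\<exists>u<f2 (f2 a). mem u (f2 (f2 a)) \<and> f1 u = f1 (f2 (f2 b)) \<and> cutR R \<gamma> (f2 u) (f2 (f2 (f2 b))) n)"

definition jnf :: "nat \<Rightarrow> nat \<Rightarrow> nat \<Rightarrow> bool" where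
  "jnf R c n \<longleftrightarrow>
     f1 c = 0 \<and> n = leafc (pr 0 (f2 c)) \<or>
     (f1 c = 1 \<or> f1 c = 2) \<and> f1 n = 1 \<and> f1 (f2 n) = f1 (f2 c) \<and>
       lfamrel (f2 (f2 c)) (f2 (f2 n)) (nfR R) \<or>
     (f1 c = 3 \<or> f1 c = 4) \<and> f1 n = 2 \<and> f1 (f2 n) = f1 (f2 c) \<and> f1 (f2 (f2 n)) = f1 (f2 (f2 c)) \<and>
       nfR R (f2 (f2 (f2 c))) (f2 (f2 (f2 n))) \<or>
     f1 c = 5 \<and> (\<exists>a<R. \<exists>b<R. nfR R (f1 (f2 (f2 c))) a \<and> nfR R (f2 (f2 (f2 c))) b \<and> cutR R (f1 (f2 c)) a b n)"

text \<open>
  A finite set of claims about normal forms and cuts is justified if each claim follows from other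
  claims of the set by one clause of the definitions; as the clauses recur on subterms, all claims
  of a justified set are true.
\<close>

definition justified :: "nat \<Rightarrow> bool" where
  "justified R \<longleftrightarrow> (\<forall>z<R. mem z R \<longrightarrow>
     (f1 z = 0 \<longrightarrow> jnf R (f1 (f2 z)) (f2 (f2 z))) \<and>
     (f1 z \<noteq> 0 \<longrightarrow> jcut R (f1 (f2 z)) (f1 (f2 (f2 z))) (f1 (f2 (f2 (f2 z)))) (f2 (f2 (f2 (f2 z))))))"

lemma dec_jcut: "pc D f \<Longrightarrow> pc D g \<Longrightarrow> pc D h \<Longrightarrow> pc D k \<Longrightarrow> pc D l \<Longrightarrow>
   pc D (\<lambda>e. of_bool (jcut (f e) (g e) (h e) (k e) (l e)))"
  by (rule cmp5[where F = "\<lambda>R \<gamma> a b n. of_bool (jcut R \<gamma> a b n)"],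
     unfold jcut_def famrel_def cutR_def) (intro dec_rules cmp_accs; simp)+

lemma dec_jnf: "pc D f \<Longrightarrow> pc D g \<Longrightarrow> pc D h \<Longrightarrow>
   pc D (\<lambda>e. of_bool (jnf (f e) (g e) (h e)))"
  by (rule cmp3[where F = "\<lambda>R c n. of_bool (jnf R c n)"],
     unfold jnf_def lfamrel_def cutR_def nfR_def) (intro dec_rules cmp_accs; simp)+

lemma dec_justified: "pc D f \<Longrightarrow> pc D (\<lambda>e. of_bool (justified (f e)))"
  by (rule cmp1[where F = "\<lambda>R. of_bool (justified R)"],
     unfold justified_def) (intro dec_rules dec_jnf dec_jcut cmp_accs; simp)+

lemma lmem_less: "lmem w F \<Longrightarrow> w < F"
proof (induction F rule: less_induct)
  case (less F)
  show ?case
  proof (cases F)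
    case 0
    then show ?thesis using less.prems by (simp add: lmem_def)
  next
    case (Suc m)
    obtain a b where ab: "prod_decode m = (a, b)" by fastforce
    then have m: "a \<le> m" "b \<le> m" using f1_le[of m] f2_le[of m] by (auto simp: f1_def f2_def)
    have "w = a \<or> lmem w b" using less.prems ab by (simp add: lmem_def Suc)
    then show ?thesis using less.IH[of b] m Suc by auto
  qed
qed

lemma lmem_fmap: "lmem (pr i x) (fmap_code m) \<longleftrightarrow> fmlookup m i = Some x"
  by (auto simp: lmem_def fmap_code_def sorted_list_of_fmap_def image_iff fmlookup_dom_iff)

lemma lmem_fmap_dom: "lmem (pr i y) (fmap_code (fmmap g F)) \<longleftrightarrow> i \<in> fmdom' F \<and> y = g (the (fmlookup F i))"
  by (auto simp: lmem_fmap fmlookup_dom'_iff)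

lemma famrel_iff:
  "famrel F N Q \<longleftrightarrow>
     (\<forall>i x. mem (pr i x) F \<longrightarrow> (\<exists>y. mem (pr i y) N \<and> Q x y)) \<and>
     (\<forall>i y. mem (pr i y) N \<longrightarrow> (\<exists>x. mem (pr i x) F)) \<and>
     (\<forall>i y y'. mem (pr i y) N \<and> mem (pr i y') N \<longrightarrow> y = y')"
proof -
  have *: "(\<forall>w<B. mem w B \<longrightarrow> P w) \<longleftrightarrow> (\<forall>i x. mem (pr i x) B \<longrightarrow> P (pr i x))"
    "(\<exists>w<B. mem w B \<and> P w) \<longleftrightarrow> (\<exists>i x. mem (pr i x) B \<and> P (pr i x))" for B P
    by (metis mem_less pr_f)+
  have "(\<forall>u<N. \<forall>u'<N. mem u N \<and> mem u' N \<and> f1 u = f1 u' \<longrightarrow> u = u') \<longleftrightarrow>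
     (\<forall>i y y'. mem (pr i y) N \<and> mem (pr i y') N \<longrightarrow> y = y')"
    by (metis f1_pr f2_pr mem_less pr_f)
  then show ?thesis unfolding famrel_def * by auto
qed

lemma lfamrel_iff:
  "lfamrel F N Q \<longleftrightarrow>
     (\<forall>i x. lmem (pr i x) F \<longrightarrow> (\<exists>y. mem (pr i y) N \<and> Q x y)) \<and>
     (\<forall>i y. mem (pr i y) N \<longrightarrow> (\<exists>x. lmem (pr i x) F)) \<and>
     (\<forall>i y y'. mem (pr i y) N \<and> mem (pr i y') N \<longrightarrow> y = y')"
proof -
  have *: "(\<forall>w<B. mem w B \<longrightarrow> P w) \<longleftrightarrow> (\<forall>i x. mem (pr i x) B \<longrightarrow> P (pr i x))"
    "(\<exists>w<B. mem w B \<and> P w) \<longleftrightarrow> (\<exists>i x. mem (pr i x) B \<and> P (pr i x))" for B P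
    by (metis mem_less pr_f)+
  have **: "(\<forall>w<B. lmem w B \<longrightarrow> P w) \<longleftrightarrow> (\<forall>i x. lmem (pr i x) B \<longrightarrow> P (pr i x))"
    "(\<exists>w<B. lmem w B \<and> P w) \<longleftrightarrow> (\<exists>i x. lmem (pr i x) B \<and> P (pr i x))" for B P
    by (metis lmem_less pr_f)+
  have "(\<forall>u<N. \<forall>u'<N. mem u N \<and> mem u' N \<and> f1 u = f1 u' \<longrightarrow> u = u') \<longleftrightarrow>
     (\<forall>i y y'. mem (pr i y) N \<and> mem (pr i y') N \<longrightarrow> y = y')"
    by (metis f1_pr f2_pr mem_less pr_f)
  then show ?thesis unfolding lfamrel_def * ** by auto
qed

lemma set_decode_graph: "set_decode F = (\<lambda>i. pr i (x i)) ` I \<longleftrightarrow> (\<forall>i y. mem (pr i y) F \<longleftrightarrow> i \<in> I \<and> y = x i)"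
proof
  assume e: "set_decode F = (\<lambda>i. pr i (x i)) ` I"
  show "\<forall>i y. mem (pr i y) F \<longleftrightarrow> i \<in> I \<and> y = x i"
    unfolding mem_def e by auto
next
  assume e: "\<forall>i y. mem (pr i y) F \<longleftrightarrow> i \<in> I \<and> y = x i"
  have "w \<in> set_decode F \<longleftrightarrow> f1 w \<in> I \<and> f2 w = x (f1 w)" for w
    using e[rule_format, of "f1 w" "f2 w"] by (simp add: mem_def)
  moreover have "f1 w \<in> I \<and> f2 w = x (f1 w) \<longleftrightarrow> w \<in> (\<lambda>i. pr i (x i)) ` I" for w
  proof
    assume "f1 w \<in> I \<and> f2 w = x (f1 w)"
    then have "f1 w \<in> I" "w = pr (f1 w) (x (f1 w))" by (auto simp: pr_eq[symmetric] eq_commute) (metis pr_f)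
    then show "w \<in> (\<lambda>i. pr i (x i)) ` I" by (rule rev_image_eqI)
  qed auto
  ultimately show "set_decode F = (\<lambda>i. pr i (x i)) ` I" by blast
qed

lemma nm_Par: "nm v (Par \<alpha> I h) c \<longleftrightarrow> (\<exists>F x. c = parc \<alpha> F \<and> (\<forall>i y. mem (pr i y) F \<longleftrightarrow> i \<in> I \<and> y = x i) \<and>
     (\<forall>i\<in>I. nm v (h i) (x i)))"
  by (simp only: nm.simps set_decode_graph)

lemma famrel_graph:
  assumes "famrel F N Q" "\<And>i y. mem (pr i y) F \<longleftrightarrow> i \<in> I \<and> y = x i"
  shows "\<exists>y. (\<forall>i z. mem (pr i z) N \<longleftrightarrow> i \<in> I \<and> z = y i) \<and> (\<forall>i\<in>I. Q (x i) (y i))"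
proof -
  have "\<forall>i\<in>I. \<exists>y. mem (pr i y) N \<and> Q (x i) y" using assms by (auto simp: famrel_iff)
  then obtain y where y: "\<forall>i\<in>I. mem (pr i (y i)) N \<and> Q (x i) (y i)" by metis
  have "mem (pr i z) N \<longleftrightarrow> i \<in> I \<and> z = y i" for i z
    using y assms unfolding famrel_iff by metis
  then show ?thesis using y by blast
qed

lemma lfamrel_graph:
  assumes "lfamrel F N Q" "\<And>i y. lmem (pr i y) F \<longleftrightarrow> i \<in> I \<and> y = x i"
  shows "\<exists>y. (\<forall>i z. mem (pr i z) N \<longleftrightarrow> i \<in> I \<and> z = y i) \<and> (\<forall>i\<in>I. Q (x i) (y i))"
proof -
  have "\<forall>i\<in>I. \<exists>y. mem (pr i y) N \<and> Q (x i) y" using assms by (auto simp: lfamrel_iff)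
  then obtain y where y: "\<forall>i\<in>I. mem (pr i (y i)) N \<and> Q (x i) (y i)" by metis
  have "mem (pr i z) N \<longleftrightarrow> i \<in> I \<and> z = y i" for i z
    using y assms unfolding lfamrel_iff by metis
  then show ?thesis using y by blast
qed

lemma justified_cut: "justified R \<Longrightarrow> cutR R \<gamma> a b n \<Longrightarrow> jcut R \<gamma> a b n"
  unfolding justified_def cutR_def using mem_less by fastforce

lemma justified_nf: "justified R \<Longrightarrow> nfR R c n \<Longrightarrow> jnf R c n"
  unfolding justified_def nfR_def using mem_less by fastforce

lemma nm_tag:
  "nm v (Leaf m) c \<Longrightarrow> f1 c = 0"
  "nm v (Par \<alpha> I h) c \<Longrightarrow> f1 c = 1 \<and> f1 (f2 c) = \<alpha>"
  "nm v (Sel \<alpha> k f) c \<Longrightarrow> f1 c = 2 \<and> f1 (f2 c) = \<alpha> \<and> f1 (f2 (f2 c)) = k \<and> nm v f (f2 (f2 (f2 c)))"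
  by auto

lemma nm_Sel_iff: "nm v (Sel \<alpha> k f) c \<longleftrightarrow> f1 c = 2 \<and> f1 (f2 c) = \<alpha> \<and> f1 (f2 (f2 c)) = k \<and> nm v f (f2 (f2 (f2 c)))"
  by (auto simp: pr_eq[symmetric]) (metis pr_f)

lemma nm_ParI: "f1 c = 1 \<Longrightarrow> f1 (f2 c) = \<alpha> \<Longrightarrow> (\<And>i y. mem (pr i y) (f2 (f2 c)) \<longleftrightarrow> i \<in> I \<and> y = x i) \<Longrightarrow>
   (\<And>i. i \<in> I \<Longrightarrow> nm v (h i) (x i)) \<Longrightarrow> nm v (Par \<alpha> I h) c"
  unfolding nm_Par by (rule exI[of _ "f2 (f2 c)"], rule exI[of _ x]) (metis pr_f)

lemma nm_ParD: "nm v (Par \<alpha> I h) c \<Longrightarrow> \<exists>x. f1 c = 1 \<and> f1 (f2 c) = \<alpha> \<and> (\<forall>i y. mem (pr i y) (f2 (f2 c)) \<longleftrightarrow> i \<in> I \<and> y = x i) \<and>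
   (\<forall>i\<in>I. nm v (h i) (x i))"
  unfolding nm_Par by fastforce

text \<open>The same double induction as in the definition of \<open>cut\<close>. For each pair of
  shapes only one clause can justify the claim, and where \<open>cut\<close> would return junk none
  can, so no claim about such a cut belongs to a justified set.\<close>

lemma cutR_sound:
  assumes R: "justified R" and v: "\<And>\<gamma> a b. v (pr 1 (pr \<gamma> (pr a b))) = op \<gamma> (v a) (v b)"
  shows "cutR R \<gamma> a b n \<Longrightarrow> nm v f a \<Longrightarrow> nm v g b \<Longrightarrow> nm v (cut (op \<gamma>) \<gamma> f g) n"
proof (induction f arbitrary: a b g n rule: nt.induct)
  case (Leaf m)
  note a = nm_tag(1)[OF Leaf.prems(2)]
  show ?case using Leaf.prems(1,3)
  proof (induction g arbitrary: b n rule: nt.induct)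
    case (Leaf m')
    note j = justified_cut[OF R Leaf.prems(1)]
    have "n = leafc (pr 1 (pr \<gamma> (pr (f2 a) (f2 b))))"
      using j a nm_tag(1)[OF Leaf.prems(2)] by (simp add: jcut_def)
    then show ?case using \<open>nm v (nt.Leaf m) a\<close> Leaf.prems(2) by (auto simp: v simp del: One_nat_def)
  next
    case (Par \<beta> J G)
    note j = justified_cut[OF R Par.prems(1)]
    obtain x where x: "f1 b = 1" "f1 (f2 b) = \<beta>" "\<And>i y. mem (pr i y) (f2 (f2 b)) \<longleftrightarrow> i \<in> J \<and> y = x i"
      "\<And>i. i \<in> J \<Longrightarrow> nm v (G i) (x i)" using nm_ParD[OF Par.prems(2)] by metis
    have j': "\<beta> \<noteq> \<gamma>" "f1 n = 1" "f1 (f2 n) = \<beta>" "famrel (f2 (f2 b)) (f2 (f2 n)) (\<lambda>x y. cutR R \<gamma> a x y)"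
      using j a x(1,2) by (auto simp: jcut_def)
    obtain y where y: "\<And>i z. mem (pr i z) (f2 (f2 n)) \<longleftrightarrow> i \<in> J \<and> z = y i" "\<And>i. i \<in> J \<Longrightarrow> cutR R \<gamma> a (x i) (y i)"
      using famrel_graph[OF j'(4) x(3)] by metis
    have "nm v (nt.Par \<beta> J (\<lambda>j. cut (op \<gamma>) \<gamma> (nt.Leaf m) (G j))) n"
      by (rule nm_ParI[OF j'(2,3) y(1)]) (rule Par.IH[OF rangeI y(2) x(4)])
    then show ?case using j'(1) by (simp del: nm.simps)
  next
    case (Sel \<beta> k g)
    note j = justified_cut[OF R Sel.prems(1)] and b = Sel.prems(2)[unfolded nm_Sel_iff]
    have j': "\<beta> \<noteq> \<gamma>" "f1 n = 2" "f1 (f2 n) = \<beta>" "f1 (f2 (f2 n)) = k" "cutR R \<gamma> a (f2 (f2 (f2 b))) (f2 (f2 (f2 n)))"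
      using j a b by (auto simp: jcut_def)
    show ?case using j' Sel.IH[OF j'(5)] b by (simp add: nm_Sel_iff del: nm.simps)
  qed
next
  case (Par \<alpha> I F)
  obtain x where x: "f1 a = 1" "f1 (f2 a) = \<alpha>" "\<And>i y. mem (pr i y) (f2 (f2 a)) \<longleftrightarrow> i \<in> I \<and> y = x i"
    "\<And>i. i \<in> I \<Longrightarrow> nm v (F i) (x i)" using nm_ParD[OF Par.prems(2)] by metis
  note IH = Par.IH[OF rangeI]
  show ?case
  proof (cases "\<alpha> = \<gamma>")
    case False
    have j': "f1 n = 1" "f1 (f2 n) = \<alpha>" "famrel (f2 (f2 a)) (f2 (f2 n)) (\<lambda>x y. cutR R \<gamma> x b y)"
      using justified_cut[OF R Par.prems(1)] False x(1,2) by (auto simp: jcut_def)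
    obtain y where y: "\<And>i z. mem (pr i z) (f2 (f2 n)) \<longleftrightarrow> i \<in> I \<and> z = y i" "\<And>i. i \<in> I \<Longrightarrow> cutR R \<gamma> (x i) b (y i)"
      using famrel_graph[OF j'(3) x(3)] by metis
    have "nm v (nt.Par \<alpha> I (\<lambda>i. cut (op \<gamma>) \<gamma> (F i) g)) n"
      by (rule nm_ParI[OF j'(1,2) y(1)]) (rule IH[OF y(2) x(4) Par.prems(3)])
    then show ?thesis using False by (simp del: nm.simps)
  next
    case True
    show ?thesis using Par.prems(1,3)
    proof (induction g arbitrary: b n rule: nt.induct)
      case (Leaf m')
      then show ?case using justified_cut[OF R Leaf.prems(1)] nm_tag(1)[OF Leaf.prems(2)] x(1,2) True by (simp add: jcut_def)
    next
      case P: (Par \<beta> J G)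
      note j = justified_cut[OF R P.prems(1)]
      obtain x' where x': "f1 b = 1" "f1 (f2 b) = \<beta>" "\<And>i y. mem (pr i y) (f2 (f2 b)) \<longleftrightarrow> i \<in> J \<and> y = x' i"
        "\<And>i. i \<in> J \<Longrightarrow> nm v (G i) (x' i)" using nm_ParD[OF P.prems(2)] by metis
      have j': "\<beta> \<noteq> \<gamma>" "f1 n = 1" "f1 (f2 n) = \<beta>" "famrel (f2 (f2 b)) (f2 (f2 n)) (\<lambda>x y. cutR R \<gamma> a x y)"
        using j x(1,2) x'(1,2) True by (auto simp: jcut_def)
      obtain y where y: "\<And>i z. mem (pr i z) (f2 (f2 n)) \<longleftrightarrow> i \<in> J \<and> z = y i" "\<And>i. i \<in> J \<Longrightarrow> cutR R \<gamma> a (x' i) (y i)"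
        using famrel_graph[OF j'(4) x'(3)] by metis
      have "nm v (nt.Par \<beta> J (\<lambda>j. cut (op \<gamma>) \<gamma> (nt.Par \<alpha> I F) (G j))) n"
        by (rule nm_ParI[OF j'(2,3) y(1)]) (rule P.IH[OF rangeI y(2) x'(4)])
      then show ?case using j'(1) True by (simp del: nm.simps)
    next
      case (Sel \<beta> k g)
      note j = justified_cut[OF R Sel.prems(1)] and b = Sel.prems(2)[unfolded nm_Sel_iff]
      show ?case
      proof (cases "\<beta> = \<gamma>")
        case False
        have j': "f1 n = 2" "f1 (f2 n) = \<beta>" "f1 (f2 (f2 n)) = k" "cutR R \<gamma> a (f2 (f2 (f2 b))) (f2 (f2 (f2 n)))"
          using j x(1,2) b False True by (auto simp: jcut_def)
        show ?thesis using j' Sel.IH[OF j'(4)] b False True by (simp add: nm_Sel_iff del: nm.simps)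
      next
        case b': True
        obtain u where u: "mem u (f2 (f2 a))" "f1 u = k" "cutR R \<gamma> (f2 u) (f2 (f2 (f2 b))) n"
          using j x(1,2) b True b' by (auto simp: jcut_def)
        have "mem (pr k (f2 u)) (f2 (f2 a))" using u(1,2) by auto
        then have "k \<in> I" "f2 u = x k" using x(3) by auto
        then have "nm v (cut (op \<gamma>) \<gamma> (F k) g) n" using IH[OF u(3)] x(4) b by simp
        then show ?thesis using True b' by simp
      qed
    qed
  qed
next
  case (Sel \<alpha> k f)
  note a = Sel.prems(2)[unfolded nm_Sel_iff]
  show ?case
  proof (cases "\<alpha> = \<gamma>")
    case False
    have j': "f1 n = 2" "f1 (f2 n) = \<alpha>" "f1 (f2 (f2 n)) = k" "cutR R \<gamma> (f2 (f2 (f2 a))) b (f2 (f2 (f2 n)))"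
      using justified_cut[OF R Sel.prems(1)] False a by (auto simp: jcut_def)
    show ?thesis using j' Sel.IH[OF j'(4)] a Sel.prems(3) False by (simp add: nm_Sel_iff del: nm.simps)
  next
    case True
    show ?thesis using Sel.prems(1,3)
    proof (induction g arbitrary: b n rule: nt.induct)
      case (Leaf m')
      then show ?case using justified_cut[OF R Leaf.prems(1)] nm_tag(1)[OF Leaf.prems(2)] a True by (simp add: jcut_def)
    next
      case S: (Sel \<beta> l g)
      note j = justified_cut[OF R S.prems(1)] and b = S.prems(2)[unfolded nm_Sel_iff]
      have j': "\<beta> \<noteq> \<gamma>" "f1 n = 2" "f1 (f2 n) = \<beta>" "f1 (f2 (f2 n)) = l" "cutR R \<gamma> a (f2 (f2 (f2 b))) (f2 (f2 (f2 n)))"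
        using j a b True by (auto simp: jcut_def)
      show ?case using j' S.IH[OF j'(5)] b True by (simp add: nm_Sel_iff del: nm.simps)
    next
      case (Par \<beta> J G)
      note j = justified_cut[OF R Par.prems(1)]
      obtain x' where x': "f1 b = 1" "f1 (f2 b) = \<beta>" "\<And>i y. mem (pr i y) (f2 (f2 b)) \<longleftrightarrow> i \<in> J \<and> y = x' i"
        "\<And>i. i \<in> J \<Longrightarrow> nm v (G i) (x' i)" using nm_ParD[OF Par.prems(2)] by metis
      show ?case
      proof (cases "\<beta> = \<gamma>")
        case False
        have j': "f1 n = 1" "f1 (f2 n) = \<beta>" "famrel (f2 (f2 b)) (f2 (f2 n)) (\<lambda>x y. cutR R \<gamma> a x y)"
          using j a x'(1,2) True False by (auto simp: jcut_def)
        obtain y where y: "\<And>i z. mem (pr i z) (f2 (f2 n)) \<longleftrightarrow> i \<in> J \<and> z = y i" "\<And>i. i \<in> J \<Longrightarrow> cutR R \<gamma> a (x' i) (y i)"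
          using famrel_graph[OF j'(3) x'(3)] by metis
        have "nm v (nt.Par \<beta> J (\<lambda>j. cut (op \<gamma>) \<gamma> (nt.Sel \<alpha> k f) (G j))) n"
          by (rule nm_ParI[OF j'(1,2) y(1)]) (rule Par.IH[OF rangeI y(2) x'(4)])
        then show ?thesis using True False by (simp del: nm.simps)
      next
        case b': True
        obtain u where u: "mem u (f2 (f2 b))" "f1 u = k" "cutR R \<gamma> (f2 (f2 (f2 a))) (f2 u) n"
          using j a x'(1,2) True b' by (auto simp: jcut_def)
        have "mem (pr k (f2 u)) (f2 (f2 b))" using u(1,2) by auto
        then have "k \<in> J" "f2 u = x' k" using x'(3) by auto
        then have "nm v (cut (op \<gamma>) \<gamma> f (G k)) n" using Sel.IH[OF u(3)] x'(4) a by simp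
        then show ?thesis using True b' by simp
      qed
    qed
  qed
qed

text \<open>\<open>v\<close> evaluates formal composites. Taken with evaluation in \<open>A\<close>
  and again with the identity, the lemma makes one code a name both of the normal form in
  \<open>A\<close> and of the formal normal form.\<close>

lemma nfR_sound:
  assumes R: "justified R" and v: "\<And>\<gamma> a b. v (pr 1 (pr \<gamma> (pr a b))) = op \<gamma> (v a) (v b)"
  shows "nfR R (tm_code t) n \<Longrightarrow> nm v (nf op (map_tm (\<lambda>x. v (pr 0 x)) t)) n"
proof (induction t arbitrary: n)
  case (Ax x)
  then show ?case using justified_nf[OF R Ax] by (simp add: jnf_def)
next
  case (Cotuple \<alpha> F)
  have j: "f1 n = 1" "f1 (f2 n) = \<alpha>" "lfamrel (fmap_code (fmmap tm_code F)) (f2 (f2 n)) (nfR R)"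
    using justified_nf[OF R Cotuple.prems] by (auto simp: jnf_def)
  obtain y where y: "\<And>i z. mem (pr i z) (f2 (f2 n)) \<longleftrightarrow> i \<in> fmdom' F \<and> z = y i"
    "\<And>i. i \<in> fmdom' F \<Longrightarrow> nfR R (tm_code (the (fmlookup F i))) (y i)"
    using lfamrel_graph[OF j(3) lmem_fmap_dom] by blast
  show ?case unfolding tm.map nf.simps fmdom'_map
  proof (rule nm_ParI[OF j(1,2) y(1)])
    fix i assume i: "i \<in> fmdom' F"
    then obtain f where f: "fmlookup F i = Some f" by (auto simp: fmlookup_dom'_iff)
    show "nm v (the (fmlookup (fmmap (nf op) (fmmap (map_tm (\<lambda>x. v (pr 0 x))) F)) i)) (y i)"
      using Cotuple.IH[OF fmran'I[OF f]] y(2)[OF i] by (simp add: f)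
  qed
next
  case (Tuple \<alpha> F)
  have j: "f1 n = 1" "f1 (f2 n) = \<alpha>" "lfamrel (fmap_code (fmmap tm_code F)) (f2 (f2 n)) (nfR R)"
    using justified_nf[OF R Tuple.prems] by (auto simp: jnf_def)
  obtain y where y: "\<And>i z. mem (pr i z) (f2 (f2 n)) \<longleftrightarrow> i \<in> fmdom' F \<and> z = y i"
    "\<And>i. i \<in> fmdom' F \<Longrightarrow> nfR R (tm_code (the (fmlookup F i))) (y i)"
    using lfamrel_graph[OF j(3) lmem_fmap_dom] by blast
  show ?case unfolding tm.map nf.simps fmdom'_map
  proof (rule nm_ParI[OF j(1,2) y(1)])
    fix i assume i: "i \<in> fmdom' F"
    then obtain f where f: "fmlookup F i = Some f" by (auto simp: fmlookup_dom'_iff)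
    show "nm v (the (fmlookup (fmmap (nf op) (fmmap (map_tm (\<lambda>x. v (pr 0 x))) F)) i)) (y i)"
      using Tuple.IH[OF fmran'I[OF f]] y(2)[OF i] by (simp add: f)
  qed
next
  case (Project \<alpha> k f)
  then show ?case using justified_nf[OF R Project.prems] by (auto simp: jnf_def nm_Sel_iff simp del: nm.simps)
next
  case (Inject \<alpha> k f)
  then show ?case using justified_nf[OF R Inject.prems] by (auto simp: jnf_def nm_Sel_iff simp del: nm.simps)
next
  case (Cut f \<gamma> g)
  obtain a b where "nfR R (tm_code f) a" "nfR R (tm_code g) b" "cutR R \<gamma> a b n"
    using justified_nf[OF R Cut.prems] by (auto simp: jnf_def)
  then show ?case using cutR_sound[where v = v and op = op, OF R v] Cut.IH by (simp del: nm.simps)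
qed

section \<open>Certificates exist for derivations\<close>

lemma mem_encode[simp]: "finite X \<Longrightarrow> mem z (set_encode X) \<longleftrightarrow> z \<in> X"
  by (simp add: mem_def)

abbreviation sub :: "nat \<Rightarrow> nat \<Rightarrow> bool" where "sub R R' \<equiv> \<forall>z. mem z R \<longrightarrow> mem z R'"

lemma sub_le: "sub R R' \<Longrightarrow> R \<le> R'"
  by (rule subset_decode_imp_le) (auto simp: mem_def)

lemma famrel_mono: "famrel F N Q \<Longrightarrow> (\<And>x y. Q x y \<Longrightarrow> Q' x y) \<Longrightarrow> famrel F N Q'"
  unfolding famrel_iff by blast

lemma lfamrel_mono: "lfamrel F N Q \<Longrightarrow> (\<And>x y. Q x y \<Longrightarrow> Q' x y) \<Longrightarrow> lfamrel F N Q'"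
  unfolding lfamrel_iff by blast

lemma cutR_mono: "sub R R' \<Longrightarrow> cutR R \<gamma> a b n \<Longrightarrow> cutR R' \<gamma> a b n"
  by (simp add: cutR_def)

lemma nfR_mono: "sub R R' \<Longrightarrow> nfR R a n \<Longrightarrow> nfR R' a n"
  by (simp add: nfR_def)

lemma jcut_mono:
  assumes "sub R R'" "jcut R \<gamma> a b n"
  shows "jcut R' \<gamma> a b n"
proof -
  note m = cutR_mono[OF assms(1)]
  have f: "famrel F N (\<lambda>x y. cutR R \<gamma> x b y) \<Longrightarrow> famrel F N (\<lambda>x y. cutR R' \<gamma> x b y)"
    "famrel F N (\<lambda>x y. cutR R \<gamma> a x y) \<Longrightarrow> famrel F N (\<lambda>x y. cutR R' \<gamma> a x y)" for F N
    by (erule famrel_mono, erule m)+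
  show ?thesis using assms(2) unfolding jcut_def
    by - (elim disj_forward conj_forward ex_forward; (assumption | erule f | erule m))
qed

lemma jnf_mono:
  assumes "sub R R'" "jnf R c n"
  shows "jnf R' c n"
proof -
  note m = cutR_mono[OF assms(1)] nfR_mono[OF assms(1)]
  have f: "lfamrel F N (nfR R) \<Longrightarrow> lfamrel F N (nfR R')" for F N
    by (erule lfamrel_mono, erule m)
  have "R \<le> R'" by (rule sub_le[OF assms(1)])
  then have l: "(\<exists>a<R. \<exists>b<R. P a b) \<Longrightarrow> (\<And>a b. P a b \<Longrightarrow> P' a b) \<Longrightarrow> (\<exists>a<R'. \<exists>b<R'. P' a b)" for P P'
    by (meson less_le_trans)
  show ?thesis using assms(2) unfolding jnf_def
    apply (elim disjE conjE)
    subgoal by blast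
    subgoal using f by blast
    subgoal using f by blast
    subgoal using m by blast
    subgoal using m by blast
    subgoal
      apply (intro disjI2 conjI)
       apply assumption
      apply (erule l)
      using m by blast
    done
qed

definition okclaim :: "nat \<Rightarrow> nat \<Rightarrow> bool" where
  "okclaim R z \<longleftrightarrow>
     (f1 z = 0 \<longrightarrow> jnf R (f1 (f2 z)) (f2 (f2 z))) \<and>
     (f1 z \<noteq> 0 \<longrightarrow> jcut R (f1 (f2 z)) (f1 (f2 (f2 z))) (f1 (f2 (f2 (f2 z)))) (f2 (f2 (f2 (f2 z)))))"

lemma justified_alt: "justified R \<longleftrightarrow> (\<forall>z. mem z R \<longrightarrow> okclaim R z)"
  unfolding justified_def okclaim_def using mem_less by blast

lemma okclaim_mono: "sub R R' \<Longrightarrow> okclaim R z \<Longrightarrow> okclaim R' z"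
  unfolding okclaim_def using jcut_mono jnf_mono by blast

text \<open>Justification by claims of a set persists when the set grows, so certificates for
  several subterms can be merged.\<close>

lemma justified_union:
  assumes "finite I" "\<And>i. i \<in> I \<Longrightarrow> justified (R i)"
  shows "\<exists>R'. justified R' \<and> (\<forall>i\<in>I. sub (R i) R')"
proof (intro exI conjI ballI)
  let ?R = "set_encode (\<Union>i\<in>I. set_decode (R i))"
  have f: "finite (\<Union>i\<in>I. set_decode (R i))" using assms(1) by auto
  show s: "sub (R i) ?R" if "i \<in> I" for i using f that by (auto simp: mem_def)
  show "justified ?R" unfolding justified_alt
  proof (intro allI impI)
    fix z assume "mem z ?R"
    then obtain i where i: "i \<in> I" "mem z (R i)" using f by (auto simp: mem_def)
    then have "okclaim (R i) z" using assms(2) by (auto simp: justified_alt)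
    then show "okclaim ?R z" by (rule okclaim_mono[OF s[OF i(1)]])
  qed
qed

lemma justified_insert:
  assumes "justified R" "okclaim R z"
  shows "\<exists>R'. justified R' \<and> sub R R' \<and> mem z R'"
proof (intro exI conjI)
  let ?R = "set_encode (insert z (set_decode R))"
  show s: "sub R ?R" and "mem z ?R" by (auto simp: mem_def)
  show "justified ?R" unfolding justified_alt
  proof (intro allI impI)
    fix w assume "mem w ?R"
    then have "okclaim R w" using assms by (auto simp: justified_alt mem_def)
    then show "okclaim ?R w" by (rule okclaim_mono[OF s])
  qed
qed

lemma justified_insert_cut:
  assumes "justified R" "jcut R \<gamma> a b n"
  shows "\<exists>R'. justified R' \<and> cutR R' \<gamma> a b n"
  using justified_insert[OF assms(1), of "pr 1 (pr \<gamma> (pr a (pr b n)))"] assms(2)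
  by (auto simp: okclaim_def cutR_def)

lemma justified_insert_nf:
  assumes "justified R" "jnf R c n"
  shows "\<exists>R'. justified R' \<and> nfR R' c n"
  using justified_insert[OF assms(1), of "pr 0 (pr c n)"] assms(2)
  by (auto simp: okclaim_def nfR_def)

definition fcode :: "nat set \<Rightarrow> (nat \<Rightarrow> nat) \<Rightarrow> nat" where
  "fcode I y = set_encode ((\<lambda>i. pr i (y i)) ` I)"

lemma mem_fcode[simp]: "finite I \<Longrightarrow> mem (pr i z) (fcode I y) \<longleftrightarrow> i \<in> I \<and> z = y i"
  by (auto simp: fcode_def)

text \<open>A family has finitely many branches, so the certificates of the branches merge into a
  single one that serves them all.\<close>

lemma justified_fam:
  assumes "finite I" and Q: "\<And>i y R R'. Q R i y \<Longrightarrow> sub R R' \<Longrightarrow> Q R' i y"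
    and e: "\<And>i. i \<in> I \<Longrightarrow> \<exists>R y. justified R \<and> Q R i y"
  shows "\<exists>R y. justified R \<and> (\<forall>i\<in>I. Q R i (y i))"
proof -
  obtain R y where R: "\<forall>i\<in>I. justified (R i) \<and> Q (R i) i (y i)" using e by metis
  obtain R' where "justified R'" "\<forall>i\<in>I. sub (R i) R'" using justified_union[OF assms(1), of R] R by blast
  then show ?thesis using R Q by blast
qed

text \<open>Here typing enters: it guarantees that some clause of \<open>jcut\<close> applies at
  every stage, so the recursion never gets stuck.\<close>

lemma cutR_exists:
  assumes "atomic lt" "cc s \<gamma> S1 S2" "ty lt S1 f" "ty lt S2 g" "nm v f a" "nm v g b"
  shows "\<exists>R n. justified R \<and> cutR R \<gamma> a b n"
  using assms
proof (induction arbitrary: a b rule: cut_induct)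
  case (ParL S1 S2 \<alpha> F g)
  obtain x where x: "f1 a = 1" "f1 (f2 a) = \<alpha>" "\<And>i y. mem (pr i y) (f2 (f2 a)) \<longleftrightarrow> i \<in> idx S1 \<alpha> \<and> y = x i"
    "\<And>i. i \<in> idx S1 \<alpha> \<Longrightarrow> nm v (F i) (x i)" using nm_ParD[OF ParL.prems(1)] by metis
  obtain R y where R: "justified R" and y: "\<forall>i\<in>idx S1 \<alpha>. cutR R \<gamma> (x i) b (y i)"
  proof -
    have "\<exists>R y. justified R \<and> (\<forall>i\<in>idx S1 \<alpha>. cutR R \<gamma> (x i) b (y i))"
    proof (rule justified_fam[where Q = "\<lambda>R i y. cutR R \<gamma> (x i) b y", OF finite_idx])
      show "\<exists>R y. justified R \<and> cutR R \<gamma> (x i) b y" if "i \<in> idx S1 \<alpha>" for i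
        by (rule ParL.IH[OF that x(4)[OF that] ParL.prems(2)])
    qed (rule cutR_mono)
    then show thesis using that by blast
  qed
  have "jcut R \<gamma> a b (parc \<alpha> (fcode (idx S1 \<alpha>) y))"
    using x y ParL(4) by (auto simp: jcut_def famrel_iff)
  then show ?case using justified_insert_cut[OF R] by blast
next
  case (SelL S1 S2 \<alpha> k f g)
  note a = SelL.prems(1)[unfolded nm_Sel_iff]
  obtain R n where R: "justified R" "cutR R \<gamma> (f2 (f2 (f2 a))) b n" using SelL.IH[of "f2 (f2 (f2 a))" b] SelL.prems(2) a by blast
  have "jcut R \<gamma> a b (selc \<alpha> k n)" using a R(2) SelL(4) by (auto simp: jcut_def)
  then show ?case using justified_insert_cut[OF R(1)] by blast
next
  case (ParR S1 S2 f \<beta> G)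
  have bl: "f1 a = 0 \<or> f1 (f2 a) = \<gamma>" using ParR(4) ParR.prems(1) by (cases f) (auto dest: nm_tag)
  obtain x where x: "f1 b = 1" "f1 (f2 b) = \<beta>" "\<And>i y. mem (pr i y) (f2 (f2 b)) \<longleftrightarrow> i \<in> idx S2 \<beta> \<and> y = x i"
    "\<And>i. i \<in> idx S2 \<beta> \<Longrightarrow> nm v (G i) (x i)" using nm_ParD[OF ParR.prems(2)] by metis
  obtain R y where R: "justified R" and y: "\<forall>i\<in>idx S2 \<beta>. cutR R \<gamma> a (x i) (y i)"
  proof -
    have "\<exists>R y. justified R \<and> (\<forall>i\<in>idx S2 \<beta>. cutR R \<gamma> a (x i) (y i))"
    proof (rule justified_fam[where Q = "\<lambda>R i y. cutR R \<gamma> a (x i) y", OF finite_idx])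
      show "\<exists>R y. justified R \<and> cutR R \<gamma> a (x i) y" if "i \<in> idx S2 \<beta>" for i
        by (rule ParR.IH[OF that ParR.prems(1) x(4)[OF that]])
    qed (rule cutR_mono)
    then show thesis using that by blast
  qed
  have "jcut R \<gamma> a b (parc \<beta> (fcode (idx S2 \<beta>) y))"
    using x y ParR(5) bl by (auto simp: jcut_def famrel_iff)
  then show ?case using justified_insert_cut[OF R] by blast
next
  case (SelR S1 S2 f \<beta> k g)
  have bl: "f1 a = 0 \<or> f1 (f2 a) = \<gamma>" using SelR(4) SelR.prems(1) by (cases f) (auto dest: nm_tag)
  note b = SelR.prems(2)[unfolded nm_Sel_iff]
  obtain R n where R: "justified R" "cutR R \<gamma> a (f2 (f2 (f2 b))) n" using SelR.IH[of a "f2 (f2 (f2 b))"] SelR.prems(1) b by blast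
  have "jcut R \<gamma> a b (selc \<beta> k n)" using b bl R(2) SelR(5) by (auto simp: jcut_def)
  then show ?case using justified_insert_cut[OF R(1)] by blast
next
  case (LeafLeaf S1 S2 p q)
  have "justified 0" by (simp add: justified_def)
  moreover have "jcut 0 \<gamma> a b (leafc (pr 1 (pr \<gamma> (pr (f2 a) (f2 b)))))"
    using LeafLeaf.prems by (simp only: jcut_def) (auto dest: nm_tag)
  ultimately show ?case using justified_insert_cut by blast
next
  case (SelPar S1 S2 k f G)
  note a = SelPar.prems(1)[unfolded nm_Sel_iff]
  obtain x where x: "f1 b = 1" "f1 (f2 b) = \<gamma>" "\<And>i y. mem (pr i y) (f2 (f2 b)) \<longleftrightarrow> i \<in> idx S1 \<gamma> \<and> y = x i"
    "\<And>i. i \<in> idx S1 \<gamma> \<Longrightarrow> nm v (G i) (x i)" using nm_ParD[OF SelPar.prems(2)] by metis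
  have k: "k \<in> idx S1 \<gamma>" using SelPar(2) by simp
  obtain R n where R: "justified R" "cutR R \<gamma> (f2 (f2 (f2 a))) (x k) n" using SelPar.IH[of "f2 (f2 (f2 a))" "x k"] x(4)[OF k] a by blast
  have "mem (pr k (x k)) (f2 (f2 b))" using x(3) k by simp
  then have "\<exists>u<f2 (f2 b). mem u (f2 (f2 b)) \<and> f1 u = k \<and> cutR R \<gamma> (f2 (f2 (f2 a))) (f2 u) n"
    using R(2) mem_less by (intro exI[of _ "pr k (x k)"]) auto
  then have "jcut R \<gamma> a b n" unfolding jcut_def using a x(1,2)
    by - (rule disjI2, rule disjI2, rule disjI2, rule disjI2, rule disjI2, rule disjI1, simp)
  then show ?case using justified_insert_cut[OF R(1)] by blast
next
  case (ParSel S1 S2 k F g)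
  note b = ParSel.prems(2)[unfolded nm_Sel_iff]
  obtain x where x: "f1 a = 1" "f1 (f2 a) = \<gamma>" "\<And>i y. mem (pr i y) (f2 (f2 a)) \<longleftrightarrow> i \<in> idx S1 \<gamma> \<and> y = x i"
    "\<And>i. i \<in> idx S1 \<gamma> \<Longrightarrow> nm v (F i) (x i)" using nm_ParD[OF ParSel.prems(1)] by metis
  have k: "k \<in> idx S1 \<gamma>" by (rule ParSel(4))
  obtain R n where R: "justified R" "cutR R \<gamma> (x k) (f2 (f2 (f2 b))) n" using ParSel.IH[of "x k" "f2 (f2 (f2 b))"] x(4)[OF k] b by blast
  have "mem (pr k (x k)) (f2 (f2 a))" using x(3) k by simp
  then have "\<exists>u<f2 (f2 a). mem u (f2 (f2 a)) \<and> f1 u = k \<and> cutR R \<gamma> (f2 u) (f2 (f2 (f2 b))) n"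
    using R(2) mem_less by (intro exI[of _ "pr k (x k)"]) auto
  then have "jcut R \<gamma> a b n" unfolding jcut_def using b x(1,2)
    by - (rule disjI2, rule disjI2, rule disjI2, rule disjI2, rule disjI2, rule disjI2, simp)
  then show ?case using justified_insert_cut[OF R(1)] by blast
qed

context symmetric_polycategory
begin

lemma nfR_exists:
  assumes "derives A \<Gamma> \<Delta> s" "s = map_tm (\<lambda>x. v (pr 0 x)) t"
    and v: "\<And>\<gamma> a b. v (pr 1 (pr \<gamma> (pr a b))) = Comp A \<gamma> (v a) (v b)"
  shows "\<exists>R n. justified R \<and> nfR R (tm_code t) n"
  using assms(1,2)
proof (induction arbitrary: t rule: derives.induct)
  case (derives_Ax f)
  then obtain x where t: "t = Ax x" by (cases t) auto
  have "justified 0" by (simp add: justified_def)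
  moreover have "jnf 0 (tm_code t) (leafc (pr 0 x))" by (simp add: t jnf_def)
  ultimately show ?case using justified_insert_nf by blast
next
  case (derives_Cotuple \<alpha> \<Gamma> Xs \<Delta> F)
  obtain F' where t: "t = Cotuple \<alpha> F'" "F = fmmap (map_tm (\<lambda>x. v (pr 0 x))) F'"
    using derives_Cotuple.prems by (cases t) auto
  have D: "fmdom' F' = fmdom' Xs" using derives_Cotuple.hyps(3) by (simp add: t)
  have e: "\<exists>R n. justified R \<and> nfR R (tm_code (the (fmlookup F' i))) n" if i: "i \<in> fmdom' F'" for i
  proof -
    obtain X f where X: "fmlookup Xs i = Some X" "fmlookup F' i = Some f"
      using fmdom'_eqE[OF i[unfolded D] D] by blast
    show ?thesis using derives_Cotuple.IH[OF X(1) _ refl] X(2) by (simp add: t)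
  qed
  obtain R y where R: "justified R" and y: "\<forall>i\<in>fmdom' F'. nfR R (tm_code (the (fmlookup F' i))) (y i)"
  proof -
    have "\<exists>R y. justified R \<and> (\<forall>i\<in>fmdom' F'. nfR R (tm_code (the (fmlookup F' i))) (y i))"
      by (rule justified_fam[where Q = "\<lambda>R i y. nfR R (tm_code (the (fmlookup F' i))) y", OF finite_fmdom'])
        (rule nfR_mono, assumption+, rule e)
    then show thesis using that by blast
  qed
  have "jnf R (tm_code t) (parc \<alpha> (fcode (fmdom' F') y))"
    using y by (simp add: t jnf_def lfamrel_iff lmem_fmap_dom)
  then show ?case using justified_insert_nf[OF R] by blast
next
  case (derives_Tuple \<alpha> \<Delta> \<Gamma> Xs F)
  obtain F' where t: "t = Tuple \<alpha> F'" "F = fmmap (map_tm (\<lambda>x. v (pr 0 x))) F'"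
    using derives_Tuple.prems by (cases t) auto
  have D: "fmdom' F' = fmdom' Xs" using derives_Tuple.hyps(3) by (simp add: t)
  have e: "\<exists>R n. justified R \<and> nfR R (tm_code (the (fmlookup F' i))) n" if i: "i \<in> fmdom' F'" for i
  proof -
    obtain X f where X: "fmlookup Xs i = Some X" "fmlookup F' i = Some f"
      using fmdom'_eqE[OF i[unfolded D] D] by blast
    show ?thesis using derives_Tuple.IH[OF X(1) _ refl] X(2) by (simp add: t)
  qed
  obtain R y where R: "justified R" and y: "\<forall>i\<in>fmdom' F'. nfR R (tm_code (the (fmlookup F' i))) (y i)"
  proof -
    have "\<exists>R y. justified R \<and> (\<forall>i\<in>fmdom' F'. nfR R (tm_code (the (fmlookup F' i))) (y i))"
      by (rule justified_fam[where Q = "\<lambda>R i y. nfR R (tm_code (the (fmlookup F' i))) y", OF finite_fmdom'])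
        (rule nfR_mono, assumption+, rule e)
    then show thesis using that by blast
  qed
  have "jnf R (tm_code t) (parc \<alpha> (fcode (fmdom' F') y))"
    using y by (simp add: t jnf_def lfamrel_iff lmem_fmap_dom)
  then show ?case using justified_insert_nf[OF R] by blast
next
  case (derives_Project \<alpha> \<Gamma> Xs \<Delta> k X f)
  obtain f' where t: "t = Project \<alpha> k f'" "f = map_tm (\<lambda>x. v (pr 0 x)) f'"
    using derives_Project.prems by (cases t) auto
  obtain R n where R: "justified R" "nfR R (tm_code f') n" using derives_Project.IH[OF t(2)] by blast
  have "jnf R (tm_code t) (selc \<alpha> k n)" using R(2) by (simp add: t jnf_def)
  then show ?case using justified_insert_nf[OF R(1)] by blast
next
  case (derives_Inject \<alpha> \<Delta> \<Gamma> Xs k X f)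
  obtain f' where t: "t = Inject \<alpha> k f'" "f = map_tm (\<lambda>x. v (pr 0 x)) f'"
    using derives_Inject.prems by (cases t) auto
  obtain R n where R: "justified R" "nfR R (tm_code f') n" using derives_Inject.IH[OF t(2)] by blast
  have "jnf R (tm_code t) (selc \<alpha> k n)" using R(2) by (simp add: t jnf_def)
  then show ?case using justified_insert_nf[OF R(1)] by blast
next
  case (derives_Cut \<gamma> \<Gamma> \<Delta> \<Gamma>' \<Delta>' Z f g)
  obtain f' g' where t: "t = Cut f' \<gamma> g'" "f = map_tm (\<lambda>x. v (pr 0 x)) f'" "g = map_tm (\<lambda>x. v (pr 0 x)) g'"
    using derives_Cut.prems by (cases t) auto
  note w = sqn_cut[OF derives_wf[OF derives_Cut(4)] derives_wf[OF derives_Cut(5)] derives_Cut(1-3)]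
  obtain R1 a where R1: "justified R1" "nfR R1 (tm_code f') a" using derives_Cut.IH(1)[OF t(2)] by blast
  obtain R2 b where R2: "justified R2" "nfR R2 (tm_code g') b" using derives_Cut.IH(2)[OF t(3)] by blast
  \<comment> \<open>Soundness identifies the codes found for the premises as names of typed terms,
    which is what the existence of a certificate for the cut requires.\<close>
  have n: "nm v (nfA f) a" "nm v (nfA g) b"
    using nfR_sound[where v = v and op = "Comp A", OF R1(1) v R1(2)] nfR_sound[where v = v and op = "Comp A", OF R2(1) v R2(2)] t by simp_all
  obtain R3 n where R3: "justified R3" "cutR R3 \<gamma> a b n"
    using cutR_exists[OF atomic_rl w(1) nfA_ty[OF derives_Cut(4)] nfA_ty[OF derives_Cut(5)] n] by blast
  obtain R where R: "justified R" "sub R1 R" "sub R2 R" "sub R3 R"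
    using justified_union[of "{R1, R2, R3}" "\<lambda>R. R"] R1(1) R2(1) R3(1) by auto
  have m: "nfR R (tm_code f') a" "nfR R (tm_code g') b" "cutR R \<gamma> a b n"
    using nfR_mono[OF R(2) R1(2)] nfR_mono[OF R(3) R2(2)] cutR_mono[OF R(4) R3(2)] by auto
  \<comment> \<open>The bounded quantifiers in the cut clause of \<open>jnf\<close> are met because
    \<open>R\<close> contains the claims that mention \<open>a\<close> and \<open>b\<close>, and so
    exceeds both.\<close>
  have "pr 0 (pr (tm_code f') a) < R" "pr 0 (pr (tm_code g') b) < R" using m(1,2) mem_less by (auto simp: nfR_def)
  then have "a < R" "b < R"
    by (meson le_prod_encode_2 le_less_trans)+
  then have "jnf R (tm_code t) n" using m by (auto simp: t jnf_def)
  then show ?case using justified_insert_nf[OF R(1)] by blast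
qed

end

subsection \<open>Codes of sequents\<close>

definition sc :: "nat sq \<Rightarrow> nat" where
  "sc S = set_encode {pr \<alpha> (pr (of_bool s) (fm_code X)) | \<alpha> s X. S \<alpha> = Some (s, X)}"

text \<open>Codes of atoms are replaced by the atoms they name. Several coded sequents may have the
  same image; kinds and index sets do not change, so the program can work with the coded
  one.\<close>

definition rs :: "(nat \<Rightarrow> 'o) \<Rightarrow> nat sq \<Rightarrow> 'o sq" where
  "rs obj S = (\<lambda>c. map_option (map_prod id (map_fm obj)) (S c))"

text \<open>An entry is the side (0 left, 1 right) paired with a formula code (1 sum, 2 product).
  Sums on the left and products on the right have the invertible rule; \<open>syn\<close> describes
  the other two combinations.\<close>

definition asy :: "nat \<Rightarrow> bool" where
  "asy y \<longleftrightarrow> f1 y = 0 \<and> f1 (f2 y) = 1 \<or> f1 y = 1 \<and> f1 (f2 y) = 2"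

definition syn :: "nat \<Rightarrow> bool" where
  "syn y \<longleftrightarrow> f1 y = 0 \<and> f1 (f2 y) = 2 \<or> f1 y = 1 \<and> f1 (f2 y) = 1"

text \<open>Removes one binary digit and sets another, which replaces the entry at
  \<open>\<alpha>\<close>. A coded sequent has only one entry per channel, so no carry
  occurs.\<close>

definition upd :: "nat \<Rightarrow> nat \<Rightarrow> nat \<Rightarrow> nat \<Rightarrow> nat" where
  "upd S \<alpha> y X = S - 2 ^ pr \<alpha> y + 2 ^ pr \<alpha> (pr (f1 y) X)"

abbreviation "bl y \<equiv> f2 (f2 y)"

lemma fm_code_inj: "fm_code X = fm_code Y \<Longrightarrow> X = Y"
proof -
  have fc: "m = m'" if e: "fmap_code (fmmap fm_code m) = fmap_code (fmmap fm_code m')"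
    and IH: "\<And>Z Z'. Z \<in> fmran' m \<Longrightarrow> fm_code Z = fm_code Z' \<Longrightarrow> Z = Z'" for m m'
  proof (rule fmap_ext)
    fix i
    have e': "fmlookup (fmmap fm_code m) i = Some x \<longleftrightarrow> fmlookup (fmmap fm_code m') i = Some x" for x
      using lmem_fmap[of i x "fmmap fm_code m"] lmem_fmap[of i x "fmmap fm_code m'"] e by simp
    show "fmlookup m i = fmlookup m' i"
    proof (cases "fmlookup m i")
      case None
      then show ?thesis using e' by (cases "fmlookup m' i") auto
    next
      case (Some Z)
      then obtain Z' where Z': "fmlookup m' i = Some Z'" "fm_code Z = fm_code Z'" using e'[of "fm_code Z"] by auto
      then show ?thesis using IH[OF fmran'I[OF Some]] Some by simp
    qed
  qed
  show "fm_code X = fm_code Y \<Longrightarrow> X = Y"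
  proof (induction X arbitrary: Y)
    case (Atom x)
    then show ?case by (cases Y) auto
  next
    case (Sum m)
    then show ?case by (cases Y) (auto intro: fc)
  next
    case (Prod m)
    then show ?case by (cases Y) (auto intro: fc)
  qed
qed

lemma finite_sc: "finite (dom S) \<Longrightarrow> finite {pr \<alpha> (pr (of_bool s) (fm_code X)) | \<alpha> s X. S \<alpha> = Some (s, X)}"
proof -
  assume "finite (dom S)"
  moreover have "{pr \<alpha> (pr (of_bool s) (fm_code X)) | \<alpha> s X. S \<alpha> = Some (s, X)} \<subseteq>
     (\<lambda>\<alpha>. case the (S \<alpha>) of (s, X) \<Rightarrow> pr \<alpha> (pr (of_bool s) (fm_code X))) ` dom S"
    by force
  ultimately show ?thesis by (meson finite_imageI finite_subset)
qed

lemma mem_sc: "finite (dom S) \<Longrightarrow> mem (pr \<alpha> y) (sc S) \<longleftrightarrow> (\<exists>s X. S \<alpha> = Some (s, X) \<and> y = pr (of_bool s) (fm_code X))"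
  unfolding mem_def sc_def by (subst set_encode_inverse[OF finite_sc]) auto

text \<open>From the code of a sequent the codes of its atoms can be recovered. Thus leaves met at
  the same number have literally the same coded sequent, which is what makes the equality test
  applicable to them.\<close>

lemma sc_inj: "finite (dom S) \<Longrightarrow> finite (dom S') \<Longrightarrow> sc S = sc S' \<Longrightarrow> S = S'"
proof
  fix \<alpha>
  assume f: "finite (dom S)" "finite (dom S')" "sc S = sc S'"
  have e: "(\<exists>s X. S \<alpha> = Some (s, X) \<and> y = pr (of_bool s) (fm_code X)) \<longleftrightarrow>
      (\<exists>s X. S' \<alpha> = Some (s, X) \<and> y = pr (of_bool s) (fm_code X))" for y
    using mem_sc[OF f(1), of \<alpha> y] mem_sc[OF f(2), of \<alpha> y] f(3) by simp
  show "S \<alpha> = S' \<alpha>"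
  proof (cases "S \<alpha>")
    case None
    show ?thesis
    proof (cases "S' \<alpha>")
      case (Some p)
      then show ?thesis using e[of "pr (of_bool (fst p)) (fm_code (snd p))"] None by (cases p) auto
    qed (use None in simp)
  next
    case (Some p)
    obtain s X where p: "p = (s, X)" by (cases p)
    obtain s' X' where "S' \<alpha> = Some (s', X')" "of_bool s = (of_bool s' :: nat)" "fm_code X = fm_code X'"
      using e[of "pr (of_bool s) (fm_code X)"] Some p by auto
    moreover from this(2) have "s = s'" by (simp only: of_bool_eq_iff)
    ultimately show ?thesis using Some p fm_code_inj by simp
  qed
qed

lemma asy_code: "asy (pr (of_bool s) (fm_code X)) \<longleftrightarrow> kind (s, X) = Some True"
  and syn_code: "syn (pr (of_bool s) (fm_code X)) \<longleftrightarrow> kind (s, X) = Some False"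
  by (cases X; cases s; simp add: asy_def syn_def)+

lemma bl_code: "kind (s, X) \<noteq> None \<Longrightarrow>
    lmem (pr k x) (bl (pr (of_bool s) (fm_code X))) \<longleftrightarrow> (\<exists>Y. fmlookup (branches X) k = Some Y \<and> x = fm_code Y)"
  by (cases X) (auto simp: lmem_fmap)

lemma upd_sc:
  assumes f: "finite (dom S)" and S: "S \<alpha> = Some (s, X)" "fmlookup (branches X) k = Some Y"
  shows "upd (sc S) \<alpha> (pr (of_bool s) (fm_code X)) (fm_code Y) = sc (nxt S \<alpha> k)"
proof -
  \<comment> \<open>The part of the sequent away from \<open>\<alpha>\<close> is split off, so that
    the old and the new code are the same number plus one power of two each.\<close>
  define A where "A T = {w. \<exists>s X. T (f1 w) = Some (s, X) \<and> f2 w = pr (of_bool s) (fm_code X)}" for T :: "nat sq"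
  have set_A: "{pr \<alpha>' (pr (of_bool s) (fm_code X)) | \<alpha>' s X. T \<alpha>' = Some (s, X)} = A T" for T
  proof (intro set_eqI iffI)
    fix w assume "w \<in> A T"
    then obtain s X where "T (f1 w) = Some (s, X)" "f2 w = pr (of_bool s) (fm_code X)" by (auto simp: A_def)
    moreover from this(2) have "w = pr (f1 w) (pr (of_bool s) (fm_code X))" by (metis pr_f)
    ultimately show "w \<in> {pr \<alpha>' (pr (of_bool s) (fm_code X)) | \<alpha>' s X. T \<alpha>' = Some (s, X)}" by blast
  next
    fix w assume "w \<in> {pr \<alpha>' (pr (of_bool s) (fm_code X)) | \<alpha>' s X. T \<alpha>' = Some (s, X)}"
    then obtain \<alpha>' s X where "w = pr \<alpha>' (pr (of_bool s) (fm_code X))" "T \<alpha>' = Some (s, X)" by blast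
    then have "T (f1 w) = Some (s, X) \<and> f2 w = pr (of_bool s) (fm_code X)" by simp
    then show "w \<in> A T" unfolding A_def by blast
  qed
  have sc: "sc T = set_encode (A T)" for T
    unfolding sc_def set_A ..
  have fA: "finite (A (S(\<alpha> := None)))"
  proof -
    have "finite (dom (S(\<alpha> := None)))" by (rule finite_subset[OF _ f]) (auto split: if_splits)
    from finite_sc[OF this] show ?thesis unfolding set_A .
  qed
  have ins: "A (S(\<alpha> \<mapsto> (s, Z))) = insert (pr \<alpha> (pr (of_bool s) (fm_code Z))) (A (S(\<alpha> := None)))" for Z
  proof (rule set_eqI)
    fix w
    have "w = pr \<alpha> (pr (of_bool s) (fm_code Z)) \<longleftrightarrow> f1 w = \<alpha> \<and> f2 w = pr (of_bool s) (fm_code Z)"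
      by (metis f1_pr f2_pr pr_f)
    then show "w \<in> A (S(\<alpha> \<mapsto> (s, Z))) \<longleftrightarrow> w \<in> insert (pr \<alpha> (pr (of_bool s) (fm_code Z))) (A (S(\<alpha> := None)))"
      unfolding insert_iff A_def mem_Collect_eq by (cases "f1 w = \<alpha>") simp_all
  qed
  have new: "pr \<alpha> z \<notin> A (S(\<alpha> := None))" for z by (simp add: A_def)
  have code: "sc (S(\<alpha> \<mapsto> (s, Z))) = 2 ^ pr \<alpha> (pr (of_bool s) (fm_code Z)) + set_encode (A (S(\<alpha> := None)))" for Z
    unfolding sc ins by (rule set_encode_insert[OF fA new])
  have "S = S(\<alpha> \<mapsto> (s, X))" using S(1) by auto
  then have 1: "sc S = 2 ^ pr \<alpha> (pr (of_bool s) (fm_code X)) + set_encode (A (S(\<alpha> := None)))"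
    using code[of X] by simp
  have n: "nxt S \<alpha> k = S(\<alpha> \<mapsto> (s, Y))" using S by (simp add: nxt_def)
  show ?thesis unfolding upd_def 1 n code by simp
qed

lemma knd_rs[simp]: "knd (rs obj S) \<alpha> = knd S \<alpha>"
proof (cases "S \<alpha>")
  case (Some p)
  then show ?thesis by (cases p; cases "snd p") (auto simp: knd_def rs_def)
qed (simp add: knd_def rs_def)

lemma branches_map: "branches (map_fm g X) = fmmap (map_fm g) (branches X)"
  by (cases X) auto

lemma idx_rs[simp]: "idx (rs obj S) \<alpha> = idx S \<alpha>"
  by (auto simp: idx_def rs_def branches_map split: option.splits)

lemma nxt_rs[simp]: "k \<in> idx S \<alpha> \<Longrightarrow> nxt (rs obj S) \<alpha> k = rs obj (nxt S \<alpha> k)"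
  by (cases "S \<alpha>") (auto simp: nxt_def rs_def idx_def branches_map fmlookup_dom'_iff fun_eq_iff)

lemma sc_async:
  assumes f: "finite (dom S)"
  shows "(mem (pr \<alpha> y) (sc S) \<and> asy y) \<Longrightarrow> knd S \<alpha> = Some True"
    and "(mem (pr \<alpha> y) (sc S) \<and> syn y) \<Longrightarrow> knd S \<alpha> = Some False"
    and "(mem (pr \<alpha> y) (sc S) \<and> (asy y \<or> syn y)) \<Longrightarrow> lmem (pr k x) (bl y) \<Longrightarrow>
       k \<in> idx S \<alpha> \<and> upd (sc S) \<alpha> y x = sc (nxt S \<alpha> k)"
    and "mem (pr \<alpha> y) (sc S) \<and> (asy y \<or> syn y) \<Longrightarrow> k \<in> idx S \<alpha> \<Longrightarrow> \<exists>x. lmem (pr k x) (bl y)"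
proof -
  have *: "\<exists>s X. S \<alpha> = Some (s, X) \<and> y = pr (of_bool s) (fm_code X)" if "mem (pr \<alpha> y) (sc S)"
    using that mem_sc[OF f] by simp
  show "(mem (pr \<alpha> y) (sc S) \<and> asy y) \<Longrightarrow> knd S \<alpha> = Some True"
    "(mem (pr \<alpha> y) (sc S) \<and> syn y) \<Longrightarrow> knd S \<alpha> = Some False"
    using * asy_code syn_code by (auto simp: knd_def)
  assume "mem (pr \<alpha> y) (sc S) \<and> (asy y \<or> syn y)"
  then obtain s X where s: "S \<alpha> = Some (s, X)" "y = pr (of_bool s) (fm_code X)" "kind (s, X) \<noteq> None"
    using * asy_code syn_code by fastforce
  show "lmem (pr k x) (bl y) \<Longrightarrow> k \<in> idx S \<alpha> \<and> upd (sc S) \<alpha> y x = sc (nxt S \<alpha> k)"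
    using bl_code[OF s(3), of k x] upd_sc[OF f s(1)] s by (auto simp: idx_def fmlookup_dom'_iff)
  show "k \<in> idx S \<alpha> \<Longrightarrow> \<exists>x. lmem (pr k x) (bl y)"
    using bl_code[OF s(3), of k] s by (auto simp: idx_def fmlookup_dom'_iff)
qed

lemma sc_knd:
  assumes f: "finite (dom S)"
  shows "knd S \<alpha> = Some True \<Longrightarrow> \<exists>y. mem (pr \<alpha> y) (sc S) \<and> asy y"
    and "knd S \<alpha> = Some False \<Longrightarrow> \<exists>y. mem (pr \<alpha> y) (sc S) \<and> syn y"
proof -
  have *: "\<exists>s X. mem (pr \<alpha> (pr (of_bool s) (fm_code X))) (sc S) \<and> kind (s, X) = Some b"
    if "knd S \<alpha> = Some b" for b
    using that unfolding mem_sc[OF f] knd_def bind_eq_Some_conv by fast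
  show "knd S \<alpha> = Some True \<Longrightarrow> \<exists>y. mem (pr \<alpha> y) (sc S) \<and> asy y"
    "knd S \<alpha> = Some False \<Longrightarrow> \<exists>y. mem (pr \<alpha> y) (sc S) \<and> syn y"
    using *[of True] *[of False] asy_code syn_code by blast+
qed

lemma pr_mono: "a < b \<Longrightarrow> pr i a < pr i b"
proof -
  have t: "triangle m \<le> triangle n" if "m \<le> n" for m n
    using that by (induction n) (auto simp: le_Suc_eq)
  assume "a < b"
  then have "triangle (i + a) < triangle (i + b)"
    using t[of "Suc (i + a)" "i + b"] by simp
  then show ?thesis by (simp add: prod_encode_def)
qed

lemma lmem_bl_less: "lmem w (bl y) \<Longrightarrow> w < y"
  using lmem_less f2_le by (meson le_trans less_le_trans)

lemma mem_pr_less: "mem (pr a b) S \<Longrightarrow> a < S \<and> b < S"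
  using mem_less le_prod_encode_1 le_prod_encode_2 by (meson le_less_trans)

lemma lmem_pr_bl: "lmem (pr k X) (bl y) \<Longrightarrow> k < y \<and> X < f2 y \<and> X < y"
proof -
  assume "lmem (pr k X) (bl y)"
  then have "pr k X < bl y" by (rule lmem_less)
  moreover have "k \<le> pr k X" "X \<le> pr k X" "bl y \<le> f2 y" "f2 y \<le> y"
    by (simp_all add: le_prod_encode_1 le_prod_encode_2 f2_le)
  ultimately show ?thesis by linarith
qed

text \<open>A component has a smaller code than the formula, and pairing is monotone, so replacing
  the formula by a component moves a binary digit to a lower place. All induction on sequents and
  all finiteness arguments about them rest on this.\<close>

lemma upd_less:
  assumes "mem (pr \<alpha> y) S" "lmem (pr k X) (bl y)"
  shows "upd S \<alpha> y X < S"
proof -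
  have "pr (f1 y) X < pr (f1 y) (f2 y)" using lmem_pr_bl[OF assms(2)] by (intro pr_mono) simp
  then have "pr \<alpha> (pr (f1 y) X) < pr \<alpha> y" by (intro pr_mono) simp
  then have l: "(2::nat) ^ pr \<alpha> (pr (f1 y) X) < 2 ^ pr \<alpha> y" by simp
  have "S div 2 ^ pr \<alpha> y \<noteq> 0" using assms(1) unfolding mem_def set_decode_def by (metis even_zero mem_Collect_eq)
  then have "2 ^ pr \<alpha> y \<le> S" by (simp add: div_eq_0_iff)
  then show ?thesis using l unfolding upd_def by linarith
qed

text \<open>Inclusion of sets implies the order of their codes. So if the elements of
  \<open>T\<close> with property \<open>P\<close> form a closed set again, its code is at most
  \<open>T\<close> by inclusion and at least \<open>T\<close> by minimality. This is rule induction
  for a set known only as the least number of its kind.\<close>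

lemma least_closed_induct:
  assumes "C T0" "T = (LEAST T. C T)" "C T \<Longrightarrow> C (set_encode {z. mem z T \<and> P z})" "mem z T"
  shows "P z"
proof -
  have "C T" unfolding assms(2) by (rule LeastI, rule assms(1))
  then have c: "C (set_encode {z. mem z T \<and> P z})" by (rule assms(3))
  have f: "finite {z. mem z T \<and> P z}" using finite_set_decode[of T] by (auto simp: mem_def)
  have "T \<le> set_encode {z. mem z T \<and> P z}" unfolding assms(2) by (rule Least_le, rule c[unfolded assms(2)])
  moreover have "set_encode {z. mem z T \<and> P z} \<le> T"
    by (rule subset_decode_imp_le) (use f in \<open>auto simp: mem_def\<close>)
  ultimately have "set_encode {z. mem z T \<and> P z} = T" by simp
  then have "mem z (set_encode {z. mem z T \<and> P z})" using assms(4) by simp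
  then show ?thesis using f by (simp add: mem_def)
qed

lemma dec_asy: "pc D f \<Longrightarrow> pc D (\<lambda>e. of_bool (asy (f e)))"
  unfolding asy_def by (intro dec_rules)

lemma dec_syn: "pc D f \<Longrightarrow> pc D (\<lambda>e. of_bool (syn (f e)))"
  unfolding syn_def by (intro dec_rules)

lemma cmp_upd: "pc D f \<Longrightarrow> pc D g \<Longrightarrow> pc D h \<Longrightarrow> pc D k \<Longrightarrow> pc D (\<lambda>e. upd (f e) (g e) (h e) (k e))"
  unfolding upd_def by (intro dec_rules)

subsection \<open>Closed sets of codes\<close>

text \<open>The least such \<open>T\<close> consists of the subterm occurrences of the two given
  terms, each paired with the coded sequent at which it occurs.\<close>

definition closedT :: "nat \<Rightarrow> nat \<Rightarrow> nat \<Rightarrow> nat \<Rightarrow> bool" where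
  "closedT S0 n1 n2 T \<longleftrightarrow> mem (pr S0 n1) T \<and> mem (pr S0 n2) T \<and>
     (\<forall>z<T. mem z T \<longrightarrow> f1 (f2 z) = 1 \<longrightarrow> (\<forall>y<f1 z. mem (pr (f1 (f2 (f2 z))) y) (f1 z) \<and> asy y \<longrightarrow>
        (\<forall>w<f2 (f2 (f2 z)). mem w (f2 (f2 (f2 z))) \<longrightarrow> (\<forall>X<y. lmem (pr (f1 w) X) (bl y) \<longrightarrow>
           mem (pr (upd (f1 z) (f1 (f2 (f2 z))) y X) (f2 w)) T)))) \<and>
     (\<forall>z<T. mem z T \<longrightarrow> f1 (f2 z) = 2 \<longrightarrow> (\<forall>y<f1 z. mem (pr (f1 (f2 (f2 z))) y) (f1 z) \<and> syn y \<longrightarrow>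
        (\<forall>X<y. lmem (pr (f1 (f2 (f2 (f2 z)))) X) (bl y) \<longrightarrow>
           mem (pr (upd (f1 z) (f1 (f2 (f2 z))) y X) (f2 (f2 (f2 (f2 z))))) T)))"

text \<open>The bounded form is for programs, the unbounded one for reasoning. The bounds are
  harmless because parts of pairs, lists and sets have smaller codes; the same applies to the other
  closure conditions.\<close>

lemma closedT_iff: "closedT S0 n1 n2 T \<longleftrightarrow> mem (pr S0 n1) T \<and> mem (pr S0 n2) T \<and>
     (\<forall>S \<alpha> F y i x X. mem (pr S (parc \<alpha> F)) T \<and> mem (pr \<alpha> y) S \<and> asy y \<and> mem (pr i x) F \<and>
        lmem (pr i X) (bl y) \<longrightarrow> mem (pr (upd S \<alpha> y X) x) T) \<and>
     (\<forall>S \<alpha> k x y X. mem (pr S (selc \<alpha> k x)) T \<and> mem (pr \<alpha> y) S \<and> syn y \<and>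
        lmem (pr k X) (bl y) \<longrightarrow> mem (pr (upd S \<alpha> y X) x) T)" (is "_ \<longleftrightarrow> ?r1 \<and> ?r2 \<and> ?A \<and> ?B")
proof -
  have A: "(\<forall>z<T. mem z T \<longrightarrow> f1 (f2 z) = 1 \<longrightarrow> (\<forall>y<f1 z. mem (pr (f1 (f2 (f2 z))) y) (f1 z) \<and> asy y \<longrightarrow>
        (\<forall>w<f2 (f2 (f2 z)). mem w (f2 (f2 (f2 z))) \<longrightarrow> (\<forall>X<y. lmem (pr (f1 w) X) (bl y) \<longrightarrow>
           mem (pr (upd (f1 z) (f1 (f2 (f2 z))) y X) (f2 w)) T)))) \<longleftrightarrow> ?A" (is "?A' \<longleftrightarrow> _")
  proof
    assume a: ?A'
    show ?A
    proof (intro allI impI, elim conjE)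
      fix S \<alpha> F y i x X
      assume h: "mem (pr S (parc \<alpha> F)) T" "mem (pr \<alpha> y) S" "asy y" "mem (pr i x) F" "lmem (pr i X) (bl y)"
      show "mem (pr (upd S \<alpha> y X) x) T"
        using a[rule_format, OF mem_less[OF h(1)], of y "pr i x" X] h mem_pr_less[OF h(2)] mem_less[OF h(4)]
          lmem_pr_bl[OF h(5)] by simp
    qed
  next
    assume a: ?A
    show ?A'
    proof (intro allI impI, elim conjE)
      fix z y w X
      assume h: "mem z T" "f1 (f2 z) = 1" "mem (pr (f1 (f2 (f2 z))) y) (f1 z)" "asy y" "mem w (f2 (f2 (f2 z)))"
        "lmem (pr (f1 w) X) (bl y)"
      have "z = pr (f1 z) (parc (f1 (f2 (f2 z))) (f2 (f2 (f2 z))))" using h(2) by (metis pr_f)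
      then show "mem (pr (upd (f1 z) (f1 (f2 (f2 z))) y X) (f2 w)) T"
        using a h by (metis pr_f)
    qed
  qed
  have B: "(\<forall>z<T. mem z T \<longrightarrow> f1 (f2 z) = 2 \<longrightarrow> (\<forall>y<f1 z. mem (pr (f1 (f2 (f2 z))) y) (f1 z) \<and> syn y \<longrightarrow>
        (\<forall>X<y. lmem (pr (f1 (f2 (f2 (f2 z)))) X) (bl y) \<longrightarrow>
           mem (pr (upd (f1 z) (f1 (f2 (f2 z))) y X) (f2 (f2 (f2 (f2 z))))) T))) \<longleftrightarrow> ?B" (is "?B' \<longleftrightarrow> _")
  proof
    assume a: ?B'
    show ?B
    proof (intro allI impI, elim conjE)
      fix S \<alpha> k x y X
      assume h: "mem (pr S (selc \<alpha> k x)) T" "mem (pr \<alpha> y) S" "syn y" "lmem (pr k X) (bl y)"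
      show "mem (pr (upd S \<alpha> y X) x) T"
        using a[rule_format, OF mem_less[OF h(1)], of y X] h mem_pr_less[OF h(2)]
          lmem_pr_bl[OF h(4)] by simp
    qed
  next
    assume a: ?B
    show ?B'
    proof (intro allI impI, elim conjE)
      fix z y X
      assume h: "mem z T" "f1 (f2 z) = 2" "mem (pr (f1 (f2 (f2 z))) y) (f1 z)" "syn y"
        "lmem (pr (f1 (f2 (f2 (f2 z)))) X) (bl y)"
      have "z = pr (f1 z) (selc (f1 (f2 (f2 z))) (f1 (f2 (f2 (f2 z)))) (f2 (f2 (f2 (f2 z)))))" using h(2) by (metis pr_f)
      then show "mem (pr (upd (f1 z) (f1 (f2 (f2 z))) y X) (f2 (f2 (f2 (f2 z))))) T"
        using a h by (metis pr_f)
    qed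
  qed
  show ?thesis unfolding closedT_def A B ..
qed

text \<open>The formal composites whose values are wanted: the leaves in \<open>T\<close> and,
  hereditarily, the components from which they are composed.\<close>

definition closedV :: "nat \<Rightarrow> nat \<Rightarrow> bool" where
  "closedV T V \<longleftrightarrow> (\<forall>z<T. mem z T \<and> f1 (f2 z) = 0 \<longrightarrow> mem (f2 (f2 z)) V) \<and>
     (\<forall>x<V. mem x V \<and> f1 x \<noteq> 0 \<longrightarrow> mem (f1 (f2 (f2 x))) V \<and> mem (f2 (f2 (f2 x))) V)"

definition onk :: "nat \<Rightarrow> nat \<Rightarrow> bool" where
  "onk y F \<longleftrightarrow> (\<forall>q<F. mem q F \<longrightarrow> (\<exists>u<y. lmem u (bl y) \<and> f1 u = f1 q)) \<and>
     (\<forall>q<F. \<forall>q'<F. mem q F \<and> mem q' F \<and> f1 q = f1 q' \<longrightarrow> q = q')"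

lemma onk_iff: "onk y F \<longleftrightarrow> (\<forall>i x. mem (pr i x) F \<longrightarrow> (\<exists>X. lmem (pr i X) (bl y))) \<and>
    (\<forall>i x x'. mem (pr i x) F \<and> mem (pr i x') F \<longrightarrow> x = x')"
proof -
  have 1: "(\<forall>q<F. mem q F \<longrightarrow> (\<exists>u<y. lmem u (bl y) \<and> f1 u = f1 q)) \<longleftrightarrow>
      (\<forall>i x. mem (pr i x) F \<longrightarrow> (\<exists>X. lmem (pr i X) (bl y)))"
    by (metis f1_pr lmem_bl_less mem_less pr_f)
  have 2: "(\<forall>q<F. \<forall>q'<F. mem q F \<and> mem q' F \<and> f1 q = f1 q' \<longrightarrow> q = q') \<longleftrightarrow>
      (\<forall>i x x'. mem (pr i x) F \<and> mem (pr i x') F \<longrightarrow> x = x')"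
    by (metis f1_pr f2_pr mem_less pr_f)
  show ?thesis unfolding onk_def 1 2 ..
qed

text \<open>The premise of congruence for \<open>Par\<close>. The families are not given in advance
  but range over all numbers below a bound, so \<open>onk\<close> must also check that they have no
  keys besides the branches and are single-valued.\<close>

definition famE :: "nat \<Rightarrow> nat \<Rightarrow> nat \<Rightarrow> nat \<Rightarrow> nat \<Rightarrow> nat \<Rightarrow> bool" where
  "famE E S \<alpha> y F F' \<longleftrightarrow> (\<forall>u<y. lmem u (bl y) \<longrightarrow> (\<exists>p<E. \<exists>p'<E. mem (pr (f1 u) p) F \<and>
      mem (pr (f1 u) p') F' \<and> mem (pr (upd S \<alpha> y (f2 u)) (pr p p')) E)) \<and> onk y F \<and> onk y F'"

lemma famE_iff: "famE E S \<alpha> y F F' \<longleftrightarrow> (\<forall>k X. lmem (pr k X) (bl y) \<longrightarrow> (\<exists>p p'. mem (pr k p) F \<and>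
      mem (pr k p') F' \<and> mem (pr (upd S \<alpha> y X) (pr p p')) E)) \<and> onk y F \<and> onk y F'"
proof -
  have b: "mem (pr t (pr p p')) E \<Longrightarrow> p < E \<and> p' < E" for t p p'
    using mem_pr_less[of t "pr p p'" E] le_prod_encode_1[of p p'] le_prod_encode_2[of p' p] by linarith
  have "(\<forall>u<y. lmem u (bl y) \<longrightarrow> (\<exists>p<E. \<exists>p'<E. mem (pr (f1 u) p) F \<and>
      mem (pr (f1 u) p') F' \<and> mem (pr (upd S \<alpha> y (f2 u)) (pr p p')) E)) \<longleftrightarrow>
    (\<forall>k X. lmem (pr k X) (bl y) \<longrightarrow> (\<exists>p p'. mem (pr k p) F \<and>
      mem (pr k p') F' \<and> mem (pr (upd S \<alpha> y X) (pr p p')) E))" (is "?l \<longleftrightarrow> ?r")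
  proof
    assume ?l
    show ?r
    proof (intro allI impI)
      fix k X assume "lmem (pr k X) (bl y)"
      then show "\<exists>p p'. mem (pr k p) F \<and> mem (pr k p') F' \<and> mem (pr (upd S \<alpha> y X) (pr p p')) E"
        using \<open>?l\<close>[rule_format, of "pr k X"] lmem_bl_less by auto
    qed
  next
    assume ?r
    show ?l
    proof (intro allI impI)
      fix u assume "lmem u (bl y)"
      then show "\<exists>p<E. \<exists>p'<E. mem (pr (f1 u) p) F \<and> mem (pr (f1 u) p') F' \<and> mem (pr (upd S \<alpha> y (f2 u)) (pr p p')) E"
        using \<open>?r\<close>[rule_format, of "f1 u" "f2 u"] b by (metis pr_f)
    qed
  qed
  then show ?thesis unfolding famE_def by simp
qed

text \<open>The three root conversions on codes; symmetry of \<open>closedE\<close> supplies the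
  other direction of the second. Entries alone do not show the shape when a family is empty, so in
  the first case both families are inspected, and in the second the \<open>Par\<close> below the
  \<open>Sel\<close> is checked separately.\<close>

definition conv :: "nat \<Rightarrow> nat \<Rightarrow> bool" where
  "conv c c' \<longleftrightarrow>
     f1 c = 1 \<and> f1 c' = 1 \<and> f1 (f2 c) \<noteq> f1 (f2 c') \<and>
       (\<forall>w<f2 (f2 c). mem w (f2 (f2 c)) \<longrightarrow> f1 (f2 w) = 1 \<and> f1 (f2 (f2 w)) = f1 (f2 c')) \<and>
       (\<forall>w<f2 (f2 c'). mem w (f2 (f2 c')) \<longrightarrow> f1 (f2 w) = 1 \<and> f1 (f2 (f2 w)) = f1 (f2 c)) \<and>
       (\<forall>w<f2 (f2 c). mem w (f2 (f2 c)) \<longrightarrow> (\<forall>u<f2 (f2 (f2 w)). mem u (f2 (f2 (f2 w))) \<longrightarrow>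
         (\<exists>w'<f2 (f2 c'). mem w' (f2 (f2 c')) \<and> f1 w' = f1 u \<and> mem (pr (f1 w) (f2 u)) (f2 (f2 (f2 w')))))) \<or>
     f1 c = 1 \<and> f1 c' = 2 \<and> f1 (f2 c) \<noteq> f1 (f2 c') \<and> f1 (f2 (f2 (f2 c'))) = 1 \<and>
       f1 (f2 (f2 (f2 (f2 c')))) = f1 (f2 c) \<and>
       (\<forall>w<f2 (f2 c). mem w (f2 (f2 c)) \<longrightarrow> f1 (f2 w) = 2 \<and> f1 (f2 (f2 w)) = f1 (f2 c') \<and>
          f1 (f2 (f2 (f2 w))) = f1 (f2 (f2 c')) \<and>
          mem (pr (f1 w) (f2 (f2 (f2 (f2 w))))) (f2 (f2 (f2 (f2 (f2 c')))))) \<or>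
     f1 c = 2 \<and> f1 (f2 (f2 (f2 c))) = 2 \<and> f1 (f2 c) \<noteq> f1 (f2 (f2 (f2 (f2 c)))) \<and>
       c' = selc (f1 (f2 (f2 (f2 (f2 c))))) (f1 (f2 (f2 (f2 (f2 (f2 c))))))
              (selc (f1 (f2 c)) (f1 (f2 (f2 c))) (f2 (f2 (f2 (f2 (f2 (f2 c)))))))"

text \<open>A triple with equal components serves as the judgement that the term is typed at the
  sequent: congruence builds these up from the leaves, and conversion is applied only between terms
  that have them. \<open>M\<close> lists the pairs of leaves with equal values. \<open>B\<close>
  will be the code of the given sequent, and \<open>2 ^ pr S E\<close> exceeds every family that
  \<open>famE\<close> admits.\<close>

definition closedE :: "nat \<Rightarrow> nat \<Rightarrow> nat \<Rightarrow> bool" where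
  "closedE M B E \<longleftrightarrow>
     (\<forall>z<M. mem z M \<and> f1 z \<le> B \<longrightarrow> mem (pr (f1 z) (pr (leafc (f1 (f2 z))) (leafc (f2 (f2 z))))) E) \<and>
     (\<forall>z<E. mem z E \<longrightarrow> mem (pr (f1 z) (pr (f2 (f2 z)) (f1 (f2 z)))) E) \<and>
     (\<forall>z<E. \<forall>z'<E. mem z E \<and> mem z' E \<and> f1 z = f1 z' \<and> f2 (f2 z) = f1 (f2 z') \<longrightarrow>
        mem (pr (f1 z) (pr (f1 (f2 z)) (f2 (f2 z')))) E) \<and>
     (\<forall>S<Suc B. \<forall>w<S. mem w S \<and> syn (f2 w) \<longrightarrow> (\<forall>u<f2 w. lmem u (bl (f2 w)) \<longrightarrow>
        (\<forall>z<E. mem z E \<and> f1 z = upd S (f1 w) (f2 w) (f2 u) \<longrightarrow>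
           mem (pr S (pr (selc (f1 w) (f1 u) (f1 (f2 z))) (selc (f1 w) (f1 u) (f2 (f2 z))))) E))) \<and>
     (\<forall>S<Suc B. \<forall>w<S. mem w S \<and> asy (f2 w) \<longrightarrow> (\<forall>F<2 ^ pr S E. \<forall>F'<2 ^ pr S E.
        famE E S (f1 w) (f2 w) F F' \<longrightarrow> mem (pr S (pr (parc (f1 w) F) (parc (f1 w) F'))) E)) \<and>
     (\<forall>z<E. \<forall>z'<E. mem z E \<and> mem z' E \<and> f1 z = f1 z' \<and> f1 (f2 z) = f2 (f2 z) \<and>
        f1 (f2 z') = f2 (f2 z') \<and> conv (f1 (f2 z)) (f1 (f2 z')) \<longrightarrow>
        mem (pr (f1 z) (pr (f1 (f2 z)) (f1 (f2 z')))) E)"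

lemma dec_closedT: "pc D f \<Longrightarrow> pc D g \<Longrightarrow> pc D h \<Longrightarrow> pc D k \<Longrightarrow>
   pc D (\<lambda>e. of_bool (closedT (f e) (g e) (h e) (k e)))"
  by (rule cmp4[where F = "\<lambda>a b c d. of_bool (closedT a b c d)"],
     unfold closedT_def) (intro dec_rules dec_asy dec_syn cmp_upd cmp_accs; simp)+

lemma dec_closedV: "pc D f \<Longrightarrow> pc D g \<Longrightarrow> pc D (\<lambda>e. of_bool (closedV (f e) (g e)))"
  by (rule cmp2[where F = "\<lambda>a b. of_bool (closedV a b)"],
     unfold closedV_def) (intro dec_rules cmp_accs; simp)+

lemma dec_onk: "pc D f \<Longrightarrow> pc D g \<Longrightarrow> pc D (\<lambda>e. of_bool (onk (f e) (g e)))"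
  by (rule cmp2[where F = "\<lambda>a b. of_bool (onk a b)"],
     unfold onk_def) (intro dec_rules cmp_accs; simp)+

lemma dec_conv: "pc D f \<Longrightarrow> pc D g \<Longrightarrow> pc D (\<lambda>e. of_bool (conv (f e) (g e)))"
  by (rule cmp2[where F = "\<lambda>a b. of_bool (conv a b)"],
     unfold conv_def) (intro dec_rules cmp_accs; simp)+

lemma dec_closedE: "pc D f \<Longrightarrow> pc D g \<Longrightarrow> pc D h \<Longrightarrow>
   pc D (\<lambda>e. of_bool (closedE (f e) (g e) (h e)))"
  by (rule cmp3[where F = "\<lambda>a b c. of_bool (closedE a b c)"],
     unfold closedE_def famE_def) (intro dec_rules dec_asy dec_syn dec_onk dec_conv cmp_upd cmp_accs; simp)+

lemma mem_bound: "(\<And>w. mem w F \<Longrightarrow> w < N) \<Longrightarrow> F < 2 ^ N"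
proof -
  assume a: "\<And>w. mem w F \<Longrightarrow> w < N"
  have "F \<le> set_encode {..<N}"
    by (rule subset_decode_imp_le) (use a in \<open>auto simp: mem_def\<close>)
  also have "set_encode {..<N} = (\<Sum>i<N. 2 ^ i)" by (simp add: set_encode_def)
  also have "(\<Sum>i<N. 2 ^ i) < (2::nat) ^ N" by (induction N) auto
  finally show ?thesis .
qed

lemma pr_mono1: "a \<le> b \<Longrightarrow> pr a i \<le> pr b i"
proof -
  have t: "triangle m \<le> triangle n" if "m \<le> n" for m n
    using that by (induction n) (auto simp: le_Suc_eq)
  assume "a \<le> b"
  then show ?thesis using t[of "a + i" "b + i"] by (simp add: prod_encode_def)
qed

text \<open>The keys are branches of a formula of \<open>S\<close> and so lie below
  \<open>S\<close>; the entries are mentioned in \<open>E\<close> and so lie below \<open>E\<close>.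
  Every member of the family is thus smaller than \<open>pr S E\<close>.\<close>

lemma famE_bound:
  assumes "famE E S \<alpha> y F F'" "mem (pr \<alpha> y) S"
  shows "F < 2 ^ pr S E" "F' < 2 ^ pr S E"
proof -
  have b: "mem (pr t (pr p p')) E \<Longrightarrow> p < E \<and> p' < E" for t p p'
    using mem_pr_less[of t "pr p p'" E] le_prod_encode_1[of p p'] le_prod_encode_2[of p' p] by linarith
  have *: "pr i x < pr S E" if "i < y" "x < E" for i x
    using pr_mono[OF that(2), of i] pr_mono1[of i S E] that(1) mem_pr_less[OF assms(2)] by linarith
  have "i < y \<and> x < E" if h: "mem (pr i x) F" for i x
  proof -
    obtain X where X: "lmem (pr i X) (bl y)" using assms(1) h unfolding famE_iff onk_iff by blast
    then obtain p p' where "mem (pr i p) F" "mem (pr (upd S \<alpha> y X) (pr p p')) E" using assms(1) unfolding famE_iff by blast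
    then show ?thesis using b lmem_pr_bl[OF X] assms(1) h unfolding famE_iff onk_iff by metis
  qed
  then show "F < 2 ^ pr S E" by (intro mem_bound) (metis * pr_f)
  have "i < y \<and> x < E" if h: "mem (pr i x) F'" for i x
  proof -
    obtain X where X: "lmem (pr i X) (bl y)" using assms(1) h unfolding famE_iff onk_iff by blast
    then obtain p p' where "mem (pr i p') F'" "mem (pr (upd S \<alpha> y X) (pr p p')) E" using assms(1) unfolding famE_iff by blast
    then show ?thesis using b lmem_pr_bl[OF X] assms(1) h unfolding famE_iff onk_iff by metis
  qed
  then show "F' < 2 ^ pr S E" by (intro mem_bound) (metis * pr_f)
qed

lemma closedE_iff: "closedE M B E \<longleftrightarrow>
   (\<forall>S a b. mem (pr S (pr a b)) M \<and> S \<le> B \<longrightarrow> mem (pr S (pr (leafc a) (leafc b))) E) \<and>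
   (\<forall>S c c'. mem (pr S (pr c c')) E \<longrightarrow> mem (pr S (pr c' c)) E) \<and>
   (\<forall>S c c' c''. mem (pr S (pr c c')) E \<and> mem (pr S (pr c' c'')) E \<longrightarrow> mem (pr S (pr c c'')) E) \<and>
   (\<forall>S \<alpha> y k X c c'. S \<le> B \<and> mem (pr \<alpha> y) S \<and> syn y \<and> lmem (pr k X) (bl y) \<and>
      mem (pr (upd S \<alpha> y X) (pr c c')) E \<longrightarrow> mem (pr S (pr (selc \<alpha> k c) (selc \<alpha> k c'))) E) \<and>
   (\<forall>S \<alpha> y F F'. S \<le> B \<and> mem (pr \<alpha> y) S \<and> asy y \<and> famE E S \<alpha> y F F' \<longrightarrow>
      mem (pr S (pr (parc \<alpha> F) (parc \<alpha> F'))) E) \<and>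
   (\<forall>S c c'. mem (pr S (pr c c)) E \<and> mem (pr S (pr c' c')) E \<and> conv c c' \<longrightarrow> mem (pr S (pr c c')) E)"
proof -
  have 1: "(\<forall>z<M. mem z M \<and> f1 z \<le> B \<longrightarrow> mem (pr (f1 z) (pr (leafc (f1 (f2 z))) (leafc (f2 (f2 z))))) E) \<longleftrightarrow>
     (\<forall>S a b. mem (pr S (pr a b)) M \<and> S \<le> B \<longrightarrow> mem (pr S (pr (leafc a) (leafc b))) E)"
  proof (intro iffI allI impI; elim conjE)
    fix S a b assume l: "\<forall>z<M. mem z M \<and> f1 z \<le> B \<longrightarrow> mem (pr (f1 z) (pr (leafc (f1 (f2 z))) (leafc (f2 (f2 z))))) E"
      and h: "mem (pr S (pr a b)) M" "S \<le> B"
    show "mem (pr S (pr (leafc a) (leafc b))) E" using l[rule_format, OF mem_less[OF h(1)]] h by simp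
  next
    fix z assume r: "\<forall>S a b. mem (pr S (pr a b)) M \<and> S \<le> B \<longrightarrow> mem (pr S (pr (leafc a) (leafc b))) E"
      and h: "mem z M" "f1 z \<le> B"
    show "mem (pr (f1 z) (pr (leafc (f1 (f2 z))) (leafc (f2 (f2 z))))) E"
      using r[rule_format, of "f1 z" "f1 (f2 z)" "f2 (f2 z)"] h by simp
  qed
  have 2: "(\<forall>z<E. mem z E \<longrightarrow> mem (pr (f1 z) (pr (f2 (f2 z)) (f1 (f2 z)))) E) \<longleftrightarrow>
     (\<forall>S c c'. mem (pr S (pr c c')) E \<longrightarrow> mem (pr S (pr c' c)) E)"
  proof (intro iffI allI impI)
    fix S c c' assume l: "\<forall>z<E. mem z E \<longrightarrow> mem (pr (f1 z) (pr (f2 (f2 z)) (f1 (f2 z)))) E"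
      and h: "mem (pr S (pr c c')) E"
    show "mem (pr S (pr c' c)) E" using l[rule_format, OF mem_less[OF h]] h by simp
  next
    fix z assume r: "\<forall>S c c'. mem (pr S (pr c c')) E \<longrightarrow> mem (pr S (pr c' c)) E" and h: "mem z E"
    show "mem (pr (f1 z) (pr (f2 (f2 z)) (f1 (f2 z)))) E"
      using r[rule_format, of "f1 z" "f1 (f2 z)" "f2 (f2 z)"] h by simp
  qed
  have 3: "(\<forall>z<E. \<forall>z'<E. mem z E \<and> mem z' E \<and> f1 z = f1 z' \<and> f2 (f2 z) = f1 (f2 z') \<longrightarrow>
        mem (pr (f1 z) (pr (f1 (f2 z)) (f2 (f2 z')))) E) \<longleftrightarrow>
     (\<forall>S c c' c''. mem (pr S (pr c c')) E \<and> mem (pr S (pr c' c'')) E \<longrightarrow> mem (pr S (pr c c'')) E)"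
  proof (intro iffI allI impI; elim conjE)
    fix S c c' c'' assume l: "\<forall>z<E. \<forall>z'<E. mem z E \<and> mem z' E \<and> f1 z = f1 z' \<and> f2 (f2 z) = f1 (f2 z') \<longrightarrow>
        mem (pr (f1 z) (pr (f1 (f2 z)) (f2 (f2 z')))) E"
      and h: "mem (pr S (pr c c')) E" "mem (pr S (pr c' c'')) E"
    show "mem (pr S (pr c c'')) E" using l[rule_format, OF mem_less[OF h(1)] mem_less[OF h(2)]] h by simp
  next
    fix z z' assume r: "\<forall>S c c' c''. mem (pr S (pr c c')) E \<and> mem (pr S (pr c' c'')) E \<longrightarrow> mem (pr S (pr c c'')) E"
      and h: "mem z E" "mem z' E" "f1 z = f1 z'" "f2 (f2 z) = f1 (f2 z')"
    have "mem (pr (f1 z) (pr (f2 (f2 z)) (f2 (f2 z')))) E" unfolding h(3,4) pr_f by (rule h(2))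
    then show "mem (pr (f1 z) (pr (f1 (f2 z)) (f2 (f2 z')))) E"
      using r[rule_format, of "f1 z" "f1 (f2 z)" "f2 (f2 z)" "f2 (f2 z')"] h(1) by simp
  qed
  have 4: "(\<forall>S<Suc B. \<forall>w<S. mem w S \<and> syn (f2 w) \<longrightarrow> (\<forall>u<f2 w. lmem u (bl (f2 w)) \<longrightarrow>
        (\<forall>z<E. mem z E \<and> f1 z = upd S (f1 w) (f2 w) (f2 u) \<longrightarrow>
           mem (pr S (pr (selc (f1 w) (f1 u) (f1 (f2 z))) (selc (f1 w) (f1 u) (f2 (f2 z))))) E))) \<longleftrightarrow>
     (\<forall>S \<alpha> y k X c c'. S \<le> B \<and> mem (pr \<alpha> y) S \<and> syn y \<and> lmem (pr k X) (bl y) \<and>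
      mem (pr (upd S \<alpha> y X) (pr c c')) E \<longrightarrow> mem (pr S (pr (selc \<alpha> k c) (selc \<alpha> k c'))) E)" (is "?l \<longleftrightarrow> ?r")
  proof
    assume l: ?l
    show ?r
    proof (intro allI impI, elim conjE)
      fix S \<alpha> y k X c c'
      assume h: "S \<le> B" "mem (pr \<alpha> y) S" "syn y" "lmem (pr k X) (bl y)" "mem (pr (upd S \<alpha> y X) (pr c c')) E"
      show "mem (pr S (pr (selc \<alpha> k c) (selc \<alpha> k c'))) E"
        using l[rule_format, of S "pr \<alpha> y" "pr k X" "pr (upd S \<alpha> y X) (pr c c')"] h mem_less[OF h(2)] mem_less[OF h(5)]
          lmem_bl_less[OF h(4)] by simp
    qed
  next
    assume r: ?r
    show ?l
    proof (intro allI impI, elim conjE)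
      fix S w u z
      assume h: "S < Suc B" "mem w S" "syn (f2 w)" "lmem u (bl (f2 w))" "mem z E" "f1 z = upd S (f1 w) (f2 w) (f2 u)"
      have "mem (pr (upd S (f1 w) (f2 w) (f2 u)) (pr (f1 (f2 z)) (f2 (f2 z)))) E"
        unfolding h(6)[symmetric] pr_f by (rule h(5))
      then show "mem (pr S (pr (selc (f1 w) (f1 u) (f1 (f2 z))) (selc (f1 w) (f1 u) (f2 (f2 z))))) E"
        using r[rule_format, of S "f1 w" "f2 w" "f1 u" "f2 u"] h by simp
    qed
  qed
  have 5: "(\<forall>S<Suc B. \<forall>w<S. mem w S \<and> asy (f2 w) \<longrightarrow> (\<forall>F<2 ^ pr S E. \<forall>F'<2 ^ pr S E.
        famE E S (f1 w) (f2 w) F F' \<longrightarrow> mem (pr S (pr (parc (f1 w) F) (parc (f1 w) F'))) E)) \<longleftrightarrow>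
     (\<forall>S \<alpha> y F F'. S \<le> B \<and> mem (pr \<alpha> y) S \<and> asy y \<and> famE E S \<alpha> y F F' \<longrightarrow>
      mem (pr S (pr (parc \<alpha> F) (parc \<alpha> F'))) E)" (is "?l \<longleftrightarrow> ?r")
  proof
    assume l: ?l
    show ?r
    proof (intro allI impI, elim conjE)
      fix S \<alpha> y F F'
      assume h: "S \<le> B" "mem (pr \<alpha> y) S" "asy y" "famE E S \<alpha> y F F'"
      show "mem (pr S (pr (parc \<alpha> F) (parc \<alpha> F'))) E"
        using l[rule_format, of S "pr \<alpha> y" F F'] h mem_less[OF h(2)] famE_bound[OF h(4,2)] by simp
    qed
  next
    assume r: ?r
    show ?l
    proof (intro allI impI, elim conjE)
      fix S w F F'
      assume h: "S < Suc B" "mem w S" "asy (f2 w)" "famE E S (f1 w) (f2 w) F F'"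
      then show "mem (pr S (pr (parc (f1 w) F) (parc (f1 w) F'))) E"
        using r[rule_format, of S "f1 w" "f2 w" F F'] by simp
    qed
  qed
  have 6: "(\<forall>z<E. \<forall>z'<E. mem z E \<and> mem z' E \<and> f1 z = f1 z' \<and> f1 (f2 z) = f2 (f2 z) \<and>
        f1 (f2 z') = f2 (f2 z') \<and> conv (f1 (f2 z)) (f1 (f2 z')) \<longrightarrow>
        mem (pr (f1 z) (pr (f1 (f2 z)) (f1 (f2 z')))) E) \<longleftrightarrow>
     (\<forall>S c c'. mem (pr S (pr c c)) E \<and> mem (pr S (pr c' c')) E \<and> conv c c' \<longrightarrow> mem (pr S (pr c c')) E)" (is "?l \<longleftrightarrow> ?r")
  proof
    assume l: ?l
    show ?r
    proof (intro allI impI, elim conjE)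
      fix S c c' assume h: "mem (pr S (pr c c)) E" "mem (pr S (pr c' c')) E" "conv c c'"
      show "mem (pr S (pr c c')) E"
        using l[rule_format, of "pr S (pr c c)" "pr S (pr c' c')"] h mem_less[OF h(1)] mem_less[OF h(2)] by simp
    qed
  next
    assume r: ?r
    show ?l
    proof (intro allI impI, elim conjE)
      fix z z' assume h: "mem z E" "mem z' E" "f1 z = f1 z'" "f1 (f2 z) = f2 (f2 z)" "f1 (f2 z') = f2 (f2 z')"
        "conv (f1 (f2 z)) (f1 (f2 z'))"
      have "mem (pr (f1 z) (pr (f1 (f2 z)) (f1 (f2 z)))) E" "mem (pr (f1 z) (pr (f1 (f2 z')) (f1 (f2 z')))) E"
        by (subst (2) h(4), simp add: h(1)) (subst (2) h(5), simp add: h(2,3))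
      then show "mem (pr (f1 z) (pr (f1 (f2 z)) (f1 (f2 z')))) E" using r h(6) by blast
    qed
  qed
  show ?thesis unfolding closedE_def 1 2 3 4 5 6 ..
qed

section \<open>Typed codes over a finite table of leaves\<close>

inductive tyc :: "nat \<Rightarrow> nat \<Rightarrow> nat \<Rightarrow> bool" for T where
  tyc_leaf: "mem (pr S (leafc a)) T \<Longrightarrow> tyc T S (leafc a)"
| tyc_sel: "mem (pr \<alpha> y) S \<Longrightarrow> syn y \<Longrightarrow> lmem (pr k X) (bl y) \<Longrightarrow> tyc T (upd S \<alpha> y X) c \<Longrightarrow>
    tyc T S (selc \<alpha> k c)"
| tyc_par: "mem (pr \<alpha> y) S \<Longrightarrow> asy y \<Longrightarrow>
    (\<And>i x. mem (pr i x) F \<Longrightarrow> \<exists>X. lmem (pr i X) (bl y) \<and> tyc T (upd S \<alpha> y X) x) \<Longrightarrow>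
    (\<And>i X. lmem (pr i X) (bl y) \<Longrightarrow> \<exists>x. mem (pr i x) F) \<Longrightarrow>
    (\<And>i x x'. mem (pr i x) F \<Longrightarrow> mem (pr i x') F \<Longrightarrow> x = x') \<Longrightarrow> tyc T S (parc \<alpha> F)"

text \<open>Each rule passes to a sequent with a smaller code, where there are finitely many terms
  by induction. A term at \<open>S\<close> is then a leaf from the table, a selection from this
  stock, or a finite family over it.\<close>

lemma finite_tyc: "finite {c. tyc T S c}"
proof (induction S rule: less_induct)
  case (less S)
  define U where "U = (\<Union>S'\<in>{..<S}. {c. tyc T S' c})"
  have fU: "finite U" unfolding U_def using less by auto
  have uS: "c \<in> U" if "tyc T (upd S \<alpha> y X) c" "mem (pr \<alpha> y) S" "lmem (pr k X) (bl y)" for \<alpha> y k X c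
    using upd_less[OF that(2,3)] that(1) by (auto simp: U_def)
  have kS: "k < S" if "mem (pr \<alpha> y) S" "lmem (pr k X) (bl y)" for \<alpha> y k X
    using lmem_pr_bl[OF that(2)] mem_pr_less[OF that(1)] by linarith
  let ?L = "(\<lambda>z. f2 z) ` set_decode T"
  let ?S = "(\<lambda>(\<alpha>, k, c). selc \<alpha> k c) ` ({..<S} \<times> {..<S} \<times> U)"
  let ?P = "(\<lambda>(\<alpha>, F). parc \<alpha> (set_encode F)) ` ({..<S} \<times> Pow ((\<lambda>(i, x). pr i x) ` ({..<S} \<times> U)))"
  have "{c. tyc T S c} \<subseteq> ?L \<union> ?S \<union> ?P"
  proof
    fix c assume "c \<in> {c. tyc T S c}"
    then have "tyc T S c" by simp
    then show "c \<in> ?L \<union> ?S \<union> ?P"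
    proof cases
      case (tyc_leaf a)
      then have "leafc a = f2 (pr S (leafc a))" "pr S (leafc a) \<in> set_decode T" by (auto simp: mem_def)
      then have "leafc a \<in> ?L" by (rule image_eqI)
      then show ?thesis using tyc_leaf by simp
    next
      case (tyc_sel \<alpha> y k X x)
      have "(\<alpha>, k, x) \<in> {..<S} \<times> {..<S} \<times> U" using tyc_sel uS kS mem_pr_less by blast
      then have "c \<in> ?S" unfolding tyc_sel(1) by (rule rev_image_eqI) simp
      then show ?thesis by simp
    next
      case (tyc_par \<alpha> y F)
      have "set_decode F \<subseteq> (\<lambda>(i, x). pr i x) ` ({..<S} \<times> U)"
      proof
        fix w assume "w \<in> set_decode F"
        then have w: "mem (pr (f1 w) (f2 w)) F" by (simp add: mem_def)
        obtain X where "lmem (pr (f1 w) X) (bl y)" "tyc T (upd S \<alpha> y X) (f2 w)" using tyc_par(4)[OF w] by blast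
        then have "(f1 w, f2 w) \<in> {..<S} \<times> U" using uS kS tyc_par(2) by blast
        then show "w \<in> (\<lambda>(i, x). pr i x) ` ({..<S} \<times> U)" by (rule rev_image_eqI) simp
      qed
      then have "(\<alpha>, set_decode F) \<in> {..<S} \<times> Pow ((\<lambda>(i, x). pr i x) ` ({..<S} \<times> U))"
        using mem_pr_less[OF tyc_par(2)] by blast
      then have "c \<in> ?P" unfolding tyc_par(1) by (rule rev_image_eqI) simp
      then show ?thesis by simp
    qed
  qed
  then show ?case by (rule finite_subset) (use fU in simp)
qed

lemma tyc_Leaf_iff: "tyc T S (leafc a) \<longleftrightarrow> mem (pr S (leafc a)) T"
  by (auto intro: tyc_leaf elim: tyc.cases)

lemma tyc_Sel_iff:
  assumes f: "finite (dom S)"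
  shows "tyc T (sc S) (selc \<alpha> k c) \<longleftrightarrow> knd S \<alpha> = Some False \<and> k \<in> idx S \<alpha> \<and> tyc T (sc (nxt S \<alpha> k)) c"
proof
  assume "tyc T (sc S) (selc \<alpha> k c)"
  then show "knd S \<alpha> = Some False \<and> k \<in> idx S \<alpha> \<and> tyc T (sc (nxt S \<alpha> k)) c"
  proof cases
    case (tyc_sel \<alpha>' y k' X c')
    then have e: "\<alpha>' = \<alpha>" "k' = k" "c' = c" by auto
    note h = tyc_sel(2-5)[unfolded e]
    show ?thesis using sc_async(2)[OF f, of \<alpha> y] sc_async(3)[OF f, of \<alpha> y k X] h by auto
  qed auto
next
  assume a: "knd S \<alpha> = Some False \<and> k \<in> idx S \<alpha> \<and> tyc T (sc (nxt S \<alpha> k)) c"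
  obtain y where y: "mem (pr \<alpha> y) (sc S)" "syn y" using sc_knd(2)[OF f] a by blast
  obtain X where X: "lmem (pr k X) (bl y)" using sc_async(4)[OF f, of \<alpha> y k] y a by blast
  show "tyc T (sc S) (selc \<alpha> k c)"
    by (rule tyc_sel[OF y X]) (use sc_async(3)[OF f, of \<alpha> y k X] y X a in auto)
qed

lemma tyc_Par_iff:
  assumes f: "finite (dom S)" and F: "\<And>i z. mem (pr i z) F \<longleftrightarrow> i \<in> I \<and> z = x i"
  shows "tyc T (sc S) (parc \<alpha> F) \<longleftrightarrow> knd S \<alpha> = Some True \<and> I = idx S \<alpha> \<and> (\<forall>i\<in>I. tyc T (sc (nxt S \<alpha> i)) (x i))"
proof
  assume "tyc T (sc S) (parc \<alpha> F)"
  then show "knd S \<alpha> = Some True \<and> I = idx S \<alpha> \<and> (\<forall>i\<in>I. tyc T (sc (nxt S \<alpha> i)) (x i))"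
  proof cases
    case (tyc_par \<alpha>' y F')
    then have e: "\<alpha>' = \<alpha>" "F' = F" by auto
    note h = tyc_par(2-6)[unfolded e]
    have k: "knd S \<alpha> = Some True" using sc_async(1)[OF f, of \<alpha> y] h by blast
    have I: "i \<in> idx S \<alpha> \<and> tyc T (sc (nxt S \<alpha> i)) (x i)" if i: "i \<in> I" for i
    proof -
      have "mem (pr i (x i)) F" unfolding F using i by simp
      then obtain X where X: "lmem (pr i X) (bl y)" "tyc T (upd (sc S) \<alpha> y X) (x i)" using h(3) by blast
      then show ?thesis using sc_async(3)[OF f, of \<alpha> y i X] h(1,2) by auto
    qed
    have "i \<in> I" if i: "i \<in> idx S \<alpha>" for i
    proof -
      obtain X where "lmem (pr i X) (bl y)" using sc_async(4)[OF f, of \<alpha> y i] h(1,2) i by blast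
      then obtain z where "mem (pr i z) F" using h(4) by blast
      then show ?thesis unfolding F by simp
    qed
    then show ?thesis using k I by blast
  qed auto
next
  assume a: "knd S \<alpha> = Some True \<and> I = idx S \<alpha> \<and> (\<forall>i\<in>I. tyc T (sc (nxt S \<alpha> i)) (x i))"
  obtain y where y: "mem (pr \<alpha> y) (sc S)" "asy y" using sc_knd(1)[OF f] a by blast
  show "tyc T (sc S) (parc \<alpha> F)"
  proof (rule tyc_par[OF y])
    fix i z assume "mem (pr i z) F"
    then have i: "i \<in> idx S \<alpha>" "z = x i" using a unfolding F by auto
    obtain X where X: "lmem (pr i X) (bl y)" using sc_async(4)[OF f, of \<alpha> y i] y i by blast
    then show "\<exists>X. lmem (pr i X) (bl y) \<and> tyc T (upd (sc S) \<alpha> y X) z"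
      using sc_async(3)[OF f, of \<alpha> y i X] y a i by auto
  next
    fix i X assume "lmem (pr i X) (bl y)"
    then have "i \<in> idx S \<alpha>" using sc_async(3)[OF f, of \<alpha> y i X] y by blast
    then show "\<exists>z. mem (pr i z) F" unfolding F using a by simp
  next
    fix i z z' assume "mem (pr i z) F" "mem (pr i z') F"
    then show "z = z'" unfolding F by simp
  qed
qed

lemma nm_leafc: "nm v m (leafc a) \<Longrightarrow> m = Leaf (v a)"
  by (cases m) auto

lemma nm_parc: "nm v m (parc \<alpha> F) \<Longrightarrow> \<exists>I h x. m = Par \<alpha> I h \<and>
    (\<forall>i z. mem (pr i z) F \<longleftrightarrow> i \<in> I \<and> z = x i) \<and> (\<forall>i\<in>I. nm v (h i) (x i))"
  by (cases m) (auto simp del: nm.simps(2) simp: nm_Par)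

lemma nm_selc: "nm v m (selc \<alpha> k c) \<Longrightarrow> \<exists>f. m = Sel \<alpha> k f \<and> nm v f c"
  by (cases m) auto

lemma nm_parcI: "(\<And>i z. mem (pr i z) F \<longleftrightarrow> i \<in> I \<and> z = x i) \<Longrightarrow> (\<And>i. i \<in> I \<Longrightarrow> nm v (h i) (x i)) \<Longrightarrow>
    nm v (Par \<alpha> I h) (parc \<alpha> F)"
  by (rule nm_ParI) simp_all

text \<open>A code determines everything but junk, hence the term up to conversion.\<close>

lemma nm_unique: "ty lt S m \<Longrightarrow> nm v m c \<Longrightarrow> nm v m' c \<Longrightarrow> peq lt S m m'"
proof (induction arbitrary: c m' rule: ty.induct)
  case (ty_Leaf S f)
  then obtain a where "c = leafc a" "v a = f" by auto
  then have "m' = Leaf f" using nm_leafc ty_Leaf.prems(2) by metis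
  then show ?case using ty_Leaf.hyps by (simp add: pe_refl)
next
  case (ty_Par S \<alpha> I h)
  obtain F x where c: "c = parc \<alpha> F" and F: "\<And>i z. mem (pr i z) F \<longleftrightarrow> i \<in> I \<and> z = x i"
    and x: "\<And>i. i \<in> I \<Longrightarrow> nm v (h i) (x i)" using ty_Par.prems(1) unfolding nm_Par by blast
  obtain I' h' x' where m': "m' = Par \<alpha> I' h'" and F': "\<And>i z. mem (pr i z) F \<longleftrightarrow> i \<in> I' \<and> z = x' i"
    and x': "\<And>i. i \<in> I' \<Longrightarrow> nm v (h' i) (x' i)" using nm_parc[OF ty_Par.prems(2)[unfolded c]] by blast
  have I: "I' = I" using F F' by blast
  have "x' i = x i" if "i \<in> I" for i using F[of i "x i"] F'[of i "x i"] that by simp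
  then have "peq lt (nxt S \<alpha> i) (h i) (h' i)" if "i \<in> I" for i
    using ty_Par.IH[OF that x[OF that]] x'[of i] I that by simp
  then show ?case unfolding m' I using ty_Par.hyps(1,2) by (intro pe_Par)
next
  case (ty_Sel S \<alpha> k f)
  obtain x where c: "c = selc \<alpha> k x" and x: "nm v f x" using ty_Sel.prems(1) by auto
  obtain f' where m': "m' = Sel \<alpha> k f'" and f': "nm v f' x" using nm_selc[OF ty_Sel.prems(2)[unfolded c]] by blast
  show ?case unfolding m' using ty_Sel.hyps(1,2) ty_Sel.IH[OF x f'] by (intro pe_Sel)
qed

text \<open>Supplies a term for a code that occurs only in the middle of a chain of related
  codes.\<close>

lemma tyc_nm_exists: "tyc T S c \<Longrightarrow> \<exists>m. nm v m c"
proof (induction rule: tyc.induct)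
  case (tyc_leaf S a)
  have "nm v (Leaf (v a)) (leafc a)" by simp
  then show ?case by blast
next
  case (tyc_sel \<alpha> y S k X c)
  then obtain m where "nm v m c" by blast
  then have "nm v (Sel \<alpha> k m) (selc \<alpha> k c)" by simp
  then show ?case by blast
next
  case (tyc_par \<alpha> y S F)
  define I where "I = {i. \<exists>x. mem (pr i x) F}"
  have "\<forall>i\<in>I. \<exists>x. mem (pr i x) F" by (simp add: I_def)
  then obtain x where x: "\<forall>i\<in>I. mem (pr i (x i)) F" by metis
  have g: "mem (pr i z) F \<longleftrightarrow> i \<in> I \<and> z = x i" for i z
    using x tyc_par.hyps(4) unfolding I_def by blast
  have "\<forall>i\<in>I. \<exists>m. nm v m (x i)" using tyc_par.IH x by blast
  then obtain h where "\<forall>i\<in>I. nm v (h i) (x i)" by metis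
  then have "nm v (Par \<alpha> I h) (parc \<alpha> F)" using g by (intro nm_parcI) auto
  then show ?case by blast
qed

definition lm :: "nat \<Rightarrow> (nat \<Rightarrow> 'l) \<Rightarrow> nat sq \<Rightarrow> 'l \<Rightarrow> bool" where
  "lm T v S f \<longleftrightarrow> (\<exists>a. mem (pr (sc S) (leafc a)) T \<and> v a = f)"

lemma tyc_ty: "nm v m c \<Longrightarrow> finite (dom S) \<Longrightarrow> tyc T (sc S) c \<Longrightarrow> ty (lm T v) S m"
proof (induction m arbitrary: c S)
  case (Leaf f)
  then obtain a where "c = leafc a" "v a = f" by auto
  then show ?case using Leaf.prems(3) by (auto simp: lm_def tyc_Leaf_iff)
next
  case (Par \<alpha> I h)
  obtain F x where c: "c = parc \<alpha> F" and F: "\<And>i z. mem (pr i z) F \<longleftrightarrow> i \<in> I \<and> z = x i"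
    and x: "\<And>i. i \<in> I \<Longrightarrow> nm v (h i) (x i)" using Par.prems(1) unfolding nm_Par by blast
  show ?case using Par.prems(3)[unfolded c tyc_Par_iff[OF Par.prems(2) F]] Par.IH[OF rangeI x] Par.prems(2) by auto
next
  case (Sel \<alpha> k f)
  obtain x where c: "c = selc \<alpha> k x" and x: "nm v f x" using Sel.prems(1) by auto
  show ?case using Sel.prems(3)[unfolded c tyc_Sel_iff[OF Sel.prems(2)]] Sel.IH[OF x] Sel.prems(2) by auto
qed

lemma tyc_fam:
  assumes "famE E S \<alpha> y F F'" "mem (pr \<alpha> y) S" "asy y"
    and E: "\<And>S c c'. mem (pr S (pr c c')) E \<Longrightarrow> tyc T S c \<and> tyc T S c'"
  shows "tyc T S (parc \<alpha> F)" "tyc T S (parc \<alpha> F')"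
proof -
  note f = assms(1)[unfolded famE_iff onk_iff]
  show "tyc T S (parc \<alpha> F)"
  proof (rule tyc_par[OF assms(2,3)])
    fix i x assume x: "mem (pr i x) F"
    then obtain X where X: "lmem (pr i X) (bl y)" using f by blast
    then obtain p p' where p: "mem (pr i p) F" "mem (pr (upd S \<alpha> y X) (pr p p')) E" using f by blast
    then have "p = x" using x f by blast
    then show "\<exists>X. lmem (pr i X) (bl y) \<and> tyc T (upd S \<alpha> y X) x" using X E[OF p(2)] by blast
  qed (use f in blast)+
  show "tyc T S (parc \<alpha> F')"
  proof (rule tyc_par[OF assms(2,3)])
    fix i x assume x: "mem (pr i x) F'"
    then obtain X where X: "lmem (pr i X) (bl y)" using f by blast
    then obtain p p' where p: "mem (pr i p') F'" "mem (pr (upd S \<alpha> y X) (pr p p')) E" using f by blast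
    then have "p' = x" using x f by blast
    then show "\<exists>X. lmem (pr i X) (bl y) \<and> tyc T (upd S \<alpha> y X) x" using X E[OF p(2)] by blast
  qed (use f in blast)+
qed

lemma conv_sound:
  assumes cv: "conv c c'" and f: "finite (dom S)" and t: "tyc T (sc S) c" "tyc T (sc S) c'"
    and n: "nm v m c" "nm v m' c'"
  shows "peq (lm T v) S m m'"
proof -
  note ty1 = tyc_ty[OF n(1) f t(1)] and ty2 = tyc_ty[OF n(2) f t(2)]
  \<comment> \<open>It suffices to convert \<open>m\<close> into any term named by
    \<open>c'\<close>, since all such terms are convertible.\<close>
  have uniq: "peq (lm T v) S m m'" if "peq (lm T v) S m m2" "nm v m2 c'" for m2
    using pe_trans[OF that(1) nm_unique[OF peq_ty2[OF that(1)] that(2) n(2)]] .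
  consider
    (PP) "f1 c = 1" "f1 c' = 1" "f1 (f2 c) \<noteq> f1 (f2 c')"
       "\<And>w. mem w (f2 (f2 c)) \<Longrightarrow> f1 (f2 w) = 1 \<and> f1 (f2 (f2 w)) = f1 (f2 c')"
       "\<And>w. mem w (f2 (f2 c')) \<Longrightarrow> f1 (f2 w) = 1 \<and> f1 (f2 (f2 w)) = f1 (f2 c)"
       "\<And>w u. mem w (f2 (f2 c)) \<Longrightarrow> mem u (f2 (f2 (f2 w))) \<Longrightarrow>
         \<exists>w'. mem w' (f2 (f2 c')) \<and> f1 w' = f1 u \<and> mem (pr (f1 w) (f2 u)) (f2 (f2 (f2 w')))"
  | (PS) "f1 c = 1" "f1 c' = 2" "f1 (f2 c) \<noteq> f1 (f2 c')" "f1 (f2 (f2 (f2 c'))) = 1"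
       "f1 (f2 (f2 (f2 (f2 c')))) = f1 (f2 c)"
       "\<And>w. mem w (f2 (f2 c)) \<Longrightarrow> f1 (f2 w) = 2 \<and> f1 (f2 (f2 w)) = f1 (f2 c') \<and>
          f1 (f2 (f2 (f2 w))) = f1 (f2 (f2 c')) \<and>
          mem (pr (f1 w) (f2 (f2 (f2 (f2 w))))) (f2 (f2 (f2 (f2 (f2 c')))))"
  | (SS) "f1 c = 2" "f1 (f2 (f2 (f2 c))) = 2" "f1 (f2 c) \<noteq> f1 (f2 (f2 (f2 (f2 c))))"
       "c' = selc (f1 (f2 (f2 (f2 (f2 c))))) (f1 (f2 (f2 (f2 (f2 (f2 c))))))
              (selc (f1 (f2 c)) (f1 (f2 (f2 c))) (f2 (f2 (f2 (f2 (f2 (f2 c)))))))"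
    using cv mem_less unfolding conv_def by blast
  then show ?thesis
  proof cases
    case PP
    define \<alpha> \<beta> F G where d: "\<alpha> = f1 (f2 c)" "\<beta> = f1 (f2 c')" "F = f2 (f2 c)" "G = f2 (f2 c')"
    have c: "c = parc \<alpha> F" "c' = parc \<beta> G" unfolding d using PP(1,2) by (metis pr_f)+
    obtain I h x where m: "m = Par \<alpha> I h" and F: "\<And>i z. mem (pr i z) F \<longleftrightarrow> i \<in> I \<and> z = x i"
      and x: "\<And>i. i \<in> I \<Longrightarrow> nm v (h i) (x i)" using nm_parc[OF n(1)[unfolded c]] by blast
    obtain J g y where m': "m' = Par \<beta> J g" and G: "\<And>i z. mem (pr i z) G \<longleftrightarrow> i \<in> J \<and> z = y i"
      and y: "\<And>i. i \<in> J \<Longrightarrow> nm v (g i) (y i)" using nm_parc[OF n(2)[unfolded c]] by blast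
    have ab: "\<alpha> \<noteq> \<beta>" using PP(3) d by simp
    have T1: "knd S \<alpha> = Some True" "I = idx S \<alpha>" "\<And>i. i \<in> I \<Longrightarrow> ty (lm T v) (nxt S \<alpha> i) (h i)" using ty1 m by auto
    have T2: "knd S \<beta> = Some True" "J = idx S \<beta>" "\<And>i. i \<in> J \<Longrightarrow> ty (lm T v) (nxt S \<beta> i) (g i)" using ty2 m' by auto
    have ex: "\<exists>hi x2. h i = Par \<beta> J hi \<and> (\<forall>j z. mem (pr j z) (f2 (f2 (x i))) \<longleftrightarrow> j \<in> J \<and> z = x2 j) \<and>
        (\<forall>j\<in>J. nm v (hi j) (x2 j))" if i: "i \<in> I" for i
    proof -
      have "mem (pr i (x i)) F" using F i by simp
      then have "f1 (x i) = 1 \<and> f1 (f2 (x i)) = \<beta>" using PP(4)[of "pr i (x i)"] d by simp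
      then have xi: "x i = parc \<beta> (f2 (f2 (x i)))" by (metis pr_f)
      obtain I' h' x' where h': "h i = Par \<beta> I' h'" "\<forall>j z. mem (pr j z) (f2 (f2 (x i))) \<longleftrightarrow> j \<in> I' \<and> z = x' j"
        "\<forall>j\<in>I'. nm v (h' j) (x' j)" using nm_parc[of v "h i" \<beta> "f2 (f2 (x i))"] x[OF i] xi by metis
      \<comment> \<open>That an inner family ranges over all branches of \<open>\<beta>\<close>
        comes from typing; \<open>conv\<close> checks only its channel.\<close>
      have "I' = J" using T1(3)[OF i] ab T2(2) unfolding h'(1) by simp
      then show ?thesis using h' by blast
    qed
    then obtain hh x2 where hh: "\<And>i. i \<in> I \<Longrightarrow> h i = Par \<beta> J (hh i)"
      "\<And>i j z. i \<in> I \<Longrightarrow> mem (pr j z) (f2 (f2 (x i))) \<longleftrightarrow> j \<in> J \<and> z = x2 i j"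
      "\<And>i j. i \<in> I \<Longrightarrow> j \<in> J \<Longrightarrow> nm v (hh i j) (x2 i j)" by metis
    let ?m2 = "Par \<beta> J (\<lambda>j. Par \<alpha> I (\<lambda>i. hh i j))"
    have "nm v (Par \<alpha> I (\<lambda>i. hh i j)) (y j)" if j: "j \<in> J" for j
    proof -
      have "mem (pr j (y j)) G" using G j by simp
      then have "f1 (y j) = 1 \<and> f1 (f2 (y j)) = \<alpha>" using PP(5)[of "pr j (y j)"] d by simp
      then have yj: "y j = parc \<alpha> (f2 (f2 (y j)))" by (metis pr_f)
      obtain I' h' y' where h': "g j = Par \<alpha> I' h'" "\<forall>i z. mem (pr i z) (f2 (f2 (y j))) \<longleftrightarrow> i \<in> I' \<and> z = y' i"
        using nm_parc[of v "g j" \<alpha> "f2 (f2 (y j))"] y[OF j] yj by metis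
      have I': "I' = I" using T2(3)[OF j] ab T1(2) unfolding h'(1) by simp
      have "y' i = x2 i j" if i: "i \<in> I" for i
      proof -
        have "mem (pr i (x i)) F" "mem (pr j (x2 i j)) (f2 (f2 (x i)))" using F i hh(2)[OF i] j by auto
        then obtain w' where w': "mem w' G" "f1 w' = j" "mem (pr i (x2 i j)) (f2 (f2 (f2 w')))"
          using PP(6)[of "pr i (x i)" "pr j (x2 i j)"] d by auto
        have "mem (pr j (f2 w')) G" using w'(1,2) by auto
        then have "f2 w' = y j" using G by simp
        then show ?thesis using w'(3) h'(2) by simp
      qed
      then have gr: "mem (pr i z) (f2 (f2 (y j))) \<longleftrightarrow> i \<in> I \<and> z = x2 i j" for i z using h'(2) I' by auto
      show ?thesis by (subst yj, rule nm_parcI[OF gr hh(3)[OF _ j]])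
    qed
    then have n2: "nm v ?m2 c'" unfolding c by (intro nm_parcI[OF G])
    have tf: "ty (lm T v) (nxt (nxt S \<alpha> i) \<beta> j) (hh i j)" if "i \<in> I" "j \<in> J" for i j
      using T1(3)[OF that(1)] that(2) unfolding hh(1)[OF that(1)] by simp
    have e: "peq (lm T v) S m (Par \<alpha> I (\<lambda>i. Par \<beta> J (hh i)))"
      unfolding m by (rule pe_ext[OF ty1[unfolded m] hh(1)])
    show ?thesis by (rule uniq[OF pe_trans[OF e pe_PP[OF ab T1(1) T2(1) T1(2) T2(2) tf]] n2])
  next
    case PS
    define \<alpha> \<beta> k F d where d: "\<alpha> = f1 (f2 c)" "\<beta> = f1 (f2 c')" "k = f1 (f2 (f2 c'))" "F = f2 (f2 c)" "d = f2 (f2 (f2 c'))"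
    have c: "c = parc \<alpha> F" "c' = selc \<beta> k d" unfolding d using PS(1,2) by (metis pr_f)+
    have dd: "d = parc \<alpha> (f2 (f2 d))" unfolding d using PS(4,5) by (metis pr_f)
    obtain I h x where m: "m = Par \<alpha> I h" and F: "\<And>i z. mem (pr i z) F \<longleftrightarrow> i \<in> I \<and> z = x i"
      and x: "\<And>i. i \<in> I \<Longrightarrow> nm v (h i) (x i)" using nm_parc[OF n(1)[unfolded c]] by blast
    obtain g where m': "m' = Sel \<beta> k g" and g: "nm v g d" using nm_selc[OF n(2)[unfolded c]] by blast
    obtain I' g' y where g': "g = Par \<alpha> I' g'" and G: "\<And>i z. mem (pr i z) (f2 (f2 d)) \<longleftrightarrow> i \<in> I' \<and> z = y i"
      using nm_parc[of v g \<alpha> "f2 (f2 d)"] g dd by metis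
    have ab: "\<alpha> \<noteq> \<beta>" using PS(3) d by simp
    have T1: "knd S \<alpha> = Some True" "I = idx S \<alpha>" "\<And>i. i \<in> I \<Longrightarrow> ty (lm T v) (nxt S \<alpha> i) (h i)" using ty1 m by auto
    have T2: "knd S \<beta> = Some False" "k \<in> idx S \<beta>" "I' = idx S \<alpha>" using ty2 ab unfolding m' g' by auto
    have ex: "\<exists>hi. h i = Sel \<beta> k hi \<and> nm v hi (f2 (f2 (f2 (x i)))) \<and> y i = f2 (f2 (f2 (x i)))" if i: "i \<in> I" for i
    proof -
      have "mem (pr i (x i)) F" using F i by simp
      then have xi: "f1 (x i) = 2 \<and> f1 (f2 (x i)) = \<beta> \<and> f1 (f2 (f2 (x i))) = k \<and> mem (pr i (f2 (f2 (f2 (x i))))) (f2 (f2 d))"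
        using PS(6)[of "pr i (x i)"] d by simp
      then have "x i = selc \<beta> k (f2 (f2 (f2 (x i))))" by (metis pr_f)
      then show ?thesis using nm_selc[of v "h i" \<beta> k "f2 (f2 (f2 (x i)))"] x[OF i] xi G by metis
    qed
    then obtain hh where hh: "\<And>i. i \<in> I \<Longrightarrow> h i = Sel \<beta> k (hh i)" "\<And>i. i \<in> I \<Longrightarrow> nm v (hh i) (y i)" by metis
    have "nm v (Par \<alpha> I hh) d" by (subst dd, rule nm_parcI[of _ _ y]) (use G T2(3) T1(2) hh(2) in auto)
    then have n2: "nm v (Sel \<beta> k (Par \<alpha> I hh)) c'" unfolding c by simp
    have tf: "ty (lm T v) (nxt (nxt S \<alpha> i) \<beta> k) (hh i)" if "i \<in> I" for i
      using T1(3)[OF that] unfolding hh(1)[OF that] by simp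
    have e: "peq (lm T v) S m (Par \<alpha> I (\<lambda>i. Sel \<beta> k (hh i)))"
      unfolding m by (rule pe_ext[OF ty1[unfolded m] hh(1)])
    show ?thesis by (rule uniq[OF pe_trans[OF e pe_PS[OF ab T1(1) T2(1) T1(2) T2(2) tf]] n2])
  next
    case SS
    define \<alpha> k \<beta> l x where d: "\<alpha> = f1 (f2 c)" "k = f1 (f2 (f2 c))" "\<beta> = f1 (f2 (f2 (f2 (f2 c))))"
      "l = f1 (f2 (f2 (f2 (f2 (f2 c)))))" "x = f2 (f2 (f2 (f2 (f2 (f2 c)))))"
    have c: "c = selc \<alpha> k (selc \<beta> l x)" unfolding d using SS(1,2) by (metis pr_f)
    have c': "c' = selc \<beta> l (selc \<alpha> k x)" unfolding d by (rule SS(4))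
    obtain g where g: "m = Sel \<alpha> k g" "nm v g (selc \<beta> l x)" using nm_selc[OF n(1)[unfolded c]] by blast
    obtain f where f: "g = Sel \<beta> l f" "nm v f x" using nm_selc[OF g(2)] by blast
    have n2: "nm v (Sel \<beta> l (Sel \<alpha> k f)) c'" unfolding c' using f(2) by simp
    have "\<alpha> \<noteq> \<beta>" using SS(3) d by simp
    then have "peq (lm T v) S m (Sel \<beta> l (Sel \<alpha> k f))"
      using ty1 unfolding g(1) f(1) by (rule conv_SS[rotated])
    then show ?thesis by (rule uniq[OF _ n2])
  qed
qed

section \<open>The saturated set is sound and complete\<close>

definition okM :: "nat \<Rightarrow> (nat \<Rightarrow> 'l) \<Rightarrow> nat \<Rightarrow> bool" where
  "okM T v M \<longleftrightarrow> (\<forall>S a b. mem (pr S (pr a b)) M \<longleftrightarrow>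
     mem (pr S (leafc a)) T \<and> mem (pr S (leafc b)) T \<and> v a = v b)"

text \<open>The total relation between typed codes, at all sequents up to \<open>B\<close>, is
  closed, and it is finite by \<open>finite_tyc\<close>.\<close>

lemma closedE_exists:
  assumes "okM T v M"
  shows "\<exists>E. closedE M B E"
proof -
  define X where "X = (\<lambda>(S, c, c'). pr S (pr c c')) ` (\<Union>S\<in>{..B}. {S} \<times> {c. tyc T S c} \<times> {c. tyc T S c})"
  have fX: "finite X" unfolding X_def by (intro finite_imageI finite_UN_I finite_cartesian_product finite_tyc) auto
  have X: "mem (pr S (pr c c')) (set_encode X) \<longleftrightarrow> S \<le> B \<and> tyc T S c \<and> tyc T S c'" for S c c'
    using fX unfolding mem_encode[OF fX] X_def by (auto simp: image_iff)
  have "closedE M B (set_encode X)" unfolding closedE_iff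
  proof (intro conjI allI impI; (elim conjE)?)
    fix S a b assume "mem (pr S (pr a b)) M" "S \<le> B"
    then show "mem (pr S (pr (leafc a) (leafc b))) (set_encode X)"
      using assms unfolding X okM_def by (auto intro: tyc_leaf)
  next
    fix S \<alpha> y k Y c c'
    assume "S \<le> B" "mem (pr \<alpha> y) S" "syn y" "lmem (pr k Y) (bl y)" "mem (pr (upd S \<alpha> y Y) (pr c c')) (set_encode X)"
    then show "mem (pr S (pr (selc \<alpha> k c) (selc \<alpha> k c'))) (set_encode X)" unfolding X by (blast intro: tyc_sel)
  next
    fix S \<alpha> y F F' assume h: "S \<le> B" "mem (pr \<alpha> y) S" "asy y" "famE (set_encode X) S \<alpha> y F F'"
    show "mem (pr S (pr (parc \<alpha> F) (parc \<alpha> F'))) (set_encode X)"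
      unfolding X using h(1) tyc_fam[OF h(4,2,3), of T] X by blast
  qed (auto simp: X)
  then show ?thesis ..
qed

lemma famE_mono: "famE E S \<alpha> y F F' \<Longrightarrow> sub E E' \<Longrightarrow> famE E' S \<alpha> y F F'"
  unfolding famE_iff by blast

definition good :: "nat \<Rightarrow> (nat \<Rightarrow> 'l) \<Rightarrow> nat \<Rightarrow> nat \<Rightarrow> nat \<Rightarrow> bool" where
  "good T v S c c' \<longleftrightarrow> tyc T S c \<and> tyc T S c' \<and> (\<forall>S0 m m'. finite (dom S0) \<longrightarrow> S = sc S0 \<longrightarrow>
     nm v m c \<longrightarrow> nm v m' c' \<longrightarrow> peq (lm T v) S0 m m')"

text \<open>The sound triples in \<open>E\<close> satisfy all closure rules, so by minimality they
  are all of \<open>E\<close>. Soundness speaks about every term with the given code, as codes do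
  not determine terms.\<close>

lemma E_sound:
  assumes M: "okM T v M" and E: "E = (LEAST E. closedE M B E)" and z: "mem (pr S (pr c c')) E"
  shows "good T v S c c'"
proof -
  define P where "P z = good T v (f1 z) (f1 (f2 z)) (f2 (f2 z))" for z
  obtain E0 where E0: "closedE M B E0" using closedE_exists[OF M] by blast
  have "P (pr S (pr c c'))"
  proof (rule least_closed_induct[where C = "closedE M B", OF E0 E _ z])
    assume cE: "closedE M B E"
    let ?E = "set_encode {z. mem z E \<and> P z}"
    have "{z. mem z E \<and> P z} \<subseteq> set_decode E" by (auto simp: mem_def)
    then have fin: "finite {z. mem z E \<and> P z}" by (rule finite_subset) simp
    have me: "mem (pr S (pr c c')) ?E \<longleftrightarrow> mem (pr S (pr c c')) E \<and> good T v S c c'" for S c c'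
      using fin by (simp add: P_def)
    have sub: "sub ?E E" using fin by simp
    note r = cE[unfolded closedE_iff]
    note r1 = r[THEN conjunct1]
      and r2 = r[THEN conjunct2, THEN conjunct1]
      and r3 = r[THEN conjunct2, THEN conjunct2, THEN conjunct1]
      and r4 = r[THEN conjunct2, THEN conjunct2, THEN conjunct2, THEN conjunct1]
      and r5 = r[THEN conjunct2, THEN conjunct2, THEN conjunct2, THEN conjunct2, THEN conjunct1]
      and r6 = r[THEN conjunct2, THEN conjunct2, THEN conjunct2, THEN conjunct2, THEN conjunct2]
    show "closedE M B ?E" unfolding closedE_iff
    proof (intro conjI allI impI; (elim conjE)?)
      fix S a b assume h: "mem (pr S (pr a b)) M" "S \<le> B"
      then have ab: "mem (pr S (leafc a)) T" "mem (pr S (leafc b)) T" "v a = v b" using M by (auto simp: okM_def)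
      have "good T v S (leafc a) (leafc b)" unfolding good_def tyc_Leaf_iff
      proof (intro conjI ab allI impI)
        fix S0 m m' assume "finite (dom S0)" "S = sc S0" "nm v m (leafc a)" "nm v m' (leafc b)"
        then show "peq (lm T v) S0 m m'" using ab nm_leafc[of v m a] nm_leafc[of v m' b] by (auto simp: lm_def intro!: pe_refl)
      qed
      then show "mem (pr S (pr (leafc a) (leafc b))) ?E" unfolding me using r1 h by blast
    next
      fix S c c' assume "mem (pr S (pr c c')) ?E"
      then have h: "mem (pr S (pr c c')) E" "good T v S c c'" by (simp_all only: me)
      have "good T v S c' c" using h(2) pe_sym unfolding good_def by blast
      then show "mem (pr S (pr c' c)) ?E" unfolding me using r2 h by blast
    next
      fix S c c' c'' assume "mem (pr S (pr c c')) ?E" "mem (pr S (pr c' c'')) ?E"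
      then have h: "mem (pr S (pr c c')) E" "good T v S c c'" "mem (pr S (pr c' c'')) E" "good T v S c' c''"
        by (simp_all only: me)
      have "good T v S c c''" unfolding good_def
      proof (intro conjI allI impI)
        fix S0 m m' assume a: "finite (dom S0)" "S = sc S0" "nm v m c" "nm v m' c''"
        \<comment> \<open>Two facts about codes can be chained only through a term named by the
          middle code; typing of that code provides one.\<close>
        obtain m2 where "nm v m2 c'" using tyc_nm_exists h(2) unfolding good_def by blast
        then have "peq (lm T v) S0 m m2" "peq (lm T v) S0 m2 m'" using h(2,4) a unfolding good_def by blast+
        then show "peq (lm T v) S0 m m'" by (rule pe_trans)
      qed (use h in \<open>auto simp: good_def\<close>)
      then show "mem (pr S (pr c c'')) ?E" unfolding me using r3 h by blast
    next
      fix S \<alpha> y k X c c'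
      assume h: "S \<le> B" "mem (pr \<alpha> y) S" "syn y" "lmem (pr k X) (bl y)" "mem (pr (upd S \<alpha> y X) (pr c c')) ?E"
      then have g: "mem (pr (upd S \<alpha> y X) (pr c c')) E" "good T v (upd S \<alpha> y X) c c'" by (simp_all only: me)
      have "good T v S (selc \<alpha> k c) (selc \<alpha> k c')" unfolding good_def
      proof (intro conjI allI impI)
        show "tyc T S (selc \<alpha> k c)" "tyc T S (selc \<alpha> k c')"
          using g(2) h unfolding good_def by (auto intro: tyc_sel)
        fix S0 m m' assume a: "finite (dom S0)" "S = sc S0" "nm v m (selc \<alpha> k c)" "nm v m' (selc \<alpha> k c')"
        obtain f f' where f: "m = Sel \<alpha> k f" "nm v f c" "m' = Sel \<alpha> k f'" "nm v f' c'"
          using nm_selc[OF a(3)] nm_selc[OF a(4)] by blast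
        have k: "knd S0 \<alpha> = Some False" "k \<in> idx S0 \<alpha>" "upd S \<alpha> y X = sc (nxt S0 \<alpha> k)"
          using sc_async(2,3)[OF a(1), of \<alpha> y] h(2,3,4) a(2) by blast+
        have "peq (lm T v) (nxt S0 \<alpha> k) f f'"
          using g(2) f k(3) a(1) unfolding good_def by simp
        then show "peq (lm T v) S0 m m'" unfolding f(1,3) using k by (intro pe_Sel)
      qed
      then show "mem (pr S (pr (selc \<alpha> k c) (selc \<alpha> k c'))) ?E" unfolding me using r4 h(1-4) g(1) by blast
    next
      fix S \<alpha> y F F' assume h: "S \<le> B" "mem (pr \<alpha> y) S" "asy y" "famE ?E S \<alpha> y F F'"
      note fE = famE_mono[OF h(4) sub]
      have tc: "tyc T S (parc \<alpha> F)" "tyc T S (parc \<alpha> F')"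
        using tyc_fam[OF h(4,2,3), of T] unfolding me good_def by blast+
      have "good T v S (parc \<alpha> F) (parc \<alpha> F')" unfolding good_def
      proof (intro conjI allI impI tc)
        fix S0 m m' assume a: "finite (dom S0)" "S = sc S0" "nm v m (parc \<alpha> F)" "nm v m' (parc \<alpha> F')"
        note ty = tyc_ty[OF a(3,1) tc(1)[unfolded a(2)]] tyc_ty[OF a(4,1) tc(2)[unfolded a(2)]]
        obtain I f x where m: "m = Par \<alpha> I f" "\<And>i z. mem (pr i z) F \<longleftrightarrow> i \<in> I \<and> z = x i"
          "\<And>i. i \<in> I \<Longrightarrow> nm v (f i) (x i)" using nm_parc[OF a(3)] by blast
        obtain I' f' x' where m': "m' = Par \<alpha> I' f'" "\<And>i z. mem (pr i z) F' \<longleftrightarrow> i \<in> I' \<and> z = x' i"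
          "\<And>i. i \<in> I' \<Longrightarrow> nm v (f' i) (x' i)" using nm_parc[OF a(4)] by blast
        have I: "knd S0 \<alpha> = Some True" "I = idx S0 \<alpha>" "I' = idx S0 \<alpha>" using ty unfolding m(1) m'(1) by auto
        have "peq (lm T v) (nxt S0 \<alpha> i) (f i) (f' i)" if i: "i \<in> idx S0 \<alpha>" for i
        proof -
          obtain X where X: "lmem (pr i X) (bl y)" using sc_async(4)[OF a(1), of \<alpha> y i] h(2,3) a(2) i by blast
          obtain p p' where p: "mem (pr i p) F" "mem (pr i p') F'" "mem (pr (upd S \<alpha> y X) (pr p p')) ?E"
            using h(4) X unfolding famE_iff by blast
          have "p = x i" "p' = x' i" using p(1,2) m(2) m'(2) by blast+
          moreover have "upd S \<alpha> y X = sc (nxt S0 \<alpha> i)" using sc_async(3)[OF a(1), of \<alpha> y i X] h(2,3) a(2) X by blast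
          ultimately have "good T v (sc (nxt S0 \<alpha> i)) (x i) (x' i)" using p(3) unfolding me by simp
          then show ?thesis using m(3)[of i] m'(3)[of i] i I a(1) unfolding good_def by simp
        qed
        then show "peq (lm T v) S0 m m'" unfolding m(1) m'(1) using I by (auto intro: pe_Par)
      qed
      then show "mem (pr S (pr (parc \<alpha> F) (parc \<alpha> F'))) ?E" unfolding me using r5 h(1-3) fE by blast
    next
      fix S c c' assume "mem (pr S (pr c c)) ?E" "mem (pr S (pr c' c')) ?E" and cv: "conv c c'"
      then have h: "mem (pr S (pr c c)) E" "good T v S c c" "mem (pr S (pr c' c')) E" "good T v S c' c'"
        by (simp_all only: me)
      have "good T v S c c'" using h(2,4) conv_sound[OF cv] unfolding good_def by blast
      then show "mem (pr S (pr c c')) ?E" unfolding me using r6 h cv by blast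
    qed
  qed
  then show ?thesis by (simp add: P_def)
qed

lemma sc_nxt_le:
  assumes "finite (dom S)" "knd S \<alpha> = Some b" "i \<in> idx S \<alpha>"
  shows "sc (nxt S \<alpha> i) \<le> sc S"
proof -
  obtain y where y: "mem (pr \<alpha> y) (sc S)" "asy y \<or> syn y"
    using sc_knd[OF assms(1), of \<alpha>] assms(2) by (cases b) auto
  then obtain X where X: "lmem (pr i X) (bl y)" using sc_async(4)[OF assms(1), of \<alpha> y i] assms(3) by blast
  show ?thesis using upd_less[OF y(1) X] sc_async(3)[OF assms(1), of \<alpha> y i X] y X by auto
qed

text \<open>An intermediate term of a conversion comes without a code. One is built here, with leaf
  codes taken from the table.\<close>

lemma tyc_code_exists:
  assumes "ty (lm T v) S m" "finite (dom S)"
  shows "\<exists>c. nm v m c \<and> tyc T (sc S) c"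
  using assms
proof (induction rule: ty.induct)
  case (ty_Leaf S f)
  then obtain a where a: "mem (pr (sc S) (leafc a)) T" "v a = f" by (auto simp: lm_def)
  then have "nm v (Leaf f) (leafc a) \<and> tyc T (sc S) (leafc a)" by (auto intro: tyc_leaf)
  then show ?case by blast
next
  case (ty_Par S \<alpha> I h)
  have "\<forall>i\<in>I. \<exists>c. nm v (h i) c \<and> tyc T (sc (nxt S \<alpha> i)) c" using ty_Par.IH ty_Par.prems by simp
  then obtain x where x: "\<forall>i\<in>I. nm v (h i) (x i) \<and> tyc T (sc (nxt S \<alpha> i)) (x i)" by metis
  have "finite I" using ty_Par.hyps(2) by simp
  then have g: "mem (pr i z) (fcode I x) \<longleftrightarrow> i \<in> I \<and> z = x i" for i z by simp
  have "nm v (Par \<alpha> I h) (parc \<alpha> (fcode I x))" by (rule nm_parcI[OF g]) (use x in blast)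
  moreover have "tyc T (sc S) (parc \<alpha> (fcode I x))"
    unfolding tyc_Par_iff[OF ty_Par.prems g] using ty_Par.hyps(1,2) x by blast
  ultimately show ?case by blast
next
  case (ty_Sel S \<alpha> k f)
  then obtain c where c: "nm v f c" "tyc T (sc (nxt S \<alpha> k)) c" by auto
  have "nm v (Sel \<alpha> k f) (selc \<alpha> k c)" using c(1) by simp
  moreover have "tyc T (sc S) (selc \<alpha> k c)" unfolding tyc_Sel_iff[OF ty_Sel.prems] using ty_Sel.hyps c(2) by blast
  ultimately show ?case by blast
qed

lemma E_par:
  assumes cE: "closedE M B E" and f: "finite (dom S)" "sc S \<le> B" and k: "knd S \<alpha> = Some True" "I = idx S \<alpha>"
    and F: "\<And>i z. mem (pr i z) F \<longleftrightarrow> i \<in> I \<and> z = x i" "\<And>i z. mem (pr i z) F' \<longleftrightarrow> i \<in> I \<and> z = x' i"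
    and e: "\<And>i. i \<in> I \<Longrightarrow> mem (pr (sc (nxt S \<alpha> i)) (pr (x i) (x' i))) E"
  shows "mem (pr (sc S) (pr (parc \<alpha> F) (parc \<alpha> F'))) E"
proof -
  obtain y where y: "mem (pr \<alpha> y) (sc S)" "asy y" using sc_knd(1)[OF f(1) k(1)] by blast
  have i: "i \<in> I \<and> upd (sc S) \<alpha> y X = sc (nxt S \<alpha> i)" if "lmem (pr i X) (bl y)" for i X
    using sc_async(3)[OF f(1), of \<alpha> y i X] y that k(2) by blast
  have "\<exists>X. lmem (pr i X) (bl y)" if "i \<in> I" for i
    using sc_async(4)[OF f(1), of \<alpha> y i] y that k(2) by blast
  then have "onk y F" "onk y F'" unfolding onk_iff F by blast+
  moreover have "\<exists>p p'. mem (pr i p) F \<and> mem (pr i p') F' \<and> mem (pr (upd (sc S) \<alpha> y X) (pr p p')) E"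
    if "lmem (pr i X) (bl y)" for i X
    using i[OF that] e[of i] unfolding F by auto
  ultimately have "famE E (sc S) \<alpha> y F F'" unfolding famE_iff by blast
  then show ?thesis using cE[unfolded closedE_iff, THEN conjunct2, THEN conjunct2, THEN conjunct2, THEN conjunct2, THEN conjunct1]
    f(2) y by blast
qed

lemma E_sel:
  assumes cE: "closedE M B E" and f: "finite (dom S)" "sc S \<le> B" and k: "knd S \<alpha> = Some False" "k \<in> idx S \<alpha>"
    and e: "mem (pr (sc (nxt S \<alpha> k)) (pr c c')) E"
  shows "mem (pr (sc S) (pr (selc \<alpha> k c) (selc \<alpha> k c'))) E"
proof -
  obtain y where y: "mem (pr \<alpha> y) (sc S)" "syn y" using sc_knd(2)[OF f(1) k(1)] by blast
  obtain X where X: "lmem (pr k X) (bl y)" using sc_async(4)[OF f(1), of \<alpha> y k] y k(2) by blast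
  have "upd (sc S) \<alpha> y X = sc (nxt S \<alpha> k)" using sc_async(3)[OF f(1), of \<alpha> y k X] y X by blast
  then have "mem (pr (upd (sc S) \<alpha> y X) (pr c c')) E" using e by simp
  then show ?thesis using cE[unfolded closedE_iff, THEN conjunct2, THEN conjunct2, THEN conjunct2, THEN conjunct1]
    f(2) y X by blast
qed

text \<open>Two codes of one term differ only in leaf codes of equal value, and these pairs are in
  \<open>M\<close>. With equal codes this yields the typing judgements that the conversion rule asks
  for.\<close>

lemma E_refl:
  assumes M: "okM T v M" and cE: "closedE M B E"
    and "ty lt S m" "finite (dom S)" "sc S \<le> B" "nm v m c" "nm v m c'" "tyc T (sc S) c" "tyc T (sc S) c'"
  shows "mem (pr (sc S) (pr c c')) E"
  using assms(3-)
proof (induction arbitrary: c c' rule: ty.induct)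
  case (ty_Leaf S f)
  obtain a where a1: "c = leafc a" "v a = f" using ty_Leaf.prems(3) by auto
  obtain a' where a2: "c' = leafc a'" "v a' = f" using ty_Leaf.prems(4) by auto
  note a = a1 a2
  have "mem (pr (sc S) (leafc a)) T" "mem (pr (sc S) (leafc a')) T"
    using ty_Leaf.prems(5,6) by (simp_all only: a tyc_Leaf_iff)
  then have "mem (pr (sc S) (pr a a')) M" by (simp only: M[unfolded okM_def, rule_format] a simp_thms)
  then have "mem (pr (sc S) (pr (leafc a) (leafc a'))) E"
    using cE[unfolded closedE_iff, THEN conjunct1] ty_Leaf.prems(2) by blast
  then show ?case by (simp only: a)
next
  case (ty_Par S \<alpha> I h)
  obtain F x where c: "c = parc \<alpha> F" and F: "\<And>i z. mem (pr i z) F \<longleftrightarrow> i \<in> I \<and> z = x i"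
    and x: "\<And>i. i \<in> I \<Longrightarrow> nm v (h i) (x i)" using ty_Par.prems(3) unfolding nm_Par by blast
  obtain F' x' where c': "c' = parc \<alpha> F'" and F': "\<And>i z. mem (pr i z) F' \<longleftrightarrow> i \<in> I \<and> z = x' i"
    and x': "\<And>i. i \<in> I \<Longrightarrow> nm v (h i) (x' i)" using ty_Par.prems(4) unfolding nm_Par by blast
  note t = ty_Par.prems(5)[unfolded c tyc_Par_iff[OF ty_Par.prems(1) F]]
    ty_Par.prems(6)[unfolded c' tyc_Par_iff[OF ty_Par.prems(1) F']]
  show ?case unfolding c c'
  proof (rule E_par[OF cE ty_Par.prems(1,2) ty_Par.hyps(1,2) F F'])
    fix i assume i: "i \<in> I"
    have "sc (nxt S \<alpha> i) \<le> B"
      using sc_nxt_le[OF ty_Par.prems(1) ty_Par.hyps(1), of i] i ty_Par.hyps(2) ty_Par.prems(2) by simp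
    moreover have "finite (dom (nxt S \<alpha> i))" using ty_Par.prems(1) by simp
    moreover have "tyc T (sc (nxt S \<alpha> i)) (x i)" "tyc T (sc (nxt S \<alpha> i)) (x' i)" using t i by blast+
    ultimately show "mem (pr (sc (nxt S \<alpha> i)) (pr (x i) (x' i))) E"
      using ty_Par.IH[OF i _ _ x[OF i] x'[OF i]] by blast
  qed
next
  case (ty_Sel S \<alpha> k f)
  obtain x where c: "c = selc \<alpha> k x" and x: "nm v f x" using ty_Sel.prems(3) by auto
  obtain x' where c': "c' = selc \<alpha> k x'" and x': "nm v f x'" using ty_Sel.prems(4) by auto
  note t = ty_Sel.prems(5)[unfolded c tyc_Sel_iff[OF ty_Sel.prems(1)]]
    ty_Sel.prems(6)[unfolded c' tyc_Sel_iff[OF ty_Sel.prems(1)]]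
  have "sc (nxt S \<alpha> k) \<le> B" using sc_nxt_le[OF ty_Sel.prems(1) ty_Sel.hyps(1,2)] ty_Sel.prems(2) by simp
  moreover have "finite (dom (nxt S \<alpha> k))" using ty_Sel.prems(1) by simp
  moreover have "tyc T (sc (nxt S \<alpha> k)) x" "tyc T (sc (nxt S \<alpha> k)) x'" using t by blast+
  ultimately have "mem (pr (sc (nxt S \<alpha> k)) (pr x x')) E" using ty_Sel.IH[OF _ _ x x'] by blast
  then show ?case unfolding c c' by (rule E_sel[OF cE ty_Sel.prems(1,2) ty_Sel.hyps(1,2)])
qed

text \<open>Holds for every closed \<open>E\<close>. The induction is over conversions whose
  intermediate terms use only leaves of the table, so each of them has a code.\<close>

lemma E_complete:
  assumes M: "okM T v M" and cE: "closedE M B E"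
    and "peq (lm T v) S m m'" "finite (dom S)" "sc S \<le> B" "nm v m c" "nm v m' c'" "tyc T (sc S) c" "tyc T (sc S) c'"
  shows "mem (pr (sc S) (pr c c')) E"
proof -
  note cEs = cE[unfolded closedE_iff]
  have symE: "mem (pr S (pr c c')) E \<Longrightarrow> mem (pr S (pr c' c)) E" for S c c'
    using cEs[THEN conjunct2, THEN conjunct1] by blast
  have transE: "mem (pr S (pr c c')) E \<Longrightarrow> mem (pr S (pr c' c'')) E \<Longrightarrow> mem (pr S (pr c c'')) E" for S c c' c''
    using cEs[THEN conjunct2, THEN conjunct2, THEN conjunct1] by blast
  \<comment> \<open>The given code \<open>c'\<close> of the converted term may use other leaf codes
    than \<open>c\<close>. So a code \<open>c''\<close> with the same leaf codes is built, to which
    \<open>conv\<close> applies literally, and \<open>E_refl\<close> leads from \<open>c''\<close>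
    to \<open>c'\<close>.\<close>
  have step: "mem (pr (sc S) (pr c c')) E"
    if "conv c c''" "ty (lm T v) S m" "ty (lm T v) S m'" "finite (dom S)" "sc S \<le> B"
      "nm v m c" "nm v m' c'" "nm v m' c''" "tyc T (sc S) c" "tyc T (sc S) c'" "tyc T (sc S) c''" for S m m' c c' c''
  proof -
    have "mem (pr (sc S) (pr c c)) E" by (rule E_refl[OF M cE that(2,4,5,6,6,9,9)])
    moreover have "mem (pr (sc S) (pr c'' c'')) E" by (rule E_refl[OF M cE that(3,4,5,8,8,11,11)])
    ultimately have "mem (pr (sc S) (pr c c'')) E"
      using cEs[THEN conjunct2, THEN conjunct2, THEN conjunct2, THEN conjunct2, THEN conjunct2] that(1) by blast
    then show ?thesis by (rule transE) (rule E_refl[OF M cE that(3,4,5,8,7,11,10)])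
  qed
  show ?thesis using assms(3-)
  proof (induction arbitrary: c c' rule: peq.induct)
    case (pe_refl S n)
    then show ?case by (rule E_refl[OF M cE])
  next
    case (pe_sym S m n)
    show ?case by (rule symE[OF pe_sym.IH[OF pe_sym.prems(1,2,4,3,6,5)]])
  next
    case (pe_trans S m n k)
    obtain c2 where c2: "nm v n c2" "tyc T (sc S) c2"
      using tyc_code_exists[OF peq_ty2[OF pe_trans.hyps(1)] pe_trans.prems(1)] by blast
    show ?case by (rule transE[OF pe_trans.IH(1)[OF pe_trans.prems(1,2,3) c2(1) pe_trans.prems(5) c2(2)]
       pe_trans.IH(2)[OF pe_trans.prems(1,2) c2(1) pe_trans.prems(4) c2(2) pe_trans.prems(6)]])
  next
    case (pe_Par S \<alpha> I h h')
    obtain F x where c: "c = parc \<alpha> F" and F: "\<And>i z. mem (pr i z) F \<longleftrightarrow> i \<in> I \<and> z = x i"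
      and x: "\<And>i. i \<in> I \<Longrightarrow> nm v (h i) (x i)" using pe_Par.prems(3) unfolding nm_Par by blast
    obtain F' x' where c': "c' = parc \<alpha> F'" and F': "\<And>i z. mem (pr i z) F' \<longleftrightarrow> i \<in> I \<and> z = x' i"
      and x': "\<And>i. i \<in> I \<Longrightarrow> nm v (h' i) (x' i)" using pe_Par.prems(4) unfolding nm_Par by blast
    note t = pe_Par.prems(5)[unfolded c tyc_Par_iff[OF pe_Par.prems(1) F]]
      pe_Par.prems(6)[unfolded c' tyc_Par_iff[OF pe_Par.prems(1) F']]
    show ?case unfolding c c'
    proof (rule E_par[OF cE pe_Par.prems(1,2) pe_Par.hyps(1,2) F F'])
      fix i assume i: "i \<in> I"
      have "sc (nxt S \<alpha> i) \<le> B"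
        using sc_nxt_le[OF pe_Par.prems(1) pe_Par.hyps(1), of i] i pe_Par.hyps(2) pe_Par.prems(2) by simp
      moreover have "finite (dom (nxt S \<alpha> i))" using pe_Par.prems(1) by simp
      moreover have "tyc T (sc (nxt S \<alpha> i)) (x i)" "tyc T (sc (nxt S \<alpha> i)) (x' i)" using t i by blast+
      ultimately show "mem (pr (sc (nxt S \<alpha> i)) (pr (x i) (x' i))) E"
        using pe_Par.IH[OF i _ _ x[OF i] x'[OF i]] by blast
    qed
  next
    case (pe_Sel S \<alpha> k f g)
    obtain x where c: "c = selc \<alpha> k x" and x: "nm v f x" using pe_Sel.prems(3) by auto
    obtain x' where c': "c' = selc \<alpha> k x'" and x': "nm v g x'" using pe_Sel.prems(4) by auto
    note t = pe_Sel.prems(5)[unfolded c tyc_Sel_iff[OF pe_Sel.prems(1)]]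
      pe_Sel.prems(6)[unfolded c' tyc_Sel_iff[OF pe_Sel.prems(1)]]
    have "sc (nxt S \<alpha> k) \<le> B" using sc_nxt_le[OF pe_Sel.prems(1) pe_Sel.hyps(1,2)] pe_Sel.prems(2) by simp
    moreover have "finite (dom (nxt S \<alpha> k))" using pe_Sel.prems(1) by simp
    moreover have "tyc T (sc (nxt S \<alpha> k)) x" "tyc T (sc (nxt S \<alpha> k)) x'" using t by blast+
    ultimately have "mem (pr (sc (nxt S \<alpha> k)) (pr x x')) E" using pe_Sel.IH[OF _ _ x x'] by blast
    then show ?case unfolding c c' by (rule E_sel[OF cE pe_Sel.prems(1,2) pe_Sel.hyps(1,2)])
  next
    case (pe_PP \<alpha> \<beta> S I J f)
    note ba = pe_PP.hyps(1)[symmetric] and fin = pe_PP.prems(1)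
    have fI: "finite I" "finite J" using pe_PP.hyps(4,5) by simp_all
    obtain F x where c: "c = parc \<alpha> F" and F: "\<And>i z. mem (pr i z) F \<longleftrightarrow> i \<in> I \<and> z = x i"
      and x: "\<And>i. i \<in> I \<Longrightarrow> nm v (Par \<beta> J (f i)) (x i)" using pe_PP.prems(3) unfolding nm_Par[of v \<alpha>] by blast
    note t = pe_PP.prems(5)[unfolded c tyc_Par_iff[OF fin F]]
    have "\<forall>i\<in>I. \<exists>Fi xi. x i = parc \<beta> Fi \<and> (\<forall>j z. mem (pr j z) Fi \<longleftrightarrow> j \<in> J \<and> z = xi j) \<and> (\<forall>j\<in>J. nm v (f i j) (xi j))"
      using x unfolding nm_Par by blast
    then obtain G x2 where x2: "\<And>i. i \<in> I \<Longrightarrow> x i = parc \<beta> (G i)"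
      "\<And>i j z. i \<in> I \<Longrightarrow> mem (pr j z) (G i) \<longleftrightarrow> j \<in> J \<and> z = x2 i j" "\<And>i j. i \<in> I \<Longrightarrow> j \<in> J \<Longrightarrow> nm v (f i j) (x2 i j)" by metis
    \<comment> \<open>The transposed double family, made of the very entries found in
      \<open>c\<close>.\<close>
    define c'' where "c'' = parc \<beta> (fcode J (\<lambda>j. parc \<alpha> (fcode I (\<lambda>i. x2 i j))))"
    have n: "nm v (Par \<beta> J (\<lambda>j. Par \<alpha> I (\<lambda>i. f i j))) c''" unfolding c''_def
      by (intro nm_parcI[OF mem_fcode[OF fI(2)]] nm_parcI[OF mem_fcode[OF fI(1)]] x2(3))
    have tx: "tyc T (sc (nxt (nxt S \<alpha> i) \<beta> j)) (x2 i j)" if "i \<in> I" "j \<in> J" for i j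
    proof -
      have "tyc T (sc (nxt S \<alpha> i)) (parc \<beta> (G i))" using t that(1) x2(1) by auto
      moreover have "finite (dom (nxt S \<alpha> i))" using fin by simp
      ultimately show ?thesis using tyc_Par_iff[OF _ x2(2)[OF that(1)]] that(2) by blast
    qed
    have "tyc T (sc (nxt S \<beta> j)) (parc \<alpha> (fcode I (\<lambda>i. x2 i j)))" if j: "j \<in> J" for j
    proof -
      have fj: "finite (dom (nxt S \<beta> j))" using fin by simp
      have k: "knd (nxt S \<beta> j) \<alpha> = Some True" "I = idx (nxt S \<beta> j) \<alpha>" using pe_PP.hyps(2,4) ba by simp_all
      have "tyc T (sc (nxt (nxt S \<beta> j) \<alpha> i)) (x2 i j)" if "i \<in> I" for i
        unfolding nxt_nxt[OF ba] by (rule tx[OF that j])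
      then show ?thesis unfolding tyc_Par_iff[OF fj mem_fcode[OF fI(1)]] using k by blast
    qed
    then have tc: "tyc T (sc S) c''" unfolding c''_def tyc_Par_iff[OF fin mem_fcode[OF fI(2)]]
      using pe_PP.hyps by blast
    have cv: "conv c c''"
    proof -
      have w: "mem w F \<longleftrightarrow> f1 w \<in> I \<and> w = pr (f1 w) (parc \<beta> (G (f1 w)))" for w
        using F[of "f1 w" "f2 w"] x2(1)[of "f1 w"] by (metis f2_pr pr_f)
      have w': "mem w (fcode J (\<lambda>j. parc \<alpha> (fcode I (\<lambda>i. x2 i j)))) \<longleftrightarrow>
          f1 w \<in> J \<and> w = pr (f1 w) (parc \<alpha> (fcode I (\<lambda>i. x2 i (f1 w))))" for w
        using mem_fcode[OF fI(2), of "f1 w" "f2 w"] by (metis f2_pr pr_f)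
      have "\<exists>w'<fcode J (\<lambda>j. parc \<alpha> (fcode I (\<lambda>i. x2 i j))). mem w' (fcode J (\<lambda>j. parc \<alpha> (fcode I (\<lambda>i. x2 i j)))) \<and>
           f1 w' = f1 u \<and> mem (pr (f1 w) (f2 u)) (f2 (f2 (f2 w')))"
        if h: "mem w F" "mem u (f2 (f2 (f2 w)))" for w u
      proof -
        have i: "f1 w \<in> I" "f2 (f2 (f2 w)) = G (f1 w)" using h(1) w[of w] by (metis f2_pr)+
        have "mem (pr (f1 u) (f2 u)) (G (f1 w))" using h(2) i(2) by simp
        then have j: "f1 u \<in> J" "f2 u = x2 (f1 w) (f1 u)" using x2(2)[OF i(1)] by blast+
        have "mem (pr (f1 u) (parc \<alpha> (fcode I (\<lambda>i. x2 i (f1 u))))) (fcode J (\<lambda>j. parc \<alpha> (fcode I (\<lambda>i. x2 i j))))"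
          using j fI by simp
        then show ?thesis using i(1) j fI mem_less
          by (intro exI[of _ "pr (f1 u) (parc \<alpha> (fcode I (\<lambda>i. x2 i (f1 u))))"]) simp
      qed
      moreover have "f1 (f2 w) = 1 \<and> f1 (f2 (f2 w)) = \<beta>" if "mem w F" for w
        using w[of w] that by (metis f1_pr f2_pr)
      moreover have "f1 (f2 w) = 1 \<and> f1 (f2 (f2 w)) = \<alpha>" if "mem w (fcode J (\<lambda>j. parc \<alpha> (fcode I (\<lambda>i. x2 i j))))" for w
        using w'[of w] that by (metis f1_pr f2_pr)
      ultimately show ?thesis unfolding conv_def c c''_def f1_pr f2_pr using pe_PP.hyps(1) by blast
    qed
    have ty: "ty (lm T v) S (Par \<alpha> I (\<lambda>i. Par \<beta> J (f i)))" "ty (lm T v) S (Par \<beta> J (\<lambda>j. Par \<alpha> I (\<lambda>i. f i j)))"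
      using peq_ty[OF peq.pe_PP[OF pe_PP.hyps]] by blast+
    show ?case by (rule step[OF cv ty pe_PP.prems(1-4) n pe_PP.prems(5,6) tc])
  next
    case (pe_PS \<alpha> \<beta> S I k f)
    note ba = pe_PS.hyps(1)[symmetric] and fin = pe_PS.prems(1)
    have fI: "finite I" using pe_PS.hyps(4) by simp
    obtain F x where c: "c = parc \<alpha> F" and F: "\<And>i z. mem (pr i z) F \<longleftrightarrow> i \<in> I \<and> z = x i"
      and x: "\<And>i. i \<in> I \<Longrightarrow> nm v (Sel \<beta> k (f i)) (x i)" using pe_PS.prems(3) unfolding nm_Par[of v \<alpha>] by blast
    note t = pe_PS.prems(5)[unfolded c tyc_Par_iff[OF fin F]]
    have "\<forall>i\<in>I. \<exists>xi. x i = selc \<beta> k xi \<and> nm v (f i) xi" using x by auto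
    then obtain x2 where x2: "\<And>i. i \<in> I \<Longrightarrow> x i = selc \<beta> k (x2 i)" "\<And>i. i \<in> I \<Longrightarrow> nm v (f i) (x2 i)" by metis
    define c'' where "c'' = selc \<beta> k (parc \<alpha> (fcode I x2))"
    have n0: "nm v (Par \<alpha> I f) (parc \<alpha> (fcode I x2))" by (intro nm_parcI[OF mem_fcode[OF fI]] x2(2))
    have n: "nm v (Sel \<beta> k (Par \<alpha> I f)) c''" unfolding c''_def nm.simps(3) using n0 by blast
    have tx: "tyc T (sc (nxt (nxt S \<alpha> i) \<beta> k)) (x2 i)" if "i \<in> I" for i
    proof -
      have "tyc T (sc (nxt S \<alpha> i)) (selc \<beta> k (x2 i))" using t that x2(1) by auto
      moreover have "finite (dom (nxt S \<alpha> i))" using fin by simp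
      ultimately show ?thesis using tyc_Sel_iff by blast
    qed
    have "tyc T (sc (nxt S \<beta> k)) (parc \<alpha> (fcode I x2))"
    proof -
      have fj: "finite (dom (nxt S \<beta> k))" using fin by simp
      have k: "knd (nxt S \<beta> k) \<alpha> = Some True" "I = idx (nxt S \<beta> k) \<alpha>" using pe_PS.hyps(2,4) ba by simp_all
      have "tyc T (sc (nxt (nxt S \<beta> k) \<alpha> i)) (x2 i)" if "i \<in> I" for i
        unfolding nxt_nxt[OF ba] by (rule tx[OF that])
      then show ?thesis unfolding tyc_Par_iff[OF fj mem_fcode[OF fI]] using k by blast
    qed
    then have tc: "tyc T (sc S) c''" unfolding c''_def tyc_Sel_iff[OF fin]
      using pe_PS.hyps by blast
    have cv: "conv c c''"
    proof -
      have "f1 (f2 w) = 2 \<and> f1 (f2 (f2 w)) = \<beta> \<and> f1 (f2 (f2 (f2 w))) = k \<and>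
          mem (pr (f1 w) (f2 (f2 (f2 (f2 w))))) (fcode I x2)" if "mem w F" for w
      proof -
        have "f1 w \<in> I" "f2 w = selc \<beta> k (x2 (f1 w))" using F[of "f1 w" "f2 w"] x2(1)[of "f1 w"] that by auto
        then show ?thesis using fI by simp
      qed
      then show ?thesis unfolding conv_def c c''_def f1_pr f2_pr using pe_PS.hyps(1) by blast
    qed
    have ty: "ty (lm T v) S (Par \<alpha> I (\<lambda>i. Sel \<beta> k (f i)))" "ty (lm T v) S (Sel \<beta> k (Par \<alpha> I f))"
      using peq_ty[OF peq.pe_PS[OF pe_PS.hyps]] by blast+
    show ?case by (rule step[OF cv ty pe_PS.prems(1-4) n pe_PS.prems(5,6) tc])
  next
    case (pe_SS \<alpha> \<beta> S k l f)
    note ba = pe_SS.hyps(1)[symmetric] and fin = pe_SS.prems(1)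
    obtain x where c: "c = selc \<alpha> k (selc \<beta> l x)" and x: "nm v f x" using pe_SS.prems(3) by auto
    define c'' where "c'' = selc \<beta> l (selc \<alpha> k x)"
    have n: "nm v (Sel \<beta> l (Sel \<alpha> k f)) c''" unfolding c''_def using x by simp
    have f1: "finite (dom (nxt S \<alpha> k))" "finite (dom (nxt S \<beta> l))" using fin by simp_all
    have "tyc T (sc (nxt (nxt S \<alpha> k) \<beta> l)) x"
      using pe_SS.prems(5) unfolding c tyc_Sel_iff[OF fin] tyc_Sel_iff[OF f1(1)] by blast
    then have tc: "tyc T (sc S) c''" unfolding c''_def tyc_Sel_iff[OF fin] tyc_Sel_iff[OF f1(2)]
      using pe_SS.hyps ba by (simp add: nxt_nxt[OF ba])
    have cv: "conv c c''" unfolding conv_def c c''_def f1_pr f2_pr using pe_SS.hyps(1) by blast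
    have ty: "ty (lm T v) S (Sel \<alpha> k (Sel \<beta> l f))" "ty (lm T v) S (Sel \<beta> l (Sel \<alpha> k f))"
      using peq_ty[OF peq.pe_SS[OF pe_SS.hyps]] by blast+
    show ?case by (rule step[OF cv ty pe_SS.prems(1-4) n pe_SS.prems(5,6) tc])
  qed
qed

section \<open>From codes of atoms to atoms\<close>

lemma peq_lift:
  assumes "peq lt S m m'" "finite (dom S)" and l: "\<And>S f. finite (dom S) \<Longrightarrow> lt S f \<Longrightarrow> lt' (rs obj S) f"
  shows "peq lt' (rs obj S) m m'"
proof -
  have t: "ty lt S m \<Longrightarrow> finite (dom S) \<Longrightarrow> ty lt' (rs obj S) m" for S m
    by (induction rule: ty.induct) (auto simp: l)
  show ?thesis using assms(1,2)
  proof (induction rule: peq.induct)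
    case (pe_refl S n)
    then show ?case by (intro peq.pe_refl t)
  next
    case (pe_sym S m n)
    show ?case by (rule peq.pe_sym[OF pe_sym.IH[OF pe_sym.prems]])
  next
    case (pe_trans S m n k)
    show ?case by (rule peq.pe_trans[OF pe_trans.IH(1)[OF pe_trans.prems] pe_trans.IH(2)[OF pe_trans.prems]])
  next
    case (pe_Par S \<alpha> I h h')
    then show ?case by (intro peq.pe_Par) auto
  next
    case (pe_Sel S \<alpha> k f g)
    then show ?case by (intro peq.pe_Sel) auto
  next
    case (pe_PP \<alpha> \<beta> S I J f)
    have "ty lt' (nxt (nxt (rs obj S) \<alpha> i) \<beta> j) (f i j)" if "i \<in> I" "j \<in> J" for i j
      using t[OF pe_PP.hyps(6)[OF that]] that pe_PP by simp
    then show ?case using pe_PP.hyps by (intro peq.pe_PP) auto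
  next
    case (pe_PS \<alpha> \<beta> S I k f)
    have "ty lt' (nxt (nxt (rs obj S) \<alpha> i) \<beta> k) (f i)" if "i \<in> I" for i
      using t[OF pe_PS.hyps(6)[OF that]] that pe_PS by simp
    then show ?case using pe_PS.hyps by (intro peq.pe_PS) auto
  next
    case (pe_SS \<alpha> \<beta> S k l f)
    have "ty lt' (nxt (nxt (rs obj S) \<alpha> k) \<beta> l) f" using t[OF pe_SS.hyps(6)] pe_SS by simp
    then show ?case using pe_SS.hyps by (intro peq.pe_SS) auto
  qed
qed

text \<open>
  Conversions permute the leaves of a term without changing the sequents at which they occur, so a
  restriction on leaves is inherited along them.
\<close>

lemma peq_restrict:
  assumes "peq lt (rs obj S) m m'" "ty lt' S m"
  shows "peq lt' S m m'"
proof -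
  have "\<forall>S. R = rs obj S \<longrightarrow> (ty lt' S m \<longleftrightarrow> ty lt' S m') \<and> (ty lt' S m \<longrightarrow> peq lt' S m m')"
    if "peq lt R m m'" for R m m'
    using that
  proof (induction rule: peq.induct)
    case (pe_refl R n)
    then show ?case by (auto intro: peq.pe_refl)
  next
    case (pe_sym R m n)
    then show ?case by (blast intro: peq.pe_sym)
  next
    case (pe_trans R m n k)
    then show ?case by (blast intro: peq.pe_trans)
  next
    case (pe_Par R \<alpha> I h h')
    then show ?case by (auto intro!: peq.pe_Par)
  next
    case (pe_Sel R \<alpha> k f g)
    then show ?case by (auto intro!: peq.pe_Sel)
  next
    case (pe_PP \<alpha> \<beta> R I J f)
    show ?case
    proof (intro allI impI)
      fix S assume S: "R = rs obj S"
      have "ty lt' S (Par \<alpha> I (\<lambda>i. Par \<beta> J (f i))) \<longleftrightarrow> (\<forall>i\<in>I. \<forall>j\<in>J. ty lt' (nxt (nxt S \<alpha> i) \<beta> j) (f i j))"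
        "ty lt' S (Par \<beta> J (\<lambda>j. Par \<alpha> I (\<lambda>i. f i j))) \<longleftrightarrow> (\<forall>i\<in>I. \<forall>j\<in>J. ty lt' (nxt (nxt S \<alpha> i) \<beta> j) (f i j))"
        using pe_PP.hyps(1-5) unfolding S by (auto simp: nxt_nxt[OF pe_PP.hyps(1)])
      then show "(ty lt' S (Par \<alpha> I (\<lambda>i. Par \<beta> J (f i))) \<longleftrightarrow> ty lt' S (Par \<beta> J (\<lambda>j. Par \<alpha> I (\<lambda>i. f i j)))) \<and>
        (ty lt' S (Par \<alpha> I (\<lambda>i. Par \<beta> J (f i))) \<longrightarrow> peq lt' S (Par \<alpha> I (\<lambda>i. Par \<beta> J (f i))) (Par \<beta> J (\<lambda>j. Par \<alpha> I (\<lambda>i. f i j))))"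
        using pe_PP.hyps(1-5) unfolding S by (auto intro!: peq.pe_PP simp del: ty_simps)
    qed
  next
    case (pe_PS \<alpha> \<beta> R I k f)
    show ?case
    proof (intro allI impI)
      fix S assume S: "R = rs obj S"
      have "ty lt' S (Par \<alpha> I (\<lambda>i. Sel \<beta> k (f i))) \<longleftrightarrow> (\<forall>i\<in>I. ty lt' (nxt (nxt S \<alpha> i) \<beta> k) (f i))"
        "ty lt' S (Sel \<beta> k (Par \<alpha> I f)) \<longleftrightarrow> (\<forall>i\<in>I. ty lt' (nxt (nxt S \<alpha> i) \<beta> k) (f i))"
        using pe_PS.hyps(1-5) unfolding S by (auto simp: nxt_nxt[OF pe_PS.hyps(1)])
      then show "(ty lt' S (Par \<alpha> I (\<lambda>i. Sel \<beta> k (f i))) \<longleftrightarrow> ty lt' S (Sel \<beta> k (Par \<alpha> I f))) \<and>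
        (ty lt' S (Par \<alpha> I (\<lambda>i. Sel \<beta> k (f i))) \<longrightarrow> peq lt' S (Par \<alpha> I (\<lambda>i. Sel \<beta> k (f i))) (Sel \<beta> k (Par \<alpha> I f)))"
        using pe_PS.hyps(1-5) unfolding S by (auto intro!: peq.pe_PS simp del: ty_simps)
    qed
  next
    case (pe_SS \<alpha> \<beta> R k l f)
    show ?case
    proof (intro allI impI)
      fix S assume S: "R = rs obj S"
      have "ty lt' S (Sel \<alpha> k (Sel \<beta> l f)) \<longleftrightarrow> ty lt' (nxt (nxt S \<alpha> k) \<beta> l) f"
        "ty lt' S (Sel \<beta> l (Sel \<alpha> k f)) \<longleftrightarrow> ty lt' (nxt (nxt S \<alpha> k) \<beta> l) f"
        using pe_SS.hyps(1-5) unfolding S by (auto simp: nxt_nxt[OF pe_SS.hyps(1)])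
      then show "(ty lt' S (Sel \<alpha> k (Sel \<beta> l f)) \<longleftrightarrow> ty lt' S (Sel \<beta> l (Sel \<alpha> k f))) \<and>
        (ty lt' S (Sel \<alpha> k (Sel \<beta> l f)) \<longrightarrow> peq lt' S (Sel \<alpha> k (Sel \<beta> l f)) (Sel \<beta> l (Sel \<alpha> k f)))"
        using pe_SS.hyps(1-5) unfolding S by (auto intro!: peq.pe_SS simp del: ty_simps)
    qed
  qed
  then show ?thesis using assms by blast
qed

text \<open>Soundness is lifted from coded sequents to sequents of atoms. For completeness, a
  conversion over the atoms, whatever its intermediate terms, is first brought down to the coded
  sequent and to the leaves of the table.\<close>

lemma E_iff:
  assumes M: "okM T v M" and E: "E = (LEAST E. closedE M B E)" and B: "finite (dom S)" "sc S \<le> B"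
    and l: "\<And>S f. finite (dom S) \<Longrightarrow> lm T v S f \<Longrightarrow> lt (rs obj S) f"
    and c: "nm v m c" "nm v m' c'" "tyc T (sc S) c" "tyc T (sc S) c'"
  shows "mem (pr (sc S) (pr c c')) E \<longleftrightarrow> peq lt (rs obj S) m m'"
proof
  assume "mem (pr (sc S) (pr c c')) E"
  then have "peq (lm T v) S m m'" using E_sound[OF M E] B c(1,2) unfolding good_def by blast
  then show "peq lt (rs obj S) m m'" using B(1) l by (rule peq_lift)
next
  assume "peq lt (rs obj S) m m'"
  then have p: "peq (lm T v) S m m'" by (rule peq_restrict[OF _ tyc_ty[OF c(1) B(1) c(3)]])
  have "closedE M B E" unfolding E using closedE_exists[OF M] by (rule LeastI_ex)
  then show "mem (pr (sc S) (pr c c')) E" by (rule E_complete[OF M _ p B c])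
qed

subsection \<open>Programs with partial subroutines\<close>

lemma pc1: "pc E (\<lambda>e. F (e ! 0)) \<Longrightarrow> pc D f \<Longrightarrow> (\<And>e. e \<in> D \<Longrightarrow> [f e] \<in> E) \<Longrightarrow> pc D (\<lambda>e. F (f e))"
  using pc_compose[of E "\<lambda>e. F (e ! 0)" "[f]" D] by simp

lemma pc2: "pc E (\<lambda>e. F (e ! 0) (e ! 1)) \<Longrightarrow> pc D f \<Longrightarrow> pc D g \<Longrightarrow>
    (\<And>e. e \<in> D \<Longrightarrow> [f e, g e] \<in> E) \<Longrightarrow> pc D (\<lambda>e. F (f e) (g e))"
  using pc_compose[of E "\<lambda>e. F (e ! 0) (e ! 1)" "[f, g]" D] by auto

lemma pc3: "pc E (\<lambda>e. F (e ! 0) (e ! 1) (e ! 2)) \<Longrightarrow> pc D f \<Longrightarrow> pc D g \<Longrightarrow> pc D h \<Longrightarrow>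
    (\<And>e. e \<in> D \<Longrightarrow> [f e, g e, h e] \<in> E) \<Longrightarrow> pc D (\<lambda>e. F (f e) (g e) (h e))"
  using pc_compose[of E "\<lambda>e. F (e ! 0) (e ! 1) (e ! 2)" "[f, g, h]" D] by (auto simp: numeral_2_eq_2)

lemma pc_rec:
  assumes "pc D b"
    and "pc {m # rec_nat (b e) (\<lambda>m r. s m r e) m # e | m e. e \<in> D \<and> m < k e} (\<lambda>e. s (e ! 0) (e ! 1) (tl (tl e)))"
    and "pc D k" "\<And>e. e \<in> D \<Longrightarrow> length e = n"
  shows "pc D (\<lambda>e. rec_nat (b e) (\<lambda>m r. s m r e) (k e))"
proof (rule pc_PrimRec[OF assms(1)[unfolded pc_def] _ assms(3,4)])
  obtain q where q: "\<And>e. e \<in> {m # rec_nat (b e) (\<lambda>m r. s m r e) m # e | m e. e \<in> D \<and> m < k e} \<Longrightarrow>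
      computes q e (s (e ! 0) (e ! 1) (tl (tl e)))" using assms(2) unfolding pc_def by blast
  have "computes q (m # rec_nat (b e) (\<lambda>m r. s m r e) m # e) (s m (rec_nat (b e) (\<lambda>m r. s m r e) m) e)"
    if "e \<in> D" "m < k e" for e m
    using q[of "m # rec_nat (b e) (\<lambda>m r. s m r e) m # e"] that by auto
  then show "\<exists>q. \<forall>e\<in>D. \<forall>m<k e. computes q (m # rec_nat (b e) (\<lambda>m r. s m r e) m # e)
      (s m (rec_nat (b e) (\<lambda>m r. s m r e) m) e)" by blast
qed

text \<open>
  The subroutine for \<open>f\<close> is only called when \<open>P\<close> holds: it is the step of a recursion that runs
  for \<open>of_bool (P e)\<close> rounds.
\<close>

lemma pc_if:
  assumes P: "pc D (\<lambda>e. of_bool (P e))" and f: "pc {e \<in> D. P e} f" and g: "pc D g"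
    and n: "\<And>e. e \<in> D \<Longrightarrow> length e = n"
  shows "pc D (\<lambda>e. if P e then f e else g e)"
proof -
  obtain q where q: "\<And>e. e \<in> D \<Longrightarrow> P e \<Longrightarrow> computes q e (f e)" using f unfolding pc_def by blast
  \<comment> \<open>Within the recursion the counter and the accumulator precede the arguments; the
    projections from position 2 on restore the argument list for \<open>q\<close>.\<close>
  have "computes (Compose q (map Arg [2..<n + 2])) (m # r # e) (f e)" if "e \<in> D" "P e" for m r e
    by (rule computes.intros(4)[where ys = e])
      (auto simp: n[OF that(1)] intro!: q that computes.intros(3)[of _ "m # r # e", simplified] simp del: upt_Suc,
       use computes.intros(3)[of "2 + _" "m # r # e"] n[OF that(1)] in \<open>fastforce simp del: upt_Suc\<close>)
  then have "pc D (\<lambda>e. rec_nat (g e) (\<lambda>m r. f e) (of_bool (P e)))"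
    using g by (intro pc_PrimRec[OF _ _ P n]) (auto simp: pc_def split: if_splits)
  then show ?thesis by (rule pc_cong) simp
qed

text \<open>Comprehension below a bound: the code is summed up digit by digit. The test is called
  only below the bound, so it may itself be partial.\<close>

lemma pc_collect:
  assumes Q: "pc {m # e | m e. e \<in> D \<and> m < k e} (\<lambda>e. of_bool (Q (e ! 0) (tl e)))"
    and k: "pc D k" and n: "\<And>e. e \<in> D \<Longrightarrow> length e = n"
  shows "pc D (\<lambda>e. set_encode {m. m < k e \<and> Q m e})"
proof -
  have r: "rec_nat 0 (\<lambda>m r. r + of_bool (Q m e) * 2 ^ m) l = set_encode {m. m < l \<and> Q m e}" for l e
  proof (induction l)
    case (Suc l)
    show ?case
    proof (cases "Q l e")
      case True
      then have "{m. m < Suc l \<and> Q m e} = insert l {m. m < l \<and> Q m e}" by (auto simp: less_Suc_eq)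
      then show ?thesis using True Suc by simp
    next
      case False
      then have "{m. m < Suc l \<and> Q m e} = {m. m < l \<and> Q m e}" by (auto simp: less_Suc_eq)
      then show ?thesis using False Suc by simp
    qed
  qed simp
  let ?X = "{m # rec_nat 0 (\<lambda>m r. r + of_bool (Q m e) * 2 ^ m) m # e | m e. e \<in> D \<and> m < k e}"
  have len: "?X \<subseteq> {e. length e = Suc (Suc n)}" using n by auto
  have a: "pc ?X (\<lambda>e. e ! i)" if "i < Suc (Suc n)" for i by (rule pc_mono[OF cmp_arg[OF that] len])
  have "pc ?X (\<lambda>e. (\<lambda>e. of_bool (Q (e ! 0) (tl e))) (map (\<lambda>f. f e) ((\<lambda>e. e ! 0) # map (\<lambda>i e. e ! i) [2..<Suc (Suc n)])))"
  proof (rule pc_compose[OF Q])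
    fix f :: "nat list \<Rightarrow> nat" assume "f \<in> set ((\<lambda>e. e ! 0) # map (\<lambda>i e. e ! i) [2..<Suc (Suc n)])"
    then show "pc ?X f" by (auto intro!: a simp del: upt_Suc)
  next
    fix e assume "e \<in> ?X"
    then obtain m d where d: "e = m # rec_nat 0 (\<lambda>m r. r + of_bool (Q m d) * 2 ^ m) m # d" "d \<in> D" "m < k d" by blast
    have "map ((!) e) [2..<Suc (Suc n)] = d"
      using n[OF d(2)] unfolding d(1) by (intro nth_equalityI) (auto simp del: upt_Suc)
    then have "map (\<lambda>f. f e) ((\<lambda>e. e ! 0) # map (\<lambda>i e. e ! i) [2..<Suc (Suc n)]) = m # d"
      using d(1) by (auto simp: o_def simp del: upt_Suc)
    then show "map (\<lambda>f. f e) ((\<lambda>e. e ! 0) # map (\<lambda>i e. e ! i) [2..<Suc (Suc n)]) \<in> {m # e | m e. e \<in> D \<and> m < k e}"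
      using d(2,3) by auto
  qed
  then have "pc ?X (\<lambda>e. of_bool (Q (e ! 0) (tl (tl e))))"
  proof (rule pc_cong)
    fix e assume "e \<in> ?X"
    then obtain m d where d: "e = m # rec_nat 0 (\<lambda>m r. r + of_bool (Q m d) * 2 ^ m) m # d" "d \<in> D" "m < k d" by blast
    have "map ((!) e) [2..<Suc (Suc n)] = d"
      using n[OF d(2)] unfolding d(1) by (intro nth_equalityI) (auto simp del: upt_Suc)
    then show "of_bool (Q (e ! 0) (tl (tl e))) =
      of_bool (Q (map (\<lambda>f. f e) ((\<lambda>e. e ! 0) # map (\<lambda>i e. e ! i) [2..<Suc (Suc n)]) ! 0)
        (tl (map (\<lambda>f. f e) ((\<lambda>e. e ! 0) # map (\<lambda>i e. e ! i) [2..<Suc (Suc n)]))))"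
      using d(1) by (auto simp: o_def simp del: upt_Suc)
  qed
  then have "pc D (\<lambda>e. rec_nat 0 (\<lambda>m r. r + of_bool (Q m e) * 2 ^ m) (k e))"
    by (intro pc_rec[OF cmp_const _ k n] cmp_add cmp_mult cmp_pow2 a) auto
  then show ?thesis unfolding r .
qed

text \<open>Lookup in the coded graph of a function: the sum has just one summand if
  \<open>a\<close> has exactly one value in \<open>W\<close>.\<close>

definition look :: "nat \<Rightarrow> nat \<Rightarrow> nat" where
  "look W a = (\<Sum>z<W. if mem (pr a z) W then z else 0)"

lemma cmp_look: "pc D f \<Longrightarrow> pc D g \<Longrightarrow> pc D (\<lambda>e. look (f e) (g e))"
  by (rule cmp2[where F = "\<lambda>a b. look a b"], unfold look_def) (intro cmp_sum dec_rules cmp_accs; simp)+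

lemma look_graph: "(\<And>z. mem (pr a z) W \<longleftrightarrow> z = c) \<Longrightarrow> look W a = c"
  using mem_pr_less[of a c W] unfolding look_def by (simp add: sum.delta)

subsection \<open>The closures exist\<close>

definition T_of :: "nat \<Rightarrow> nat \<Rightarrow> nat \<Rightarrow> nat" where "T_of S a b = (LEAST T. closedT S a b T)"

definition V_of :: "nat \<Rightarrow> nat" where "V_of T = (LEAST V. closedV T V)"

lemma f2_less: "f1 y \<noteq> 0 \<Longrightarrow> f2 y < y"
proof -
  have t: "n \<le> triangle n" for n by (induction n) auto
  assume "f1 y \<noteq> 0"
  then have "f2 y < f1 y + f2 y" by simp
  also have "\<dots> \<le> pr (f1 y) (f2 y)" using t[of "f1 y + f2 y"] by (simp add: prod_encode_def)
  finally show ?thesis by simp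
qed

lemma closedT_exists: "\<exists>T. closedT S0 a b T"
proof -
  \<comment> \<open>Descending into a subterm lowers both the code of the sequent and the code of
    the term, so all pairs up to the initial values form a closed set.\<close>
  define X where "X = (\<lambda>(S, n). pr S n) ` ({..S0} \<times> {..max a b})"
  have fX: "finite X" unfolding X_def by simp
  have X: "pr S n \<in> X \<longleftrightarrow> S \<le> S0 \<and> n \<le> max a b" for S n unfolding X_def by (auto simp: image_iff)
  have "closedT S0 a b (set_encode X)" unfolding closedT_iff mem_encode[OF fX] X
  proof (intro conjI allI impI; (elim conjE)?)
    fix S \<alpha> F y i x X assume h: "S \<le> S0" "parc \<alpha> F \<le> max a b" "mem (pr \<alpha> y) S" "mem (pr i x) F" "lmem (pr i X) (bl y)"
    have "x < F" using mem_pr_less[OF h(4)] by simp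
    also have "F \<le> parc \<alpha> F" using le_prod_encode_2 by (meson le_trans)
    finally have "x \<le> max a b" using h(2) by linarith
    moreover show "upd S \<alpha> y X \<le> S0" using upd_less[OF h(3,5)] h(1) by simp
    ultimately show "x \<le> max a b" by simp
  next
    fix S \<alpha> k x y X assume h: "S \<le> S0" "selc \<alpha> k x \<le> max a b" "mem (pr \<alpha> y) S" "lmem (pr k X) (bl y)"
    have "x \<le> selc \<alpha> k x" using le_prod_encode_2 by (meson le_trans)
    then show "x \<le> max a b" using h(2) by linarith
    show "upd S \<alpha> y X \<le> S0" using upd_less[OF h(3,4)] h(1) by simp
  qed auto
  then show ?thesis ..
qed

lemma closedV_exists: "\<exists>V. closedV T V"
proof
  show "closedV T (set_encode {..<T})"
    unfolding closedV_def using f1_le f2_le by (auto intro: le_less_trans[OF _ le_less_trans] order.trans) 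
qed

lemma cmp_T: "pc D f \<Longrightarrow> pc D g \<Longrightarrow> pc D h \<Longrightarrow> pc D (\<lambda>e. T_of (f e) (g e) (h e))"
proof (rule cmp3[where F = T_of], unfold T_of_def)
  show "cmp 3 (\<lambda>e. LEAST T. closedT (e ! 0) (e ! 1) (e ! 2) T)"
    by (rule pc_Least[where n = 3]) (auto intro!: dec_closedT cmp_accs closedT_exists)
qed

lemma cmp_V: "pc D f \<Longrightarrow> pc D (\<lambda>e. V_of (f e))"
proof (rule cmp1[where F = V_of], unfold V_of_def)
  show "cmp 1 (\<lambda>e. LEAST V. closedV (e ! 0) V)"
    by (rule pc_Least[where n = 1]) (auto intro!: dec_closedV cmp_accs closedV_exists)
qed

text \<open>The search runs over pairs of a candidate and a certificate for it, because checking a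
  certificate needs bounded quantifiers only.\<close>

definition nf_of :: "nat \<Rightarrow> nat" where
  "nf_of c = f1 (LEAST w. justified (f2 w) \<and> nfR (f2 w) c (f1 w))"

lemma nf_of: 
  assumes "\<exists>R n. justified R \<and> nfR R c n"
  shows "\<exists>R. justified R \<and> nfR R c (nf_of c)"
proof -
  obtain R n where "justified R" "nfR R c n" using assms by blast
  then have "justified (f2 (pr n R)) \<and> nfR (f2 (pr n R)) c (f1 (pr n R))" by simp
  from LeastI[of "\<lambda>w. justified (f2 w) \<and> nfR (f2 w) c (f1 w)", OF this] show ?thesis unfolding nf_of_def by blast
qed

lemma pc_nf:
  assumes "pc D f" "\<And>e. e \<in> D \<Longrightarrow> \<exists>R n. justified R \<and> nfR R (f e) n"
  shows "pc D (\<lambda>e. nf_of (f e))"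
proof (rule pc1[where E = "{e. length e = 1 \<and> (\<exists>R n. justified R \<and> nfR R (e ! 0) n)}", OF _ assms(1)])
  have "dec (Suc 1) (\<lambda>e. justified (f2 (e ! 0)) \<and> nfR (f2 (e ! 0)) (tl e ! 0) (f1 (e ! 0)))"
    unfolding nfR_def by (intro dec_rules dec_justified cmp_accs) simp_all
  then show "pc {e. length e = 1 \<and> (\<exists>R n. justified R \<and> nfR R (e ! 0) n)} (\<lambda>e. nf_of (e ! 0))"
    unfolding nf_of_def
  proof (intro cmp_f1 pc_Least[where n = 1])
    fix e :: "nat list" assume "e \<in> {e. length e = 1 \<and> (\<exists>R n. justified R \<and> nfR R (e ! 0) n)}"
    then obtain R n where "justified R" "nfR R (e ! 0) n" by blast
    then have "justified (f2 (pr n R)) \<and> nfR (f2 (pr n R)) (e ! 0) (f1 (pr n R))" by simp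
    then show "\<exists>w. justified (f2 w) \<and> nfR (f2 w) (e ! 0) (f1 w)" by blast
  qed auto
qed (use assms(2) in simp)

definition E_of :: "nat \<Rightarrow> nat \<Rightarrow> nat" where "E_of M B = (LEAST E. closedE M B E)"

lemma pc_E:
  assumes "pc D f" "pc D g" "\<And>e. e \<in> D \<Longrightarrow> \<exists>E. closedE (f e) (g e) E"
  shows "pc D (\<lambda>e. E_of (f e) (g e))"
proof (rule pc2[where E = "{e. length e = 2 \<and> (\<exists>E. closedE (e ! 0) (e ! 1) E)}", OF _ assms(1,2)])
  show "pc {e. length e = 2 \<and> (\<exists>E. closedE (e ! 0) (e ! 1) E)} (\<lambda>e. E_of (e ! 0) (e ! 1))"
    unfolding E_of_def by (rule pc_Least[where n = 2]) (auto intro!: dec_closedE cmp_accs)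
qed (use assms(3) in simp)

text \<open>The sides come as coded lists, a sequent is coded as a set. Minimization converts: the
  least set that contains the required entries contains nothing else.\<close>

definition seqP :: "nat \<Rightarrow> nat \<Rightarrow> nat \<Rightarrow> bool" where
  "seqP g d S \<longleftrightarrow> (\<forall>w<g. lmem w g \<longrightarrow> mem (pr (f1 w) (pr 0 (f2 w))) S) \<and>
     (\<forall>w<d. lmem w d \<longrightarrow> mem (pr (f1 w) (pr 1 (f2 w))) S)"

definition S_of :: "nat \<Rightarrow> nat \<Rightarrow> nat" where "S_of g d = (LEAST S. seqP g d S)"

lemma pc_S:
  assumes "pc D f" "pc D g" "\<And>e. e \<in> D \<Longrightarrow> \<exists>S. seqP (f e) (g e) S"
  shows "pc D (\<lambda>e. S_of (f e) (g e))"
proof (rule pc2[where E = "{e. length e = 2 \<and> (\<exists>S. seqP (e ! 0) (e ! 1) S)}", OF _ assms(1,2)])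
  have "dec (Suc 2) (\<lambda>e. seqP (tl e ! 0) (tl e ! 1) (e ! 0))"
    unfolding seqP_def by (intro dec_rules cmp_accs; simp)
  then show "pc {e. length e = 2 \<and> (\<exists>S. seqP (e ! 0) (e ! 1) S)} (\<lambda>e. S_of (e ! 0) (e ! 1))"
    unfolding S_of_def by (rule pc_Least[where n = 2]) auto
qed (use assms(3) in simp)

lemma S_of_code:
  assumes d: "\<And>c. fmlookup \<Gamma> c = None \<or> fmlookup \<Delta> c = None" and f: "finite (dom (sqn \<Gamma> \<Delta>))"
  shows "seqP (family_code \<Gamma>) (family_code \<Delta>) (sc (sqn \<Gamma> \<Delta>))"
    and "S_of (family_code \<Gamma>) (family_code \<Delta>) = sc (sqn \<Gamma> \<Delta>)"
proof -
  have s: "seqP (family_code \<Gamma>) (family_code \<Delta>) S \<longleftrightarrow>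
      (\<forall>\<alpha> X. fmlookup \<Gamma> \<alpha> = Some X \<longrightarrow> mem (pr \<alpha> (pr 0 (fm_code X))) S) \<and>
      (\<forall>\<alpha> X. fmlookup \<Delta> \<alpha> = Some X \<longrightarrow> mem (pr \<alpha> (pr 1 (fm_code X))) S)" for S
  proof -
    have l: "(\<forall>w<family_code G. lmem w (family_code G) \<longrightarrow> mem (pr (f1 w) (pr i (f2 w))) S) \<longleftrightarrow>
        (\<forall>\<alpha> X. fmlookup G \<alpha> = Some X \<longrightarrow> mem (pr \<alpha> (pr i (fm_code X))) S)" for G i
    proof
      assume h: "\<forall>w<family_code G. lmem w (family_code G) \<longrightarrow> mem (pr (f1 w) (pr i (f2 w))) S"
      show "\<forall>\<alpha> X. fmlookup G \<alpha> = Some X \<longrightarrow> mem (pr \<alpha> (pr i (fm_code X))) S"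
      proof (intro allI impI)
        fix \<alpha> X assume "fmlookup G \<alpha> = Some X"
        then have l: "lmem (pr \<alpha> (fm_code X)) (family_code G)" by (simp add: family_code_def lmem_fmap)
        then show "mem (pr \<alpha> (pr i (fm_code X))) S" using h[rule_format, OF lmem_less[OF l] l] by simp
      qed
    next
      assume h: "\<forall>\<alpha> X. fmlookup G \<alpha> = Some X \<longrightarrow> mem (pr \<alpha> (pr i (fm_code X))) S"
      show "\<forall>w<family_code G. lmem w (family_code G) \<longrightarrow> mem (pr (f1 w) (pr i (f2 w))) S"
      proof (intro allI impI)
        fix w assume "lmem w (family_code G)"
        then have "lmem (pr (f1 w) (f2 w)) (family_code G)" by simp
        then obtain X where "fmlookup G (f1 w) = Some X" "f2 w = fm_code X"
          unfolding family_code_def lmem_fmap by auto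
        then show "mem (pr (f1 w) (pr i (f2 w))) S" using h by simp
      qed
    qed
    show ?thesis unfolding seqP_def l ..
  qed
  have q: "sqn \<Gamma> \<Delta> \<alpha> = Some (b, X) \<longleftrightarrow> fmlookup (if b then \<Delta> else \<Gamma>) \<alpha> = Some X" for \<alpha> b X
    using d[of \<alpha>] by (auto simp: sqn_def split: option.splits)
  have m: "mem (pr \<alpha> y) (sc (sqn \<Gamma> \<Delta>)) \<longleftrightarrow>
      (\<exists>X. fmlookup \<Gamma> \<alpha> = Some X \<and> y = pr 0 (fm_code X)) \<or> (\<exists>X. fmlookup \<Delta> \<alpha> = Some X \<and> y = pr 1 (fm_code X))" for \<alpha> y
    unfolding mem_sc[OF f] q ex_bool_eq by auto
  show 1: "seqP (family_code \<Gamma>) (family_code \<Delta>) (sc (sqn \<Gamma> \<Delta>))" unfolding s m by blast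
  show "S_of (family_code \<Gamma>) (family_code \<Delta>) = sc (sqn \<Gamma> \<Delta>)" unfolding S_of_def
  proof (rule Least_equality)
    show "seqP (family_code \<Gamma>) (family_code \<Delta>) (sc (sqn \<Gamma> \<Delta>))" by (rule 1)
  next
    fix S assume h: "seqP (family_code \<Gamma>) (family_code \<Delta>) S"
    have "mem z S" if "mem z (sc (sqn \<Gamma> \<Delta>))" for z
    proof -
      have "mem (pr (f1 z) (f2 z)) (sc (sqn \<Gamma> \<Delta>))" using that by simp
      then have "mem (pr (f1 z) (f2 z)) S"
        using h unfolding s m by (auto simp del: pr_f One_nat_def)
      then show ?thesis by simp
    qed
    then show "sc (sqn \<Gamma> \<Delta>) \<le> S" by (intro sub_le) blast
  qed
qed

text \<open>Every subterm occurrence lies in \<open>T\<close> by closure, in particular every leaf,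
  so the typed term is typed with leaves from the table.\<close>

lemma tyc_T:
  assumes T: "closedT S0 a b T"
  shows "ty lt (rs obj S) m \<Longrightarrow> finite (dom S) \<Longrightarrow> nm v m c \<Longrightarrow> mem (pr (sc S) c) T \<Longrightarrow> tyc T (sc S) c"
proof (induction m arbitrary: S c)
  case (Leaf x)
  then show ?case by (auto intro: tyc_leaf)
next
  case (Par \<alpha> I h)
  obtain F x where c: "c = parc \<alpha> F" and F: "\<And>i z. mem (pr i z) F \<longleftrightarrow> i \<in> I \<and> z = x i"
    and x: "\<And>i. i \<in> I \<Longrightarrow> nm v (h i) (x i)" using Par.prems(3) unfolding nm_Par by blast
  have k: "knd S \<alpha> = Some True" "I = idx S \<alpha>" "\<And>i. i \<in> I \<Longrightarrow> ty lt (nxt (rs obj S) \<alpha> i) (h i)" using Par.prems(1) by auto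
  obtain y where y: "mem (pr \<alpha> y) (sc S)" "asy y" using sc_knd(1)[OF Par.prems(2) k(1)] by blast
  show ?case unfolding c tyc_Par_iff[OF Par.prems(2) F]
  proof (intro conjI k ballI)
    fix i assume i: "i \<in> I"
    obtain X where X: "lmem (pr i X) (bl y)" using sc_async(4)[OF Par.prems(2), of \<alpha> y i] y i k(2) by blast
    have u: "upd (sc S) \<alpha> y X = sc (nxt S \<alpha> i)" using sc_async(3)[OF Par.prems(2), of \<alpha> y i X] y X by blast
    have "mem (pr i (x i)) F" using F i by simp
    then have "mem (pr (sc (nxt S \<alpha> i)) (x i)) T"
      using T[unfolded closedT_iff, THEN conjunct2, THEN conjunct2, THEN conjunct1] Par.prems(4) y X unfolding c u[symmetric] by blast
    moreover have "ty lt (rs obj (nxt S \<alpha> i)) (h i)" using k(3)[OF i] i k(2) by simp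
    moreover have "finite (dom (nxt S \<alpha> i))" using Par.prems(2) by simp
    ultimately show "tyc T (sc (nxt S \<alpha> i)) (x i)" using Par.IH[of "h i"] x[OF i] by blast
  qed
next
  case (Sel \<alpha> k f)
  obtain x where c: "c = selc \<alpha> k x" and x: "nm v f x" using Sel.prems(3) by auto
  have k: "knd S \<alpha> = Some False" "k \<in> idx S \<alpha>" "ty lt (nxt (rs obj S) \<alpha> k) f" using Sel.prems(1) by auto
  obtain y where y: "mem (pr \<alpha> y) (sc S)" "syn y" using sc_knd(2)[OF Sel.prems(2) k(1)] by blast
  obtain X where X: "lmem (pr k X) (bl y)" using sc_async(4)[OF Sel.prems(2), of \<alpha> y k] y k(2) by blast
  have u: "upd (sc S) \<alpha> y X = sc (nxt S \<alpha> k)" using sc_async(3)[OF Sel.prems(2), of \<alpha> y k X] y X by blast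
  have "mem (pr (sc (nxt S \<alpha> k)) x) T"
    using T[unfolded closedT_iff, THEN conjunct2, THEN conjunct2, THEN conjunct2] Sel.prems(4) y X unfolding c u[symmetric] by blast
  moreover have "ty lt (rs obj (nxt S \<alpha> k)) f" using k by simp
  moreover have "finite (dom (nxt S \<alpha> k))" using Sel.prems(2) by simp
  ultimately have "tyc T (sc (nxt S \<alpha> k)) x" using Sel.IH x by blast
  then show ?case unfolding c tyc_Sel_iff[OF Sel.prems(2)] using k by blast
qed

text \<open>
  Every sequent code in the closure comes with a term that is typed there, so that the leaves in the
  closure are well-typed formal composites.
\<close>

lemma T_ty:
  assumes f: "finite (dom S0)" and a: "ty lt (rs obj S0) ma" "nm v ma a" and b: "ty lt (rs obj S0) mb" "nm v mb b"
    and z: "mem (pr S c) (T_of (sc S0) a b)"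
  shows "\<exists>S1 m. finite (dom S1) \<and> S = sc S1 \<and> ty lt (rs obj S1) m \<and> nm v m c"
proof -
  define P where "P z \<longleftrightarrow> (\<exists>S1 m. finite (dom S1) \<and> f1 z = sc S1 \<and> ty lt (rs obj S1) m \<and> nm v m (f2 z))" for z
  obtain T0 where T0: "closedT (sc S0) a b T0" using closedT_exists by blast
  let ?T = "T_of (sc S0) a b"
  have "P (pr S c)"
  proof (rule least_closed_induct[where C = "closedT (sc S0) a b", OF T0 T_of_def _ z])
    assume cT: "closedT (sc S0) a b ?T"
    note c = cT[unfolded closedT_iff]
    let ?U = "set_encode {z. mem z ?T \<and> P z}"
    have "{z. mem z ?T \<and> P z} \<subseteq> set_decode ?T" by (auto simp: mem_def)
    then have fin: "finite {z. mem z ?T \<and> P z}" by (rule finite_subset) simp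
    have mU: "mem (pr S c) ?U \<longleftrightarrow> mem (pr S c) ?T \<and> (\<exists>S1 m. finite (dom S1) \<and> S = sc S1 \<and> ty lt (rs obj S1) m \<and> nm v m c)" for S c
      using fin by (simp add: P_def)
    show "closedT (sc S0) a b ?U" unfolding closedT_iff mU
    proof (intro conjI allI impI; (elim conjE exE)?)
      show "mem (pr (sc S0) a) ?T" "mem (pr (sc S0) b) ?T" using c by blast+
      show "\<exists>S1 m. finite (dom S1) \<and> sc S0 = sc S1 \<and> ty lt (rs obj S1) m \<and> nm v m a"
        "\<exists>S1 m. finite (dom S1) \<and> sc S0 = sc S1 \<and> ty lt (rs obj S1) m \<and> nm v m b"
        using f a b by blast+
    next
      fix S \<alpha> F y i x X S1 m
      assume h: "mem (pr S (parc \<alpha> F)) ?T" "mem (pr \<alpha> y) S" "asy y" "mem (pr i x) F" "lmem (pr i X) (bl y)"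
        and m: "finite (dom S1)" "S = sc S1" "ty lt (rs obj S1) m" "nm v m (parc \<alpha> F)"
      show "mem (pr (upd S \<alpha> y X) x) ?T" using c[THEN conjunct2, THEN conjunct2, THEN conjunct1] h by blast
      obtain I g xs where g: "m = Par \<alpha> I g" "\<And>i z. mem (pr i z) F \<longleftrightarrow> i \<in> I \<and> z = xs i" "\<And>i. i \<in> I \<Longrightarrow> nm v (g i) (xs i)"
        using nm_parc[OF m(4)] by blast
      have i: "i \<in> I" "x = xs i" using h(4) g(2) by blast+
      have k: "i \<in> idx S1 \<alpha>" "upd S \<alpha> y X = sc (nxt S1 \<alpha> i)" using sc_async(3)[OF m(1), of \<alpha> y i X] h m(2) by blast+
      have "ty lt (nxt (rs obj S1) \<alpha> i) (g i)" using m(3) i(1) unfolding g(1) by blast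
      then have "ty lt (rs obj (nxt S1 \<alpha> i)) (g i)" using k(1) by simp
      moreover have "finite (dom (nxt S1 \<alpha> i))" using m(1) by simp
      ultimately show "\<exists>S1 m. finite (dom S1) \<and> upd S \<alpha> y X = sc S1 \<and> ty lt (rs obj S1) m \<and> nm v m x"
        using g(3)[OF i(1)] i(2) k(2) by blast
    next
      fix S \<alpha> k x y X S1 m
      assume h: "mem (pr S (selc \<alpha> k x)) ?T" "mem (pr \<alpha> y) S" "syn y" "lmem (pr k X) (bl y)"
        and m: "finite (dom S1)" "S = sc S1" "ty lt (rs obj S1) m" "nm v m (selc \<alpha> k x)"
      show "mem (pr (upd S \<alpha> y X) x) ?T" using c[THEN conjunct2, THEN conjunct2, THEN conjunct2] h by blast
      obtain g where g: "m = Sel \<alpha> k g" "nm v g x" using nm_selc[OF m(4)] by blast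
      have k: "k \<in> idx S1 \<alpha>" "upd S \<alpha> y X = sc (nxt S1 \<alpha> k)" using sc_async(3)[OF m(1), of \<alpha> y k X] h m(2) by blast+
      have "ty lt (nxt (rs obj S1) \<alpha> k) g" using m(3) unfolding g(1) by blast
      then have "ty lt (rs obj (nxt S1 \<alpha> k)) g" using k(1) by simp
      moreover have "finite (dom (nxt S1 \<alpha> k))" using m(1) by simp
      ultimately show "\<exists>S1 m. finite (dom S1) \<and> upd S \<alpha> y X = sc S1 \<and> ty lt (rs obj S1) m \<and> nm v m x"
        using g(2) k(2) by blast
    qed
  qed
  then show ?thesis by (simp add: P_def)
qed

subsection \<open>Formal composites and the oracles\<close>

text \<open>The axiom with code \<open>x\<close> is labelled \<open>pr 0 x\<close>, a formal composite \<open>pr 1 (pr \<gamma> (pr a b))\<close>.\<close>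

function fold_comp :: "(nat \<Rightarrow> 'x) \<Rightarrow> (nat \<Rightarrow> 'x \<Rightarrow> 'x \<Rightarrow> 'x) \<Rightarrow> nat \<Rightarrow> 'x" where
  "fold_comp g c y = (if f1 y = 0 then g (f2 y)
     else c (f1 (f2 y)) (fold_comp g c (f1 (f2 (f2 y)))) (fold_comp g c (f2 (f2 (f2 y)))))"
  by pat_completeness auto
termination
proof (relation "measure (\<lambda>(g, c, y). y)")
  fix g c and y :: nat assume "f1 y \<noteq> 0"
  then have "f2 (f2 y) < y" using f2_less[of y] f2_le[of "f2 y"] by linarith
  then show "((g, c, f1 (f2 (f2 y))), g, c, y) \<in> measure (\<lambda>(g, c, y). y)"
    "((g, c, f2 (f2 (f2 y))), g, c, y) \<in> measure (\<lambda>(g, c, y). y)"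
    using f1_le[of "f2 (f2 y)"] f2_le[of "f2 (f2 y)"] by auto
qed simp

declare fold_comp.simps[simp del]

lemma fold_comp_pr[simp]:
  "fold_comp g c (pr 0 x) = g x"
  "fold_comp g c (pr (Suc 0) (pr \<gamma> (pr a b))) = c \<gamma> (fold_comp g c a) (fold_comp g c b)"
  by (simp_all add: fold_comp.simps[of g c "pr _ _"])

abbreviation "la y \<equiv> f1 (f2 (f2 y))"
abbreviation "rb y \<equiv> f2 (f2 (f2 y))"

lemma ab_less: "f1 y \<noteq> 0 \<Longrightarrow> la y < y \<and> rb y < y"
  using f2_less[of y] f2_le[of "f2 y"] f1_le[of "f2 (f2 y)"] f2_le[of "f2 (f2 y)"] by linarith

text \<open>The oracles as functions on codes. \<open>comp\<close> is fixed once among the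
  admissible results, and both oracles are assumed correct only where the hypotheses of the theorem
  grant an answer.\<close>

locale presentation = symmetric_polycategory A for A :: "('o, 'm) polycat" +
  fixes mor :: "nat \<Rightarrow> 'm" and MC :: "nat set" and comp :: "nat \<Rightarrow> nat \<Rightarrow> nat \<Rightarrow> nat"
  assumes mor_Mor: "x \<in> MC \<Longrightarrow> mor x \<in> Mor A"
    and comp: "x \<in> MC \<Longrightarrow> y \<in> MC \<Longrightarrow> composable A \<gamma> (mor x) (mor y) \<Longrightarrow>
       comp \<gamma> x y \<in> MC \<and> mor (comp \<gamma> x y) = Comp A \<gamma> (mor x) (mor y)"
    and pc_comp: "pc {[x, \<gamma>, y] | x \<gamma> y. x \<in> MC \<and> y \<in> MC \<and> composable A \<gamma> (mor x) (mor y)}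
       (\<lambda>e. comp (e ! 1) (e ! 0) (e ! 2))"
    and pc_equal: "pc {[x, y] | x y. x \<in> MC \<and> y \<in> MC \<and> Dom A (mor x) = Dom A (mor y) \<and> Cod A (mor x) = Cod A (mor y)}
       (\<lambda>e. of_bool (mor (e ! 0) = mor (e ! 1)))"
begin

definition "val = fold_comp mor (Comp A)"
definition "ev = fold_comp (\<lambda>x. x) comp"

text \<open>Every composition occurring in the expression is defined in \<open>A\<close>. On such
  expressions \<open>ev\<close> stays within the domain of the composition program.\<close>

inductive valid :: "nat \<Rightarrow> bool" where
  valid_Ax: "x \<in> MC \<Longrightarrow> valid (pr 0 x)"
| valid_Comp: "valid a \<Longrightarrow> valid b \<Longrightarrow> composable A \<gamma> (val a) (val b) \<Longrightarrow> valid (pr 1 (pr \<gamma> (pr a b)))"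

lemma val_pr: "val (pr 0 x) = mor x" "val (pr 1 (pr \<gamma> (pr a b))) = Comp A \<gamma> (val a) (val b)"
  by (simp_all add: val_def)

lemma ev_pr: "ev (pr 0 x) = x" "ev (pr 1 (pr \<gamma> (pr a b))) = comp \<gamma> (ev a) (ev b)"
  by (simp_all add: ev_def)

lemma valid_ev: "valid y \<Longrightarrow> ev y \<in> MC \<and> mor (ev y) = val y"
  by (induction rule: valid.induct) (simp_all add: val_pr ev_pr comp del: One_nat_def)

lemma valid_Mor: "valid y \<Longrightarrow> val y \<in> Mor A"
  using valid_ev mor_Mor by metis

lemma valid_cases:
  assumes "valid y"
  shows "f1 y = 0 \<and> ev y = f2 y \<or> f1 y = 1 \<and> valid (la y) \<and> valid (rb y) \<and>
    composable A (f1 (f2 y)) (val (la y)) (val (rb y)) \<and> ev y = comp (f1 (f2 y)) (ev (la y)) (ev (rb y))"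
  using assms by (cases rule: valid.cases) (simp_all add: ev_pr del: One_nat_def)

definition lt_valid :: "'o sq \<Rightarrow> nat \<Rightarrow> bool" where
  "lt_valid S y \<longleftrightarrow> valid y \<and> S = mseq A (val y)"

lemma opok_valid: "opok lt_valid True \<gamma> (\<lambda>a b. pr 1 (pr \<gamma> (pr a b)))"
  unfolding opok_def lt_valid_def
proof (intro allI impI, elim conjE)
  fix S1 S2 a b assume h: "cc True \<gamma> S1 S2" "valid a" "S1 = mseq A (val a)" "valid b" "S2 = mseq A (val b)"
  then have c: "composable A \<gamma> (val a) (val b)" using cc_composable valid_Mor by blast
  show "valid (pr 1 (pr \<gamma> (pr a b))) \<and> cs \<gamma> S1 S2 = mseq A (val (pr 1 (pr \<gamma> (pr a b))))"
    using valid_Comp[OF h(2,4) c] mseq_Comp[OF c] h(3,5) by (simp only: val_pr simp_thms)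
qed

text \<open>One search result is read in two ways: evaluated, it names the normal form in
  \<open>A\<close>; unevaluated, it names a typed term with formal composites as leaves, from which
  the validity of the leaves will follow.\<close>

lemma nf_code:
  assumes "tm_named_by mor MC t s" "derives A \<Gamma> \<Delta> s"
  shows "\<exists>R n. justified R \<and> nfR R (tm_code t) n"
    and "nm val (nfA s) (nf_of (tm_code t))"
    and "\<exists>m. ty lt_valid (sqn \<Gamma> \<Delta>) m \<and> nm (\<lambda>x. x) m (nf_of (tm_code t))"
proof -
  have t: "set_tm t \<subseteq> MC" "s = map_tm mor t" using assms(1) by (auto simp: tm_named_by_def)
  have s: "s = map_tm (\<lambda>x. val (pr 0 x)) t" by (simp add: t val_pr)
  show ex: "\<exists>R n. justified R \<and> nfR R (tm_code t) n" by (rule nfR_exists[where v = val, OF assms(2) s val_pr(2)])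
  obtain R where R: "justified R" "nfR R (tm_code t) (nf_of (tm_code t))" using nf_of[OF ex] by blast
  show "nm val (nfA s) (nf_of (tm_code t))" unfolding s by (rule nfR_sound[where v = val and op = "Comp A", OF R(1) val_pr(2) R(2)])
  let ?op = "\<lambda>\<gamma> a b. pr 1 (pr \<gamma> (pr a b))"
  have "ty lt_valid (sqn \<Gamma> \<Delta>) (nf ?op (map_tm (\<lambda>x. pr 0 x) t))"
  proof (rule nf_ty[OF assms(2), where v = val])
    show "s = map_tm val (map_tm (\<lambda>x. pr 0 x) t)" by (simp add: s tm.map_comp o_def)
    show "lt_valid (mseq A (val x)) x" if "x \<in> set_tm (map_tm (\<lambda>x. pr 0 x) t)" for x
      using that t(1) by (auto simp: tm.set_map lt_valid_def intro: valid_Ax)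
    show "atomic lt_valid" by (rule atomic_mseq[of _ A]) (auto simp: lt_valid_def)
    show "opok lt_valid True \<gamma> (?op \<gamma>)" for \<gamma> by (rule opok_valid)
  qed
  moreover have "nm (\<lambda>x. x) (nf ?op (map_tm (\<lambda>x. pr 0 x) t)) (nf_of (tm_code t))"
    by (rule nfR_sound[where v = "\<lambda>x. x", OF R(1) refl R(2)])
  ultimately show "\<exists>m. ty lt_valid (sqn \<Gamma> \<Delta>) m \<and> nm (\<lambda>x. x) m (nf_of (tm_code t))" by blast
qed

definition okT :: "(nat \<Rightarrow> 'o) \<Rightarrow> nat \<Rightarrow> bool" where
  "okT obj T \<longleftrightarrow> (\<forall>S a. mem (pr S (leafc a)) T \<longrightarrow>
     (\<exists>S1. finite (dom S1) \<and> S = sc S1 \<and> valid a \<and> rs obj S1 = mseq A (val a)))"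

text \<open>By \<open>sc_inj\<close> both leaves are typed at the same coded sequent, whose image
  under \<open>obj\<close> is the sequent of both values. Domains and codomains thus agree without
  any comparison of atoms.\<close>

lemma okT_eq:
  assumes "okT obj T" "mem (pr S (leafc a)) T" "mem (pr S (leafc b)) T"
  shows "valid a" "valid b" "Dom A (val a) = Dom A (val b)" "Cod A (val a) = Cod A (val b)"
proof -
  obtain S1 where 1: "finite (dom S1)" "S = sc S1" "valid a" "rs obj S1 = mseq A (val a)"
    using assms(1,2) unfolding okT_def by blast
  obtain S2 where 2: "finite (dom S2)" "S = sc S2" "valid b" "rs obj S2 = mseq A (val b)"
    using assms(1,3) unfolding okT_def by blast
  have "S1 = S2" using sc_inj[OF 1(1) 2(1)] 1(2) 2(2) by simp
  then have m: "mseq A (val a) = mseq A (val b)" using 1(4) 2(4) by simp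
  show v: "valid a" "valid b" by fact+
  note i = mseq_iff[OF valid_Mor[OF v(1)]] mseq_iff[OF valid_Mor[OF v(2)]]
  have "fmlookup (Dom A (val a)) c = Some Z \<longleftrightarrow> fmlookup (Dom A (val b)) c = Some Z"
    "fmlookup (Cod A (val a)) c = Some Z \<longleftrightarrow> fmlookup (Cod A (val b)) c = Some Z" for c Z
    using i(1,2,4,5)[of c Z] m by simp_all
  then show "Dom A (val a) = Dom A (val b)" "Cod A (val a) = Cod A (val b)"
    by (metis fmap_ext option.exhaust)+
qed

lemma okT_T_of:
  assumes f: "finite (dom S0)" and a: "ty lt_valid (rs obj S0) ma" "nm (\<lambda>x. x) ma a"
    and b: "ty lt_valid (rs obj S0) mb" "nm (\<lambda>x. x) mb b"
  shows "okT obj (T_of (sc S0) a b)"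
  unfolding okT_def
proof (intro allI impI)
  fix S x assume "mem (pr S (leafc x)) (T_of (sc S0) a b)"
  then obtain S1 m where m: "finite (dom S1)" "S = sc S1" "ty lt_valid (rs obj S1) m" "nm (\<lambda>x. x) m (leafc x)"
    using T_ty[OF f a b] by blast
  then have "m = Leaf x" using nm_leafc[OF m(4)] by simp
  then show "\<exists>S1. finite (dom S1) \<and> S = sc S1 \<and> valid x \<and> rs obj S1 = mseq A (val x)"
    using m unfolding lt_valid_def by auto
qed

definition okV :: "nat \<Rightarrow> bool" where
  "okV V \<longleftrightarrow> (\<forall>y. mem y V \<longrightarrow> valid y \<and> (f1 y \<noteq> 0 \<longrightarrow> mem (la y) V \<and> mem (rb y) V))"

lemma closedV_V_of: "closedV T (V_of T)"
  unfolding V_of_def by (rule LeastI_ex[OF closedV_exists])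

lemma okV_V_of:
  assumes "okT obj T"
  shows "okV (V_of T)"
proof -
  note cV = closedV_V_of[of T, unfolded closedV_def]
  have "valid y" if y: "mem y (V_of T)" for y
  proof (rule least_closed_induct[where C = "closedV T" and P = valid, OF closedV_V_of V_of_def _ y])
    let ?V = "set_encode {z. mem z (V_of T) \<and> valid z}"
    have "{z. mem z (V_of T) \<and> valid z} \<subseteq> set_decode (V_of T)" by (auto simp: mem_def)
    then have "finite {z. mem z (V_of T) \<and> valid z}" by (rule finite_subset) simp
    then have m: "mem z ?V \<longleftrightarrow> mem z (V_of T) \<and> valid z" for z by simp
    show "closedV T ?V" unfolding closedV_def m
    proof (intro conjI allI impI; elim conjE)
      fix z assume z: "z < T" "mem z T" "f1 (f2 z) = 0"
      then show "mem (f2 (f2 z)) (V_of T)" using cV by blast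
      have "mem (pr (f1 z) (leafc (f2 (f2 z)))) T" using z(2,3) by (metis pr_f)
      then show "valid (f2 (f2 z))" using assms unfolding okT_def by blast
    next
      fix x assume x: "mem x (V_of T)" "valid x" "f1 x \<noteq> 0"
      then show "mem (la x) (V_of T)" "mem (rb x) (V_of T)" using cV mem_less[OF x(1)] by blast+
      show "valid (la x)" "valid (rb x)" using valid_cases[OF x(2)] x(3) by auto
    qed
  qed
  then show ?thesis using cV mem_less unfolding okV_def by blast
qed

lemma V_of_leaf: "mem (pr S (leafc a)) T \<Longrightarrow> mem a (V_of T)"
  using closedV_V_of[of T, unfolded closedV_def, THEN conjunct1, rule_format, of "pr S (leafc a)"] mem_less by simp

text \<open>
  The table of values of the formal composites in \<open>V\<close>, filled in the order of their codes, so that the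
  values of both components have been entered before \<open>comp\<close> is applied to them.
\<close>

definition tab_step :: "nat \<Rightarrow> nat \<Rightarrow> nat \<Rightarrow> nat" where
  "tab_step V y W = (if mem y V
     then W + 2 ^ pr y (if f1 y \<noteq> 0 then comp (f1 (f2 y)) (look W (la y)) (look W (rb y)) else f2 y) else W)"

definition tab :: "nat \<Rightarrow> nat \<Rightarrow> nat" where
  "tab V k = rec_nat 0 (tab_step V) k"

definition W_of :: "nat \<Rightarrow> nat" where "W_of V = tab V V"

lemma tab:
  assumes "okV V"
  shows "tab V k = set_encode ((\<lambda>y. pr y (ev y)) ` {y. y < k \<and> mem y V})"
    and "a < k \<Longrightarrow> mem a V \<Longrightarrow> look (tab V k) a = ev a"
proof -
  let ?X = "\<lambda>k. (\<lambda>y. pr y (ev y)) ` {y. y < k \<and> mem y V}"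
  have fin: "finite (?X k)" for k by simp
  have lk: "look (set_encode (?X k)) a = ev a" if "a < k" "mem a V" for a k
    by (rule look_graph) (use that in \<open>auto simp: image_iff\<close>)
  show 1: "tab V k = set_encode (?X k)"
  proof (induction k)
    case (Suc k)
    have t: "tab V (Suc k) = tab_step V k (tab V k)" by (simp add: tab_def)
    show ?case
    proof (cases "mem k V")
      case True
      have ek: "(if f1 k \<noteq> 0 then comp (f1 (f2 k)) (look (tab V k) (la k)) (look (tab V k) (rb k)) else f2 k) = ev k"
      proof (cases "f1 k = 0")
        case False
        have "look (tab V k) (la k) = ev (la k)" "look (tab V k) (rb k) = ev (rb k)"
          unfolding Suc using assms True False ab_less[of k] by (auto simp: okV_def intro!: lk)
        then show ?thesis using False valid_cases[of k] assms True unfolding okV_def by simp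
      next
        case True
        then show ?thesis using valid_cases[of k] assms \<open>mem k V\<close> unfolding okV_def by simp
      qed
      have "tab V (Suc k) = tab V k + 2 ^ pr k (ev k)" unfolding t tab_step_def ek using True by (rule if_P)
      also have "\<dots> = set_encode (?X k) + 2 ^ pr k (ev k)" unfolding Suc ..
      also have "\<dots> = set_encode (insert (pr k (ev k)) (?X k))"
        by (subst set_encode_insert[OF fin]) auto
      also have "insert (pr k (ev k)) (?X k) = ?X (Suc k)" using True by (auto simp: less_Suc_eq)
      finally show ?thesis .
    next
      case False
      then have "{y. y < Suc k \<and> mem y V} = {y. y < k \<and> mem y V}" by (auto simp: less_Suc_eq)
      then show ?thesis using False Suc t by (simp add: tab_step_def)
    qed
  qed (simp add: tab_def)
  show "look (tab V k) a = ev a" if "a < k" "mem a V" unfolding 1 by (rule lk[OF that])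
qed

lemma look_W: "okV V \<Longrightarrow> mem a V \<Longrightarrow> look (W_of V) a = ev a"
  unfolding W_of_def by (rule tab(2)[OF _ mem_less])

lemma pc_W:
  assumes "pc D f" "\<And>e. e \<in> D \<Longrightarrow> okV (f e)"
  shows "pc D (\<lambda>e. W_of (f e))"
proof (rule pc1[where E = "{[V] | V. okV V}", OF _ assms(1)])
  let ?D = "{[V] | V. okV V}"
  \<comment> \<open>The states that the recursion visits. In them the accumulator is the table of
    all codes below \<open>m\<close>, so both components of \<open>m\<close> already have their
    values.\<close>
  let ?X = "{m # rec_nat 0 (\<lambda>m r. tab_step (e ! 0) m r) m # e | m e. e \<in> ?D \<and> m < e ! 0}"
  have len: "?X \<subseteq> {e. length e = 3}" "?D \<subseteq> {e. length e = 1}" by auto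
  have a: "pc ?X (\<lambda>e. e ! i)" if "i < 3" for i by (rule pc_mono[OF cmp_arg[OF that] len(1)])
  have tl: "pc ?X (\<lambda>e. tl (tl e) ! 0)" by (rule pc_mono[OF cmp_accs(3) len(1)]) simp
  let ?Y = "{e \<in> {e \<in> ?X. mem (e ! 0) (tl (tl e) ! 0)}. f1 (e ! 0) \<noteq> 0}"
  have aY: "pc ?Y (\<lambda>e. e ! i)" if "i < 3" for i by (rule pc_mono[OF a[OF that]]) auto
  have aZ: "pc {e \<in> ?X. mem (e ! 0) (tl (tl e) ! 0)} (\<lambda>e. e ! i)" if "i < 3" for i
    by (rule pc_mono[OF a[OF that]]) auto
  have c: "pc ?Y (\<lambda>e. comp (f1 (f2 (e ! 0))) (look (e ! 1) (la (e ! 0))) (look (e ! 1) (rb (e ! 0))))"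
  proof (rule pc3[where F = "\<lambda>x \<gamma> y. comp \<gamma> x y", OF pc_comp])
    fix e assume "e \<in> ?Y"
    then obtain m V where e: "e = [m, tab V m, V]" and h: "okV V" "m < V" "mem m V" "f1 m \<noteq> 0"
      by (auto simp: tab_def)
    have "look (tab V m) (la m) = ev (la m)" "look (tab V m) (rb m) = ev (rb m)"
      using h ab_less[of m] by (auto simp: okV_def intro!: tab(2))
    moreover have "valid (la m)" "valid (rb m)" "composable A (f1 (f2 m)) (val (la m)) (val (rb m))"
      using valid_cases[of m] h unfolding okV_def by auto
    ultimately have "look (tab V m) (la m) \<in> MC \<and> look (tab V m) (rb m) \<in> MC \<and>
       composable A (f1 (f2 m)) (mor (look (tab V m) (la m))) (mor (look (tab V m) (rb m)))"
      using valid_ev by simp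
    then show "[look (e ! 1) (la (e ! 0)), f1 (f2 (e ! 0)), look (e ! 1) (rb (e ! 0))] \<in>
        {[x, \<gamma>, y] | x \<gamma> y. x \<in> MC \<and> y \<in> MC \<and> composable A \<gamma> (mor x) (mor y)}"
      unfolding e by simp
  qed (intro cmp_look cmp_f1 cmp_f2 aY; simp)+
  have "pc ?X (\<lambda>e. if mem (e ! 0) (tl (tl e) ! 0) then e ! 1 + 2 ^ pr (e ! 0) (if f1 (e ! 0) \<noteq> 0
        then comp (f1 (f2 (e ! 0))) (look (e ! 1) (la (e ! 0))) (look (e ! 1) (rb (e ! 0))) else f2 (e ! 0)) else e ! 1)"
  proof (rule pc_if[where n = 3])
    show "pc ?X (\<lambda>e. of_bool (mem (e ! 0) (tl (tl e) ! 0)))" by (intro dec_mem a tl) simp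
    show "pc ?X (\<lambda>e. e ! 1)" by (rule a) simp
    show "pc {e \<in> ?X. mem (e ! 0) (tl (tl e) ! 0)} (\<lambda>e. e ! 1 + 2 ^ pr (e ! 0) (if f1 (e ! 0) \<noteq> 0
        then comp (f1 (f2 (e ! 0))) (look (e ! 1) (la (e ! 0))) (look (e ! 1) (rb (e ! 0))) else f2 (e ! 0)))"
    proof (intro cmp_add cmp_pow2 cmp_pr aZ pc_if[where n = 3] c)
      show "pc {e \<in> ?X. mem (e ! 0) (tl (tl e) ! 0)} (\<lambda>e. of_bool (f1 (e ! 0) \<noteq> 0))"
        by (intro dec_not dec_eq cmp_f1 aZ cmp_const) simp
      show "pc {e \<in> ?X. mem (e ! 0) (tl (tl e) ! 0)} (\<lambda>e. f2 (e ! 0))" by (intro cmp_f2 aZ) simp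
    qed (use len(1) in auto)
  qed (use len(1) in auto)
  then have "pc ?X (\<lambda>e. tab_step (tl (tl e) ! 0) (e ! 0) (e ! 1))"
    by (rule pc_cong) (rule tab_step_def)
  then have "pc ?D (\<lambda>e. rec_nat 0 (\<lambda>m r. tab_step (e ! 0) m r) (e ! 0))"
    by (intro pc_rec[OF cmp_const, where n = 1] pc_mono[OF cmp_arg len(2)]) auto
  then show "pc ?D (\<lambda>e. W_of (e ! 0))" unfolding W_of_def tab_def .
qed (use assms(2) in simp)

text \<open>Sequents and leaf codes occurring in \<open>T\<close> are smaller than \<open>T\<close>,
  so the bound covers all relevant triples. Membership in \<open>T\<close> at a common sequent
  precedes the comparison of values, because only then is the equality test reliable.\<close>

definition M_of :: "nat \<Rightarrow> nat" where
  "M_of T = set_encode {z. z < pr T (pr T T) \<and> mem (pr (f1 z) (leafc (f1 (f2 z)))) T \<and>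
     mem (pr (f1 z) (leafc (f2 (f2 z)))) T \<and> val (f1 (f2 z)) = val (f2 (f2 z))}"

lemma okM_M_of: "okM T val (M_of T)"
  unfolding okM_def
proof (intro allI)
  fix S a b
  have mono: "pr i x \<le> pr j y" if "i \<le> j" "x \<le> y" for i j x y
  proof -
    have t: "triangle m \<le> triangle n" if "m \<le> n" for m n using that by (induction n) (auto simp: le_Suc_eq)
    show ?thesis using t[of "i + x" "j + y"] that by (simp add: prod_encode_def)
  qed
  have "pr S (pr a b) < pr T (pr T T)" if "mem (pr S (leafc a)) T" "mem (pr S (leafc b)) T"
  proof -
    have "S < T" "a < T" "b < T"
      using mem_pr_less[OF that(1)] mem_pr_less[OF that(2)] le_prod_encode_2[of a 0] le_prod_encode_2[of b 0] by linarith+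
    then have "pr S (pr a b) \<le> pr T (pr a b)" "pr a b < pr T T"
      using mono[of S T "pr a b" "pr a b"] mono[of a T b b] pr_mono[of b T T] by linarith+
    then show ?thesis using pr_mono[of "pr a b" "pr T T" T] by linarith
  qed
  then show "mem (pr S (pr a b)) (M_of T) \<longleftrightarrow> mem (pr S (leafc a)) T \<and> mem (pr S (leafc b)) T \<and> val a = val b"
    unfolding M_of_def by (subst mem_encode) auto
qed

lemma pc_M:
  assumes "pc D f" "\<And>e. e \<in> D \<Longrightarrow> okT obj (f e)"
  shows "pc D (\<lambda>e. M_of (f e))"
proof -
  \<comment> \<open>The table of values is handed over as a second argument, so that the test for a
    single triple only has to look values up.\<close>
  let ?D = "{[T, W_of (V_of T)] | T. okT obj T}"
  let ?X = "{m # e | m e. e \<in> ?D \<and> m < pr (e ! 0) (pr (e ! 0) (e ! 0))}"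
  have len: "?X \<subseteq> {e. length e = 3}" "?D \<subseteq> {e. length e = 2}" by auto
  have a: "pc ?X (\<lambda>e. e ! i)" if "i < 3" for i by (rule pc_mono[OF cmp_arg[OF that] len(1)])
  have tl: "pc ?X (\<lambda>e. tl e ! i)" if "1 + i < 3" for i by (rule pc_mono[OF cmp_accs(2)[OF that] len(1)])
  let ?c = "\<lambda>z T. mem (pr (f1 z) (leafc (f1 (f2 z)))) T \<and> mem (pr (f1 z) (leafc (f2 (f2 z)))) T"
  let ?Y = "{e \<in> ?X. ?c (e ! 0) (tl e ! 0)}"
  have aY: "pc ?Y (\<lambda>e. e ! i)" if "i < 3" for i by (rule pc_mono[OF a[OF that]]) auto
  have tlY: "pc ?Y (\<lambda>e. tl e ! i)" if "1 + i < 3" for i by (rule pc_mono[OF tl[OF that]]) auto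
  have Y: "\<exists>z T. e = [z, T, W_of (V_of T)] \<and> okT obj T \<and> ?c z T" if "e \<in> ?Y" for e using that by auto
  have lk: "look (W_of (V_of T)) x = ev x" if "okT obj T" "mem (pr S (leafc x)) T" for T S x
    by (rule look_W[OF okV_V_of[OF that(1)] V_of_leaf[OF that(2)]])
  have "pc ?Y (\<lambda>e. of_bool (mor (look (tl e ! 1) (f1 (f2 (e ! 0)))) = mor (look (tl e ! 1) (f2 (f2 (e ! 0))))))"
  proof (rule pc2[where F = "\<lambda>x y. of_bool (mor x = mor y)", OF pc_equal])
    fix e assume "e \<in> ?Y"
    then obtain z T where e: "e = [z, T, W_of (V_of T)]" "okT obj T" "?c z T" using Y by blast
    note o = okT_eq[OF e(2) e(3)[THEN conjunct1] e(3)[THEN conjunct2]]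
    note l = lk[OF e(2) e(3)[THEN conjunct1]] lk[OF e(2) e(3)[THEN conjunct2]]
    show "[look (tl e ! 1) (f1 (f2 (e ! 0))), look (tl e ! 1) (f2 (f2 (e ! 0)))] \<in>
        {[x, y] | x y. x \<in> MC \<and> y \<in> MC \<and> Dom A (mor x) = Dom A (mor y) \<and> Cod A (mor x) = Cod A (mor y)}"
      unfolding e(1) using o(3,4) valid_ev[OF o(1)] valid_ev[OF o(2)] l by simp
  qed (intro cmp_look cmp_f1 cmp_f2 aY tlY; simp)+
  then have y: "pc ?Y (\<lambda>e. of_bool (val (f1 (f2 (e ! 0))) = val (f2 (f2 (e ! 0)))))"
  proof (rule pc_cong)
    fix e assume "e \<in> ?Y"
    then obtain z T where e: "e = [z, T, W_of (V_of T)]" "okT obj T" "?c z T" using Y by blast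
    note o = okT_eq[OF e(2) e(3)[THEN conjunct1] e(3)[THEN conjunct2]]
    note l = lk[OF e(2) e(3)[THEN conjunct1]] lk[OF e(2) e(3)[THEN conjunct2]]
    show "of_bool (val (f1 (f2 (e ! 0))) = val (f2 (f2 (e ! 0)))) =
       of_bool (mor (look (tl e ! 1) (f1 (f2 (e ! 0)))) = mor (look (tl e ! 1) (f2 (f2 (e ! 0)))))"
      unfolding e(1) using valid_ev[OF o(1)] valid_ev[OF o(2)] l by simp
  qed
  have "pc ?X (\<lambda>e. if ?c (e ! 0) (tl e ! 0) then of_bool (val (f1 (f2 (e ! 0))) = val (f2 (f2 (e ! 0)))) else 0)"
  proof (rule pc_if[where n = 3, OF _ y cmp_const])
    show "pc ?X (\<lambda>e. of_bool (?c (e ! 0) (tl e ! 0)))" by (intro dec_rules a tl; simp)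
  qed (use len(1) in blast)
  then have "pc ?X (\<lambda>e. of_bool (mem (pr (f1 (e ! 0)) (leafc (f1 (f2 (e ! 0))))) (tl e ! 0) \<and>
     mem (pr (f1 (e ! 0)) (leafc (f2 (f2 (e ! 0))))) (tl e ! 0) \<and> val (f1 (f2 (e ! 0))) = val (f2 (f2 (e ! 0)))))"
    by (rule pc_cong) auto
  then have "pc ?D (\<lambda>e. set_encode {z. z < pr (e ! 0) (pr (e ! 0) (e ! 0)) \<and>
     (mem (pr (f1 z) (leafc (f1 (f2 z)))) (e ! 0) \<and> mem (pr (f1 z) (leafc (f2 (f2 z)))) (e ! 0) \<and>
      val (f1 (f2 z)) = val (f2 (f2 z)))})"
    by (rule pc_collect[where n = 2]) (auto intro!: cmp_pr pc_mono[OF cmp_arg len(2)])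
  then have "pc ?D (\<lambda>e. M_of (e ! 0))" unfolding M_of_def .
  then show ?thesis
  proof (rule pc2[where F = "\<lambda>T W. M_of T", OF _ assms(1)])
    show "pc D (\<lambda>e. W_of (V_of (f e)))" by (intro pc_W cmp_V assms(1) okV_V_of[OF assms(2)])
  qed (use assms(2) in blast)
qed

text \<open>The domain consists of codes of actual derivations of a common sequent; typing is never
  tested. As bound for the saturated set the given sequent itself will do, since rules lead only to
  smaller ones.\<close>

lemma decision:
  fixes obj OC
  defines "D \<equiv> {[family_code \<Gamma>c, family_code \<Delta>c, tm_code sc, tm_code tc] | \<Gamma>c \<Delta>c sc tc.
      \<exists>\<Gamma> \<Delta> s t. family_named_by obj OC \<Gamma>c \<Gamma> \<and> family_named_by obj OC \<Delta>c \<Delta> \<and>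
       tm_named_by mor MC sc s \<and> tm_named_by mor MC tc t \<and> derives A \<Gamma> \<Delta> s \<and> derives A \<Gamma> \<Delta> t}"
  defines "S e \<equiv> S_of (e ! 0) (e ! 1)" and "a e \<equiv> nf_of (e ! 2)" and "b e \<equiv> nf_of (e ! 3)"
  defines "T e \<equiv> T_of (S e) (a e) (b e)"
  defines "E e \<equiv> E_of (M_of (T e)) (S e)"
  shows "pc D (\<lambda>e. of_bool (mem (pr (S e) (pr (a e) (b e))) (E e)))"
    and "family_named_by obj OC \<Gamma>c \<Gamma> \<Longrightarrow> family_named_by obj OC \<Delta>c \<Delta> \<Longrightarrow>
       tm_named_by mor MC s' s \<Longrightarrow> tm_named_by mor MC t' t \<Longrightarrow> derives A \<Gamma> \<Delta> s \<Longrightarrow> derives A \<Gamma> \<Delta> t \<Longrightarrow>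
       e = [family_code \<Gamma>c, family_code \<Delta>c, tm_code s', tm_code t'] \<Longrightarrow>
       mem (pr (S e) (pr (a e) (b e))) (E e) \<longleftrightarrow> equivalent A \<Gamma> \<Delta> s t"
proof -
  have main: "(\<exists>X. seqP (e ! 0) (e ! 1) X) \<and> (\<exists>R n. justified R \<and> nfR R (e ! 2) n) \<and>
      (\<exists>R n. justified R \<and> nfR R (e ! 3) n) \<and> okT obj (T e) \<and>
      (mem (pr (S e) (pr (a e) (b e))) (E e) \<longleftrightarrow> equivalent A \<Gamma> \<Delta> s t)"
    if h: "family_named_by obj OC \<Gamma>c \<Gamma>" "family_named_by obj OC \<Delta>c \<Delta>"
       "tm_named_by mor MC s' s" "tm_named_by mor MC t' t" "derives A \<Gamma> \<Delta> s" "derives A \<Gamma> \<Delta> t"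
      and e: "e = [family_code \<Gamma>c, family_code \<Delta>c, tm_code s', tm_code t']" for \<Gamma>c \<Delta>c s' t' \<Gamma> \<Delta> s t e
  proof -
    \<comment> \<open>The sequent of atom codes. The program sees only this one; the sequent of
      atoms is its image under \<open>rs obj\<close>.\<close>
    define S0 where "S0 = sqn \<Gamma>c \<Delta>c"
    have G: "\<Gamma> = fmmap (map_fm obj) \<Gamma>c" "\<Delta> = fmmap (map_fm obj) \<Delta>c" using h(1,2) by (simp_all add: family_named_by_def)
    have rs: "rs obj S0 = sqn \<Gamma> \<Delta>" by (rule ext) (simp add: rs_def S0_def sqn_def G option.map_comp o_def split: option.split)
    note wf = derives_wf[OF h(5)]
    have fin: "finite (dom S0)"
    proof -
      have "dom S0 = dom (rs obj S0)" by (auto simp: rs_def)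
      then show ?thesis unfolding rs using lf_sqn(3)[OF wf] by simp
    qed
    have "fmlookup \<Gamma>c c = None \<or> fmlookup \<Delta>c c = None" for c
      using wf[unfolded wf_seq_alt, THEN conjunct1, rule_format, of c] unfolding G by simp
    note So = S_of_code[OF this fin[unfolded S0_def]]
    have Sc: "S e = sc S0" using So(2) by (simp add: S_def e S0_def)
    have ab: "a e = nf_of (tm_code s')" "b e = nf_of (tm_code t')" by (simp_all add: a_def b_def e)
    note ns = nf_code[OF h(3,5)] and nt = nf_code[OF h(4,6)]
    obtain ms mt where m: "ty lt_valid (rs obj S0) ms" "nm (\<lambda>x. x) ms (a e)" "ty lt_valid (rs obj S0) mt" "nm (\<lambda>x. x) mt (b e)"
      using ns(3) nt(3) unfolding rs ab by blast
    have T: "T e = T_of (sc S0) (a e) (b e)" unfolding T_def Sc ..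
    have okT: "okT obj (T e)" unfolding T by (rule okT_T_of[OF fin m])
    have cT: "closedT (sc S0) (a e) (b e) (T e)" unfolding T T_of_def by (rule LeastI_ex[OF closedT_exists])
    have nm: "nm val (nfA s) (a e)" "nm val (nfA t) (b e)" using ns(2) nt(2) unfolding ab .
    have ty: "ty (rl A) (rs obj S0) (nfA s)" "ty (rl A) (rs obj S0) (nfA t)"
      unfolding rs by (rule nfA_ty[OF h(5)], rule nfA_ty[OF h(6)])
    have tc: "tyc (T e) (sc S0) (a e)" "tyc (T e) (sc S0) (b e)"
      using tyc_T[OF cT ty(1) fin nm(1)] tyc_T[OF cT ty(2) fin nm(2)] cT[unfolded closedT_iff] by blast+
    \<comment> \<open>A leaf of the table is valid for some sequent with the same code, and by
      injectivity of \<open>sc\<close> that sequent is the present one.\<close>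
    have l: "rl A (rs obj S1) f" if "finite (dom S1)" "lm (T e) val S1 f" for S1 f
    proof -
      obtain x where x: "mem (pr (sc S1) (leafc x)) (T e)" "val x = f" using \<open>lm (T e) val S1 f\<close> by (auto simp: lm_def)
      then obtain S2 where S2: "finite (dom S2)" "sc S1 = sc S2" "valid x" "rs obj S2 = mseq A (val x)"
        using okT unfolding okT_def by blast
      have "S1 = S2" by (rule sc_inj[OF that(1) S2(1,2)])
      then show ?thesis using S2 valid_Mor x(2) unfolding rl_def by blast
    qed
    have "mem (pr (sc S0) (pr (a e) (b e))) (E e) \<longleftrightarrow> peq (rl A) (rs obj S0) (nfA s) (nfA t)"
      by (rule E_iff[where T = "T e" and v = val and M = "M_of (T e)" and B = "sc S0" and lt = "rl A" and obj = obj, OF okM_M_of _ fin _ l nm tc]) (simp_all add: E_def E_of_def Sc)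
    then have "mem (pr (S e) (pr (a e) (b e))) (E e) \<longleftrightarrow> equivalent A \<Gamma> \<Delta> s t"
      unfolding equivalent_iff_peq[OF h(5,6)] Sc rs .
    moreover have "\<exists>X. seqP (e ! 0) (e ! 1) X" using So(1) by (auto simp: e)
    moreover have "\<exists>R n. justified R \<and> nfR R (e ! 2) n" "\<exists>R n. justified R \<and> nfR R (e ! 3) n"
      using ns(1) nt(1) by (simp_all add: e)
    ultimately show ?thesis using okT by blast
  qed
  have D: "(\<exists>X. seqP (e ! 0) (e ! 1) X) \<and> (\<exists>R n. justified R \<and> nfR R (e ! 2) n) \<and>
      (\<exists>R n. justified R \<and> nfR R (e ! 3) n) \<and> okT obj (T e)" if "e \<in> D" for e
    using that main unfolding D_def by blast
  have len: "D \<subseteq> {e. length e = 4}" unfolding D_def by auto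
  have arg: "pc D (\<lambda>e. e ! i)" if "i < 4" for i by (rule pc_mono[OF cmp_arg[OF that] len])
  have pS: "pc D S" unfolding S_def by (rule pc_S) (use arg D in auto)
  have pa: "pc D a" unfolding a_def by (rule pc_nf) (use arg D in auto)
  have pb: "pc D b" unfolding b_def by (rule pc_nf) (use arg D in auto)
  have pT: "pc D T" unfolding T_def by (rule cmp_T[OF pS pa pb])
  have pM: "pc D (\<lambda>e. M_of (T e))" by (rule pc_M[OF pT]) (use D in blast)
  have pE: "pc D E" unfolding E_def by (rule pc_E[OF pM pS closedE_exists[OF okM_M_of]])
  show "pc D (\<lambda>e. of_bool (mem (pr (S e) (pr (a e) (b e))) (E e)))" by (intro dec_mem cmp_pr pS pa pb pE)
  show "family_named_by obj OC \<Gamma>c \<Gamma> \<Longrightarrow> family_named_by obj OC \<Delta>c \<Delta> \<Longrightarrow>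
       tm_named_by mor MC s' s \<Longrightarrow> tm_named_by mor MC t' t \<Longrightarrow> derives A \<Gamma> \<Delta> s \<Longrightarrow> derives A \<Gamma> \<Delta> t \<Longrightarrow>
       e = [family_code \<Gamma>c, family_code \<Delta>c, tm_code s', tm_code t'] \<Longrightarrow>
       mem (pr (S e) (pr (a e) (b e))) (E e) \<longleftrightarrow> equivalent A \<Gamma> \<Delta> s t"
    using main by blast
qed

end

theorem mainTheorem4:
  fixes A :: "('o, 'm) polycat"
    and obj :: "nat \<Rightarrow> 'o" and OC :: "nat set"
    and mor :: "nat \<Rightarrow> 'm" and MC :: "nat set"
  assumes "symmetric_polycategory A"
    and "numbering obj OC (Obj A)"
    and "numbering mor MC (Mor A)"
    and "composition_computable A mor MC"
    and "equality_decidable A mor MC"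
  shows "\<exists>p. \<forall>\<Gamma>\<^sub>c \<Delta>\<^sub>c s\<^sub>c t\<^sub>c \<Gamma> \<Delta> s t.
           family_named_by obj OC \<Gamma>\<^sub>c \<Gamma> \<longrightarrow> family_named_by obj OC \<Delta>\<^sub>c \<Delta> \<longrightarrow>
           tm_named_by mor MC s\<^sub>c s \<longrightarrow> tm_named_by mor MC t\<^sub>c t \<longrightarrow>
           derives A \<Gamma> \<Delta> s \<longrightarrow> derives A \<Gamma> \<Delta> t \<longrightarrow>
           computes p [family_code \<Gamma>\<^sub>c, family_code \<Delta>\<^sub>c, tm_code s\<^sub>c, tm_code t\<^sub>c]
             (if equivalent A \<Gamma> \<Delta> s t then 1 else 0)"
proof -
  obtain p where p: "\<And>x y \<gamma>. x \<in> MC \<Longrightarrow> y \<in> MC \<Longrightarrow> composable A \<gamma> (mor x) (mor y) \<Longrightarrow>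
      \<exists>z\<in>MC. computes p [x, \<gamma>, y] z \<and> mor z = Comp A \<gamma> (mor x) (mor y)"
    using assms(4) unfolding composition_computable_def by blast
  \<comment> \<open>Chosen among the results that \<open>p\<close> returns, so that \<open>p\<close>
    computes it; where the composite is undefined its value is arbitrary.\<close>
  define comp where "comp \<gamma> x y = (SOME z. z \<in> MC \<and> computes p [x, \<gamma>, y] z \<and> mor z = Comp A \<gamma> (mor x) (mor y))" for \<gamma> x y
  have comp: "comp \<gamma> x y \<in> MC \<and> computes p [x, \<gamma>, y] (comp \<gamma> x y) \<and> mor (comp \<gamma> x y) = Comp A \<gamma> (mor x) (mor y)"
    if "x \<in> MC" "y \<in> MC" "composable A \<gamma> (mor x) (mor y)" for x y \<gamma>
    unfolding comp_def by (rule someI_ex) (use p[OF that] in blast)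
  obtain q where q: "\<And>x y. x \<in> MC \<Longrightarrow> y \<in> MC \<Longrightarrow> Dom A (mor x) = Dom A (mor y) \<Longrightarrow> Cod A (mor x) = Cod A (mor y) \<Longrightarrow>
      computes q [x, y] (of_bool (mor x = mor y))"
    using assms(5) unfolding equality_decidable_def of_bool_def by blast
  interpret symmetric_polycategory A by (rule assms(1))
  interpret presentation A mor MC comp
  proof
    show "mor x \<in> Mor A" if "x \<in> MC" for x using assms(3) that by (auto simp: numbering_def)
    show "pc {[x, \<gamma>, y] | x \<gamma> y. x \<in> MC \<and> y \<in> MC \<and> composable A \<gamma> (mor x) (mor y)}
       (\<lambda>e. comp (e ! 1) (e ! 0) (e ! 2))"
      unfolding pc_def by (rule exI[of _ p]) (auto simp: numeral_2_eq_2 comp)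
    show "pc {[x, y] | x y. x \<in> MC \<and> y \<in> MC \<and> Dom A (mor x) = Dom A (mor y) \<and> Cod A (mor x) = Cod A (mor y)}
       (\<lambda>e. of_bool (mor (e ! 0) = mor (e ! 1)))"
    proof -
      have "computes q e (of_bool (mor (e ! 0) = mor (e ! 1)))"
        if e: "e \<in> {[x, y] | x y. x \<in> MC \<and> y \<in> MC \<and> Dom A (mor x) = Dom A (mor y) \<and> Cod A (mor x) = Cod A (mor y)}" for e
      proof -
        obtain x y where xy: "e = [x, y]" "x \<in> MC" "y \<in> MC" "Dom A (mor x) = Dom A (mor y)" "Cod A (mor x) = Cod A (mor y)"
          using e by blast
        show ?thesis using q[OF xy(2-5)] unfolding xy(1) by simp
      qed
      then show ?thesis unfolding pc_def by blast
    qed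
  qed (simp_all add: comp)
  note d = decision[where obj = obj and OC = OC]
  show ?thesis using d(1)[unfolded pc_def]
  proof (elim exE, intro exI allI impI)
    fix P \<Gamma>c \<Delta>c s' t' \<Gamma> \<Delta> s t
    assume P: "\<forall>e\<in>{[family_code \<Gamma>c, family_code \<Delta>c, tm_code sc, tm_code tc] | \<Gamma>c \<Delta>c sc tc.
      \<exists>\<Gamma> \<Delta> s t. family_named_by obj OC \<Gamma>c \<Gamma> \<and> family_named_by obj OC \<Delta>c \<Delta> \<and>
       tm_named_by mor MC sc s \<and> tm_named_by mor MC tc t \<and> derives A \<Gamma> \<Delta> s \<and> derives A \<Gamma> \<Delta> t}.
       computes P e (of_bool (mem (pr (S_of (e ! 0) (e ! 1)) (pr (nf_of (e ! 2)) (nf_of (e ! 3))))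
         (E_of (M_of (T_of (S_of (e ! 0) (e ! 1)) (nf_of (e ! 2)) (nf_of (e ! 3)))) (S_of (e ! 0) (e ! 1)))))"
    assume h: "family_named_by obj OC \<Gamma>c \<Gamma>" "family_named_by obj OC \<Delta>c \<Delta>"
       "tm_named_by mor MC s' s" "tm_named_by mor MC t' t" "derives A \<Gamma> \<Delta> s" "derives A \<Gamma> \<Delta> t"
    have "computes P [family_code \<Gamma>c, family_code \<Delta>c, tm_code s', tm_code t'] (of_bool (equivalent A \<Gamma> \<Delta> s t))"
      using P[rule_format, of "[family_code \<Gamma>c, family_code \<Delta>c, tm_code s', tm_code t']"]
      unfolding d(2)[OF h refl] using h by blast
    then show "computes P [family_code \<Gamma>c, family_code \<Delta>c, tm_code s', tm_code t']
        (if equivalent A \<Gamma> \<Delta> s t then 1 else 0)"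
      by (simp only: of_bool_def)
  qed
qed

end
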